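(* Let $X$ be a simplicial set. The following are equivalent. (1) The simplicial set $X$ is fibrant in the minimal model structure on simplicial sets. (2) The map $X\to\ast$ to the terminal simplicial set has the right lifting property with respect to the class of widened inclusions. (3) The map $X\to\ast$ has the right lifting property with respect to the set of iso-horn inclusions.
   Context: Simplicial sets are functors $\Delta^{\mathrm{op}}\to\mathsf{Set}$; $\Delta[n]$ is the standard $n$-simplex and $\partial\Delta[n]$ its boundary. $J=N(\mathbb{I})$ is the nerve of the free-living isomorphism $\mathbb{I}$ (two objects $0,1$ and exactly one morphism in each hom-set). A Cisinski model structure on the category $\mathsf{sSet}$ of simplicial sets is a cofibrantly generated model structure whose cofibrations are exactly the monomorphisms. One Cisinski model structure is a localization of another if its class of weak equivalences contains that of the other. The minimal (Cisinski) model structure is the Cisinski model structure on $\mathsf{sSet}$ of which every Cisinski model structure on $\mathsf{sSet}$ is a localization; it exists, and it is the Cisinski model structure in which a simplicial set $X$ is fibrant if and only if $X\to\ast$ has the right lifting property with respect to the pushout-products $$(J\times\partial\Delta[n])\cup(\{0\}\times\Delta[n])\hookrightarrow J\times\Delta[n],\qquad n\geq 0.$$ Given a set of vertices $S$ of a simplicial set $Z$, the full subcomplex of $Z$ on $S$ consists of the simplices of $Z$ all of whose vertices lie in $S$. For a simplicial set $X$ and $\nu\subseteq X_0$, the widening $W_\nu(X)$ of $X$ at $\nu$ is the full subcomplex of $J\times X$ on the vertex set $(\{0\}\times X_0)\cup(\{1\}\times\nu)$. Given an inclusion of simplicial sets $X\subseteq Y$ and a subset $\nu\subseteq Y_0$,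 the inclusion $(\{0\}\times Y)\cup W_{\nu\cap X_0}(X)\hookrightarrow W_\nu(Y)$ is called a widened inclusion (the inclusion $X\hookrightarrow Y$ widened at $\nu$). For $n\geq 1$ and $0\leq i\leq n-1$, the isoplex is $\overline{\nabla}_i[n]=W_{\{i\}}(\Delta[n-1])$, and the iso-horn is its subcomplex $\overline{\mathbb{V}}_i[n]=W_{\{i\}\cap(\partial\Delta[n-1])_0}(\partial\Delta[n-1])\cup(\{0\}\times\Delta[n-1])$. The inclusion $\overline{\mathbb{V}}_i[n]\hookrightarrow\overline{\nabla}_i[n]$ is called an iso-horn inclusion. *)

theory Defs
  imports Main "HOL-Library.FuncSet" "HOL-Library.Equipollence"
begin

section \<open>Small sets\<close>

text \<open>
  The category of sets is modelled by a family U of subsets of a type. Every Grothendieck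
  universe that contains an infinite set gives such a family (take for U the small sets of
  elements of the universe), but only the following closure properties are demanded, so that U may
  also consist of all subsets of a type, see \<open>set_universe_UNIV\<close> below. Closure under bijective
  copies, binary products, binary unions and countable powers is a consequence.
\<close>

definition set_universe :: "'u set set \<Rightarrow> bool" where
  "set_universe U \<longleftrightarrow>
     (\<exists>A\<in>U. infinite A) \<and>
     (\<forall>A\<in>U. \<forall>B. B \<lesssim> A \<longrightarrow> B \<in> U) \<and>
     (\<forall>A\<in>U. \<exists>B\<in>U. ((UNIV :: nat set) \<rightarrow>\<^sub>E A) \<lesssim> B)"

text \<open>Being set-sized, for collections of elements of another type.\<close>

definition small :: "'u set set \<Rightarrow> 'b set \<Rightarrow> bool" where
  "small U I \<longleftrightarrow> (\<exists>A\<in>U. I \<lesssim> A)"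


section \<open>Simplicial sets\<close>

text \<open>The morphisms from [m] to [n] in the category \<open>\<Delta>\<close>, with [n] = {0, ..., n}.\<close>

definition ops :: "nat \<Rightarrow> nat \<Rightarrow> (nat \<Rightarrow> nat) set" where
  "ops m n = {\<alpha> \<in> {..m} \<rightarrow>\<^sub>E {..n}. mono_on {..m} \<alpha>}"

text \<open>
  \<open>act X m n \<alpha>\<close> is the map from n-simplices to m-simplices induced by \<open>\<alpha> : [m] \<rightarrow> [n]\<close>. Both
  dimensions are arguments because the sets of simplices in different dimensions may overlap.
  Values of \<open>act\<close> outside \<open>ops m n\<close> and \<open>smp X n\<close> are irrelevant.
\<close>

record 'a sset =
  smp :: "nat \<Rightarrow> 'a set"
  act :: "nat \<Rightarrow> nat \<Rightarrow> (nat \<Rightarrow> nat) \<Rightarrow> 'a \<Rightarrow> 'a"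

definition simplicial_set :: "'a sset \<Rightarrow> bool" where
  "simplicial_set X \<longleftrightarrow>
     (\<forall>m n. \<forall>\<alpha>\<in>ops m n. \<forall>x\<in>smp X n. act X m n \<alpha> x \<in> smp X m) \<and>
     (\<forall>n. \<forall>x\<in>smp X n. act X n n (\<lambda>i\<in>{..n}. i) x = x) \<and>
     (\<forall>k m n. \<forall>\<beta>\<in>ops k m. \<forall>\<alpha>\<in>ops m n. \<forall>x\<in>smp X n.
        act X k n (compose {..k} \<alpha> \<beta>) x = act X k m \<beta> (act X m n \<alpha> x))"

definition ssets :: "'u set set \<Rightarrow> 'u sset set" where
  "ssets U = {X. simplicial_set X \<and> (\<forall>n. smp X n \<in> U)}"

definition subcomplex :: "'a sset \<Rightarrow> 'a sset \<Rightarrow> bool" where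
  "subcomplex X Y \<longleftrightarrow> simplicial_set X \<and> simplicial_set Y \<and>
     (\<forall>n. smp X n \<subseteq> smp Y n) \<and>
     (\<forall>m n. \<forall>\<alpha>\<in>ops m n. \<forall>x\<in>smp X n. act X m n \<alpha> x = act Y m n \<alpha> x)"

definition vertex :: "'a sset \<Rightarrow> nat \<Rightarrow> nat \<Rightarrow> 'a \<Rightarrow> 'a" where
  "vertex X n i x = act X 0 n (\<lambda>k\<in>{..0}. i) x"

definition full_subcomplex :: "'a sset \<Rightarrow> 'a set \<Rightarrow> 'a sset" where
  "full_subcomplex Z S = Z\<lparr>smp := \<lambda>n. {x \<in> smp Z n. \<forall>i\<le>n. vertex Z n i x \<in> S}\<rparr>"

definition sset_prod :: "'a sset \<Rightarrow> 'b sset \<Rightarrow> ('a \<times> 'b) sset" where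
  "sset_prod X Y =
     \<lparr>smp = \<lambda>n. smp X n \<times> smp Y n,
      act = \<lambda>m n \<alpha> z. (act X m n \<alpha> (fst z), act Y m n \<alpha> (snd z))\<rparr>"

definition point :: "'a sset" where
  "point = \<lparr>smp = \<lambda>n. {undefined}, act = \<lambda>m n \<alpha> x. x\<rparr>"

definition simplex :: "nat \<Rightarrow> (nat \<Rightarrow> nat) sset" where
  "simplex n = \<lparr>smp = \<lambda>m. ops m n, act = \<lambda>k m \<beta> \<alpha>. compose {..k} \<alpha> \<beta>\<rparr>"

definition boundary :: "nat \<Rightarrow> (nat \<Rightarrow> nat) sset" where
  "boundary n = (simplex n)\<lparr>smp := \<lambda>m. {\<alpha> \<in> ops m n. \<alpha> ` {..m} \<noteq> {..n}}\<rparr>"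

definition simplex_vertex :: "nat \<Rightarrow> nat \<Rightarrow> nat" where
  "simplex_vertex i = (\<lambda>k\<in>{..0}. i)"

text \<open>
  The nerve of the category with set of objects P that has exactly one morphism from a to b if
  \<open>(a, b) \<in> R\<close> and none otherwise (R a preorder on P). A functor from [n] to such a category is
  determined by its effect on objects.
\<close>

definition thin_nerve :: "'c set \<Rightarrow> ('c \<times> 'c) set \<Rightarrow> (nat \<Rightarrow> 'c) sset" where
  "thin_nerve P R =
     \<lparr>smp = \<lambda>n. {x \<in> {..n} \<rightarrow>\<^sub>E P. \<forall>j\<le>n. \<forall>i\<le>j. (x i, x j) \<in> R},
      act = \<lambda>m n \<alpha> x. compose {..m} x \<alpha>\<rparr>"

definition J :: "(nat \<Rightarrow> nat) sset" where
  "J = thin_nerve {0, 1} ({0, 1} \<times> {0, 1})"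

definition J_vertex :: "nat \<Rightarrow> nat \<Rightarrow> nat" where
  "J_vertex e = (\<lambda>k\<in>{..0}. e)"

text \<open>The subcomplex {0} of J: all degeneracies of the vertex 0.\<close>

definition J0 :: "(nat \<Rightarrow> nat) sset" where
  "J0 = J\<lparr>smp := \<lambda>n. {\<lambda>k\<in>{..n}. 0}\<rparr>"


section \<open>Simplicial maps and lifting\<close>

text \<open>
  The components of a map are extensional functions, so that equality of records is equality of
  maps. Source and target may live over different types.
\<close>

record ('a, 'b) smap =
  src :: "'a sset"
  tgt :: "'b sset"
  fn :: "nat \<Rightarrow> 'a \<Rightarrow> 'b"

definition simplicial_map :: "('a, 'b) smap \<Rightarrow> bool" where
  "simplicial_map f \<longleftrightarrow> simplicial_set (src f) \<and> simplicial_set (tgt f) \<and>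
     (\<forall>n. fn f n \<in> smp (src f) n \<rightarrow>\<^sub>E smp (tgt f) n) \<and>
     (\<forall>m n. \<forall>\<alpha>\<in>ops m n. \<forall>x\<in>smp (src f) n.
        fn f m (act (src f) m n \<alpha> x) = act (tgt f) m n \<alpha> (fn f n x))"

definition smaps :: "'u set set \<Rightarrow> ('u, 'u) smap set" where
  "smaps U = {f. simplicial_map f \<and> src f \<in> ssets U \<and> tgt f \<in> ssets U}"

definition comp_map :: "('b, 'c) smap \<Rightarrow> ('a, 'b) smap \<Rightarrow> ('a, 'c) smap"  (infixl "\<circ>\<^sub>s" 55) where
  "g \<circ>\<^sub>s f = \<lparr>src = src f, tgt = tgt g, fn = \<lambda>n. compose (smp (src f) n) (fn g n) (fn f n)\<rparr>"

definition inclusion :: "'a sset \<Rightarrow> 'a sset \<Rightarrow> ('a, 'a) smap" where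
  "inclusion X Y = \<lparr>src = X, tgt = Y, fn = \<lambda>n. \<lambda>x\<in>smp X n. x\<rparr>"

definition id_map :: "'a sset \<Rightarrow> ('a, 'a) smap" where
  "id_map X = inclusion X X"

definition to_point :: "'a sset \<Rightarrow> ('a, 'a) smap" where
  "to_point X = \<lparr>src = X, tgt = point, fn = \<lambda>n. \<lambda>x\<in>smp X n. undefined\<rparr>"

text \<open>p has the right lifting property with respect to i.\<close>

definition rlp :: "('a, 'b) smap \<Rightarrow> ('c, 'd) smap \<Rightarrow> bool" where
  "rlp p i \<longleftrightarrow>
     (\<forall>u v. simplicial_map u \<and> src u = src i \<and> tgt u = src p \<and>
            simplicial_map v \<and> src v = tgt i \<and> tgt v = tgt p \<and>
            p \<circ>\<^sub>s u = v \<circ>\<^sub>s i \<longrightarrow>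
        (\<exists>h. simplicial_map h \<and> src h = tgt i \<and> tgt h = src p \<and> h \<circ>\<^sub>s i = u \<and> p \<circ>\<^sub>s h = v))"

definition monic :: "'u set set \<Rightarrow> ('u, 'u) smap \<Rightarrow> bool" where
  "monic U f \<longleftrightarrow> f \<in> smaps U \<and>
     (\<forall>g\<in>smaps U. \<forall>h\<in>smaps U. src g = src h \<and> tgt g = src f \<and> tgt h = src f \<and>
        f \<circ>\<^sub>s g = f \<circ>\<^sub>s h \<longrightarrow> g = h)"


section \<open>Model structures\<close>

record 'u model_str =
  weq :: "('u, 'u) smap set"
  cof :: "('u, 'u) smap set"
  fib :: "('u, 'u) smap set"

definition two_of_three :: "'u set set \<Rightarrow> ('u, 'u) smap set \<Rightarrow> bool" where
  "two_of_three U W \<longleftrightarrow> (\<forall>f\<in>smaps U. \<forall>g\<in>smaps U. tgt f = src g \<longrightarrow>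
     (f \<in> W \<and> g \<in> W \<longrightarrow> g \<circ>\<^sub>s f \<in> W) \<and>
     (f \<in> W \<and> g \<circ>\<^sub>s f \<in> W \<longrightarrow> g \<in> W) \<and>
     (g \<in> W \<and> g \<circ>\<^sub>s f \<in> W \<longrightarrow> f \<in> W))"

definition retract_of :: "'u set set \<Rightarrow> ('u, 'u) smap \<Rightarrow> ('u, 'u) smap \<Rightarrow> bool" where
  "retract_of U f g \<longleftrightarrow> f \<in> smaps U \<and> g \<in> smaps U \<and>
     (\<exists>i\<in>smaps U. \<exists>r\<in>smaps U. \<exists>i'\<in>smaps U. \<exists>r'\<in>smaps U.
        src i = src f \<and> tgt i = src g \<and> src r = src g \<and> tgt r = src f \<and>
        src i' = tgt f \<and> tgt i' = tgt g \<and> src r' = tgt g \<and> tgt r' = tgt f \<and>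
        r \<circ>\<^sub>s i = id_map (src f) \<and> r' \<circ>\<^sub>s i' = id_map (tgt f) \<and>
        g \<circ>\<^sub>s i = i' \<circ>\<^sub>s f \<and> f \<circ>\<^sub>s r = r' \<circ>\<^sub>s g)"

definition retract_closed :: "'u set set \<Rightarrow> ('u, 'u) smap set \<Rightarrow> bool" where
  "retract_closed U C \<longleftrightarrow> (\<forall>g\<in>C. \<forall>f. retract_of U f g \<longrightarrow> f \<in> C)"

definition factors :: "'u set set \<Rightarrow> ('u, 'u) smap set \<Rightarrow> ('u, 'u) smap set \<Rightarrow> bool" where
  "factors U L R \<longleftrightarrow> (\<forall>f\<in>smaps U. \<exists>i\<in>L. \<exists>p\<in>R. tgt i = src p \<and> p \<circ>\<^sub>s i = f)"

definition model_structure :: "'u set set \<Rightarrow> 'u model_str \<Rightarrow> bool" where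
  "model_structure U M \<longleftrightarrow>
     weq M \<subseteq> smaps U \<and> cof M \<subseteq> smaps U \<and> fib M \<subseteq> smaps U \<and>
     two_of_three U (weq M) \<and>
     retract_closed U (weq M) \<and> retract_closed U (cof M) \<and> retract_closed U (fib M) \<and>
     (\<forall>i\<in>cof M \<inter> weq M. \<forall>p\<in>fib M. rlp p i) \<and>
     (\<forall>i\<in>cof M. \<forall>p\<in>fib M \<inter> weq M. rlp p i) \<and>
     factors U (cof M \<inter> weq M) (fib M) \<and>
     factors U (cof M) (fib M \<inter> weq M)"

text \<open>
  The usual clause that the generating sets permit the small object argument is omitted, since
  every simplicial set is a small object.
\<close>

definition cofibrantly_generated :: "'u set set \<Rightarrow> 'u model_str \<Rightarrow> bool" where
  "cofibrantly_generated U M \<longleftrightarrow>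
     (\<exists>I K. I \<subseteq> smaps U \<and> K \<subseteq> smaps U \<and> small U I \<and> small U K \<and>
        fib M \<inter> weq M = {p \<in> smaps U. \<forall>i\<in>I. rlp p i} \<and>
        fib M = {p \<in> smaps U. \<forall>i\<in>K. rlp p i})"

definition cisinski :: "'u set set \<Rightarrow> 'u model_str \<Rightarrow> bool" where
  "cisinski U M \<longleftrightarrow> model_structure U M \<and> cofibrantly_generated U M \<and> cof M = {f. monic U f}"

definition localization_of :: "'u model_str \<Rightarrow> 'u model_str \<Rightarrow> bool" where
  "localization_of M' M \<longleftrightarrow> weq M \<subseteq> weq M'"

text \<open>
  There is at most one such M: weak equivalences and cofibrations of two of them agree, and
  they determine the fibrations.
\<close>

definition minimal_model_structure :: "'u set set \<Rightarrow> 'u model_str \<Rightarrow> bool" where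
  "minimal_model_structure U M \<longleftrightarrow>
     cisinski U M \<and> (\<forall>M'. cisinski U M' \<longrightarrow> localization_of M' M)"

definition fibrant :: "'u model_str \<Rightarrow> 'u sset \<Rightarrow> bool" where
  "fibrant M X \<longleftrightarrow> to_point X \<in> fib M"


section \<open>Widenings\<close>

definition widening :: "'a set \<Rightarrow> 'a sset \<Rightarrow> ((nat \<Rightarrow> nat) \<times> 'a) sset" where
  "widening \<nu> X =
     full_subcomplex (sset_prod J X) ({J_vertex 0} \<times> smp X 0 \<union> {J_vertex 1} \<times> \<nu>)"

text \<open>The union of {0} \<open>\<times>\<close> Y and \<open>W\<^bsub>\<nu> \<inter> X\<^sub>0\<^esub>(X)\<close> inside J \<open>\<times>\<close> Y.\<close>

definition widened_source :: "'a sset \<Rightarrow> 'a sset \<Rightarrow> 'a set \<Rightarrow> ((nat \<Rightarrow> nat) \<times> 'a) sset" where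
  "widened_source X Y \<nu> =
     (sset_prod J Y)\<lparr>smp := \<lambda>n. smp (sset_prod J0 Y) n \<union> smp (widening (\<nu> \<inter> smp X 0) X) n\<rparr>"

definition widened_inclusion ::
    "'a sset \<Rightarrow> 'a sset \<Rightarrow> 'a set \<Rightarrow> ((nat \<Rightarrow> nat) \<times> 'a, (nat \<Rightarrow> nat) \<times> 'a) smap" where
  "widened_inclusion X Y \<nu> = inclusion (widened_source X Y \<nu>) (widening \<nu> Y)"

definition widened_inclusions ::
    "'u set set \<Rightarrow> ((nat \<Rightarrow> nat) \<times> 'u, (nat \<Rightarrow> nat) \<times> 'u) smap set" where
  "widened_inclusions U =
     {widened_inclusion X Y \<nu> | X Y \<nu>. X \<in> ssets U \<and> Y \<in> ssets U \<and> subcomplex X Y \<and> \<nu> \<subseteq> smp Y 0}"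

definition isoplex :: "nat \<Rightarrow> nat \<Rightarrow> ((nat \<Rightarrow> nat) \<times> (nat \<Rightarrow> nat)) sset" where
  "isoplex i n = widening {simplex_vertex i} (simplex (n - 1))"

definition iso_horn :: "nat \<Rightarrow> nat \<Rightarrow> ((nat \<Rightarrow> nat) \<times> (nat \<Rightarrow> nat)) sset" where
  "iso_horn i n = widened_source (boundary (n - 1)) (simplex (n - 1)) {simplex_vertex i}"

definition iso_horn_inclusions ::
    "((nat \<Rightarrow> nat) \<times> (nat \<Rightarrow> nat), (nat \<Rightarrow> nat) \<times> (nat \<Rightarrow> nat)) smap set" where
  "iso_horn_inclusions = {inclusion (iso_horn i n) (isoplex i n) | i n. 1 \<le> n \<and> i \<le> n - 1}"


section \<open>Well-formedness\<close>

lemma set_universe_UNIV: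
  assumes "infinite (UNIV :: 'u set)" and "(UNIV :: (nat \<Rightarrow> 'u) set) \<lesssim> (UNIV :: 'u set)"
  shows "set_universe (UNIV :: 'u set set)"
proof -
  have "((UNIV :: nat set) \<rightarrow>\<^sub>E A) \<lesssim> (UNIV :: 'u set)" for A :: "'u set"
    using assms(2) lepoll_trans subset_imp_lepoll subset_UNIV by blast
  then show ?thesis
    using assms(1) unfolding set_universe_def by blast
qed

lemma set_universe_nat_bool: "set_universe (UNIV :: (nat \<Rightarrow> bool) set set)"
proof (rule set_universe_UNIV)
  have "inj (\<lambda>n::nat. (\<lambda>k. k = n))"
    by (auto simp: inj_def fun_eq_iff)
  then have "infinite (range (\<lambda>n::nat. (\<lambda>k. k = n)))"
    by (rule range_inj_infinite)
  then show "infinite (UNIV :: (nat \<Rightarrow> bool) set)"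
    using infinite_super subset_UNIV by blast
  have "inj (\<lambda>(f :: nat \<Rightarrow> nat \<Rightarrow> bool) k. f (fst (prod_decode k)) (snd (prod_decode k)))"
  proof (rule injI, intro ext)
    fix f g :: "nat \<Rightarrow> nat \<Rightarrow> bool" and a b
    assume "(\<lambda>k. f (fst (prod_decode k)) (snd (prod_decode k))) =
            (\<lambda>k. g (fst (prod_decode k)) (snd (prod_decode k)))"
    from fun_cong[OF this, of "prod_encode (a, b)"] show "f a b = g a b"
      by simp
  qed
  then show "(UNIV :: (nat \<Rightarrow> nat \<Rightarrow> bool) set) \<lesssim> (UNIV :: (nat \<Rightarrow> bool) set)"
    unfolding lepoll_def by blast
qed

lemma ops_compose: "\<beta> \<in> ops k m \<Longrightarrow> \<alpha> \<in> ops m n \<Longrightarrow> compose {..k} \<alpha> \<beta> \<in> ops k n"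
  by (auto simp: ops_def compose_def PiE_iff monotone_on_def)

lemma ops_le: "\<alpha> \<in> ops m n \<Longrightarrow> i \<le> m \<Longrightarrow> \<alpha> i \<le> n"
  by (auto simp: ops_def)

lemma simplicial_set_simplex: "simplicial_set (simplex n)"
  unfolding simplicial_set_def simplex_def
  by (auto simp: ops_compose) (auto simp: ops_def compose_def PiE_iff extensional_def fun_eq_iff)

lemma J_simps: "smp J n = ({..n} \<rightarrow>\<^sub>E {0, 1})" "act J m n \<alpha> x = compose {..m} x \<alpha>"
proof -
  have "x i \<in> {0, 1}" if "x \<in> {..n} \<rightarrow>\<^sub>E {0, 1}" "i \<le> n" for x :: "nat \<Rightarrow> nat" and i
    using that by (simp add: PiE_iff)
  then show "smp J n = ({..n} \<rightarrow>\<^sub>E {0, 1})"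
    unfolding J_def thin_nerve_def by (simp add: set_eq_iff) (meson le_trans)
qed (simp add: J_def thin_nerve_def)

lemma simplicial_set_J: "simplicial_set J"
  unfolding simplicial_set_def
proof (intro conjI allI ballI)
  fix m n \<alpha> x assume "\<alpha> \<in> ops m n" "x \<in> smp J n"
  then have "x (\<alpha> i) \<in> {0, 1}" if "i \<le> m" for i
    using that ops_le[of \<alpha> m n i] unfolding J_simps by (simp add: PiE_iff)
  then show "act J m n \<alpha> x \<in> smp J m"
    unfolding J_simps by (simp add: compose_def PiE_iff)
next
  fix n x assume "x \<in> smp J n"
  then show "act J n n (\<lambda>i\<in>{..n}. i) x = x"
    unfolding J_simps by (intro ext) (simp add: compose_def PiE_iff extensional_def)
next
  fix k m n \<beta> \<alpha> x assume "\<beta> \<in> ops k m"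
  then show "act J k n (compose {..k} \<alpha> \<beta>) x = act J k m \<beta> (act J m n \<alpha> x)"
    unfolding J_simps by (intro ext) (simp add: compose_def ops_le)
qed

lemma simplicial_set_prod:
  "simplicial_set X \<Longrightarrow> simplicial_set Y \<Longrightarrow> simplicial_set (sset_prod X Y)"
  unfolding simplicial_set_def sset_prod_def by auto

lemma subcomplex_restrict:
  assumes "simplicial_set X" and "\<And>n. S n \<subseteq> smp X n"
    and "\<And>m n \<alpha> x. \<alpha> \<in> ops m n \<Longrightarrow> x \<in> S n \<Longrightarrow> act X m n \<alpha> x \<in> S m"
  shows "subcomplex (X\<lparr>smp := S\<rparr>) X"
  using assms unfolding subcomplex_def simplicial_set_def by simp (meson subsetD)

lemma vertex_act:
  assumes "simplicial_set X" "\<alpha> \<in> ops m n" "x \<in> smp X n" "i \<le> m"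
  shows "vertex X m i (act X m n \<alpha> x) = vertex X n (\<alpha> i) x"
proof -
  have "(\<lambda>k\<in>{..0}. i) \<in> ops 0 m"
    using assms(4) by (auto simp: ops_def monotone_on_def)
  moreover have "compose {..0} \<alpha> (\<lambda>k\<in>{..0}. i) = (\<lambda>k\<in>{..0}. \<alpha> i)"
    by (auto simp: compose_def)
  ultimately show ?thesis
    using assms unfolding vertex_def simplicial_set_def by metis
qed

lemma subcomplex_full: "simplicial_set Z \<Longrightarrow> subcomplex (full_subcomplex Z S) Z"
  unfolding full_subcomplex_def
  by (rule subcomplex_restrict) (auto simp: vertex_act ops_le, auto simp: simplicial_set_def)

lemma subcomplex_widening: "simplicial_set X \<Longrightarrow> subcomplex (widening \<nu> X) (sset_prod J X)"
  unfolding widening_def by (intro subcomplex_full simplicial_set_prod simplicial_set_J)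

lemma subcomplex_boundary: "subcomplex (boundary n) (simplex n)"
  unfolding boundary_def
proof (rule subcomplex_restrict[OF simplicial_set_simplex])
  fix m k \<alpha> x assume a: "\<alpha> \<in> ops m k" and x: "x \<in> {\<alpha> \<in> ops k n. \<alpha> ` {..k} \<noteq> {..n}}"
  have "compose {..m} x \<alpha> ` {..m} \<subseteq> x ` {..k}" "x ` {..k} \<subseteq> {..n}"
    using a x by (auto simp: compose_def ops_le dest: ops_le)
  moreover have "x ` {..k} \<noteq> {..n}" "compose {..m} x \<alpha> \<in> ops m n"
    using a x ops_compose by auto
  ultimately show "act (simplex n) m k \<alpha> x \<in> {\<alpha> \<in> ops m n. \<alpha> ` {..m} \<noteq> {..n}}"
    by (auto simp only: simplex_def sset.simps mem_Collect_eq)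
qed (auto simp: simplex_def)

lemma J0_act: "\<alpha> \<in> ops m n \<Longrightarrow> act J m n \<alpha> (\<lambda>k\<in>{..n}. 0) = (\<lambda>k\<in>{..m}. 0)"
  unfolding J_simps by (intro ext) (simp add: compose_def ops_le)

lemma subcomplex_widened_source:
  assumes XY: "subcomplex X Y"
  shows "subcomplex (widened_source X Y \<nu>) (widening \<nu> Y)"
proof -
  let ?P = "sset_prod J Y" and ?W = "widening (\<nu> \<inter> smp X 0) X"
  let ?S = "\<lambda>n. smp (sset_prod J0 Y) n \<union> smp ?W n"
  have X: "simplicial_set X" and Y: "simplicial_set Y" using XY by (auto simp: subcomplex_def)
  note W = subcomplex_widening[OF Y, of \<nu>] and WX = subcomplex_widening[OF X, of "\<nu> \<inter> smp X 0"]
  have actX: "act X m n \<alpha> x = act Y m n \<alpha> x" if "\<alpha> \<in> ops m n" "x \<in> smp X n" for m n \<alpha> x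
    using XY that by (auto simp: subcomplex_def)
  have const: "(\<lambda>k\<in>{..0}. i) \<in> ops 0 n" if "i \<le> n" for i n :: nat
    using that by (auto simp: ops_def monotone_on_def)
  have vX: "vertex (sset_prod J X) n i z = vertex ?P n i z"
    if "z \<in> smp (sset_prod J X) n" "i \<le> n" for n i z
    using that actX[OF const] by (auto simp: vertex_def sset_prod_def)
  have sub: "?S n \<subseteq> smp (widening \<nu> Y) n" for n
  proof
    fix z assume "z \<in> ?S n"
    then consider "z \<in> smp (sset_prod J0 Y) n" | "z \<in> smp ?W n" by blast
    then show "z \<in> smp (widening \<nu> Y) n"
    proof cases
      case 1
      then obtain y where z: "z = (\<lambda>k\<in>{..n}. 0, y)" and y: "y \<in> smp Y n"
        by (auto simp: sset_prod_def J0_def)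
      have "vertex ?P n i z \<in> {J_vertex 0} \<times> smp Y 0" if "i \<le> n" for i
        using Y y const[OF that] J0_act[OF const[OF that]]
        by (auto simp: vertex_def sset_prod_def z J_vertex_def simplicial_set_def)
      moreover have "z \<in> smp ?P n"
        using y by (auto simp: z sset_prod_def J_def thin_nerve_def)
      ultimately show ?thesis by (auto simp: widening_def full_subcomplex_def)
    next
      case 2
      moreover have "smp X n \<subseteq> smp Y n" "smp X 0 \<subseteq> smp Y 0" using XY by (auto simp: subcomplex_def)
      ultimately show ?thesis
        using vX by (fastforce simp: widening_def full_subcomplex_def sset_prod_def)
    qed
  qed
  have closed: "act ?P m n \<alpha> z \<in> ?S m" if a: "\<alpha> \<in> ops m n" and z: "z \<in> ?S n" for m n \<alpha> z
    using z
  proof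
    assume "z \<in> smp (sset_prod J0 Y) n"
    then have "act ?P m n \<alpha> z \<in> smp (sset_prod J0 Y) m"
      using Y a J0_act[OF a] by (auto simp: sset_prod_def J0_def simplicial_set_def)
    then show ?thesis ..
  next
    assume z: "z \<in> smp ?W n"
    then have "snd z \<in> smp X n"
      by (auto simp: widening_def full_subcomplex_def sset_prod_def)
    then have "act ?P m n \<alpha> z = act (sset_prod J X) m n \<alpha> z"
      using actX[OF a] by (simp add: sset_prod_def)
    also have "\<dots> = act ?W m n \<alpha> z" by (simp add: widening_def full_subcomplex_def)
    also have "\<dots> \<in> smp ?W m"
      using WX a z by (auto simp: subcomplex_def simplicial_set_def)
    finally show ?thesis ..
  qed
  have "smp (widening \<nu> Y) n \<subseteq> smp ?P n" for n using W by (auto simp: subcomplex_def)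
  then have "subcomplex (widened_source X Y \<nu>) ?P"
    unfolding widened_source_def using sub closed
    by (intro subcomplex_restrict simplicial_set_prod simplicial_set_J Y) blast+
  then show ?thesis
    using W sub by (auto simp: subcomplex_def widened_source_def widening_def full_subcomplex_def)
qed

end

theory Submission
 imports Defs "HOL-Library.Countable_Set"
begin

text \<open>
 Call Z a J-fibrant simplicial set if Z \<rightarrow> * lifts against the pushout-products of the definition of the minimal model structure.

 J-fibrant sets lift against all widened inclusions, since (t, (x, y)) \<mapsto> (min t x, y) contracts a widening into {0} \<times> Y.
 Conversely the cells of J \<times> simplex n that are missing in the pushout-product can be attached along iso-horns, one vertex of
 simplex n being doubled at a time.

 In every Cisinski model structure J \<times> Y \<rightarrow> Y lifts against monomorphisms, so that the pushout-products are trivial cofibrations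
 and fibrant objects are J-fibrant. For the converse in the minimal model structure M it suffices to have one Cisinski
 model structure in which all J-fibrant objects are fibrant: its weak equivalences contain those of M. In the one constructed here, weak
 equivalences are the maps A \<rightarrow> B inducing bijections [B, Z] \<rightarrow> [A, Z] of J-homotopy classes for all J-fibrant Z.

 The free J-fibrant set R(A) on A consists of terms that name fillers of all horns. Sets in U are not
 closed under countable unions of sets of unbounded size, and R(A) need not be small. If the fillers in a J-fibrant set are
 chosen continuously, i.e. such that the filler in dimension m depends on the horn only up to a finite dimension, then the closure of A
 under the chosen fillers is finitary in each dimension and hence small. Such choices exist since a filler can be corrected without changing its
 skeleta; this rests on the fact that maps J \<times> K \<rightarrow> Z that agree on the nondecreasing simplices of J are homotopic
 relative to the ends. Monomorphisms A \<rightarrow> B that are weak equivalences are the ones for which B deforms into R(A) inside R(B), a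
 condition that holds for a cofinal system of countable subcomplexes; this gives a generating set.
\<close>

section \<open>Simplicial maps, subcomplexes and lifting\<close>

text \<open>Two extensions over J of the same data on nondecreasing simplices cannot be compared
  through an extension property: these simplices form a copy of the 1-simplex, and a map on it need
  not extend to J at all. Instead one extension is composed with the inverse of the other. The
  resulting path is constant on nondecreasing simplices and is contracted through a simplicial set
  of 0-1 matrices, into which the square \<open>J \<times> J\<close> maps by outer products.

  A second obstacle is the base. Chosen fillers and lifts against trivial cofibrations are available
  over J-fibrant bases only. A map to B is therefore factored over S_B and the result is cut down to
  the part over B; right properness of this base change keeps the first factor a weak equivalence.

  Terms form a type of their own. Maps, subcomplexes and lifting are therefore treated unbundled and
  across types (\<open>shom\<close>, \<open>subc\<close>, \<open>lft\<close>), and small objects are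
  copied into U where the model structure requires it.\<close>

abbreviation "ss == simplicial_set"

abbreviation "cyl == sset_prod J"

lemma ss_act: "ss X ==> \<alpha> \<in> ops m n ==> x \<in> smp X n ==> act X m n \<alpha> x \<in> smp X m"
 by (auto simp: simplicial_set_def)

lemma ss_id: "ss X ==> x \<in> smp X n ==> act X n n (\<lambda>i\<in>{..n}. i) x = x"
 by (auto simp: simplicial_set_def)

lemma ss_comp: "ss X ==> \<beta> \<in> ops k m ==> \<alpha> \<in> ops m n ==> x \<in> smp X n ==>
  act X k m \<beta> (act X m n \<alpha> x) = act X k n (compose {..k} \<alpha> \<beta>) x"
 by (auto simp: simplicial_set_def)

lemma ops_mono: "\<alpha> \<in> ops m n ==> i \<le> j ==> j \<le> m ==> \<alpha> i \<le> \<alpha> j"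
 by (auto simp: ops_def monotone_on_def)

lemma opsI: "\<alpha> \<in> extensional {..m} ==> (!!i. i \<le> m ==> \<alpha> i \<le> n) ==>
  (!!i j. i \<le> j ==> j \<le> m ==> \<alpha> i \<le> \<alpha> j) ==> \<alpha> \<in> ops m n"
 by (auto simp: ops_def monotone_on_def PiE_iff)

lemma ops_ext: "\<alpha> \<in> ops m n ==> \<alpha> \<in> extensional {..m}"
 by (auto simp: ops_def PiE_iff)

lemma ops_eqI: "\<alpha> \<in> ops m n ==> \<beta> \<in> ops m n' ==> (!!i. i \<le> m ==> \<alpha> i = \<beta> i) ==> \<alpha> = \<beta>"
 by (metis (no_types) atMost_iff extensionalityI ops_ext)

lemma ops_id: "(\<lambda>i\<in>{..n}. i) \<in> ops n n"
 by (rule opsI) auto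

lemma compose_id_right: "\<alpha> \<in> ops m n ==> compose {..m} \<alpha> (\<lambda>i\<in>{..m}. i) = \<alpha>"
 by (rule extensionalityI[OF _ ops_ext]) (auto simp: compose_def)

lemma compose_id_left: "\<alpha> \<in> ops m n ==> compose {..m} (\<lambda>i\<in>{..n}. i) \<alpha> = \<alpha>"
 by (rule extensionalityI[OF _ ops_ext]) (auto simp: compose_def ops_le)

lemma compose_at: "i \<in> A ==> compose A g f i = g (f i)"
 by (simp add: compose_def)

text \<open>Unlike the records of type \<open>smap\<close>, the components are not extensional:
  composites and restrictions are plain lambda terms, and equality is only ever stated on
  simplices.\<close>

definition shom :: "'a sset => 'b sset => (nat => 'a => 'b) => bool" where
 "shom X Y f \<longleftrightarrow> (\<forall>n. \<forall>x\<in>smp X n. f n x \<in> smp Y n) \<and>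
   (\<forall>m n. \<forall>\<alpha>\<in>ops m n. \<forall>x\<in>smp X n. f m (act X m n \<alpha> x) = act Y m n \<alpha> (f n x))"

text \<open>A subcomplex is the family of its sets of simplices and inherits the action, so that
  unions, intersections and chains are operations on sets; \<open>res\<close> makes it a simplicial
  set.\<close>

definition subc :: "'a sset => (nat => 'a set) => bool" where
 "subc X S \<longleftrightarrow> (\<forall>n. S n \<subseteq> smp X n) \<and> (\<forall>m n. \<forall>\<alpha>\<in>ops m n. \<forall>x\<in>S n. act X m n \<alpha> x \<in> S m)"

definition res :: "'a sset => (nat => 'a set) => 'a sset" where
 "res X S = X\<lparr>smp := S\<rparr>"

lemma res_simps [simp]: "smp (res X S) = S" "act (res X S) = act X" "res (res X S) S' = res X S'"
  "res X (smp X) = X"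
 by (auto simp: res_def)

lemma shomI: "(!!n x. x \<in> smp X n ==> f n x \<in> smp Y n) ==>
  (!!m n \<alpha> x. \<alpha> \<in> ops m n ==> x \<in> smp X n ==> f m (act X m n \<alpha> x) = act Y m n \<alpha> (f n x)) ==> shom X Y f"
 by (auto simp: shom_def)

lemma shom_in: "shom X Y f ==> x \<in> smp X n ==> f n x \<in> smp Y n"
 by (auto simp: shom_def)

lemma shom_act: "shom X Y f ==> \<alpha> \<in> ops m n ==> x \<in> smp X n ==> f m (act X m n \<alpha> x) = act Y m n \<alpha> (f n x)"
 by (auto simp: shom_def)

lemma shom_comp: "shom X Y f ==> shom Y Z g ==> shom X Z (%n x. g n (f n x))"
 by (auto simp: shom_def)

lemma shom_ident: "shom X X (%n x. x)"
 by (auto simp: shom_def)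

lemma shom_cong: "shom X Y f ==> (!!n x. x \<in> smp X n ==> f n x = g n x) ==> ss X ==> shom X Y g"
 by (auto simp: shom_def) (metis ss_act)

lemma subc_sub: "subc X S ==> x \<in> S n ==> x \<in> smp X n"
 by (auto simp: subc_def)

lemma subc_act: "subc X S ==> \<alpha> \<in> ops m n ==> x \<in> S n ==> act X m n \<alpha> x \<in> S m"
 by (auto simp: subc_def)

lemma subc_empty: "subc X (%n. {})"
 by (auto simp: subc_def)

lemma subc_Un: "subc X S ==> subc X T ==> subc X (%n. S n \<union> T n)"
 by (auto simp: subc_def)

lemma subc_Int: "subc X S ==> subc X T ==> subc X (%n. S n \<inter> T n)"
 by (auto simp: subc_def)

lemma ss_res: "ss X ==> subc X S ==> ss (res X S)"
 unfolding simplicial_set_def subc_def by (simp add: subset_iff)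

lemma subc_res: "subc X S ==> subc X T ==> (!!n. S n \<subseteq> T n) ==> subc (res X T) S"
 by (auto simp: subc_def)

lemma shom_res: "shom X Y f ==> (!!n. S n \<subseteq> smp X n) ==> shom (res X S) Y f"
 by (auto simp: shom_def subset_iff)

lemma shom_into_res: "shom X Y f ==> (!!n x. x \<in> smp X n ==> f n x \<in> S n) ==> shom X (res Y S) f"
 by (auto simp: shom_def)

lemma shom_from_res: "shom X (res Y S) f ==> subc Y S ==> shom X Y f"
 by (simp add: shom_def subc_def) blast

lemma shom_res_mono: "shom (res X S) Y f ==> (!!n. S' n \<subseteq> S n) ==> shom (res X S') Y f"
 by (auto simp: shom_def subset_iff)

lemma shom_union:
 assumes "subc D C1" "subc D C2" "shom (res D C1) E g1" "shom (res D C2) E g2"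
  "!!n x. x \<in> C1 n ==> x \<in> C2 n ==> g1 n x = g2 n x"
 shows "shom (res D (%n. C1 n \<union> C2 n)) E (%n x. if x \<in> C1 n then g1 n x else g2 n x)"
proof (rule shomI)
 fix m n \<alpha> x assume a: "\<alpha> \<in> ops m n" and x: "x \<in> smp (res D (%n. C1 n \<union> C2 n)) n"
 show "(if act (res D (%n. C1 n \<union> C2 n)) m n \<alpha> x \<in> C1 m then g1 m (act (res D (%n. C1 n \<union> C2 n)) m n \<alpha> x)
   else g2 m (act (res D (%n. C1 n \<union> C2 n)) m n \<alpha> x)) = act E m n \<alpha> (if x \<in> C1 n then g1 n x else g2 n x)"
 proof (cases "x \<in> C1 n")
  case True
  then show ?thesis using subc_act[OF assms(1) a] shom_act[OF assms(3) a] by simp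
 next
  case False
  then have "x \<in> C2 n" using x by simp
  then have "g2 m (act D m n \<alpha> x) = act E m n \<alpha> (g2 n x)" "act D m n \<alpha> x \<in> C2 m"
   using subc_act[OF assms(2) a] shom_act[OF assms(4) a] by auto
  then show ?thesis using False assms(5) by auto
 qed
qed (use assms(3,4) in "auto simp: shom_def")

lemma sset_prod_simps [simp]: "smp (sset_prod X Y) n = smp X n \<times> smp Y n"
  "act (sset_prod X Y) m n \<alpha> z = (act X m n \<alpha> (fst z), act Y m n \<alpha> (snd z))"
 by (auto simp: sset_prod_def)

lemma shom_pair: "shom X Y f ==> shom X Z g ==> shom X (sset_prod Y Z) (%n x. (f n x, g n x))"
 by (auto simp: shom_def)

lemma shom_fst: "shom (sset_prod X Y) X (%n. fst)"
 by (auto simp: shom_def)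

lemma shom_snd: "shom (sset_prod X Y) Y (%n. snd)"
 by (auto simp: shom_def)

text \<open>Stated for a subcomplex rather than a monomorphism, so that successive cell attachments
  are comparisons of families of sets. Injective maps of records are reduced to it by
  \<open>rlp_lft\<close>.\<close>

definition lft :: "'e sset => 'y sset => (nat => 'e => 'y) => 'd sset => (nat => 'd set) => bool" where
 "lft E Y q D C \<longleftrightarrow> (\<forall>g w. shom (res D C) E g \<and> shom D Y w \<and> (\<forall>n. \<forall>x\<in>C n. q n (g n x) = w n x) -->
   (\<exists>h. shom D E h \<and> (\<forall>n. \<forall>x\<in>smp D n. q n (h n x) = w n x) \<and> (\<forall>n. \<forall>x\<in>C n. h n x = g n x)))"

lemma lftD:
 assumes "lft E Y q D C" "shom (res D C) E g" "shom D Y w" "!!n x. x \<in> C n ==> q n (g n x) = w n x"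
 obtains h where "shom D E h" "!!n x. x \<in> smp D n ==> q n (h n x) = w n x" "!!n x. x \<in> C n ==> h n x = g n x"
 using assms unfolding lft_def by metis

lemma lftI:
 assumes "!!g w. shom (res D C) E g ==> shom D Y w ==> (!!n x. x \<in> C n ==> q n (g n x) = w n x) ==>
   \<exists>h. shom D E h \<and> (\<forall>n. \<forall>x\<in>smp D n. q n (h n x) = w n x) \<and> (\<forall>n. \<forall>x\<in>C n. h n x = g n x)"
 shows "lft E Y q D C"
 using assms unfolding lft_def by blast

lemma lft_refl: "lft E Y q D (smp D)"
 by (rule lftI) (metis res_simps(4))

lemma lft_trans:
 assumes "lft E Y q (res D C') C" "lft E Y q D C'" "!!n. C n \<subseteq> C' n" "!!n. C' n \<subseteq> smp D n"
 shows "lft E Y q D C"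
proof (rule lftI)
 fix g w assume g: "shom (res D C) E g" and w: "shom D Y w" and gw: "!!n x. x \<in> C n ==> q n (g n x) = w n x"
 obtain h1 where h1: "shom (res D C') E h1" "!!n x. x \<in> C' n ==> q n (h1 n x) = w n x" "!!n x. x \<in> C n ==> h1 n x = g n x"
  using lftD[OF assms(1), of g w] g gw shom_res[OF w assms(4)] by auto
 obtain h where h: "shom D E h" "!!n x. x \<in> smp D n ==> q n (h n x) = w n x" "!!n x. x \<in> C' n ==> h n x = h1 n x"
  using lftD[OF assms(2) h1(1) w h1(2)] by auto
 show "\<exists>h. shom D E h \<and> (\<forall>n. \<forall>x\<in>smp D n. q n (h n x) = w n x) \<and> (\<forall>n. \<forall>x\<in>C n. h n x = g n x)"
  using h h1(3) assms(3) by (intro exI[of _ h]) (auto simp: subset_iff)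
qed

text \<open>Pushouts: D is the union of C and the image of P, glued along P0.\<close>

lemma lft_attach:
 assumes P: "ss P" and chi: "shom P D \<chi>" and l: "lft E Y q P P0" and P0: "subc P P0" and C: "subc D C"
  and P0C: "!!n x. x \<in> P0 n ==> \<chi> n x \<in> C n"
  and inj: "!!n x x'. x \<in> smp P n ==> x \<notin> P0 n ==> x' \<in> smp P n ==> x' \<notin> P0 n ==> \<chi> n x = \<chi> n x' ==> x = x'"
  and disj: "!!n x. x \<in> smp P n ==> x \<notin> P0 n ==> \<chi> n x \<notin> C n"
  and cov: "!!n x. x \<in> smp D n ==> x \<in> C n \<or> x \<in> \<chi> n ` smp P n"
 shows "lft E Y q D C"
proof (rule lftI)
 fix g w assume g: "shom (res D C) E g" and w: "shom D Y w" and gw: "!!n x. x \<in> C n ==> q n (g n x) = w n x"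
 have gX: "shom (res P P0) E (%n x. g n (\<chi> n x))"
  by (rule shom_comp[OF _ g]) (use P0C chi P0 in "auto simp: shom_def subc_def subset_iff")
 obtain hP where hP: "shom P E hP" "!!n x. x \<in> smp P n ==> q n (hP n x) = w n (\<chi> n x)"
   "!!n x. x \<in> P0 n ==> hP n x = g n (\<chi> n x)"
  using lftD[OF l gX shom_comp[OF chi w]] gw P0C by (metis (no_types, lifting))
 define h where "h = (%n y. if y \<in> C n then g n y else hP n (SOME x. x \<in> smp P n \<and> x \<notin> P0 n \<and> \<chi> n x = y))"
 have hC: "h n y = g n y" if "y \<in> C n" for n y using that by (simp add: h_def)
 have hX: "h n (\<chi> n x) = hP n x" if x: "x \<in> smp P n" for n x
 proof (cases "x \<in> P0 n")
  case True then show ?thesis using hP(3) hC P0C by simp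
 next
  case False
  let ?x = "SOME x'. x' \<in> smp P n \<and> x' \<notin> P0 n \<and> \<chi> n x' = \<chi> n x"
  have "?x \<in> smp P n \<and> ?x \<notin> P0 n \<and> \<chi> n ?x = \<chi> n x"
   by (rule someI[of _ x]) (use x False in auto)
  then have "?x = x" using inj x False by blast
  then show ?thesis using disj[OF x False] by (simp add: h_def)
 qed
 have "shom D E h"
 proof (rule shomI)
  fix n y assume y: "y \<in> smp D n"
  show "h n y \<in> smp E n"
   using cov[OF y] hC hX shom_in[OF g] shom_in[OF hP(1)] by auto
 next
  fix m n \<alpha> y assume a: "\<alpha> \<in> ops m n" and y: "y \<in> smp D n"
  from cov[OF y] show "h m (act D m n \<alpha> y) = act E m n \<alpha> (h n y)"
  proof
   assume "y \<in> C n"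
   then show ?thesis using hC subc_act[OF C a] shom_act[OF g a] by simp
  next
   assume "y \<in> \<chi> n ` smp P n"
   then obtain x where x: "x \<in> smp P n" "y = \<chi> n x" by auto
   have "act D m n \<alpha> y = \<chi> m (act P m n \<alpha> x)" using shom_act[OF chi a x(1)] x(2) by simp
   then show ?thesis using hX[OF ss_act[OF P a x(1)]] hX[OF x(1)] shom_act[OF hP(1) a x(1)] x(2) by simp
  qed
 qed
 moreover have "q n (h n y) = w n y" if "y \<in> smp D n" for n y
  using cov[OF that] hC gw hX hP(2) by auto
 ultimately show "\<exists>h. shom D E h \<and> (\<forall>n. \<forall>x\<in>smp D n. q n (h n x) = w n x) \<and> (\<forall>n. \<forall>x\<in>C n. h n x = g n x)"
  using hC by blast
qed

text \<open>Transfinite extension of a lift. The stages are indexed by states C in Q and not by the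
  subcomplexes \<open>F C\<close> themselves: a step has to enlarge the state strictly, while
  \<open>F C\<close> may stay the same, which happens in \<open>prism_step\<close>.\<close>

lemma lft_zorn:
 fixes F :: "(nat \<times> 'c) set => nat => 'd set"
 assumes C0: "C0 \<in> Q"
  and ch: "!!K. K \<noteq> {} ==> K \<subseteq> Q ==> (!!A B. A \<in> K ==> B \<in> K ==> A \<subseteq> B \<or> B \<subseteq> A) ==> \<Union>K \<in> Q"
  and FU: "!!K n. K \<noteq> {} ==> K \<subseteq> Q ==> (!!A B. A \<in> K ==> B \<in> K ==> A \<subseteq> B \<or> B \<subseteq> A) ==> F (\<Union>K) n = (\<Union>C\<in>K. F C n)"
  and Fm: "!!C C' n. C \<in> Q ==> C' \<in> Q ==> C \<subseteq> C' ==> F C n \<subseteq> F C' n"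
  and Fs: "!!C. C \<in> Q ==> subc D (F C)"
  and step: "!!C. C \<in> Q ==> C0 \<subseteq> C ==> F C \<noteq> smp D ==> \<exists>C'\<in>Q. C \<subset> C' \<and> lft E Y q (res D (F C')) (F C)"
 shows "lft E Y q D (F C0)"
proof (rule lftI)
 fix g w assume g: "shom (res D (F C0)) E g" and w: "shom D Y w" and gw: "!!n x. x \<in> F C0 n ==> q n (g n x) = w n x"
 define ok where "ok C G \<longleftrightarrow> C \<in> Q \<and> C0 \<subseteq> C \<and>
   (\<forall>n x e. (n,x,e) \<in> G --> x \<in> F C n \<and> e \<in> smp E n \<and> q n e = w n x) \<and>
   (\<forall>n x e e'. (n,x,e) \<in> G \<and> (n,x,e') \<in> G --> e = e') \<and>
   (\<forall>n. \<forall>x\<in>F C n. \<exists>e. (n,x,e) \<in> G) \<and>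
   (\<forall>m n \<alpha> x e. \<alpha> \<in> ops m n \<and> (n,x,e) \<in> G --> (m, act D m n \<alpha> x, act E m n \<alpha> e) \<in> G) \<and>
   (\<forall>n. \<forall>x\<in>F C0 n. (n,x,g n x) \<in> G)" for C and G :: "(nat \<times> 'd \<times> 'a) set"
 \<comment> \<open>State and graph of a partial lift are packed into one set by the injections of a
   sum type, so that Zorn's lemma for inclusion orders both at once.\<close>
 define A where "A = {S. ok (Inl -` S) (Inr -` S)}"
 have okD: "\<exists>h. shom (res D (F C)) E h \<and> (\<forall>n. \<forall>x\<in>F C n. q n (h n x) = w n x \<and> (n,x,h n x) \<in> G) \<and> (\<forall>n. \<forall>x\<in>F C0 n. h n x = g n x)"
  if o: "ok C G" for C G
 proof -
  define h where "h = (%n x. SOME e. (n,x,e) \<in> G)"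
  have hG: "(n,x,h n x) \<in> G" if "x \<in> F C n" for n x
   unfolding h_def by (rule someI_ex) (use o that in "auto simp: ok_def")
  have un: "e = h n x" if "(n,x,e) \<in> G" for n x e
  proof -
   have "x \<in> F C n" using o that unfolding ok_def by blast
   from hG[OF this] show ?thesis using o that unfolding ok_def by blast
  qed
  have sub: "subc D (F C)" using Fs o by (auto simp: ok_def)
  have "shom (res D (F C)) E h"
  proof (rule shomI)
   fix n x assume "x \<in> smp (res D (F C)) n"
   then have "(n,x,h n x) \<in> G" using hG by simp
   then show "h n x \<in> smp E n" using o unfolding ok_def by blast
  next
   fix m n \<alpha> x assume a: "\<alpha> \<in> ops m n" and "x \<in> smp (res D (F C)) n"
   then have "(n,x,h n x) \<in> G" using hG by simp
   then have "(m, act D m n \<alpha> x, act E m n \<alpha> (h n x)) \<in> G" using o a unfolding ok_def by blast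
   then show "h m (act (res D (F C)) m n \<alpha> x) = act E m n \<alpha> (h n x)" using un by simp
  qed
  moreover have "q n (h n x) = w n x" if "x \<in> F C n" for n x using hG[OF that] o unfolding ok_def by blast
  moreover have "h n x = g n x" if "x \<in> F C0 n" for n x
  proof -
   have "(n,x,g n x) \<in> G" using o that unfolding ok_def by blast
   then show ?thesis using un by simp
  qed
  ultimately show ?thesis using hG by blast
 qed
 have okI: "ok C {(n,x,h n x) | n x. x \<in> F C n}"
  if "C \<in> Q" "C0 \<subseteq> C" "shom (res D (F C)) E h" "!!n x. x \<in> F C n ==> q n (h n x) = w n x" "!!n x. x \<in> F C0 n ==> h n x = g n x" for C h
 proof -
  have 1: "!!n x. x \<in> F C n ==> h n x \<in> smp E n" using shom_in[OF that(3)] by simp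
  have 2: "!!m n \<alpha> x. \<alpha> \<in> ops m n ==> x \<in> F C n ==> h m (act D m n \<alpha> x) = act E m n \<alpha> (h n x)" using shom_act[OF that(3)] by simp
  have 3: "!!m n \<alpha> x. \<alpha> \<in> ops m n ==> x \<in> F C n ==> act D m n \<alpha> x \<in> F C m" by (rule subc_act[OF Fs[OF that(1)]])
  show ?thesis
   unfolding ok_def
  proof (intro conjI that allI impI ballI)
   show "(m, act D m n \<alpha> x, act E m n \<alpha> e) \<in> {(n,x,h n x) | n x. x \<in> F C n}"
    if "\<alpha> \<in> ops m n \<and> (n,x,e) \<in> {(n,x,h n x) | n x. x \<in> F C n}" for m n \<alpha> x e
    using that 2[of \<alpha> m n x] 3[of \<alpha> m n x] by simp
   show "(n,x,g n x) \<in> {(n,x,h n x) | n x. x \<in> F C n}" if "x \<in> F C0 n" for n x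
    using that \<open>!!n x. x \<in> F C0 n ==> h n x = g n x\<close>[OF that] Fm[OF C0 \<open>C \<in> Q\<close> \<open>C0 \<subseteq> C\<close>] by (auto simp: subset_iff)
  qed (use 1 that(4) in auto)
 qed
 have vI: "Inl -` (Inl ` C \<union> Inr ` G) = C" "Inr -` (Inl ` C \<union> Inr ` G) = G" for C :: "(nat \<times> 'c) set" and G :: "(nat \<times> 'd \<times> 'a) set"
  by auto
 have "\<exists>M\<in>A. \<forall>X\<in>A. M \<subseteq> X --> X = M"
 proof (rule subset_Zorn_nonempty)
  have "ok C0 {(n,x,g n x) | n x. x \<in> F C0 n}" by (rule okI) (use C0 g gw in auto)
  then have "Inl ` C0 \<union> Inr ` {(n,x,g n x) | n x. x \<in> F C0 n} \<in> A"
   unfolding A_def by (simp only: mem_Collect_eq vI)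
  then show "A \<noteq> {}" by blast
 next
  fix S assume S: "S \<noteq> {}" "subset.chain A S"
  have SA: "ok (Inl -` X) (Inr -` X)" if "X \<in> S" for X
   using S(2) that by (auto simp: subset_chain_def A_def)
  have tot: "X \<subseteq> X' \<or> X' \<subseteq> X" if "X \<in> S" "X' \<in> S" for X X'
   using S(2) that by (auto simp: subset_chain_def)
  let ?K = "(%X. Inl -` X) ` S"
  have K1: "?K \<noteq> {}" using S(1) by auto
  have K2: "?K \<subseteq> Q" using SA unfolding ok_def by blast
  have K3: "!!A B. A \<in> ?K ==> B \<in> ?K ==> A \<subseteq> B \<or> B \<subseteq> A"
  proof -
   fix A B :: "(nat \<times> 'c) set" assume "A \<in> ?K" "B \<in> ?K"
   then obtain X X' where X: "X \<in> S" "A = Inl -` X" "X' \<in> S" "B = Inl -` X'" by blast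
   show "A \<subseteq> B \<or> B \<subseteq> A" using tot[OF X(1,3)] unfolding X(2,4) by (metis vimage_mono)
  qed
  have F1: "F (\<Union>?K) n = (\<Union>X\<in>S. F (Inl -` X) n)" for n
   using FU[OF K1 K2 K3] by simp
  have "ok (\<Union>?K) (\<Union>X\<in>S. Inr -` X)"
   unfolding ok_def
  proof (intro conjI allI impI ballI)
   show "\<Union>?K \<in> Q" by (rule ch[OF K1 K2 K3])
   obtain X where X: "X \<in> S" using S(1) by blast
   from SA[OF X] have "C0 \<subseteq> Inl -` X" unfolding ok_def by (elim conjE)
   then show "C0 \<subseteq> \<Union>?K" using X by (metis UN_upper order_trans)
   show "x \<in> F (\<Union>?K) n" "e \<in> smp E n" "q n e = w n x" if "(n,x,e) \<in> (\<Union>X\<in>S. Inr -` X)" for n x e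
   proof -
    from that obtain X where X: "X \<in> S" "(n,x,e) \<in> Inr -` X" by blast
    have "x \<in> F (Inl -` X) n \<and> e \<in> smp E n \<and> q n e = w n x"
     using SA[OF X(1)] X(2) unfolding ok_def by blast
    then show "x \<in> F (\<Union>?K) n" "e \<in> smp E n" "q n e = w n x" using F1 X(1) by auto
   qed
   show "e = e'" if "(n,x,e) \<in> (\<Union>X\<in>S. Inr -` X) \<and> (n,x,e') \<in> (\<Union>X\<in>S. Inr -` X)" for n x e e'
   proof -
    from that obtain X X' where X: "X \<in> S" "(n,x,e) \<in> Inr -` X" "X' \<in> S" "(n,x,e') \<in> Inr -` X'" by blast
    then obtain Z where "Z \<in> S" "X \<subseteq> Z" "X' \<subseteq> Z" using tot by blast
    then have "(n,x,e) \<in> Inr -` Z \<and> (n,x,e') \<in> Inr -` Z" "ok (Inl -` Z) (Inr -` Z)" using X SA by auto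
    then show ?thesis unfolding ok_def by blast
   qed
   show "\<exists>e. (n,x,e) \<in> (\<Union>X\<in>S. Inr -` X)" if "x \<in> F (\<Union>?K) n" for n x
   proof -
    from that obtain X where X: "X \<in> S" "x \<in> F (Inl -` X) n" using F1 by blast
    then have "\<exists>e. (n,x,e) \<in> Inr -` X" using SA[OF X(1)] unfolding ok_def by blast
    then show ?thesis using X(1) by blast
   qed
   show "(m, act D m n \<alpha> x, act E m n \<alpha> e) \<in> (\<Union>X\<in>S. Inr -` X)" if "\<alpha> \<in> ops m n \<and> (n,x,e) \<in> (\<Union>X\<in>S. Inr -` X)" for m n \<alpha> x e
   proof -
    from that obtain X where X: "X \<in> S" "(n,x,e) \<in> Inr -` X" by blast
    then have "(m, act D m n \<alpha> x, act E m n \<alpha> e) \<in> Inr -` X" using SA[OF X(1)] that unfolding ok_def by blast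
    then show ?thesis using X(1) by blast
   qed
   show "(n,x,g n x) \<in> (\<Union>X\<in>S. Inr -` X)" if x: "x \<in> F C0 n" for n x
   proof -
    obtain X where X: "X \<in> S" using S(1) by blast
    then have "(n,x,g n x) \<in> Inr -` X" using SA[OF X] x unfolding ok_def by blast
    then show ?thesis using X by blast
   qed
  qed
  then show "\<Union>S \<in> A" by (simp add: A_def vimage_Union)
 qed
 then obtain M where M: "M \<in> A" "!!X. X \<in> A ==> M \<subseteq> X ==> X = M" by blast
 let ?C = "Inl -` M" and ?G = "Inr -` M"
 have o: "ok ?C ?G" using M(1) by (simp add: A_def)
 then have CQ: "?C \<in> Q" "C0 \<subseteq> ?C" by (auto simp: ok_def)
 obtain h where h: "shom (res D (F ?C)) E h" "!!n x. x \<in> F ?C n ==> q n (h n x) = w n x \<and> (n,x,h n x) \<in> ?G"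
   "!!n x. x \<in> F C0 n ==> h n x = g n x"
  using okD[OF o] by blast
 have "F ?C = smp D"
 proof (rule ccontr)
  assume "F ?C \<noteq> smp D"
  then obtain C' where C': "C' \<in> Q" "?C \<subset> C'" "lft E Y q (res D (F C')) (F ?C)" using step[OF CQ] by blast
  have w': "shom (res D (F C')) Y w" by (rule shom_res[OF w]) (use Fs[OF C'(1)] in "auto simp: subc_def")
  obtain h' where h': "shom (res D (F C')) E h'" "!!n x. x \<in> F C' n ==> q n (h' n x) = w n x" "!!n x. x \<in> F ?C n ==> h' n x = h n x"
   using lftD[OF C'(3) _ w', of h] h by auto
  have fs: "F C0 n \<subseteq> F ?C n" for n by (rule Fm[OF C0 CQ])
  let ?G' = "{(n,x,h' n x) | n x. x \<in> F C' n}"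
  have "h' n x = g n x" if "x \<in> F C0 n" for n x
   using h'(3)[of x n] h(3)[OF that] fs[of n] that by auto
  moreover have "C0 \<subseteq> C'" using CQ(2) C'(2) by blast
  ultimately have "ok C' ?G'"
   using okI[OF C'(1) _ h'(1,2)] by blast
  then have 1: "Inl ` C' \<union> Inr ` ?G' \<in> A"
   unfolding A_def by (simp only: mem_Collect_eq vI)
  have "?G \<subseteq> ?G'"
  proof
   fix t assume t: "t \<in> ?G"
   obtain n x e where te: "t = (n,x,e)" by (cases t) auto
   have x: "x \<in> F ?C n" using o t te unfolding ok_def by blast
   then have "e = h n x" using h(2)[OF x] o t te unfolding ok_def by blast
   moreover have "x \<in> F C' n" using Fm[OF CQ(1) C'(1)] C'(2) x by blast
   ultimately show "t \<in> ?G'" using te h'(3)[OF x] by auto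
  qed
  have "M \<subseteq> Inl ` C' \<union> Inr ` ?G'"
  proof
   fix s assume s: "s \<in> M"
   show "s \<in> Inl ` C' \<union> Inr ` ?G'"
   proof (cases s)
    case (Inl a) then show ?thesis using s C'(2) by auto
   next
    case (Inr b)
    then have "b \<in> ?G" using s by simp
    then have "b \<in> ?G'" by (rule subsetD[OF \<open>?G \<subseteq> ?G'\<close>])
    then show ?thesis unfolding Inr by (intro UnI2 imageI)
   qed
  qed
  from M(2)[OF 1 this] have "Inl -` (Inl ` C' \<union> Inr ` ?G') = ?C" by simp
  then have "C' = ?C" by (simp only: vI)
  then show False using C'(2) by blast
 qed
 then show "\<exists>h. shom D E h \<and> (\<forall>n. \<forall>x\<in>smp D n. q n (h n x) = w n x) \<and> (\<forall>n. \<forall>x\<in>F C0 n. h n x = g n x)"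
  using h by (intro exI[of _ h]) auto
qed

section \<open>Nondegenerate simplices\<close>

text \<open>A section through a prescribed i is what lets \<open>nondeg_unique\<close> read off a
  degeneracy operator at each of its arguments.\<close>

lemma section_through:
 assumes a: "\<alpha> \<in> ops m n" and s: "\<alpha> ` {..m} = {..n}" and i: "i \<le> m"
 obtains \<sigma> where "\<sigma> \<in> ops n m" "compose {..n} \<alpha> \<sigma> = (\<lambda>k\<in>{..n}. k)" "\<sigma> (\<alpha> i) = i"
proof -
 define \<sigma> where "\<sigma> = (\<lambda>b\<in>{..n}. if b = \<alpha> i then i else (LEAST k. k \<le> m \<and> \<alpha> k = b))"
 have ex: "\<exists>k. k \<le> m \<and> \<alpha> k = b" if "b \<le> n" for b
  using s that by (metis atMost_iff image_iff)
 have P: "\<sigma> b \<le> m \<and> \<alpha> (\<sigma> b) = b" if "b \<le> n" for b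
  using LeastI_ex[OF ex[OF that]] i that by (auto simp: \<sigma>_def)
 have mono: "\<sigma> b \<le> \<sigma> c" if "b \<le> c" "c \<le> n" for b c
 proof (cases "b = c")
  case False
  then have "\<alpha> (\<sigma> b) < \<alpha> (\<sigma> c)" using P that by simp
  then show ?thesis using ops_mono[OF a] P that by (meson le_trans linorder_not_le nle_le)
 qed auto
 have "\<sigma> \<in> ops n m" by (rule opsI) (use P mono in "auto simp: \<sigma>_def")
 moreover have "compose {..n} \<alpha> \<sigma> = (\<lambda>k\<in>{..n}. k)"
  using P by (auto simp: compose_def)
 moreover have "\<sigma> (\<alpha> i) = i" using ops_le[OF a i] by (simp add: \<sigma>_def)
 ultimately show ?thesis using that by blast
qed

lemma nonsurj_factor:
 assumes a: "\<alpha> \<in> ops m n" and s: "\<alpha> ` {..m} \<noteq> {..n}"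
 obtains \<beta> \<delta> where "n > 0" "\<beta> \<in> ops m (n-1)" "\<delta> \<in> ops (n-1) n" "\<alpha> = compose {..m} \<delta> \<beta>"
proof -
 have "\<alpha> ` {..m} \<subseteq> {..n}" using ops_le[OF a] by auto
 then obtain v where v: "v \<le> n" "!!i. i \<le> m ==> \<alpha> i \<noteq> v" using s by blast
 have n: "n > 0" using v ops_le[OF a, of 0] by (metis le_0_eq not_gr0 zero_le)
 define \<delta> where "\<delta> = (\<lambda>i\<in>{..n-1}. if i < v then i else i + 1)"
 define \<beta> where "\<beta> = (\<lambda>i\<in>{..m}. if \<alpha> i < v then \<alpha> i else \<alpha> i - 1)"
 have "\<delta> \<in> ops (n-1) n" by (rule opsI) (use n in "auto simp: \<delta>_def")
 moreover have B: "\<beta> \<in> ops m (n-1)"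
 proof (rule opsI)
  fix i j assume "i \<le> j" "j \<le> m"
  then show "\<beta> i \<le> \<beta> j" using ops_mono[OF a, of i j] v(2)[of i] v(2)[of j] by (auto simp: \<beta>_def)
 next
  fix i assume "i \<le> m"
  then show "\<beta> i \<le> n - 1" using ops_le[OF a, of i] v by (auto simp: \<beta>_def)
 qed (auto simp: \<beta>_def)
 moreover have "\<alpha> = compose {..m} \<delta> \<beta>"
 proof (rule extensionalityI[OF ops_ext[OF a]])
  fix i assume i: "i \<in> {..m}"
  then have "\<beta> i \<le> n - 1" using ops_le[OF B] by simp
  then show "\<alpha> i = compose {..m} \<delta> \<beta> i"
   using i v(2)[of i] by (auto simp: compose_def \<delta>_def \<beta>_def)
 qed (auto simp: compose_def)
 ultimately show ?thesis using that n by blast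
qed

definition nondeg :: "'a sset => nat => 'a => bool" where
 "nondeg X n x \<longleftrightarrow> x \<in> smp X n \<and> (\<forall>m<n. \<forall>\<alpha>\<in>ops n m. \<forall>z\<in>smp X m. x \<noteq> act X n m \<alpha> z)"

text \<open>If \<tau> were not onto, x would be degenerate, factoring through dimension n - 1; and a
  monotone surjection of a finite chain onto itself is the identity.\<close>

lemma nondeg_endo:
 assumes X: "ss X" and x: "nondeg X n x" and t: "\<tau> \<in> ops n n" "x = act X n n \<tau> x" "i \<le> n"
 shows "\<tau> i = i"
proof -
 have xs: "x \<in> smp X n" using x by (simp add: nondeg_def)
 have "\<tau> ` {..n} = {..n}"
 proof (rule ccontr)
  assume "\<tau> ` {..n} \<noteq> {..n}"
  then obtain \<beta> \<delta> where b: "n > 0" "\<beta> \<in> ops n (n-1)" "\<delta> \<in> ops (n-1) n" "\<tau> = compose {..n} \<delta> \<beta>"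
   using nonsurj_factor[OF t(1)] by metis
  have "x = act X n (n-1) \<beta> (act X (n-1) n \<delta> x)"
   using t(2) b ss_comp[OF X b(2,3) xs] by simp
  then show False using x b(1,2) ss_act[OF X b(3) xs] unfolding nondeg_def by (metis One_nat_def diff_less zero_less_one)
 qed
 then obtain \<sigma> where s: "\<sigma> \<in> ops n n" "compose {..n} \<tau> \<sigma> = (\<lambda>k\<in>{..n}. k)"
  using section_through[OF t(1)] by (metis zero_le)
 have inj: "inj_on \<tau> {..n}" using \<open>\<tau> ` {..n} = {..n}\<close> by (simp add: eq_card_imp_inj_on)
 have lt: "\<tau> j < \<tau> k" if "j < k" "k \<le> n" for j k
 proof -
  have "\<tau> j \<noteq> \<tau> k" using inj_onD[OF inj, of j k] that by auto
  then show ?thesis using ops_mono[OF t(1), of j k] that by simp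
 qed
 have lo: "j \<le> \<tau> j" if "j \<le> n" for j using that
 proof (induction j)
  case (Suc j) then show ?case using lt[of j "Suc j"] by simp
 qed auto
 have hi: "\<tau> (n - j) \<le> n - j" if "j \<le> n" for j using that
 proof (induction j)
  case 0 then show ?case using ops_le[OF t(1)] by simp
 next
  case (Suc j)
  then have "\<tau> (n - Suc j) < \<tau> (n - j)" "\<tau> (n - j) \<le> n - j" using lt[of "n - Suc j" "n - j"] by auto
  then show ?case using Suc.prems by linarith
 qed
 show ?thesis using lo[OF t(3)] hi[of "n - i"] t(3) by simp
qed

text \<open>Uniqueness half of the Eilenberg-Zilber lemma: for a section \<sigma> of \<alpha>
  through i, the operator \<alpha>' \<sigma> fixes x, hence is the identity, which at \<alpha> i
  says that \<alpha>' i = \<alpha> i.\<close>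

lemma nondeg_unique:
 assumes X: "ss X" and x: "nondeg X n x" and a: "\<alpha> \<in> ops m n" "\<alpha>' \<in> ops m n"
  and s: "\<alpha> ` {..m} = {..n}" and e: "act X m n \<alpha> x = act X m n \<alpha>' x"
 shows "\<alpha> = \<alpha>'"
proof (rule ops_eqI[OF a])
 fix i assume i: "i \<le> m"
 have xs: "x \<in> smp X n" using x by (simp add: nondeg_def)
 obtain \<sigma> where g: "\<sigma> \<in> ops n m" "compose {..n} \<alpha> \<sigma> = (\<lambda>k\<in>{..n}. k)" "\<sigma> (\<alpha> i) = i"
  by (rule section_through[OF a(1) s i])
 have "x = act X n m \<sigma> (act X m n \<alpha> x)" using ss_comp[OF X g(1) a(1) xs] g(2) ss_id[OF X xs] by simp
 also have "\<dots> = act X n n (compose {..n} \<alpha>' \<sigma>) x" using e ss_comp[OF X g(1) a(2) xs] by simp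
 finally have "(compose {..n} \<alpha>' \<sigma>) (\<alpha> i) = \<alpha> i"
  using nondeg_endo[OF X x ops_compose[OF g(1) a(2)]] ops_le[OF a(1) i] by blast
 then show "\<alpha> i = \<alpha>' i" using g(3) ops_le[OF a(1) i] by (simp add: compose_def)
qed

text \<open>Eilenberg-Zilber decomposition, with d the least dimension through which x factors. The
  section \<sigma> recovers z from x, which transfers membership in a subcomplex from x to z;
  minimality of d is kept as a conclusion because later proofs compare it with other
  factorizations.\<close>

lemma ez_exists:
 assumes X: "ss X" and x: "x \<in> smp X n"
 obtains d \<alpha> \<sigma> z where "d \<le> n" "\<alpha> \<in> ops n d" "\<sigma> \<in> ops d n" "compose {..d} \<alpha> \<sigma> = (\<lambda>k\<in>{..d}. k)" "\<alpha> ` {..n} = {..d}"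
   "nondeg X d z" "x = act X n d \<alpha> z" "z = act X d n \<sigma> x"
   "!!m \<beta> y. \<beta> \<in> ops n m ==> y \<in> smp X m ==> x = act X n m \<beta> y ==> d \<le> m"
proof -
 define R where "R d \<longleftrightarrow> (\<exists>\<alpha>\<in>ops n d. \<exists>z\<in>smp X d. x = act X n d \<alpha> z)" for d
 have "R n" unfolding R_def using x ss_id[OF X x] ops_id by metis
 define d where "d = (LEAST d. R d)"
 have Rd: "R d" "d \<le> n" using LeastI[of R n] Least_le[of R n] \<open>R n\<close> by (auto simp: d_def)
 have min: "d \<le> k" if "R k" for k using that Least_le[of R k] by (simp add: d_def)
 obtain \<alpha> z where a: "\<alpha> \<in> ops n d" and z: "z \<in> smp X d" and xz: "x = act X n d \<alpha> z" using Rd R_def by blast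
 have s: "\<alpha> ` {..n} = {..d}"
 proof (rule ccontr)
  assume "\<alpha> ` {..n} \<noteq> {..d}"
  then obtain \<beta> \<delta> where b: "d > 0" "\<beta> \<in> ops n (d-1)" "\<delta> \<in> ops (d-1) d" "\<alpha> = compose {..n} \<delta> \<beta>"
   using nonsurj_factor[OF a] by metis
  have "R (d - 1)" unfolding R_def using b ss_comp[OF X b(2,3) z] ss_act[OF X b(3) z] xz by metis
  then show False using min[of "d-1"] b(1) by simp
 qed
 obtain \<sigma> where g: "\<sigma> \<in> ops d n" "compose {..d} \<alpha> \<sigma> = (\<lambda>k\<in>{..d}. k)"
  using section_through[OF a s] by (metis zero_le)
 have zs: "z = act X d n \<sigma> x" using ss_comp[OF X g(1) a z] g(2) ss_id[OF X z] xz by simp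
 have "nondeg X d z"
  unfolding nondeg_def
 proof (intro conjI z allI impI ballI notI)
  fix m \<beta> y assume m: "m < d" "\<beta> \<in> ops d m" "y \<in> smp X m" "z = act X d m \<beta> y"
  then have "R m" unfolding R_def using xz ss_comp[OF X a m(2,3)] ops_compose[OF a m(2)] by metis
  then show False using min m(1) by fastforce
 qed
 then show ?thesis using that[of d \<alpha> \<sigma> z] Rd(2) a g s xz zs min R_def by blast
qed

section \<open>Naive fibrations\<close>

definition zero :: "nat => nat => nat" where "zero n = (\<lambda>k\<in>{..n}. 0)"
definition one :: "nat => nat => nat" where "one n = (\<lambda>k\<in>{..n}. 1)"

lemma zero_J [simp]: "zero n \<in> smp J n" and one_J [simp]: "one n \<in> smp J n"
 by (auto simp: J_simps zero_def one_def)

lemma zero_at [simp]: "i \<le> n ==> zero n i = 0" and one_at [simp]: "i \<le> n ==> one n i = 1"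
 by (auto simp: zero_def one_def)

lemma zero_act [simp]: "\<alpha> \<in> ops m n ==> act J m n \<alpha> (zero n) = zero m"
 and one_act [simp]: "\<alpha> \<in> ops m n ==> act J m n \<alpha> (one n) = one m"
 unfolding J_simps zero_def one_def by (auto simp: compose_def ops_le)

lemma J_cases: "x \<in> smp J n ==> i \<le> n ==> x i = 0 \<or> x i = 1"
 by (auto simp: J_simps PiE_iff)

lemma J_act_at: "i \<le> m ==> act J m n \<alpha> x i = x (\<alpha> i)"
 by (simp add: J_simps compose_def)

lemma J_eqI: "x \<in> smp J n ==> y \<in> smp J n ==> (!!i. i \<le> n ==> x i = y i) ==> x = y"
 by (auto simp: J_simps intro: PiE_ext)

lemma zero_not_one [simp]: "zero n \<noteq> one n" "one n \<noteq> zero n"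
 by (metis order_refl zero_at one_at zero_neq_one)+

text \<open>The minimum of 0-1 sequences, written as a product; it contracts J to the vertex 0.
  Since simplices of J are arbitrary sequences of vertices, every operation on vertices is
  simplicial.\<close>

definition jand :: "nat => (nat => nat) => (nat => nat) => nat => nat" where
 "jand n x y = (\<lambda>i\<in>{..n}. x i * y i)"

definition jnot :: "nat => (nat => nat) => nat => nat" where
 "jnot n x = (\<lambda>i\<in>{..n}. 1 - x i)"

lemma jand_J [simp]: "x \<in> smp J n ==> y \<in> smp J n ==> jand n x y \<in> smp J n"
 using J_cases[of x n] J_cases[of y n] by (force simp: jand_def J_simps PiE_iff)

lemma jnot_J [simp]: "x \<in> smp J n ==> jnot n x \<in> smp J n"
 using J_cases[of x n] by (force simp: jnot_def J_simps PiE_iff)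

lemma jand_act: "\<alpha> \<in> ops m n ==> jand m (act J m n \<alpha> x) (act J m n \<alpha> y) = act J m n \<alpha> (jand n x y)"
 by (auto simp: jand_def J_simps compose_def ops_le fun_eq_iff)

lemma jnot_act: "\<alpha> \<in> ops m n ==> jnot m (act J m n \<alpha> x) = act J m n \<alpha> (jnot n x)"
 by (auto simp: jnot_def J_simps compose_def ops_le fun_eq_iff)

lemma jand_zero [simp]: "jand n (zero n) y = zero n" "jand n y (zero n) = zero n"
 by (auto simp: jand_def zero_def)

lemma jand_one [simp]: "y \<in> smp J n ==> jand n (one n) y = y" "y \<in> smp J n ==> jand n y (one n) = y"
 by (auto simp: jand_def J_simps fun_eq_iff PiE_iff extensional_def one_def)

lemma jnot_zero [simp]: "jnot n (zero n) = one n" "jnot n (one n) = zero n"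
 by (auto simp: jnot_def zero_def one_def)

lemma jnot_jnot [simp]: "x \<in> smp J n ==> jnot n (jnot n x) = x"
proof (rule J_eqI)
 fix i assume "x \<in> smp J n" "i \<le> n"
 then show "jnot n (jnot n x) i = x i" using J_cases[of x n i] by (auto simp: jnot_def)
qed simp_all

text \<open>The pushout-product of the inclusions of 0 in J and of C in D, as a subcomplex of
  \<open>cyl D\<close>.\<close>

definition box :: "'d sset => (nat => 'd set) => nat => ((nat => nat) \<times> 'd) set" where
 "box D C n = {(x, d). x \<in> smp J n \<and> d \<in> smp D n \<and> (d \<in> C n \<or> x = zero n)}"

text \<open>The naive fibrations of Cisinski's theory: the relative form of J-fibrancy. That such
  maps lift against all trivial cofibrations is shown over J-fibrant bases only, in
  \<open>tc_nfib\<close>.\<close>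

definition nfib :: "'e sset => 'y sset => (nat => 'e => 'y) => bool" where
 "nfib E Y q \<longleftrightarrow> ss E \<and> ss Y \<and> shom E Y q \<and>
   (\<forall>n. lft E Y q (cyl (simplex n)) (box (simplex n) (smp (boundary n))))"

definition pt :: "unit sset" where
 "pt = \<lparr>smp = %n. {()}, act = %m n \<alpha> x. x\<rparr>"

definition jfib :: "'a sset => bool" where
 "jfib Z \<longleftrightarrow> nfib Z pt (%_ _. ())"

lemma ss_pt [simp]: "ss pt"
 by (auto simp: simplicial_set_def pt_def)

lemma shom_pt [simp]: "shom X pt w"
 by (auto simp: shom_def pt_def)

lemma subc_box: "ss D ==> subc D C ==> subc (cyl D) (box D C)"
 by (auto simp: subc_def box_def ss_act simplicial_set_J)

lemma simplex_simps: "smp (simplex n) m = ops m n" "act (simplex n) k m \<beta> \<alpha> = compose {..k} \<alpha> \<beta>"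
 by (auto simp: simplex_def)

lemma boundary_simps: "smp (boundary n) m = {\<alpha> \<in> ops m n. \<alpha> ` {..m} \<noteq> {..n}}" "act (boundary n) = act (simplex n)"
 by (auto simp: boundary_def)

lemma subc_boundary: "subc (simplex n) (smp (boundary n))"
 using subcomplex_boundary[of n] unfolding subcomplex_def subc_def by (metis ss_act)

lemma nonsurj_deg:
 assumes "ss D" "subc D C" "!!k y. k < n ==> y \<in> smp D k ==> y \<in> C k"
  "d \<in> smp D n" "\<alpha> \<in> ops m n" "\<alpha> ` {..m} \<noteq> {..n}"
 shows "act D m n \<alpha> d \<in> C m"
proof -
 obtain \<beta> \<delta> where b: "n > 0" "\<beta> \<in> ops m (n-1)" "\<delta> \<in> ops (n-1) n" "\<alpha> = compose {..m} \<delta> \<beta>"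
  using nonsurj_factor[OF assms(5,6)] by metis
 have "act D (n-1) n \<delta> d \<in> C (n-1)" using assms(3)[of "n-1"] b ss_act[OF assms(1) b(3) assms(4)] by simp
 then show ?thesis using ss_comp[OF assms(1) b(2,3) assms(4)] b(4) subc_act[OF assms(2) b(2)] by metis
qed

text \<open>Cell induction reduces an arbitrary inclusion to boundaries. A missing simplex d of
  least dimension is nondegenerate with all proper faces present, and by Eilenberg-Zilber its
  degeneracies are new and pairwise distinct, so that adding d glues one generating
  pushout-product.\<close>

lemma box_lft:
 assumes q: "nfib E Y q" and D: "ss D" and C: "subc D C"
 shows "lft E Y q (cyl D) (box D C)"
proof -
 define Q where "Q = {S. subc D (%n. {d. (n,d) \<in> S})}"
 define F where "F S = box D (%n. {d. (n,d) \<in> S})" for S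
 define S0 where "S0 = {(n,d). d \<in> C n}"
 let ?JD = "cyl D"
 have "lft E Y q ?JD (F S0)"
 proof (rule lft_zorn[where Q = Q and F = F])
  show "S0 \<in> Q" using C by (simp add: Q_def S0_def)
  show "\<Union>K \<in> Q" if "K \<subseteq> Q" for K using that unfolding Q_def subc_def by blast
  show "F (\<Union>K) n = (\<Union>C\<in>K. F C n)" if "K \<noteq> {}" for K n using that by (auto simp: F_def box_def)
  show "F A n \<subseteq> F B n" if "A \<subseteq> B" for A B n using that by (auto simp: F_def box_def)
  show "subc ?JD (F A)" if "A \<in> Q" for A using that subc_box[OF D] by (auto simp: Q_def F_def)
 next
  fix S assume S: "S \<in> Q" "S0 \<subseteq> S" and ne: "F S \<noteq> smp ?JD"
  let ?S = "%n. {d. (n,d) \<in> S}"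
  have sS: "subc D ?S" using S(1) by (simp add: Q_def)
  have "\<exists>n d. d \<in> smp D n \<and> (n,d) \<notin> S"
  proof (rule ccontr)
   assume "\<not> ?thesis"
   then have "F S = smp ?JD" by (auto simp: F_def box_def fun_eq_iff)
   then show False using ne by simp
  qed
  then have ex: "\<exists>n. \<exists>d. d \<in> smp D n \<and> (n,d) \<notin> S" .
  define n where "n = (LEAST n. \<exists>d. d \<in> smp D n \<and> (n,d) \<notin> S)"
  obtain d where d: "d \<in> smp D n" "(n,d) \<notin> S" using LeastI_ex[OF ex] by (auto simp: n_def)
  have low: "y \<in> ?S k" if "k < n" "y \<in> smp D k" for k y
   using not_less_Least[of k "%n. \<exists>d. d \<in> smp D n \<and> (n,d) \<notin> S"] that by (auto simp: n_def)
  have nd: "nondeg D n d"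
   unfolding nondeg_def
  proof (intro conjI d allI impI ballI notI)
   fix m \<alpha> z assume "m < n" "\<alpha> \<in> ops n m" "z \<in> smp D m" "d = act D n m \<alpha> z"
   then show False using subc_act[OF sS, of \<alpha> n m z] low d(2) by auto
  qed
  define S' where "S' = S \<union> {(m, act D m n \<alpha> d) | m \<alpha>. \<alpha> \<in> ops m n}"
  have "subc D (%n. {d. (n,d) \<in> S'})"
   unfolding subc_def
  proof (intro conjI allI ballI subsetI)
   fix m x assume "x \<in> {d. (m,d) \<in> S'}"
   then show "x \<in> smp D m" using subc_sub[OF sS] ss_act[OF D _ d(1)] by (auto simp: S'_def)
  next
   fix k m \<beta> x assume b: "\<beta> \<in> ops k m" and x: "x \<in> {d. (m,d) \<in> S'}"
   then consider "(m,x) \<in> S" | \<alpha> where "\<alpha> \<in> ops m n" "x = act D m n \<alpha> d" by (auto simp: S'_def)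
   then show "act D k m \<beta> x \<in> {d. (k,d) \<in> S'}"
   proof cases
    case 1 then show ?thesis using subc_act[OF sS b] by (auto simp: S'_def)
   next
    case 2 then show ?thesis using ss_comp[OF D b 2(1) d(1)] ops_compose[OF b 2(1)] by (auto simp: S'_def)
   qed
  qed
  then have S'Q: "S' \<in> Q" by (simp add: Q_def)
  have "d = act D n n (\<lambda>i\<in>{..n}. i) d" using ss_id[OF D d(1)] by simp
  then have dS': "(n,d) \<in> S'" unfolding S'_def using ops_id by blast
  define \<chi> where "\<chi> m z = (fst z, act D m n (snd z) d)" for m and z :: "(nat => nat) \<times> (nat => nat)"
  have "lft E Y q (res ?JD (F S')) (F S)"
  proof (rule lft_attach[where \<chi> = \<chi> and P = "cyl (simplex n)" and ?P0.0 = "box (simplex n) (smp (boundary n))"])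
   show "ss (cyl (simplex n))" by (simp add: simplicial_set_prod simplicial_set_J simplicial_set_simplex)
   show "lft E Y q (cyl (simplex n)) (box (simplex n) (smp (boundary n)))" using q by (simp add: nfib_def)
   show "subc (cyl (simplex n)) (box (simplex n) (smp (boundary n)))"
    by (rule subc_box[OF simplicial_set_simplex subc_boundary])
   have inS': "(m, act D m n \<alpha> d) \<in> S'" if "\<alpha> \<in> ops m n" for m \<alpha> using that by (auto simp: S'_def)
   show "shom (cyl (simplex n)) (res ?JD (F S')) \<chi>"
    by (rule shomI) (auto simp: \<chi>_def F_def box_def simplex_simps inS' ss_act[OF D _ d(1)] ss_comp[OF D _ _ d(1)])
   have FSS: "F S k \<subseteq> F S' k" for k by (auto simp: F_def box_def S'_def)
   show "subc (res ?JD (F S')) (F S)"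
    by (rule subc_res) (use FSS subc_box[OF D] S'Q sS in "auto simp: F_def Q_def")
   show "\<chi> m z \<in> F S m" if "z \<in> box (simplex n) (smp (boundary n)) m" for m z
   proof -
    have "fst z \<in> smp J m" "snd z \<in> ops m n" "fst z = zero m \<or> snd z ` {..m} \<noteq> {..n}"
     using that by (auto simp: box_def simplex_simps boundary_simps)
    moreover have "snd z ` {..m} \<noteq> {..n} ==> (m, act D m n (snd z) d) \<in> S"
     using nonsurj_deg[OF D sS low d(1)] \<open>snd z \<in> ops m n\<close> by simp
    ultimately show ?thesis unfolding \<chi>_def F_def box_def using ss_act[OF D _ d(1)] by blast
   qed
   have off: "snd z \<in> ops m n \<and> snd z ` {..m} = {..n} \<and> fst z \<noteq> zero m \<and> fst z \<in> smp J m"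
    if "z \<in> smp (cyl (simplex n)) m" "z \<notin> box (simplex n) (smp (boundary n)) m" for z m
    using that by (auto simp: box_def boundary_simps simplex_simps)
   show "z = z'" if z: "z \<in> smp (cyl (simplex n)) m" "z \<notin> box (simplex n) (smp (boundary n)) m"
    "z' \<in> smp (cyl (simplex n)) m" "z' \<notin> box (simplex n) (smp (boundary n)) m" "\<chi> m z = \<chi> m z'" for m z z'
   proof -
    have "snd z = snd z'" by (rule nondeg_unique[OF D nd]) (use off[OF z(1,2)] off[OF z(3,4)] z(5) in "auto simp: \<chi>_def")
    then show ?thesis using z(5) by (auto simp: \<chi>_def prod_eq_iff)
   qed
   show "\<chi> m z \<notin> F S m" if z: "z \<in> smp (cyl (simplex n)) m" "z \<notin> box (simplex n) (smp (boundary n)) m" for m z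
   proof
    assume "\<chi> m z \<in> F S m"
    then have "act D m n (snd z) d \<in> ?S m" using off[OF z] by (auto simp: \<chi>_def F_def box_def)
    moreover obtain \<sigma> where s: "\<sigma> \<in> ops n m" "compose {..n} (snd z) \<sigma> = (\<lambda>k\<in>{..n}. k)"
     using section_through[of "snd z" m n 0] off[OF z] by (metis zero_le)
    ultimately have "act D n m \<sigma> (act D m n (snd z) d) \<in> ?S n" using subc_act[OF sS s(1)] by blast
    then show False using ss_comp[OF D s(1) _ d(1)] off[OF z] s(2) ss_id[OF D d(1)] d(2) by simp
   qed
   show "x \<in> F S m \<or> x \<in> \<chi> m ` smp (cyl (simplex n)) m" if x: "x \<in> smp (res ?JD (F S')) m" for m x
   proof (cases "x \<in> F S m")
    case False
    then have "(m, snd x) \<in> S'" "(m, snd x) \<notin> S" "fst x \<in> smp J m" using x by (auto simp: F_def box_def)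
    then obtain \<alpha> where "\<alpha> \<in> ops m n" "snd x = act D m n \<alpha> d" by (auto simp: S'_def)
    then have "x = \<chi> m (fst x, \<alpha>)" "(fst x, \<alpha>) \<in> smp (cyl (simplex n)) m"
     using \<open>fst x \<in> smp J m\<close> by (auto simp: \<chi>_def simplex_simps prod_eq_iff)
    then show ?thesis by blast
   qed auto
  qed
  moreover have "S \<subset> S'" using dS' d(2) by (auto simp: S'_def)
  ultimately show "\<exists>C'\<in>Q. S \<subset> C' \<and> lft E Y q (res ?JD (F C')) (F S)" using S'Q by blast
 qed
 then show ?thesis by (simp add: F_def S0_def)
qed

lemma nfib_ss: "nfib E Y q ==> ss E" "nfib E Y q ==> ss Y" "nfib E Y q ==> shom E Y q"
 by (auto simp: nfib_def)

lemma jfib_ss: "jfib Z ==> ss Z"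
 by (auto simp: jfib_def nfib_def)

lemma nfib_id: "ss Y ==> nfib Y Y (%n x. x)"
 unfolding nfib_def by (auto intro!: lftI shom_ident)

lemma ss_J [simp]: "ss J" by (rule simplicial_set_J)

lemma ss_prod [simp]: "ss X ==> ss Y ==> ss (sset_prod X Y)"
 by (rule simplicial_set_prod)

text \<open>Homotopy extension and lifting: w is a homotopy in the base, g a lift of it over C, and
  g0 a lift of its start. Applications read the result at \<open>one n\<close>.\<close>

lemma box_use:
 assumes q: "nfib E Y q" and D: "ss D" and C: "subc D C"
  and w: "shom (cyl D) Y w" and g: "shom (cyl (res D C)) E g" and g0: "shom D E g0"
  and c: "!!n x. x \<in> C n ==> g n (zero n, x) = g0 n x"
  and qg: "!!n t x. t \<in> smp J n ==> x \<in> C n ==> q n (g n (t, x)) = w n (t, x)"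
  and qg0: "!!n x. x \<in> smp D n ==> q n (g0 n x) = w n (zero n, x)"
 obtains h where "shom (cyl D) E h" "!!n t x. t \<in> smp J n ==> x \<in> smp D n ==> q n (h n (t, x)) = w n (t, x)"
  "!!n t x. t \<in> smp J n ==> x \<in> C n ==> h n (t, x) = g n (t, x)" "!!n x. x \<in> smp D n ==> h n (zero n, x) = g0 n x"
proof -
 let ?JD = "cyl D"
 have Cs: "x \<in> smp D n" if "x \<in> C n" for x n using subc_sub[OF C that] .
 have s1: "subc ?JD (%n. smp J n \<times> C n)"
  using C by (auto simp: subc_def ss_act)
 have s2: "subc ?JD (%n. {zero n} \<times> smp D n)"
  using D by (auto simp: subc_def ss_act)
 have g': "shom (res ?JD (%n. smp J n \<times> C n)) E g" using g by (auto simp: shom_def)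
 have g0': "shom (res ?JD (%n. {zero n} \<times> smp D n)) E (%n z. g0 n (snd z))"
  using g0 by (auto simp: shom_def)
 define G where "G n z = (if z \<in> smp J n \<times> C n then g n z else g0 n (snd z))" for n and z :: "(nat => nat) \<times> 'c"
 have "shom (res ?JD (%n. smp J n \<times> C n \<union> {zero n} \<times> smp D n)) E G"
  unfolding G_def by (rule shom_union[OF s1 s2 g' g0']) (use c in auto)
 moreover have "(%n. smp J n \<times> C n \<union> {zero n} \<times> smp D n) = box D C"
  using Cs by (fastforce simp: box_def fun_eq_iff set_eq_iff)
 ultimately have G: "shom (res ?JD (box D C)) E G" by simp
 have qG: "q n (G n z) = w n z" if "z \<in> box D C n" for n z
  using that qg qg0 by (auto simp: box_def G_def)
 obtain h where h: "shom ?JD E h" "!!n x. x \<in> smp ?JD n ==> q n (h n x) = w n x" "!!n x. x \<in> box D C n ==> h n x = G n x"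
  using lftD[OF box_lft[OF q D C] G w qG] by metis
 have "h n (t, x) = g n (t, x)" if "t \<in> smp J n" "x \<in> C n" for n t x
  using h(3)[of "(t,x)" n] that Cs[of x n] by (auto simp: box_def G_def)
 moreover have "h n (zero n, x) = g0 n x" if "x \<in> smp D n" for n x
  using h(3)[of "(zero n,x)" n] that c[of x n] by (auto simp: box_def G_def)
 ultimately show ?thesis using that[of h] h(1,2) by auto
qed

lemma box_use2:
 assumes q: "nfib E Y q" and D: "ss D" and C1: "subc D C1" and C2: "subc D C2"
  and w: "shom (cyl D) Y w" and g1: "shom (cyl (res D C1)) E g1" and g2: "shom (cyl (res D C2)) E g2"
  and g0: "shom D E g0"
  and c12: "!!n t x. t \<in> smp J n ==> x \<in> C1 n ==> x \<in> C2 n ==> g1 n (t, x) = g2 n (t, x)"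
  and c1: "!!n x. x \<in> C1 n ==> g1 n (zero n, x) = g0 n x"
  and c2: "!!n x. x \<in> C2 n ==> g2 n (zero n, x) = g0 n x"
  and qg1: "!!n t x. t \<in> smp J n ==> x \<in> C1 n ==> q n (g1 n (t, x)) = w n (t, x)"
  and qg2: "!!n t x. t \<in> smp J n ==> x \<in> C2 n ==> q n (g2 n (t, x)) = w n (t, x)"
  and qg0: "!!n x. x \<in> smp D n ==> q n (g0 n x) = w n (zero n, x)"
 obtains h where "shom (cyl D) E h" "!!n t x. t \<in> smp J n ==> x \<in> smp D n ==> q n (h n (t, x)) = w n (t, x)"
  "!!n t x. t \<in> smp J n ==> x \<in> C1 n ==> h n (t, x) = g1 n (t, x)"
  "!!n t x. t \<in> smp J n ==> x \<in> C2 n ==> h n (t, x) = g2 n (t, x)" "!!n x. x \<in> smp D n ==> h n (zero n, x) = g0 n x"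
proof -
 let ?JD = "cyl D" and ?C = "%n. C1 n \<union> C2 n"
 have s1: "subc ?JD (%n. smp J n \<times> C1 n)" "subc ?JD (%n. smp J n \<times> C2 n)"
  using C1 C2 by (auto simp: subc_def ss_act)
 define G where "G n z = (if z \<in> smp J n \<times> C1 n then g1 n z else g2 n z)" for n and z :: "(nat => nat) \<times> 'c"
 have "shom (res ?JD (%n. smp J n \<times> C1 n \<union> smp J n \<times> C2 n)) E G"
  unfolding G_def by (rule shom_union[OF s1]) (use g1 g2 c12 in "auto simp: shom_def")
 moreover have "cyl (res D ?C) = res ?JD (%n. smp J n \<times> C1 n \<union> smp J n \<times> C2 n)"
  by (auto simp: sset_prod_def res_def)
 ultimately have G: "shom (cyl (res D ?C)) E G" by simp
 obtain h where h: "shom ?JD E h" "!!n t x. t \<in> smp J n ==> x \<in> smp D n ==> q n (h n (t, x)) = w n (t, x)"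
  "!!n t x. t \<in> smp J n ==> x \<in> ?C n ==> h n (t, x) = G n (t, x)" "!!n x. x \<in> smp D n ==> h n (zero n, x) = g0 n x"
  by (rule box_use[OF q D subc_Un[OF C1 C2] w G g0]) (use c1 c2 qg1 qg2 qg0 in "auto simp: G_def")
 have "h n (t, x) = g2 n (t, x)" if "t \<in> smp J n" "x \<in> C2 n" for n t x
  using h(3)[of t n x] that c12[of t n x] by (auto simp: G_def)
 moreover have "h n (t, x) = g1 n (t, x)" if "t \<in> smp J n" "x \<in> C1 n" for n t x
  using h(3)[of t n x] that by (auto simp: G_def)
 ultimately show ?thesis using that[of h] h(1,2,4) by auto
qed

text \<open>The deformation moves C within itself. A path of maps starts as g after h at time 0,
  follows g after h on C and lies over w after h; at time 1, where h is the identity, it solves the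
  lifting problem.\<close>

lemma lft_deformation:
 assumes q: "nfib E Y q" and D: "ss D" and C: "subc D C"
  and h: "shom (cyl D) D h"
  and h1: "!!n x. x \<in> smp D n ==> h n (one n, x) = x"
  and h0: "!!n x. x \<in> smp D n ==> h n (zero n, x) \<in> C n"
  and hC: "!!n t x. t \<in> smp J n ==> x \<in> C n ==> h n (t, x) \<in> C n"
 shows "lft E Y q D C"
proof (rule lftI)
 fix g w assume g: "shom (res D C) E g" and w: "shom D Y w" and gw: "!!n x. x \<in> C n ==> q n (g n x) = w n x"
 have Cs: "x \<in> smp D n" if "x \<in> C n" for x n using subc_sub[OF C that] .
 have hr: "shom (cyl (res D C)) (res D C) h"
  using h hC Cs by (auto simp: shom_def)
 have z: "shom D (cyl D) (%n x. (zero n, x))" by (rule shomI) (auto simp:)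
 have o: "shom D (cyl D) (%n x. (one n, x))" by (rule shomI) (auto simp:)
 have hz: "shom D (res D C) (%n x. h n (zero n, x))"
  by (rule shom_into_res[OF shom_comp[OF z h]]) (use h0 in auto)
 obtain k where k: "shom (cyl D) E k" "!!n t x. t \<in> smp J n ==> x \<in> smp D n ==> q n (k n (t, x)) = w n (h n (t, x))"
  "!!n t x. t \<in> smp J n ==> x \<in> C n ==> k n (t, x) = g n (h n (t, x))"
  by (rule box_use[OF q D C shom_comp[OF h w] shom_comp[OF hr g] shom_comp[OF hz g]])
    (use hC h0 gw in auto)
 show "\<exists>h. shom D E h \<and> (\<forall>n. \<forall>x\<in>smp D n. q n (h n x) = w n x) \<and> (\<forall>n. \<forall>x\<in>C n. h n x = g n x)"
  by (rule exI[of _ "%n x. k n (one n, x)"])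
    (use shom_comp[OF o k(1)] k(2,3) h1 Cs in "auto")
qed

lemma nfib_comp:
 assumes q: "nfib E Y q" and p: "nfib Y Z p"
 shows "nfib E Z (%n x. p n (q n x))"
 unfolding nfib_def
proof (intro conjI allI)
 show "shom E Z (%n x. p n (q n x))" by (rule shom_comp[OF nfib_ss(3)[OF q] nfib_ss(3)[OF p]])
 fix n
 let ?D = "cyl (simplex n)" and ?C = "box (simplex n) (smp (boundary n))"
 have lq: "lft E Y q ?D ?C" and lp: "lft Y Z p ?D ?C" using assms by (auto simp: nfib_def)
 show "lft E Z (%n x. p n (q n x)) ?D ?C"
 proof (rule lftI)
  fix g w assume g: "shom (res ?D ?C) E g" "shom ?D Z w" "!!n x. x \<in> ?C n ==> p n (q n (g n x)) = w n x"
  obtain k where k: "shom ?D Y k" "!!n x. x \<in> smp ?D n ==> p n (k n x) = w n x" "!!n x. x \<in> ?C n ==> k n x = q n (g n x)"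
   using lftD[OF lp shom_comp[OF g(1) nfib_ss(3)[OF q]] g(2,3)] by metis
  obtain h where "shom ?D E h" "!!n x. x \<in> smp ?D n ==> q n (h n x) = k n x" "!!n x. x \<in> ?C n ==> h n x = g n x"
   using lftD[OF lq g(1) k(1)] k(3) by metis
  then show "\<exists>h. shom ?D E h \<and> (\<forall>n. \<forall>x\<in>smp ?D n. p n (q n (h n x)) = w n x) \<and> (\<forall>n. \<forall>x\<in>?C n. h n x = g n x)"
   using k(2) by (intro exI[of _ h]) auto
 qed
qed (use assms nfib_ss in auto)

lemma nfib_jfib: "nfib E Y q ==> jfib Y ==> jfib E"
 unfolding jfib_def using nfib_comp[of E Y q pt "%_ _. ()"] by simp

section \<open>Pullbacks of naive fibrations\<close>

definition pull :: "'e sset => (nat => 'e => 'y) => 'b sset => (nat => 'b => 'y) => ('b \<times> 'e) sset" where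
 "pull E q B r = res (sset_prod B E) (%n. {(b, e). b \<in> smp B n \<and> e \<in> smp E n \<and> r n b = q n e})"

lemma pull_simps [simp]: "smp (pull E q B r) n = {(b, e). b \<in> smp B n \<and> e \<in> smp E n \<and> r n b = q n e}"
  "act (pull E q B r) m n \<alpha> z = (act B m n \<alpha> (fst z), act E m n \<alpha> (snd z))"
 by (auto simp: pull_def)

lemma ss_pull:
 assumes "ss E" "ss B" "shom E Y q" "shom B Y r"
 shows "ss (pull E q B r)"
 unfolding pull_def
 by (rule ss_res) (use assms in "auto simp: subc_def ss_act shom_act")

lemma lft_pull:
 assumes "lft E Y q D C" "shom B Y r" "!!n x. x \<in> C n ==> x \<in> smp D n"
 shows "lft (pull E q B r) B (%n. fst) D C"
proof (rule lftI)
 fix g w assume g: "shom (res D C) (pull E q B r) g" and w: "shom D B w" and gw: "!!n x. x \<in> C n ==> fst (g n x) = w n x"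
 have g2: "shom (res D C) E (%n x. snd (g n x))" using g by (simp add: shom_def case_prod_unfold)
 have "q n (snd (g n x)) = r n (w n x)" if "x \<in> C n" for n x
  using shom_in[OF g, of x n] that gw[OF that] by auto
 then obtain h where h: "shom D E h" "!!n x. x \<in> smp D n ==> q n (h n x) = r n (w n x)" "!!n x. x \<in> C n ==> h n x = snd (g n x)"
  using lftD[OF assms(1) g2 shom_comp[OF w assms(2)]] by metis
 have "shom D (pull E q B r) (%n x. (w n x, h n x))"
  using h w by (auto simp: shom_def)
 then show "\<exists>h. shom D (pull E q B r) h \<and> (\<forall>n. \<forall>x\<in>smp D n. fst (h n x) = w n x) \<and> (\<forall>n. \<forall>x\<in>C n. h n x = g n x)"
  using h(3) gw by (intro exI[of _ "%n x. (w n x, h n x)"]) (auto simp: prod_eq_iff)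
qed

lemma nfib_pull:
 assumes q: "nfib E Y q" and B: "ss B" and r: "shom B Y r"
 shows "nfib (pull E q B r) B (%n. fst)"
 unfolding nfib_def
proof (intro conjI allI B)
 show "ss (pull E q B r)" using ss_pull nfib_ss[OF q] B r by blast
 show "shom (pull E q B r) B (%n. fst)" by (auto simp: shom_def)
 fix n
 show "lft (pull E q B r) B (%n. fst) (cyl (simplex n)) (box (simplex n) (smp (boundary n)))"
  by (rule lft_pull[OF _ r]) (use q in "auto simp: nfib_def box_def")
qed

lemma subc_preimage: "shom E Y q ==> subc Y B ==> ss E ==> subc E (%n. {x \<in> smp E n. q n x \<in> B n})"
 by (auto simp: subc_def ss_act shom_act)

section \<open>Homotopies relative to a subcomplex\<close>

definition htp :: "'x sset => (nat => 'x set) => 'z sset => (nat => 'x => 'z) => (nat => 'x => 'z) => bool" where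
 "htp X C Z f g \<longleftrightarrow> (\<exists>G. shom (cyl X) Z G \<and> (\<forall>n. \<forall>x\<in>smp X n. G n (zero n, x) = f n x \<and> G n (one n, x) = g n x) \<and>
   (\<forall>n. \<forall>t\<in>smp J n. \<forall>x\<in>C n. G n (t, x) = f n x))"

lemma htpE:
 assumes "htp X C Z f g"
 obtains G where "shom (cyl X) Z G" "!!n x. x \<in> smp X n ==> G n (zero n, x) = f n x"
  "!!n x. x \<in> smp X n ==> G n (one n, x) = g n x" "!!n t x. t \<in> smp J n ==> x \<in> C n ==> G n (t, x) = f n x"
 using assms unfolding htp_def by (metis (no_types, lifting))

lemma htpI:
 assumes "shom (cyl X) Z G" "!!n x. x \<in> smp X n ==> G n (zero n, x) = f n x"
  "!!n x. x \<in> smp X n ==> G n (one n, x) = g n x" "!!n t x. t \<in> smp J n ==> x \<in> C n ==> G n (t, x) = f n x"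
 shows "htp X C Z f g"
 using assms unfolding htp_def by blast

lemma htp_refl: "shom X Z f ==> htp X C Z f f"
 by (rule htpI[where G = "%n z. f n (snd z)"]) (auto simp: shom_def)

lemma htp_agree: "htp X C Z f g ==> subc X C ==> x \<in> C n ==> f n x = g n x"
 by (erule htpE) (metis one_J subc_sub)

lemma htp_mono: "htp X C Z f g ==> (!!n. C' n \<subseteq> C n) ==> htp X C' Z f g"
 by (erule htpE, rule htpI) (auto simp: subset_iff)

lemma htp_cong: "htp X C Z f g ==> (!!n x. x \<in> smp X n ==> f n x = f' n x) ==> (!!n x. x \<in> smp X n ==> g n x = g' n x)
  ==> subc X C ==> htp X C Z f' g'"
 by (erule htpE, rule htpI) (auto dest: subc_sub)

lemma shom_flip: "shom (cyl X) (cyl X) (%n z. (jnot n (fst z), snd z))"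
 by (auto simp: shom_def jnot_act)

lemma htp_sym:
 assumes h: "htp X C Z f g" and C: "subc X C"
 shows "htp X C Z g f"
proof -
 obtain G where G: "shom (cyl X) Z G" "!!n x. x \<in> smp X n ==> G n (zero n, x) = f n x"
  "!!n x. x \<in> smp X n ==> G n (one n, x) = g n x" "!!n t x. t \<in> smp J n ==> x \<in> C n ==> G n (t, x) = f n x"
  using htpE[OF h] by metis
 show ?thesis
  by (rule htpI[OF shom_comp[OF shom_flip G(1)]]) (use G(2-4) htp_agree[OF h C] in auto)
qed

lemma htp_post: "htp X C Z f g ==> shom Z Z' k ==> htp X C Z' (%n x. k n (f n x)) (%n x. k n (g n x))"
proof (erule htpE)
 fix G assume "shom Z Z' k" and G: "shom (cyl X) Z G" "!!n x. x \<in> smp X n ==> G n (zero n, x) = f n x"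
  "!!n x. x \<in> smp X n ==> G n (one n, x) = g n x" "!!n t x. t \<in> smp J n ==> x \<in> C n ==> G n (t, x) = f n x"
 then show "htp X C Z' (%n x. k n (f n x)) (%n x. k n (g n x))"
  by (intro htpI[OF shom_comp[OF G(1)]]) auto
qed

lemma shom_Jtimes: "shom X Y k ==> shom (cyl X) (cyl Y) (%n z. (fst z, k n (snd z)))"
 by (auto simp: shom_def)

lemma htp_pre:
 assumes h: "htp X C Z f g" and k: "shom X' X k" and C: "!!n x. x \<in> C' n ==> k n x \<in> C n"
 shows "htp X' C' Z (%n x. f n (k n x)) (%n x. g n (k n x))"
proof -
 obtain G where G: "shom (cyl X) Z G" "!!n x. x \<in> smp X n ==> G n (zero n, x) = f n x"
  "!!n x. x \<in> smp X n ==> G n (one n, x) = g n x" "!!n t x. t \<in> smp J n ==> x \<in> C n ==> G n (t, x) = f n x"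
  using htpE[OF h] by metis
 show ?thesis
  by (rule htpI[OF shom_comp[OF shom_Jtimes[OF k] G(1)]]) (use G shom_in[OF k] C in auto)
qed

definition ends :: "nat => (nat => nat) set" where
 "ends n = {zero n, one n}"

lemma subc_ends: "subc J ends"
 by (auto simp: subc_def ends_def)

lemma subc_prod1: "subc X S ==> ss Y ==> subc (sset_prod X Y) (%n. S n \<times> smp Y n)"
 by (auto simp: subc_def ss_act)

lemma subc_prod2: "subc Y S ==> ss X ==> subc (sset_prod X Y) (%n. smp X n \<times> S n)"
 by (auto simp: subc_def ss_act)

text \<open>The factor X is usually J, the time of a box filling. The case distinction is compatible
  with operators because they preserve both ends and the ends are disjoint.\<close>

lemma shom_ends:
 assumes f: "shom (sset_prod X Y) Z f" and g: "shom (sset_prod X Y) Z g"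
 shows "shom (sset_prod X (res (cyl Y) (%n. ends n \<times> smp Y n))) Z
   (%n z. if fst (snd z) = zero n then f n (fst z, snd (snd z)) else g n (fst z, snd (snd z)))"
proof (rule shomI)
 fix m n \<alpha> z assume a: "\<alpha> \<in> ops m n" and z: "z \<in> smp (sset_prod X (res (cyl Y) (%n. ends n \<times> smp Y n))) n"
 obtain x e y where ze: "z = (x, e, y)" by (cases z) auto
 then have "e = zero n \<or> e = one n" "x \<in> smp X n" "y \<in> smp Y n" using z by (auto simp: ends_def)
 then show "(if fst (snd (act (sset_prod X (res (cyl Y) (%n. ends n \<times> smp Y n))) m n \<alpha> z)) = zero m
    then f m (fst (act (sset_prod X (res (cyl Y) (%n. ends n \<times> smp Y n))) m n \<alpha> z), snd (snd (act (sset_prod X (res (cyl Y) (%n. ends n \<times> smp Y n))) m n \<alpha> z)))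
    else g m (fst (act (sset_prod X (res (cyl Y) (%n. ends n \<times> smp Y n))) m n \<alpha> z), snd (snd (act (sset_prod X (res (cyl Y) (%n. ends n \<times> smp Y n))) m n \<alpha> z)))) =
   act Z m n \<alpha> (if fst (snd z) = zero n then f n (fst z, snd (snd z)) else g n (fst z, snd (snd z)))"
  using shom_act[OF f a, of "(x,y)"] shom_act[OF g a, of "(x,y)"]
  by (auto simp: ze a)
qed (use shom_in[OF f] shom_in[OF g] in "auto simp: ends_def")

text \<open>Composition is a box filling on \<open>cyl (cyl X)\<close> with outer coordinate as
  time. It starts with G, the end 0 of the inner path stays at f, the end 1 moves along K, and C is
  stationary; the composite is the inner path at time 1.\<close>

lemma htp_trans:
 assumes Z: "jfib Z" and X: "ss X" and C: "subc X C" and fg: "htp X C Z f g" and gk: "htp X C Z g k"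
 shows "htp X C Z f k"
proof -
 obtain G where G: "shom (cyl X) Z G" "!!n x. x \<in> smp X n ==> G n (zero n, x) = f n x"
  "!!n x. x \<in> smp X n ==> G n (one n, x) = g n x" "!!n t x. t \<in> smp J n ==> x \<in> C n ==> G n (t, x) = f n x"
  using htpE[OF fg] by metis
 obtain K where K: "shom (cyl X) Z K" "!!n x. x \<in> smp X n ==> K n (zero n, x) = g n x"
  "!!n x. x \<in> smp X n ==> K n (one n, x) = k n x" "!!n t x. t \<in> smp J n ==> x \<in> C n ==> K n (t, x) = g n x"
  using htpE[OF gk] by metis
 have agr: "f n x = g n x" if "x \<in> C n" for n x using htp_agree[OF fg C that] .
 have Cs: "x \<in> smp X n" if "x \<in> C n" for x n using subc_sub[OF C that] .
 let ?D = "cyl X"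
 have fX: "shom X Z f"
  by (rule shom_cong[OF shom_comp[OF _ G(1)], of X "%n x. (zero n, x)"]) (use G(2) X in "auto simp: shom_def")
 let ?g1 = "%n z. if fst (snd z) = zero n then f n (snd (fst z, snd (snd z))) else K n (fst z, snd (snd z))"
 have g1: "shom (cyl (res ?D (%n. ends n \<times> smp X n))) Z ?g1"
  by (rule shom_ends[OF shom_comp[OF shom_snd fX] K(1)])
 have fC: "shom (res X C) Z f" by (rule shom_res[OF fX]) (use Cs in auto)
 have g2: "shom (cyl (res ?D (%n. smp J n \<times> C n))) Z (%n z. f n (snd (snd z)))"
  using fC by (auto simp: shom_def)
 obtain h where h: "shom (cyl ?D) Z h"
   "!!n t x. t \<in> smp J n ==> x \<in> ends n \<times> smp X n ==> h n (t, x) = ?g1 n (t, x)"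
   "!!n t x. t \<in> smp J n ==> x \<in> smp J n \<times> C n ==> h n (t, x) = f n (snd x)"
  by (rule box_use2[OF Z[unfolded jfib_def] _ subc_prod1[OF subc_ends X] subc_prod2[OF C ss_J] shom_pt g1 g2 G(1)])
    (use X G K agr Cs in "auto simp: ends_def zero_not_one")
 have o: "shom ?D (cyl ?D) (%n x. (one n, x))" by (rule shomI) (auto simp:)
 show ?thesis
 proof (rule htpI[OF shom_comp[OF o h(1)]])
  fix n x assume x: "x \<in> smp X n"
  show "h n (one n, zero n, x) = f n x" using h(2)[of "one n" n "(zero n, x)"] x by (simp add: ends_def)
  show "h n (one n, one n, x) = k n x" using h(2)[of "one n" n "(one n, x)"] x K(3)
   by (auto simp: ends_def)
 next
  fix n t x assume "t \<in> smp J n" "x \<in> C n"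
  then show "h n (one n, t, x) = f n x" using h(3)[of "one n" n "(t, x)"] by simp
 qed
qed

lemma subc_UN: "(!!i. i \<in> I ==> subc D (C i)) ==> subc D (%n. \<Union>i\<in>I. C i n)"
 unfolding subc_def by (simp add: UN_subset_iff) blast

lemma lft_ex:
 assumes "lft E Y q D C" "shom (res D C) E g" "shom D Y w" "!!n x. x \<in> C n ==> q n (g n x) = w n x"
 shows "\<exists>h. shom D E h \<and> (\<forall>n. \<forall>x\<in>smp D n. q n (h n x) = w n x) \<and> (\<forall>n. \<forall>x\<in>C n. h n x = g n x)"
 using assms unfolding lft_def by blast

lemma box_use0:
 assumes q: "nfib E Y q" and D: "ss D" and w: "shom (cyl D) Y w" and g0: "shom D E g0"
  and qg0: "!!n x. x \<in> smp D n ==> q n (g0 n x) = w n (zero n, x)"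
 obtains h where "shom (cyl D) E h" "!!n t x. t \<in> smp J n ==> x \<in> smp D n ==> q n (h n (t, x)) = w n (t, x)"
  "!!n x. x \<in> smp D n ==> h n (zero n, x) = g0 n x"
proof -
 have e: "shom (cyl (res D (%n. {}))) E (%_ _. undefined)" by (auto simp: shom_def)
 obtain h where "shom (cyl D) E h" "!!n t x. t \<in> smp J n ==> x \<in> smp D n ==> q n (h n (t, x)) = w n (t, x)"
  "!!n x. x \<in> smp D n ==> h n (zero n, x) = g0 n x"
  by (rule box_use[OF q D subc_empty w e g0]) (use qg0 in auto)
 then show ?thesis using that by blast
qed

section \<open>Free fibrant replacement\<close>

text \<open>
 The simplices obtained from A by attaching a copy of J x simplex j along each horn over Y: u is the horn,
 w the cell in the base and the last argument of Cell a simplex of J x simplex j outside the horn.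
\<close>

type_synonym js = "(nat => nat) \<times> (nat => nat)"

datatype ('a, 'y) tm = Leaf 'a | Cell nat "nat => js => ('a, 'y) tm" "nat => js => 'y" js

abbreviation JS :: "nat => js sset" where "JS j == cyl (simplex j)"
abbreviation HB :: "nat => nat => js set" where "HB j == box (simplex j) (smp (boundary j))"

text \<open>A term \<open>Cell j u w y\<close> names only a simplex y off the horn. When an operator
  moves y into the horn, the simplex there is already given by u; this is the gluing.\<close>

definition tact :: "'a sset => nat => nat => (nat => nat) => ('a, 'y) tm => ('a, 'y) tm" where
 "tact A m n \<beta> t = (case t of Leaf a => Leaf (act A m n \<beta> a) | Cell j u w y =>
   (if act (JS j) m n \<beta> y \<in> HB j m then u m (act (JS j) m n \<beta> y) else Cell j u w (act (JS j) m n \<beta> y)))"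

definition tq :: "(nat => 'a => 'y) => nat => ('a, 'y) tm => 'y" where
 "tq f n t = (case t of Leaf a => f n a | Cell j u w y => w n y)"

text \<open>Simpliciality of u on the horn is spelled out through \<open>tact\<close>, since
  well-formedness must be available before \<open>free\<close> is. The recursion is through the
  values of u, so terms are well-founded although a horn has infinitely many simplices.\<close>

inductive wf :: "'a sset => 'y sset => (nat => 'a => 'y) => nat => ('a, 'y) tm => bool" for A Y f where
 wf_Leaf: "a \<in> smp A n ==> wf A Y f n (Leaf a)"
| wf_Cell: "(!!d z. z \<in> HB j d ==> wf A Y f d (u d z)) ==>
  (\<forall>d e \<beta> z. \<beta> \<in> ops d e --> z \<in> HB j e --> u d (act (JS j) d e \<beta> z) = tact A d e \<beta> (u e z)) ==>
  shom (JS j) Y w ==> (\<forall>d z. z \<in> HB j d --> tq f d (u d z) = w d z) ==>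
  y \<in> smp (JS j) n ==> y \<notin> HB j n ==> wf A Y f n (Cell j u w y)"

definition free :: "'a sset => 'y sset => (nat => 'a => 'y) => ('a, 'y) tm sset" where
 "free A Y f = \<lparr>smp = %n. {t. wf A Y f n t}, act = tact A\<rparr>"

lemma free_simps [simp]: "t \<in> smp (free A Y f) n \<longleftrightarrow> wf A Y f n t" "act (free A Y f) = tact A"
 by (auto simp: free_def)

lemma ss_JS [simp]: "ss (JS j)"
 by (simp add: simplicial_set_simplex)

lemma subc_HB: "subc (JS j) (HB j)"
 by (rule subc_box[OF simplicial_set_simplex subc_boundary])

lemma tact_Leaf [simp]: "tact A m n \<beta> (Leaf a) = Leaf (act A m n \<beta> a)"
 by (simp add: tact_def)

lemma tact_Cell: "tact A m n \<beta> (Cell j u w y) =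
  (if act (JS j) m n \<beta> y \<in> HB j m then u m (act (JS j) m n \<beta> y) else Cell j u w (act (JS j) m n \<beta> y))"
 by (simp add: tact_def)

lemma tq_simps [simp]: "tq f n (Leaf a) = f n a" "tq f n (Cell j u w y) = w n y"
 by (auto simp: tq_def)

lemma wf_tact:
 assumes A: "ss A" and t: "wf A Y f n t" and b: "\<beta> \<in> ops m n"
 shows "wf A Y f m (tact A m n \<beta> t)"
 using t
proof (cases rule: wf.cases)
 case (wf_Leaf a)
 then show ?thesis using ss_act[OF A b] by (auto intro: wf.wf_Leaf)
next
 case (wf_Cell j u w y)
 then show ?thesis unfolding wf_Cell(1) tact_Cell using ss_act[OF ss_JS b wf_Cell(6)]
  by (auto intro!: wf.wf_Cell simp del: sset_prod_simps)
qed

lemma ss_free: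
 assumes A: "ss A"
 shows "ss (free A Y f)"
 unfolding simplicial_set_def
proof (intro conjI allI ballI)
 show "act (free A Y f) m n \<alpha> t \<in> smp (free A Y f) m" if "\<alpha> \<in> ops m n" "t \<in> smp (free A Y f) n" for m n \<alpha> t
  using wf_tact[OF A] that by simp
 show "act (free A Y f) n n (\<lambda>i\<in>{..n}. i) t = t" if "t \<in> smp (free A Y f) n" for n t
 proof -
  have "wf A Y f n t" using that by simp
  then show ?thesis
  proof (cases rule: wf.cases)
   case (wf_Leaf a) then show ?thesis using ss_id[OF A] by simp
  next
   case (wf_Cell j u w y)
   then show ?thesis using ss_id[OF ss_JS wf_Cell(6)] by (simp add: tact_Cell del: sset_prod_simps)
  qed
 qed
 show "act (free A Y f) k n (compose {..k} \<alpha> \<beta>) t = act (free A Y f) k m \<beta> (act (free A Y f) m n \<alpha> t)"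
  if b: "\<beta> \<in> ops k m" and a: "\<alpha> \<in> ops m n" and t: "t \<in> smp (free A Y f) n" for k m n \<beta> \<alpha> t
 proof -
  have "wf A Y f n t" using t by simp
  then show ?thesis
  proof (cases rule: wf.cases)
   case (wf_Leaf a') then show ?thesis using ss_comp[OF A b a] by simp
  next
   case (wf_Cell j u w y)
   have "act (JS j) k n (compose {..k} \<alpha> \<beta>) y = act (JS j) k m \<beta> (act (JS j) m n \<alpha> y)"
    using ss_comp[OF ss_JS b a wf_Cell(6)] by simp
   moreover have "u k (act (JS j) k m \<beta> (act (JS j) m n \<alpha> y)) = tact A k m \<beta> (u m (act (JS j) m n \<alpha> y))"
    if "act (JS j) m n \<alpha> y \<in> HB j m" using wf_Cell(3) b that by blast
   ultimately show ?thesis using wf_Cell(1) subc_act[OF subc_HB b, of "act (JS j) m n \<alpha> y" j]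
    by (simp add: tact_Cell del: sset_prod_simps)
  qed
 qed
qed

lemma shom_tq:
 assumes A: "ss A" and f: "shom A Y f"
 shows "shom (free A Y f) Y (tq f)"
proof (rule shomI)
 fix n t assume "t \<in> smp (free A Y f) n"
 then have "wf A Y f n t" by simp
 then show "tq f n t \<in> smp Y n" using f by cases (auto simp: shom_def)
next
 fix m n \<alpha> t assume a: "\<alpha> \<in> ops m n" and "t \<in> smp (free A Y f) n"
 then have "wf A Y f n t" by simp
 then show "tq f m (act (free A Y f) m n \<alpha> t) = act Y m n \<alpha> (tq f n t)"
 proof cases
  case (wf_Leaf a') then show ?thesis using shom_act[OF f a] by simp
 next
  case (wf_Cell j u w y)
  have "w m (act (JS j) m n \<alpha> y) = act Y m n \<alpha> (w n y)" using shom_act[OF wf_Cell(4) a wf_Cell(6)] .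
  moreover have "tq f m (u m (act (JS j) m n \<alpha> y)) = w m (act (JS j) m n \<alpha> y)"
   if "act (JS j) m n \<alpha> y \<in> HB j m" using wf_Cell(5) that by blast
  ultimately show ?thesis using wf_Cell(1) by (simp add: tact_Cell del: sset_prod_simps)
 qed
qed

lemma shom_Leaf: "shom A (free A Y f) (%n. Leaf)"
 by (auto simp: shom_def intro: wf_Leaf)

text \<open>The characteristic map of the cell attached along u over w, which by construction fills
  that horn.\<close>

definition fillc :: "nat => (nat => js => ('a, 'y) tm) => (nat => js => 'y) => nat => js => ('a, 'y) tm" where
 "fillc j u w n z = (if z \<in> HB j n then u n z else Cell j u w z)"

lemma shom_fillc:
 assumes A: "ss A" and u: "shom (res (JS j) (HB j)) (free A Y f) u" and w: "shom (JS j) Y w"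
  and q: "!!n z. z \<in> HB j n ==> tq f n (u n z) = w n z"
 shows "shom (JS j) (free A Y f) (fillc j u w)"
proof (rule shomI)
 fix n z assume "z \<in> smp (JS j) n"
 then show "fillc j u w n z \<in> smp (free A Y f) n"
  using shom_in[OF u] shom_act[OF u] w q by (auto simp: fillc_def intro!: wf_Cell simp del: sset_prod_simps)
next
 fix m n \<alpha> z assume a: "\<alpha> \<in> ops m n" and z: "z \<in> smp (JS j) n"
 show "fillc j u w m (act (JS j) m n \<alpha> z) = act (free A Y f) m n \<alpha> (fillc j u w n z)"
 proof (cases "z \<in> HB j n")
  case True
  then show ?thesis using subc_act[OF subc_HB a True] shom_act[OF u a] by (simp add: fillc_def del: sset_prod_simps)
 next
  case False
  then show ?thesis by (simp add: fillc_def tact_Cell del: sset_prod_simps)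
 qed
qed

lemma nfib_free:
 assumes A: "ss A" and Y: "ss Y" and f: "shom A Y f"
 shows "nfib (free A Y f) Y (tq f)"
 unfolding nfib_def
proof (intro conjI allI ss_free A Y shom_tq f lftI)
 fix j u w assume u: "shom (res (JS j) (HB j)) (free A Y f) u" and w: "shom (JS j) Y w"
  and q: "!!n z. z \<in> HB j n ==> tq f n (u n z) = w n z"
 show "\<exists>h. shom (JS j) (free A Y f) h \<and> (\<forall>n. \<forall>x\<in>smp (JS j) n. tq f n (h n x) = w n x) \<and> (\<forall>n. \<forall>x\<in>HB j n. h n x = u n x)"
  by (rule exI[of _ "fillc j u w"]) (use shom_fillc[OF A u w q] q in "auto simp: fillc_def")
qed

text \<open>A subcomplex with this property contains a cell as soon as it contains one simplex of
  its interior, so that cells are attached whole or not at all.\<close>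

definition csat :: "(nat => ('a, 'y) tm set) => bool" where
 "csat C \<longleftrightarrow> (\<forall>n m j u w z z'. Cell j u w z \<in> C n --> z' \<in> smp (JS j) m --> z' \<notin> HB j m --> Cell j u w z' \<in> C m)"

text \<open>Contracts J x simplex j to {0} x simplex j while keeping the horn inside itself. It
  serves to deform cells into their horns and, in \<open>filler_transport\<close>, to change
  fillers.\<close>

definition jcon :: "nat => (nat => nat) \<times> js => js" where
 "jcon n z = (jand n (fst z) (fst (snd z)), snd (snd z))"

lemma jcon:
 "shom (cyl (JS j)) (JS j) jcon"
 "t \<in> smp J n ==> z \<in> HB j n ==> jcon n (t, z) \<in> HB j n"
 "z \<in> smp (JS j) n ==> jcon n (zero n, z) \<in> HB j n"
 "z \<in> smp (JS j) n ==> jcon n (one n, z) = z"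
 by (auto simp: shom_def jcon_def jand_act box_def)

text \<open>The contraction of a cell into its horn is lifted along the fibration p to the
  pulled-back cell, which is thereby deformed into the pulled-back horn. The deformation leaves the
  factor L alone.\<close>

lemma cell_pull_lft:
 fixes S :: "'s sset" and L :: "'l sset"
 assumes S: "nfib S F p" and \<chi>: "shom (JS j) F \<chi>" and L: "ss L" and L0: "subc L L0" and q: "nfib Z Y q"
 shows "lft Z Y q (sset_prod (pull S p (JS j) \<chi>) L)
   (%n. {(y, l). y \<in> smp (pull S p (JS j) \<chi>) n \<and> l \<in> smp L n \<and> (fst y \<in> HB j n \<or> l \<in> L0 n)})"
proof -
 let ?P = "pull S p (JS j) \<chi>"
 have Sss: "ss S" "ss F" "shom S F p" using nfib_ss[OF S] by auto
 have P: "ss ?P" by (rule ss_pull[OF Sss(1) ss_JS Sss(3) \<chi>])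
 \<comment> \<open>Lifting of paths starts at time 0, whereas the deformation has to be the identity
   at time 1. This is the origin of the two reversals by \<open>jnot\<close>.\<close>
 have w: "shom (cyl ?P) F (%n z. \<chi> n (jcon n (jnot n (fst z), fst (snd z))))"
  by (rule shom_comp[OF _ \<chi>], rule shom_comp[OF _ jcon(1)]) (auto simp: shom_def jnot_act case_prod_unfold)
 have g0: "shom ?P S (%n. snd)" by (auto simp: shom_def)
 obtain k where k: "shom (cyl ?P) S k"
   "!!n t x. t \<in> smp J n ==> x \<in> smp ?P n ==> p n (k n (t, x)) = \<chi> n (jcon n (jnot n t, fst x))"
   "!!n x. x \<in> smp ?P n ==> k n (zero n, x) = snd x"
  by (rule box_use0[OF S P w g0]) (auto simp: jcon(4) simp del: sset_prod_simps)
 define h where "h n z = ((jcon n (fst z, fst (fst (snd z))), k n (jnot n (fst z), fst (snd z))), snd (snd z))"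
  for n and z :: "(nat => nat) \<times> (js \<times> 's) \<times> 'l"
 show ?thesis
 proof (rule lft_deformation[OF q, where h = h])
  show "ss (sset_prod ?P L)" using P L by simp
  show "subc (sset_prod ?P L) (%n. {(y, l). y \<in> smp ?P n \<and> l \<in> smp L n \<and> (fst y \<in> HB j n \<or> l \<in> L0 n)})"
   using ss_act[OF P] ss_act[OF L] subc_act[OF L0] subc_act[OF subc_HB]
   unfolding subc_def by (auto simp del: sset_prod_simps simp: sset_prod_simps(1)[of ?P L] sset_prod_simps(2)[of ?P L])
  have kk: "shom (cyl ?P) S (%n z. k n (jnot n (fst z), snd z))"
   by (rule shom_comp[OF shom_flip k(1)])
  have jj: "shom (cyl ?P) (JS j) (%n z. jcon n (fst z, fst (snd z)))"
   by (rule shom_comp[OF _ jcon(1)]) (auto simp: shom_def)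
  have both: "shom (cyl ?P) ?P (%n z. (jcon n (fst z, fst (snd z)), k n (jnot n (fst z), snd z)))"
  proof (rule shomI)
   fix n z assume z: "z \<in> smp (cyl ?P) n"
   then show "(jcon n (fst z, fst (snd z)), k n (jnot n (fst z), snd z)) \<in> smp ?P n"
    using shom_in[OF kk z] shom_in[OF jj z] k(2)[of "jnot n (fst z)" n "snd z"] by auto
  next
   fix m n \<alpha> z assume "\<alpha> \<in> ops m n" "z \<in> smp (cyl ?P) n"
   then show "(jcon m (fst (act (cyl ?P) m n \<alpha> z), fst (snd (act (cyl ?P) m n \<alpha> z))),
      k m (jnot m (fst (act (cyl ?P) m n \<alpha> z)), snd (act (cyl ?P) m n \<alpha> z))) =
      act ?P m n \<alpha> (jcon n (fst z, fst (snd z)), k n (jnot n (fst z), snd z))"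
    using shom_act[OF kk] shom_act[OF jj] by (metis (no_types, lifting) fst_conv snd_conv pull_simps(2))
  qed
  have "shom (cyl (sset_prod ?P L)) (cyl ?P) (%n z. (fst z, fst (snd z)))"
   by (auto simp: shom_def)
  from shom_comp[OF this both]
  have h1: "shom (cyl (sset_prod ?P L)) ?P (%n z. (jcon n (fst z, fst (fst (snd z))), k n (jnot n (fst z), fst (snd z))))"
   by simp
  have h2: "shom (cyl (sset_prod ?P L)) L (%n z. snd (snd z))" by (auto simp: shom_def)
  show "shom (cyl (sset_prod ?P L)) (sset_prod ?P L) h"
   unfolding h_def by (rule shom_pair[OF h1 h2])
  show "h n (one n, x) = x" if "x \<in> smp (sset_prod ?P L) n" for n x
   using that by (auto simp: h_def jcon(4) k(3) prod_eq_iff simp del: sset_prod_simps(2) pull_simps(2))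
  have hin: "h n (t, x) \<in> smp (sset_prod ?P L) n" if "t \<in> smp J n" "x \<in> smp (sset_prod ?P L) n" for n t x
   using shom_in[OF \<open>shom (cyl (sset_prod ?P L)) (sset_prod ?P L) h\<close>, of "(t,x)" n] that by simp
  show "h n (zero n, x) \<in> {(y, l). y \<in> smp ?P n \<and> l \<in> smp L n \<and> (fst y \<in> HB j n \<or> l \<in> L0 n)}"
   if x: "x \<in> smp (sset_prod ?P L) n" for n x
  proof -
   have "fst (fst x) \<in> smp (JS j) n" using x by auto
   then have "jcon n (zero n, fst (fst x)) \<in> HB j n" by (rule jcon(3))
   then show ?thesis using hin[OF zero_J x] by (auto simp: h_def)
  qed
  show "h n (t, x) \<in> {(y, l). y \<in> smp ?P n \<and> l \<in> smp L n \<and> (fst y \<in> HB j n \<or> l \<in> L0 n)}"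
   if t: "t \<in> smp J n" and x: "x \<in> {(y, l). y \<in> smp ?P n \<and> l \<in> smp L n \<and> (fst y \<in> HB j n \<or> l \<in> L0 n)}" for n t x
  proof -
   have "x \<in> smp (sset_prod ?P L) n" using x by auto
   then show ?thesis using hin[OF t, of x] x jcon(2)[OF t, of "fst (fst x)" j] by (auto simp: h_def)
  qed
 qed
qed

text \<open>As terms are well-founded, some missing cell has its horn in T already. Its preimage in
  S is attached along the preimage of the horn; the gluing is a pushout because terms are equal only
  if they are built alike. A general fibration S over the free object gives right properness. The
  pair (L, L0) covers extension, with L a point, and uniqueness up to homotopy, with L = J and its
  ends.\<close>

lemma free_lft:
 fixes A :: "'a sset" and Y :: "'y sset" and S :: "'s sset" and L :: "'l sset"
 assumes A: "ss A"
  and S: "nfib S (free A Y f) p" and C0: "subc (free A Y f) C0" "!!n a. a \<in> smp A n ==> Leaf a \<in> C0 n" "csat C0"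
  and L: "ss L" and L0: "subc L L0" and q: "nfib Z Y' q"
 shows "lft Z Y' q (sset_prod S L) (%n. {(s, l). s \<in> smp S n \<and> l \<in> smp L n \<and> (p n s \<in> C0 n \<or> l \<in> L0 n)})"
proof -
 let ?F = "free A Y f"
 have Sss: "ss S" "ss ?F" "shom S ?F p" using nfib_ss[OF S] by auto
 define pc where "pc T n = {t. (n, t) \<in> T}" for T :: "(nat \<times> ('a, 'y) tm) set" and n
 define Q where "Q = {T. subc ?F (pc T) \<and> csat (pc T) \<and> (\<forall>n. C0 n \<subseteq> pc T n)}"
 define FF where "FF T n = {(s, l). s \<in> smp S n \<and> l \<in> smp L n \<and> (p n s \<in> pc T n \<or> l \<in> L0 n)}" for T n
 define T0 where "T0 = {(n, t). t \<in> C0 n}"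
 have pT0: "pc T0 = C0" by (auto simp: pc_def T0_def fun_eq_iff)
 have sub: "subc (sset_prod S L) (FF T)" if "T \<in> Q" for T
 proof -
  have "subc ?F (pc T)" using that by (simp add: Q_def)
  from subc_act[OF this] show ?thesis
   using ss_act[OF Sss(1)] ss_act[OF L] subc_act[OF L0] shom_act[OF Sss(3)] unfolding subc_def FF_def
   by auto
 qed
 have "lft Z Y' q (sset_prod S L) (FF T0)"
 proof (rule lft_zorn[where Q = Q and F = FF])
  show "T0 \<in> Q" using C0 by (simp add: Q_def pT0)
  show "\<Union>K \<in> Q" if K: "K \<noteq> {}" "K \<subseteq> Q" for K
  proof -
   have pU: "pc (\<Union>K) n = (\<Union>T\<in>K. pc T n)" for n by (auto simp: pc_def)
   have Kq: "subc ?F (pc T)" "csat (pc T)" "!!n. C0 n \<subseteq> pc T n" if "T \<in> K" for T using K(2) that by (auto simp: Q_def)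
   have "subc ?F (%n. \<Union>T\<in>K. pc T n)" by (rule subc_UN) (rule Kq(1))
   moreover have "(%n. \<Union>T\<in>K. pc T n) = pc (\<Union>K)" using pU by (simp add: fun_eq_iff)
   ultimately have "subc ?F (pc (\<Union>K))" by simp
   moreover have "csat (pc (\<Union>K))"
    unfolding csat_def
   proof (intro allI impI)
    fix n m j u w z z' assume a: "Cell j u w z \<in> pc (\<Union>K) n" "z' \<in> smp (JS j) m" "z' \<notin> HB j m"
    then obtain T where T: "T \<in> K" "Cell j u w z \<in> pc T n" using pU by blast
    then have "Cell j u w z' \<in> pc T m" using Kq(2)[OF T(1)] a(2,3) unfolding csat_def by blast
    then show "Cell j u w z' \<in> pc (\<Union>K) m" using T(1) pU by blast
   qed
   moreover have "\<forall>n. C0 n \<subseteq> pc (\<Union>K) n" using K(1) Kq(3) unfolding pU by blast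
   ultimately show ?thesis by (simp add: Q_def)
  qed
  show "FF (\<Union>K) n = (\<Union>C\<in>K. FF C n)" if "K \<noteq> {}" for K n using that by (auto simp: FF_def pc_def)
  show "FF T n \<subseteq> FF T' n" if "T \<subseteq> T'" for T T' n using that by (auto simp: FF_def pc_def)
  show "subc (sset_prod S L) (FF T)" if "T \<in> Q" for T by (rule sub[OF that])
 next
  fix T assume T: "T \<in> Q" and ne: "FF T \<noteq> smp (sset_prod S L)"
  have Tq: "subc ?F (pc T)" "csat (pc T)" "!!n. C0 n \<subseteq> pc T n" using T by (auto simp: Q_def)
  have "\<exists>n j u w y. wf A Y f n (Cell j u w y) \<and> Cell j u w y \<notin> pc T n \<and> (\<forall>d z. z \<in> HB j d --> u d z \<in> pc T d)"
  proof (rule ccontr)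
   assume neg: "\<not> ?thesis"
   have "t \<in> pc T n" if "wf A Y f n t" for n t
    using that
   proof induction
    case (wf_Leaf a n) then show ?case using C0(2) Tq(3) by blast
   next
    case (wf_Cell j u w y n)
    have "wf A Y f n (Cell j u w y)" by (rule wf.wf_Cell) (use wf_Cell in auto)
    then show ?case using neg wf_Cell by blast
   qed
   then have "FF T = smp (sset_prod S L)" using shom_in[OF Sss(3)] by (auto simp: FF_def fun_eq_iff)
   then show False using ne by simp
  qed
  then obtain n j u w y where c: "wf A Y f n (Cell j u w y)" "Cell j u w y \<notin> pc T n" "!!d z. z \<in> HB j d ==> u d z \<in> pc T d" by blast
  from c(1) have u: "!!d z. z \<in> HB j d ==> wf A Y f d (u d z)"
   "\<forall>d e \<beta> z. \<beta> \<in> ops d e --> z \<in> HB j e --> u d (act (JS j) d e \<beta> z) = tact A d e \<beta> (u e z)"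
   "shom (JS j) Y w" "!!d z. z \<in> HB j d ==> tq f d (u d z) = w d z" "y \<in> smp (JS j) n" "y \<notin> HB j n"
   by (auto elim: wf.cases)
  have "shom (res (JS j) (HB j)) ?F u" using u(1,2) by (auto simp: shom_def simp del: sset_prod_simps)
  then have chi: "shom (JS j) ?F (fillc j u w)" by (rule shom_fillc[OF A _ u(3,4)])
  have notT: "Cell j u w z \<notin> pc T m" if "z \<in> smp (JS j) m" "z \<notin> HB j m" for z m
   using Tq(2) c(2) u(5,6) that unfolding csat_def by blast
  define T' where "T' = T \<union> {(m, fillc j u w m z) | m z. z \<in> smp (JS j) m}"
  have pT': "pc T' m = pc T m \<union> fillc j u w m ` smp (JS j) m" for m by (auto simp: pc_def T'_def simp del: sset_prod_simps)
  have "subc ?F (pc T')"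
   using Tq(1) shom_in[OF chi] shom_act[OF chi] ss_act[OF ss_JS[of j]] unfolding subc_def pT'
   by (auto simp del: sset_prod_simps) (metis imageI)
  moreover have "csat (pc T')"
   unfolding csat_def
  proof (intro allI impI)
   fix n m j' u' w' z z' assume z: "Cell j' u' w' z \<in> pc T' n" "z' \<in> smp (JS j') m" "z' \<notin> HB j' m"
   show "Cell j' u' w' z' \<in> pc T' m"
   proof (cases "Cell j' u' w' z \<in> pc T n")
    case True then show ?thesis using Tq(2) z unfolding csat_def pT' by blast
   next
    case False
    then obtain z0 where z0: "z0 \<in> smp (JS j) n" "Cell j' u' w' z = fillc j u w n z0" using z(1) pT' by blast
    then have "z0 \<notin> HB j n" using False c(3) by (auto simp: fillc_def)
    then have "j' = j \<and> u' = u \<and> w' = w" using z0 by (simp add: fillc_def)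
    then have "Cell j' u' w' z' = fillc j u w m z'" "z' \<in> smp (JS j) m" using z by (auto simp: fillc_def)
    then show ?thesis using pT' by blast
   qed
  qed
  ultimately have T'Q: "T' \<in> Q" using Tq(3) by (auto simp: Q_def pT')
  let ?P = "pull S p (JS j) (fillc j u w)"
  let ?PB = "%n. {(y, l). y \<in> smp ?P n \<and> l \<in> smp L n \<and> (fst y \<in> HB j n \<or> l \<in> L0 n)}"
  have Pss: "ss ?P" by (rule ss_pull[OF Sss(1) ss_JS Sss(3) chi])
  define \<chi> where "\<chi> n z = (snd (fst z), snd z)" for n :: nat and z :: "(js \<times> 's) \<times> 'l"
  have "lft Z Y' q (res (sset_prod S L) (FF T')) (FF T)"
  proof (rule lft_attach[where \<chi> = \<chi> and P = "sset_prod ?P L" and ?P0.0 = ?PB])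
   show "ss (sset_prod ?P L)" using Pss L by simp
   show "lft Z Y' q (sset_prod ?P L) ?PB" by (rule cell_pull_lft[OF S chi L L0 q])
   show "subc (sset_prod ?P L) ?PB"
    using ss_act[OF Pss] ss_act[OF L] subc_act[OF L0] subc_act[OF subc_HB]
    unfolding subc_def by (auto simp del: sset_prod_simps simp: sset_prod_simps(1)[of ?P L] sset_prod_simps(2)[of ?P L])
   show "shom (sset_prod ?P L) (res (sset_prod S L) (FF T')) \<chi>"
   proof (rule shomI)
    fix n z assume "z \<in> smp (sset_prod ?P L) n"
    then have "fst (fst z) \<in> smp (JS j) n" "snd (fst z) \<in> smp S n" "snd z \<in> smp L n" "fillc j u w n (fst (fst z)) = p n (snd (fst z))"
     by (auto simp: case_prod_unfold)
    moreover from this have "p n (snd (fst z)) \<in> pc T' n" unfolding pT' by (metis UnI2 imageI)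
    ultimately show "\<chi> n z \<in> smp (res (sset_prod S L) (FF T')) n" by (simp add: \<chi>_def FF_def)
   qed (simp add: \<chi>_def)
   show "subc (res (sset_prod S L) (FF T')) (FF T)"
    by (rule subc_res[OF sub[OF T] sub[OF T'Q]]) (auto simp: FF_def pT')
   show "\<chi> n z \<in> FF T n" if "z \<in> ?PB n" for n z
   proof -
    obtain y s l where z: "z = ((y, s), l)" by (metis prod.collapse)
    then show ?thesis using that c(3)[of y n] by (auto simp: \<chi>_def FF_def fillc_def)
   qed
   have off: "fst (fst z) \<in> smp (JS j) n \<and> fst (fst z) \<notin> HB j n \<and> p n (snd (fst z)) = Cell j u w (fst (fst z)) \<and> snd z \<notin> L0 n"
    if "z \<in> smp (sset_prod ?P L) n" "z \<notin> ?PB n" for n z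
   proof -
    have 1: "fst (fst z) \<in> smp (JS j) n" "fillc j u w n (fst (fst z)) = p n (snd (fst z))" "fst (fst z) \<notin> HB j n" "snd z \<notin> L0 n"
     using that by (auto simp: case_prod_unfold)
    then show ?thesis by (simp add: fillc_def)
   qed
   show "z = z'" if z: "z \<in> smp (sset_prod ?P L) n" "z \<notin> ?PB n" "z' \<in> smp (sset_prod ?P L) n" "z' \<notin> ?PB n" "\<chi> n z = \<chi> n z'" for n z z'
    using off[OF z(1,2)] off[OF z(3,4)] z(5) by (auto simp: \<chi>_def prod_eq_iff)
   show "\<chi> n z \<notin> FF T n" if "z \<in> smp (sset_prod ?P L) n" "z \<notin> ?PB n" for n z
    using off[OF that] notT[of "fst (fst z)" n] by (auto simp: \<chi>_def FF_def)
   show "x \<in> FF T n \<or> x \<in> \<chi> n ` smp (sset_prod ?P L) n" if x: "x \<in> smp (res (sset_prod S L) (FF T')) n" for n x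
   proof (cases "x \<in> FF T n")
    case False
    then have xs: "fst x \<in> smp S n" "snd x \<in> smp L n" "p n (fst x) \<in> pc T' n" "p n (fst x) \<notin> pc T n"
     using x by (auto simp: FF_def)
    then obtain z where z: "z \<in> smp (JS j) n" "p n (fst x) = fillc j u w n z" unfolding pT' by blast
    then have "((z, fst x), snd x) \<in> smp (sset_prod ?P L) n" using xs by simp
    moreover have "\<chi> n ((z, fst x), snd x) = x" by (simp add: \<chi>_def)
    ultimately show ?thesis by (metis imageI)
   qed auto
  qed
  moreover have "T \<subset> T'"
  proof -
   have "fillc j u w n y = Cell j u w y" using u(6) by (simp add: fillc_def)
   then have "Cell j u w y \<in> pc T' n" unfolding pT' using u(5) by (metis UnI2 imageI)
   then have "(n, Cell j u w y) \<in> T'" by (simp add: pc_def)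
   then show ?thesis using c(2) by (auto simp: T'_def pc_def)
  qed
  ultimately show "\<exists>C'\<in>Q. T \<subset> C' \<and> lft Z Y' q (res (sset_prod S L) (FF C')) (FF T)" using T'Q by blast
 qed
 moreover have "FF T0 = (%n. {(s, l). s \<in> smp S n \<and> l \<in> smp L n \<and> (p n s \<in> C0 n \<or> l \<in> L0 n)})"
  by (simp add: FF_def pT0 fun_eq_iff)
 ultimately show ?thesis by simp
qed

lemma free_ext:
 assumes A: "ss A"
  and S: "nfib S (free A Y f) p" and C0: "subc (free A Y f) C0" "!!n a. a \<in> smp A n ==> Leaf a \<in> C0 n" "csat C0"
  and q: "nfib Z Y' q"
 shows "lft Z Y' q S (%n. {s \<in> smp S n. p n s \<in> C0 n})"
proof (rule lftI)
 let ?C = "%n. {s \<in> smp S n. p n s \<in> C0 n}"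
 let ?C' = "%n. {(s, l::unit). s \<in> smp S n \<and> l \<in> smp pt n \<and> (p n s \<in> C0 n \<or> l \<in> {})}"
 fix g w assume g: "shom (res S ?C) Z g" and w: "shom S Y' w" and gw: "!!n x. x \<in> ?C n ==> q n (g n x) = w n x"
 have l: "lft Z Y' q (sset_prod S pt) ?C'"
  by (rule free_lft[OF A S C0 ss_pt subc_empty q])
 have "shom (res (sset_prod S pt) ?C') Z (%n z. g n (fst z))" using g by (auto simp: shom_def)
 then have 1: "shom (res (sset_prod S pt) ?C') Z (%n z. g n (fst z))" .
 have 2: "shom (sset_prod S pt) Y' (%n z. w n (fst z))" using w by (auto simp: shom_def)
 have 3: "q n (g n (fst x)) = w n (fst x)" if "x \<in> ?C' n" for n x using gw that by auto
 obtain h where h: "shom (sset_prod S pt) Z h" "!!n x. x \<in> smp (sset_prod S pt) n ==> q n (h n x) = w n (fst x)"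
   "!!n x. x \<in> ?C' n ==> h n x = g n (fst x)"
  using lft_ex[OF l 1 2 3] by blast
 have "shom S (sset_prod S pt) (%n s. (s, ()))" by (auto simp: shom_def pt_def)
 from shom_comp[OF this h(1)]
 show "\<exists>h. shom S Z h \<and> (\<forall>n. \<forall>x\<in>smp S n. q n (h n x) = w n x) \<and> (\<forall>n. \<forall>x\<in>?C n. h n x = g n x)"
  by (rule_tac exI[of _ "%n s. h n (s, ())"]) (use h in "auto simp: pt_def")
qed

lemma free_unique:
 assumes A: "ss A"
  and S: "nfib S (free A Y f) p" and C0: "subc (free A Y f) C0" "!!n a. a \<in> smp A n ==> Leaf a \<in> C0 n" "csat C0"
  and Z: "jfib Z" and f1: "shom S Z f1" and f2: "shom S Z f2"
  and eq: "!!n s. s \<in> smp S n ==> p n s \<in> C0 n ==> f1 n s = f2 n s"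
 shows "htp S (%n. {s \<in> smp S n. p n s \<in> C0 n}) Z f1 f2"
proof -
 let ?C = "%n. {(s, l). s \<in> smp S n \<and> l \<in> smp J n \<and> (p n s \<in> C0 n \<or> l \<in> ends n)}"
 let ?g = "%n z. if snd z = zero n then f1 n (fst z) else f2 n (fst z)"
 have l: "lft Z pt (%_ _. ()) (sset_prod S J) ?C"
  by (rule free_lft[OF A S C0 ss_J subc_ends Z[unfolded jfib_def]])
 have "shom (res (sset_prod S J) ?C) Z ?g"
 proof (rule shomI)
  fix m n \<alpha> z assume a: "\<alpha> \<in> ops m n" and z: "z \<in> smp (res (sset_prod S J) ?C) n"
  have z': "fst z \<in> smp S n" "snd z \<in> smp J n" "p n (fst z) \<in> C0 n \<or> snd z = zero n \<or> snd z = one n" using z by (auto simp: ends_def)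
  have "p m (act S m n \<alpha> (fst z)) \<in> C0 m" if "p n (fst z) \<in> C0 n"
   using shom_act[OF nfib_ss(3)[OF S] a z'(1)] subc_act[OF C0(1) a that] by simp
  then show "?g m (act (res (sset_prod S J) ?C) m n \<alpha> z) = act Z m n \<alpha> (?g n z)"
   using z' a shom_act[OF f1 a z'(1)] shom_act[OF f2 a z'(1)] eq[OF z'(1)] eq[OF ss_act[OF nfib_ss(1)[OF S] a z'(1)]]
   by auto
 qed (use shom_in[OF f1] shom_in[OF f2] in auto)
 then obtain h where h: "shom (sset_prod S J) Z h" "!!n x. x \<in> ?C n ==> h n x = ?g n x"
  using lftD[OF l _ shom_pt] by auto
 have sw: "shom (cyl S) (sset_prod S J) (%n z. (snd z, fst z))" by (auto simp: shom_def)
 show ?thesis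
  by (rule htpI[OF shom_comp[OF sw h(1)]]) (use h(2) eq in "auto simp: ends_def")
qed

lemma csat_Leaf: "csat (%n. Leaf ` smp A n)"
 by (auto simp: csat_def)

lemma subc_Leaf: "ss A ==> subc (free A Y f) (%n. Leaf ` smp A n)"
 by (auto simp: subc_def ss_act intro: wf_Leaf)

section \<open>Homotopies of paths that agree on the edge from 0 to 1\<close>

lemma lft_omega:
 assumes st: "!!r::nat. lft E Y q (res D (C (Suc r))) (C r)" and sub: "!!r. subc D (C r)"
  and mono: "!!r n. C r n \<subseteq> C (Suc r) n" and cov: "!!n x. x \<in> smp D n ==> \<exists>r. x \<in> C r n"
 shows "lft E Y q D (C 0)"
proof (rule lftI)
 fix g w assume g: "shom (res D (C 0)) E g" and w: "shom D Y w" and gw: "!!n x. x \<in> C 0 n ==> q n (g n x) = w n x"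
 define P where "P r h \<longleftrightarrow> shom (res D (C r)) E h \<and> (\<forall>n. \<forall>x\<in>C r n. q n (h n x) = w n x) \<and> (r = 0 --> h = g)" for r h
 have "\<exists>h. \<forall>r. P r (h r) \<and> (\<forall>n. \<forall>x\<in>C r n. h (Suc r) n x = h r n x)"
 proof (rule dependent_nat_choice)
  show "\<exists>h. P 0 h" using g gw by (auto simp: P_def)
  fix h r assume "P r h"
  then have 1: "shom (res (res D (C (Suc r))) (C r)) E h" and 2: "!!n x. x \<in> C r n ==> q n (h n x) = w n x" by (auto simp: P_def)
  have 3: "shom (res D (C (Suc r))) Y w" by (rule shom_res[OF w]) (use sub in "auto simp: subc_def")
  show "\<exists>h'. P (Suc r) h' \<and> (\<forall>n. \<forall>x\<in>C r n. h' n x = h n x)"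
   using lft_ex[OF st 1 3 2] by (auto simp: P_def)
 qed
 then obtain h where h: "!!r. P r (h r)" "!!r n x. x \<in> C r n ==> h (Suc r) n x = h r n x" by blast
 have Cm: "C r n \<subseteq> C (r + k) n" for r k n by (induction k) (use mono in auto)
 have hm: "h (r + k) n x = h r n x" if "x \<in> C r n" for r k n x
 proof (induction k)
  case (Suc k)
  have "x \<in> C (r + k) n" using that Cm by blast
  then show ?case using h(2)[of x "r+k" n] Suc by simp
 qed simp
 define H where "H n x = h (LEAST r. x \<in> C r n) n x" for n x
 have H: "H n x = h r n x" if x: "x \<in> C r n" for r n x
 proof -
  let ?l = "LEAST r. x \<in> C r n"
  have "x \<in> C ?l n" by (rule LeastI[of _ r]) (rule x)
  moreover have "?l \<le> r" by (rule Least_le) (rule x)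
  ultimately show ?thesis using hm[of x ?l n "r - ?l"] by (simp add: H_def)
 qed
 have "shom D E H"
 proof (rule shomI)
  fix n x assume "x \<in> smp D n"
  then obtain r where "x \<in> C r n" using cov by blast
  then show "H n x \<in> smp E n" using H h(1)[of r] by (auto simp: P_def shom_def)
 next
  fix m n \<alpha> x assume a: "\<alpha> \<in> ops m n" and "x \<in> smp D n"
  then obtain r where r: "x \<in> C r n" using cov by blast
  have "act D m n \<alpha> x \<in> C r m" using subc_act[OF sub a r] .
  then show "H m (act D m n \<alpha> x) = act E m n \<alpha> (H n x)"
   using H r h(1)[of r] a by (auto simp: P_def shom_def)
 qed
 moreover have "q n (H n x) = w n x" if xD: "x \<in> smp D n" for n x
 proof -
  obtain r where r: "x \<in> C r n" using cov xD by blast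
  then show ?thesis using H[OF r] h(1)[of r] by (auto simp: P_def)
 qed
 moreover have "H n x = g n x" if "x \<in> C 0 n" for n x using H[OF that] h(1)[of 0] by (auto simp: P_def)
 ultimately show "\<exists>h. shom D E h \<and> (\<forall>n. \<forall>x\<in>smp D n. q n (h n x) = w n x) \<and> (\<forall>n. \<forall>x\<in>C 0 n. h n x = g n x)" by blast
qed

section \<open>Threshold matrices and the paths read from them\<close>

definition mon :: "nat => (nat => nat) set" where
 "mon n = {x \<in> smp J n. \<forall>i j. i \<le> j --> j \<le> n --> x i \<le> x j}"

lemma subc_mon: "subc J mon"
 unfolding subc_def
proof (intro conjI allI ballI)
 fix m n \<alpha> x assume a: "\<alpha> \<in> ops m n" and x: "x \<in> mon n"
 then show "act J m n \<alpha> x \<in> mon m"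
  using ss_act[OF ss_J a, of x] ops_mono[OF a] ops_le[OF a] by (auto simp: mon_def J_act_at)
qed (auto simp: mon_def)

lemma ends_mon: "x \<in> ends n ==> x \<in> mon n"
 by (auto simp: ends_def mon_def)

lemma ends_J: "x \<in> ends n ==> x \<in> smp J n"
 by (auto simp: ends_def)

text \<open>0-1 matrices with rows and columns indexed by [n], on which operators reindex both. They
  replace the square \<open>J \<times> J\<close> because the data on its sides extend to the larger
  subcomplex \<open>T1\<close>, which has a cell structure.\<close>

definition TT :: "(nat \<times> nat => nat) sset" where
 "TT = \<lparr>smp = %n. ({..n} \<times> {..n}) \<rightarrow>\<^sub>E {0, 1}, act = %m n \<alpha> M. restrict (%p. M (\<alpha> (fst p), \<alpha> (snd p))) ({..m} \<times> {..m})\<rparr>"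

lemma TT_at: "j \<le> m ==> k \<le> m ==> act TT m n \<alpha> M (j, k) = M (\<alpha> j, \<alpha> k)"
 by (simp add: TT_def)

lemma TT_eqI:
 assumes "M \<in> smp TT n" "M' \<in> smp TT n" "!!j k. j \<le> n ==> k \<le> n ==> M (j, k) = M' (j, k)"
 shows "M = M'"
proof (rule PiE_ext)
 show "M \<in> ({..n} \<times> {..n}) \<rightarrow>\<^sub>E {0, 1}" "M' \<in> ({..n} \<times> {..n}) \<rightarrow>\<^sub>E {0, 1}" using assms(1,2) by (simp_all add: TT_def)
 fix p assume "p \<in> {..n} \<times> {..n}"
 then show "M p = M' p" using assms(3) by (cases p) auto
qed

lemma TT_val: "M \<in> smp TT n ==> j \<le> n ==> k \<le> n ==> M (j, k) = 0 \<or> M (j, k) = 1"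
 by (auto simp: TT_def PiE_iff)

lemma TT_intro: "(!!j k. j \<le> n ==> k \<le> n ==> f (j, k) = 0 \<or> f (j, k) = (1::nat)) ==> restrict f ({..n} \<times> {..n}) \<in> smp TT n"
 by (auto simp: TT_def PiE_iff)

lemma ss_TT: "ss TT"
 unfolding simplicial_set_def
proof (intro conjI allI ballI)
 fix m n \<alpha> M assume a: "\<alpha> \<in> ops m n" and M: "M \<in> smp TT n"
 show A: "act TT m n \<alpha> M \<in> smp TT m"
  using TT_val[OF M ops_le[OF a] ops_le[OF a]] by (auto simp: TT_def PiE_iff)
next
 fix n M assume M: "M \<in> smp TT n"
 then show "act TT n n (\<lambda>i\<in>{..n}. i) M = M"
  by (auto simp: TT_def PiE_iff extensional_def fun_eq_iff)
next
 fix k m n \<beta> \<alpha> M assume "\<beta> \<in> ops k m" "\<alpha> \<in> ops m n"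
 then show "act TT k n (compose {..k} \<alpha> \<beta>) M = act TT k m \<beta> (act TT m n \<alpha> M)"
  by (auto simp: TT_def fun_eq_iff compose_def ops_le)
qed

text \<open>Left of column i the matrix depends on the column only, from column i on it depends on
  the row only. The case i = 0 carries the path to be contracted, the case i = \<open>Suc n\<close>
  a side on which the contraction is constant.\<close>

definition thr :: "nat => (nat \<times> nat => nat) => nat => bool" where
 "thr n M i \<longleftrightarrow> i \<le> Suc n \<and> (\<forall>k<i. \<forall>j\<le>n. \<forall>j'\<le>n. M (j, k) = M (j', k)) \<and> (\<forall>k\<le>n. i \<le> k --> (\<forall>j\<le>n. M (j, k) = M (j, n)))"

lemma thr_col: "thr n M i ==> k < i ==> j \<le> n ==> j' \<le> n ==> M (j, k) = M (j', k)"
 unfolding thr_def by blast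

lemma thr_row: "thr n M i ==> i \<le> k ==> k \<le> n ==> j \<le> n ==> M (j, k) = M (j, n)"
 unfolding thr_def by blast

definition T1 :: "nat => (nat \<times> nat => nat) set" where
 "T1 n = {M \<in> smp TT n. \<exists>i. thr n M i}"

definition mu :: "nat => (nat \<times> nat => nat) => nat => nat => nat" where
 "mu n M i = (\<lambda>j\<in>{..n}. if i \<le> j then M (j, j) else 0)"

text \<open>Transports a threshold along \<alpha>: the first index sent to i or beyond. The
  implication under \<open>LEAST\<close> makes \<open>Suc m\<close> the value if there is no such
  index.\<close>

definition push :: "nat => (nat => nat) => nat => nat" where
 "push m \<alpha> i = (LEAST j. j \<le> m --> i \<le> \<alpha> j)"

lemma push:
 assumes a: "\<alpha> \<in> ops m n"
 shows "push m \<alpha> i \<le> Suc m" "j \<le> m ==> push m \<alpha> i \<le> j \<longleftrightarrow> i \<le> \<alpha> j"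
proof -
 have 0: "Suc m \<le> m --> i \<le> \<alpha> (Suc m)" by simp
 show "push m \<alpha> i \<le> Suc m" unfolding push_def by (rule Least_le) simp
 have 1: "push m \<alpha> i \<le> m --> i \<le> \<alpha> (push m \<alpha> i)"
  unfolding push_def by (rule LeastI[of "%j. j \<le> m --> i \<le> \<alpha> j"]) (rule 0)
 show "push m \<alpha> i \<le> j \<longleftrightarrow> i \<le> \<alpha> j" if j: "j \<le> m"
 proof
  assume "push m \<alpha> i \<le> j"
  then show "i \<le> \<alpha> j" using 1 j ops_mono[OF a, of "push m \<alpha> i" j] by linarith
 next
  assume "i \<le> \<alpha> j"
  then show "push m \<alpha> i \<le> j" unfolding push_def by (intro Least_le) simp
 qed
qed

lemma thr_act:
 assumes a: "\<alpha> \<in> ops m n" and t: "thr n M i"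
 shows "thr m (act TT m n \<alpha> M) (push m \<alpha> i)"
 unfolding thr_def
proof (intro conjI allI impI)
 show "push m \<alpha> i \<le> Suc m" by (rule push(1)[OF a])
next
 fix k j j' assume k: "k < push m \<alpha> i" and j: "j \<le> m" "j' \<le> m"
 have km: "k \<le> m" using k push(1)[OF a, of i] by simp
 then have "\<alpha> k < i" using push(2)[OF a km, of i] k by simp
 then show "act TT m n \<alpha> M (j, k) = act TT m n \<alpha> M (j', k)"
  using thr_col[OF t, of "\<alpha> k" "\<alpha> j" "\<alpha> j'"] j km ops_le[OF a] by (simp add: TT_at)
next
 fix k j assume k: "k \<le> m" "push m \<alpha> i \<le> k" and j: "j \<le> m"
 then have "i \<le> \<alpha> k" "i \<le> \<alpha> m" using push(2)[OF a k(1), of i] push(2)[OF a order_refl, of i] by auto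
 then have "M (\<alpha> j, \<alpha> k) = M (\<alpha> j, n)" "M (\<alpha> j, \<alpha> m) = M (\<alpha> j, n)"
  using thr_row[OF t, of "\<alpha> k" "\<alpha> j"] thr_row[OF t, of "\<alpha> m" "\<alpha> j"] j k ops_le[OF a] by auto
 then show "act TT m n \<alpha> M (j, k) = act TT m n \<alpha> M (j, m)" using j k by (simp add: TT_at)
qed

lemma subc_T1: "subc TT T1"
 using thr_act ss_act[OF ss_TT] by (fastforce simp: subc_def T1_def)

lemma mu_J: "M \<in> smp TT n ==> mu n M i \<in> smp J n"
 using TT_val[of M n] by (force simp: mu_def J_simps PiE_iff)

lemma mu_act:
 assumes a: "\<alpha> \<in> ops m n"
 shows "mu m (act TT m n \<alpha> M) (push m \<alpha> i) = act J m n \<alpha> (mu n M i)"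
proof
 fix j show "mu m (act TT m n \<alpha> M) (push m \<alpha> i) j = act J m n \<alpha> (mu n M i) j"
 proof (cases "j \<le> m")
  case True
  then show ?thesis using push(2)[OF a True, of i] ops_le[OF a True] by (simp add: mu_def J_act_at TT_at)
 qed (simp add: mu_def J_simps compose_def)
qed

text \<open>With thresholds i < i' each row is constant from column i on, and column i is itself
  constant. So all entries from column i on coincide, and either reading is a block of zeros
  followed by a constant.\<close>

lemma mu_mon:
 assumes M: "M \<in> smp TT n" and t: "thr n M i" "thr n M i'" and lt: "i < i'"
 shows "mu n M i \<in> mon n" "mu n M i' \<in> mon n"
proof -
 have iN: "i \<le> n" using t(2) lt by (auto simp: thr_def)
 have "M (j, j) = M (0, i)" if "i \<le> j" "j \<le> n" for j
 proof -
  have "M (j, j) = M (j, n)" "M (j, i) = M (j, n)" using thr_row[OF t(1) that that(2)] thr_row[OF t(1) order_refl iN that(2)] by auto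
  moreover have "M (j, i) = M (0, i)" by (rule thr_col[OF t(2) lt that(2)]) simp
  ultimately show ?thesis by simp
 qed
 then show "mu n M i \<in> mon n" "mu n M i' \<in> mon n"
  using mu_J[OF M] lt by (auto simp: mon_def mu_def)
qed

definition Psi :: "(nat => (nat => nat) \<times> 'k => 'e) => nat => (nat \<times> nat => nat) \<times> 'k => 'e" where
 "Psi c n z = c n (mu n (fst z) (SOME i. thr n (fst z) i), snd z)"

text \<open>A matrix may have several thresholds, but different ones give nondecreasing readings by
  \<open>mu_mon\<close>, and there c only depends on k. Hence the choice in \<open>Psi\<close> is
  harmless.\<close>

lemma Psi_eq:
 assumes c: "\<forall>n. \<forall>t\<in>mon n. \<forall>k\<in>smp K n. c n (t, k) = y0 n k"
  and M: "M \<in> smp TT n" and k: "k \<in> smp K n" and t: "thr n M i"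
 shows "Psi c n (M, k) = c n (mu n M i, k)"
proof -
 define i' where "i' = (SOME i. thr n M i)"
 have "thr n M i'" using t unfolding i'_def by (rule someI)
 then consider "i = i'" | "mu n M i \<in> mon n" "mu n M i' \<in> mon n"
  using mu_mon[OF M t] mu_mon[OF M _ t] by (metis nat_neq_iff)
 then have "c n (mu n M i', k) = c n (mu n M i, k)" using c k by cases auto
 then show ?thesis by (simp add: Psi_def i'_def)
qed

lemma shom_Psi:
 assumes c: "\<forall>n. \<forall>t\<in>mon n. \<forall>k\<in>smp K n. c n (t, k) = y0 n k"
  and cs: "shom (cyl K) E c" and K: "ss K"
 shows "shom (sset_prod (res TT T1) K) E (Psi c)"
proof (rule shomI)
 fix n z assume "z \<in> smp (sset_prod (res TT T1) K) n"
 then show "Psi c n z \<in> smp E n" using shom_in[OF cs] mu_J by (auto simp: Psi_def T1_def)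
next
 fix m n \<alpha> z assume a: "\<alpha> \<in> ops m n" and z: "z \<in> smp (sset_prod (res TT T1) K) n"
 obtain M k where Mk: "z = (M, k)" "M \<in> smp TT n" "k \<in> smp K n" using z by (cases z) (auto simp: T1_def)
 obtain i where i: "thr n M i" using z Mk(1) by (auto simp: T1_def)
 have "Psi c m (act TT m n \<alpha> M, act K m n \<alpha> k) = c m (act J m n \<alpha> (mu n M i), act K m n \<alpha> k)"
  using Psi_eq[OF c ss_act[OF ss_TT a Mk(2)] ss_act[OF K a Mk(3)] thr_act[OF a i]] mu_act[OF a] by simp
 also have "\<dots> = act E m n \<alpha> (c n (mu n M i, k))" using shom_act[OF cs a, of "(mu n M i, k)"] Mk(3) mu_J[OF Mk(2)] by simp
 finally show "Psi c m (act (sset_prod (res TT T1) K) m n \<alpha> z) = act E m n \<alpha> (Psi c n z)"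
  using Psi_eq[OF c Mk(2,3) i] Mk(1) by simp
qed

section \<open>Filtration of threshold matrices by the number of alternations\<close>

primrec cnt :: "(nat => nat) => nat => nat" where
 "cnt x 0 = x 0"
| "cnt x (Suc k) = cnt x k + (if x (Suc k) \<noteq> x k then 1 else 0)"

lemma cnt_mono: "i \<le> j ==> cnt x i \<le> cnt x j"
 by (induction j) (auto simp: le_Suc_eq)

lemma cnt_cong: "(!!i. i \<le> k ==> x i = y i) ==> cnt x k = cnt y k"
 by (induction k) auto

lemma cnt_mod: "(!!i. i \<le> k ==> x i = 0 \<or> x i = 1) ==> cnt x k mod 2 = x k"
proof (induction k)
 case (Suc k)
 have IH: "cnt x k mod 2 = x k" by (rule Suc.IH) (use Suc.prems in auto)
 have "x k = 0 \<or> x k = 1" "x (Suc k) = 0 \<or> x (Suc k) = 1" using Suc.prems by auto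
 then show ?case using IH by (auto simp: mod_Suc)
qed auto

text \<open>\<open>cnt x\<close> counts the changes of x after a virtual initial 0, which makes x
  its sequence of parities. It is the least nondecreasing sequence with these parities, as each
  change forces an increase.\<close>

lemma cnt_le:
 assumes "!!i. i \<le> k ==> x i = \<gamma> i mod 2" "!!i j. i \<le> j ==> j \<le> k ==> \<gamma> i \<le> \<gamma> j"
 shows "i \<le> k ==> cnt x i \<le> \<gamma> i"
proof (induction i)
 case (Suc i)
 then have "cnt x i \<le> \<gamma> i" "\<gamma> i \<le> \<gamma> (Suc i)" using assms(2) by auto
 moreover have "x (Suc i) \<noteq> x i ==> \<gamma> i \<noteq> \<gamma> (Suc i)" using assms(1) Suc.prems by auto
 ultimately show ?case by auto
qed (use assms in auto)

lemma cnt_eq_back: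
 assumes "!!i. i \<le> k ==> x i = \<gamma> i mod 2" "!!i j. i \<le> j ==> j \<le> k ==> \<gamma> i \<le> \<gamma> j" "\<gamma> k \<le> cnt x k"
 shows "i \<le> k ==> cnt x i = \<gamma> i"
proof (induction "k - i" arbitrary: i)
 case 0
 have "cnt x k \<le> \<gamma> k" by (rule cnt_le[OF assms(1,2)]) auto
 then show ?case using 0 assms(3) by simp
next
 case (Suc d)
 have IH: "cnt x (Suc i) = \<gamma> (Suc i)" by (rule Suc.hyps(1)) (use Suc.hyps(2) Suc.prems in linarith)+
 have le: "cnt x i \<le> \<gamma> i" by (rule cnt_le[OF assms(1,2)]) (use Suc.prems in auto)
 have "\<gamma> i \<le> \<gamma> (Suc i)" "x (Suc i) \<noteq> x i ==> \<gamma> i \<noteq> \<gamma> (Suc i)" using assms(1,2) Suc by auto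
 then show ?case using IH le by (auto split: if_splits)
qed

lemma cnt_onto: "x 0 \<le> 1 ==> 1 \<le> v ==> v \<le> cnt x k ==> \<exists>i\<le>k. cnt x i = v"
proof (induction k)
 case (Suc k)
 show ?case
 proof (cases "v \<le> cnt x k")
  case True then show ?thesis using Suc by (meson le_Suc_eq)
 next
  case False
  then have "v = cnt x (Suc k)" using Suc.prems(3) by (auto split: if_splits)
  then show ?thesis by blast
 qed
qed auto

text \<open>A nondecreasing sequence that omits none of 1, ..., r starts at 0 or 1 and never
  increases by more than one, so its steps are exactly the changes of parity.\<close>

lemma cnt_is:
 assumes x: "!!i. i \<le> k ==> x i = \<gamma> i mod 2" and m: "!!i j. i \<le> j ==> j \<le> k ==> \<gamma> i \<le> \<gamma> j"
  and r: "!!i. i \<le> k ==> \<gamma> i \<le> r" and on: "!!v. 1 \<le> v ==> v \<le> r ==> v \<in> \<gamma> ` {..k}"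
 shows "i \<le> k ==> cnt x i = \<gamma> i"
proof (induction i)
 case 0
 have "\<gamma> 0 \<le> 1"
 proof (rule ccontr)
  assume "\<not> \<gamma> 0 \<le> 1"
  then have "1 \<le> r" using r[of 0] by simp
  then obtain j where "j \<le> k" "\<gamma> j = 1" using on[of 1] by auto
  then show False using m[of 0 j] \<open>\<not> \<gamma> 0 \<le> 1\<close> by simp
 qed
 then show ?case using x[of 0] by simp
next
 case (Suc i)
 then have IH: "cnt x i = \<gamma> i" by simp
 have "\<gamma> (Suc i) \<le> Suc (\<gamma> i)"
 proof (rule ccontr)
  assume n: "\<not> \<gamma> (Suc i) \<le> Suc (\<gamma> i)"
  then have "Suc (\<gamma> i) \<le> r" using r[OF Suc.prems] by simp
  then obtain j where j: "j \<le> k" "\<gamma> j = Suc (\<gamma> i)" using on[of "Suc (\<gamma> i)"] by auto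
  then show False using m[of j i] m[of "Suc i" j] n Suc.prems by (cases "j \<le> i") auto
 qed
 moreover have "\<gamma> i \<le> \<gamma> (Suc i)" using m[of i "Suc i"] Suc.prems by simp
 ultimately have "\<gamma> (Suc i) = \<gamma> i \<or> \<gamma> (Suc i) = Suc (\<gamma> i)" by linarith
 then show ?case using IH x[OF Suc.prems] x[of i] Suc.prems by (auto simp: mod_Suc split: if_splits)
qed

lemma cnt_comp:
 assumes a: "\<alpha> \<in> ops m n" and x: "!!i. i \<le> n ==> x i = 0 \<or> x i = 1"
 shows "cnt (%k. x (\<alpha> k)) m \<le> cnt x n"
proof -
 have "cnt (%k. x (\<alpha> k)) m \<le> cnt x (\<alpha> m)"
  by (rule cnt_le[of m _ "%k. cnt x (\<alpha> k)"])
    (use cnt_mod[of _ x] x ops_le[OF a] ops_mono[OF a] cnt_mono in "force+")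
 then show ?thesis using cnt_mono[OF ops_le[OF a order_refl], of x] by simp
qed

definition Tr :: "nat => nat => (nat \<times> nat => nat) set" where
 "Tr r n = {M \<in> T1 n. \<forall>j\<le>n. cnt (%k. M (j, k)) n \<le> r}"

lemma Tr_act:
 assumes a: "\<alpha> \<in> ops m n" and M: "M \<in> Tr r n"
 shows "act TT m n \<alpha> M \<in> Tr r m"
proof -
 have MT: "M \<in> T1 n" "M \<in> smp TT n" using M by (auto simp: Tr_def T1_def)
 have "cnt (%k. act TT m n \<alpha> M (j, k)) m \<le> r" if j: "j \<le> m" for j
 proof -
  have "cnt (%k. act TT m n \<alpha> M (j, k)) m = cnt (%k. M (\<alpha> j, \<alpha> k)) m"
   by (rule cnt_cong) (use j in "simp add: TT_at")
  also have "\<dots> \<le> cnt (%k. M (\<alpha> j, k)) n" by (rule cnt_comp[OF a]) (use TT_val[OF MT(2) ops_le[OF a j]] in auto)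
  also have "\<dots> \<le> r" using M ops_le[OF a j] by (simp add: Tr_def)
  finally show ?thesis .
 qed
 then show ?thesis using subc_act[OF subc_T1 a MT(1)] by (simp add: Tr_def)
qed

text \<open>Every row consists of the parities of \<alpha>, except that the top value r is lowered
  to r - 1 in rows with y j = 0. Thus \<alpha> gives the pattern of alternations and y selects the
  rows that perform the last one; (y, \<alpha>) are coordinates on a cell J x simplex r.\<close>

definition cm :: "nat => nat => (nat => nat) => (nat => nat) => nat \<times> nat => nat" where
 "cm r n y \<alpha> = restrict (%p. if \<alpha> (snd p) = r \<and> y (fst p) = 0 then (r - 1) mod 2 else \<alpha> (snd p) mod 2) ({..n} \<times> {..n})"

lemma cm_at: "j \<le> n ==> k \<le> n ==> cm r n y \<alpha> (j, k) = (if \<alpha> k = r \<and> y j = 0 then r - 1 else \<alpha> k) mod 2"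
 by (simp add: cm_def)

lemma cm_T1:
 assumes a: "\<alpha> \<in> ops n r"
 shows "cm r n y \<alpha> \<in> T1 n"
proof -
 have "cm r n y \<alpha> \<in> smp TT n" unfolding cm_def by (rule TT_intro) auto
 moreover have "thr n (cm r n y \<alpha>) (push n \<alpha> r)"
  unfolding thr_def
 proof (intro conjI allI impI)
  show "push n \<alpha> r \<le> Suc n" by (rule push(1)[OF a])
 next
  fix k j j' assume k: "k < push n \<alpha> r" and j: "j \<le> n" "j' \<le> n"
  have km: "k \<le> n" using k push(1)[OF a, of r] by simp
  then have "\<alpha> k < r" using push(2)[OF a km, of r] k by simp
  then show "cm r n y \<alpha> (j, k) = cm r n y \<alpha> (j', k)" using j km by (simp add: cm_at)
 next
  fix k j assume k: "k \<le> n" "push n \<alpha> r \<le> k" and j: "j \<le> n"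
  then have "r \<le> \<alpha> k" "r \<le> \<alpha> n" using push(2)[OF a k(1), of r] push(2)[OF a order_refl, of r] by auto
  then have "\<alpha> k = r" "\<alpha> n = r" using ops_le[OF a k(1)] ops_le[OF a order_refl] by auto
  then show "cm r n y \<alpha> (j, k) = cm r n y \<alpha> (j, n)" using j k by (simp add: cm_at)
 qed
 ultimately show ?thesis by (auto simp: T1_def)
qed

lemma cm_act:
 assumes "\<beta> \<in> ops m n"
 shows "cm r m (act J m n \<beta> y) (compose {..m} \<alpha> \<beta>) = act TT m n \<beta> (cm r n y \<alpha>)"
 using assms by (auto simp: cm_def TT_def fun_eq_iff J_act_at compose_def ops_le)

lemma cm_cnt:
 assumes a: "\<alpha> \<in> ops n r" and j: "j \<le> n"
 shows "cnt (%k. cm r n y \<alpha> (j, k)) n \<le> r" "y j = 0 ==> 0 < r ==> cnt (%k. cm r n y \<alpha> (j, k)) n < r"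
  "y j \<noteq> 0 ==> cnt (%k. cm r n y \<alpha> (j, k)) n = r ==> {1..r} \<subseteq> \<alpha> ` {..n}"
  "y j \<noteq> 0 ==> {1..r} \<subseteq> \<alpha> ` {..n} ==> i \<le> n ==> cnt (%k. cm r n y \<alpha> (j, k)) i = \<alpha> i"
proof -
 let ?x = "%k. cm r n y \<alpha> (j, k)"
 define \<gamma> where "\<gamma> k = (if \<alpha> k = r \<and> y j = 0 then r - 1 else \<alpha> k)" for k
 have x: "!!i. i \<le> n ==> ?x i = \<gamma> i mod 2" using j by (simp add: cm_at \<gamma>_def)
 have le: "!!i. i \<le> n ==> \<alpha> i \<le> r" using ops_le[OF a] .
 have m: "\<gamma> i \<le> \<gamma> k" if "i \<le> k" "k \<le> n" for i k
  using ops_mono[OF a that] le[of k] le[of i] that by (auto simp: \<gamma>_def)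
 have c: "cnt ?x n \<le> \<gamma> n" by (rule cnt_le[OF x m]) auto
 moreover have "\<gamma> n \<le> r" using le by (auto simp: \<gamma>_def)
 ultimately show "cnt ?x n \<le> r" by simp
 show "cnt ?x n < r" if "y j = 0" "0 < r"
  using c le[of n] that by (auto simp: \<gamma>_def split: if_splits)
 assume y: "y j \<noteq> 0"
 then have ga: "\<gamma> = \<alpha>" by (auto simp: \<gamma>_def)
 show "{1..r} \<subseteq> \<alpha> ` {..n}" if e: "cnt ?x n = r"
 proof
  fix v assume v: "v \<in> {1..r}"
  have "?x 0 \<le> 1" using x[of 0] by simp
  then obtain i where i: "i \<le> n" "cnt ?x i = v" using cnt_onto[of ?x v n] v e by auto
  have "cnt ?x i = \<gamma> i" by (rule cnt_eq_back[OF x m _ i(1)]) (use e \<open>\<gamma> n \<le> r\<close> in auto)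
  then show "v \<in> \<alpha> ` {..n}" using i ga by auto
 qed
 show "cnt ?x i = \<alpha> i" if on: "{1..r} \<subseteq> \<alpha> ` {..n}" and i: "i \<le> n"
 proof -
  have "v \<in> \<gamma> ` {..n}" if "1 \<le> v" "v \<le> r" for v using on that unfolding ga by (meson atLeastAtMost_iff subsetD)
  moreover have "\<gamma> i \<le> r" if "i \<le> n" for i using le[OF that] by (simp add: ga)
  ultimately have "cnt ?x i = \<gamma> i" using cnt_is[of n ?x \<gamma> r i] x m i by blast
  then show ?thesis by (simp add: ga)
 qed
qed

text \<open>\<alpha> counts alternations along a row j0 attaining r, and y marks all rows attaining
  r. Left of the threshold every row agrees with row j0. From the threshold on, where \<alpha> is r,
  a row has the parity of r, or the opposite one if it has fewer alternations.\<close>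

lemma cm_cover:
 assumes M: "M \<in> Tr r n" and j0: "j0 \<le> n" "cnt (%k. M (j0, k)) n = r" and r: "0 < r"
 obtains y \<alpha> where "y \<in> smp J n" "\<alpha> \<in> ops n r" "M = cm r n y \<alpha>"
proof -
 have MT: "M \<in> smp TT n" using M by (auto simp: Tr_def T1_def)
 obtain i where t: "thr n M i" using M by (auto simp: Tr_def T1_def)
 have le: "cnt (%k. M (j, k)) n \<le> r" if "j \<le> n" for j using M that by (simp add: Tr_def)
 let ?c = "%j k. cnt (%k. M (j, k)) k"
 define \<alpha> where "\<alpha> = (\<lambda>k\<in>{..n}. ?c j0 k)"
 define y where "y = (\<lambda>j\<in>{..n}. if ?c j n = r then 1 else (0::nat))"
 have y: "y \<in> smp J n" by (auto simp: y_def J_simps PiE_iff)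
 have a: "\<alpha> \<in> ops n r"
 proof (rule opsI)
  fix i assume "i \<le> n"
  then show "\<alpha> i \<le> r" using cnt_mono[of i n "%k. M (j0, k)"] j0 by (simp add: \<alpha>_def)
 qed (auto simp: \<alpha>_def cnt_mono)
 have col: "M (j, k) = M (j0, k)" if "k < i" "j \<le> n" for j k by (rule thr_col[OF t that j0(1)])
 have row: "M (j, k) = M (j, n)" if "i \<le> k" "k \<le> n" "j \<le> n" for j k by (rule thr_row[OF t that])
 have val: "?c j k mod 2 = M (j, k)" if "j \<le> n" "k \<le> n" for j k
  by (rule cnt_mod) (use TT_val[OF MT that(1)] that(2) in auto)
 have pre: "?c j k = ?c j0 k" if "k < i" "j \<le> n" for j k
  by (rule cnt_cong, rule col) (use that in auto)
 have tail: "?c j0 k = r" if "i \<le> k" "k \<le> n" for k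
 proof -
  have "?c j0 n' = ?c j0 k" if "k \<le> n'" "n' \<le> n" for n' using that
  proof (induction n')
   case (Suc n')
   show ?case
   proof (cases "k \<le> n'")
    case True
    then have "M (j0, Suc n') = M (j0, n')" using row[of "Suc n'" j0] row[of n' j0] Suc.prems \<open>i \<le> k\<close> j0 by simp
    then show ?thesis using Suc True by simp
   next
    case False then show ?thesis using Suc.prems by (simp add: le_antisym not_less_eq_eq)
   qed
  qed simp
  from this[of n] show ?thesis using that j0(2) by simp
 qed
 have "M = cm r n y \<alpha>"
 proof (rule TT_eqI[OF MT])
  show "cm r n y \<alpha> \<in> smp TT n" using cm_T1[OF a] by (auto simp: T1_def)
  fix j k assume j: "j \<le> n" and k: "k \<le> n"
  show "M (j, k) = cm r n y \<alpha> (j, k)"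
  proof (cases "k < i")
   case True
   have "?c j k = \<alpha> k" using pre[OF True j] k by (simp add: \<alpha>_def)
   moreover have "\<not> (\<alpha> k = r \<and> y j = 0)"
   proof
    assume "\<alpha> k = r \<and> y j = 0"
    then have "r \<le> ?c j n" using \<open>?c j k = \<alpha> k\<close> cnt_mono[OF k, of "%k. M (j, k)"] by simp
    then show False using le[OF j] \<open>\<alpha> k = r \<and> y j = 0\<close> j by (simp add: y_def)
   qed
   ultimately show ?thesis using val[OF j k] cm_at[OF j k] by auto
  next
   case False
   then have ak: "\<alpha> k = r" using tail[of k] k by (simp add: \<alpha>_def)
   have Mjk: "M (j, k) = M (j, n)" by (rule row) (use False j k in auto)
   show ?thesis
   proof (cases "?c j n = r")
    case True
    then have "M (j, n) = r mod 2" using val[OF j order_refl] by simp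
    then show ?thesis using cm_at[OF j k] ak True Mjk j by (simp add: y_def)
   next
    case F: False
    have "M (j, n) \<noteq> r mod 2"
    proof
     assume e: "M (j, n) = r mod 2"
     have "M (j, k') = M (j0, k')" if "k' \<le> n" for k'
     proof (cases "k' < i")
      case False
      then have "M (j, k') = M (j, n)" "M (j0, k') = M (j0, n)" using row[of k' j] row[of k' j0] that j j0 by auto
      moreover have "M (j0, n) = r mod 2" using val[OF j0(1) order_refl] j0(2) by simp
      ultimately show ?thesis using e by simp
     next
      case True
      then show ?thesis by (rule col) (rule j)
     qed
     then have "?c j n = ?c j0 n" by (rule cnt_cong)
     then show False using F j0 by simp
    qed
    moreover have "(r - 1) mod 2 \<noteq> r mod 2" using r by (cases r) (auto simp: mod_Suc)
    moreover have "M (j, n) = 0 \<or> M (j, n) = 1" by (rule TT_val[OF MT j order_refl])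
    moreover have "(r - 1) mod 2 = 0 \<or> (r - 1) mod 2 = 1" "r mod 2 = 0 \<or> r mod 2 = 1" by auto
    ultimately have "M (j, n) = (r - 1) mod 2" by auto
    then show ?thesis using cm_at[OF j k] ak F Mjk j by (simp add: y_def)
   qed
  qed
 qed
 then show ?thesis using that y a by blast
qed

definition FT :: "'k sset => nat => nat => ((nat => nat) \<times> (nat \<times> nat => nat) \<times> 'k) set" where
 "FT K r n = {(s, M, k). s \<in> smp J n \<and> M \<in> T1 n \<and> k \<in> smp K n \<and> (s \<in> ends n \<or> M \<in> Tr r n)}"

text \<open>Matrices with exactly r alternations in some row are the
  \<open>cm r n y \<alpha>\<close> with y not constantly 0 and \<alpha> covering 1, ..., r, and they
  determine y and \<alpha>. So the step is a pushout of a \<open>box\<close> whose underlying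
  inclusion is that of A in the product of J, simplex r and K. The value 0 is not in the covering
  condition because a row may begin with 1.\<close>

lemma FT_step:
 fixes K :: "'k sset"
 assumes q: "nfib E Y q" and K: "ss K"
 shows "lft E Y q (res (cyl (sset_prod (res TT T1) K)) (FT K (Suc r'))) (FT K r')"
proof -
 define r where "r = Suc r'"
 have r: "0 < r" "r' = r - 1" by (auto simp: r_def)
 let ?D = "cyl (sset_prod (res TT T1) K)"
 let ?B = "cyl (sset_prod (simplex r) K)"
 define A where "A n = {(s, \<alpha>, k). s \<in> smp J n \<and> \<alpha> \<in> ops n r \<and> k \<in> smp K n \<and> (s \<in> ends n \<or> \<not> {1..r} \<subseteq> \<alpha> ` {..n})}" for n
 define \<chi> where "\<chi> n z = (fst (snd z), cm r n (fst z) (fst (snd (snd z))), snd (snd (snd z)))"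
  for n and z :: "(nat => nat) \<times> (nat => nat) \<times> (nat => nat) \<times> 'k"
 have B: "ss ?B" using K by (simp add: simplicial_set_simplex)
 have im: "compose {..m} \<alpha> \<beta> ` {..m} \<subseteq> \<alpha> ` {..n}" if "\<beta> \<in> ops m n" for m n \<alpha> \<beta>
  using that by (auto simp: compose_def ops_le)
 have A: "subc ?B A"
  unfolding subc_def
 proof (intro conjI allI ballI)
  fix m n \<beta> z assume b: "\<beta> \<in> ops m n" and z: "z \<in> A n"
  obtain s \<alpha> k where zz: "z = (s, \<alpha>, k)" by (cases z) auto
  have i: "s \<in> smp J n" "\<alpha> \<in> ops n r" "k \<in> smp K n" "s \<in> ends n \<or> \<not> {1..r} \<subseteq> \<alpha> ` {..n}" using z by (auto simp: zz A_def)
  have "\<not> {1..r} \<subseteq> compose {..m} \<alpha> \<beta> ` {..m}" if "\<not> {1..r} \<subseteq> \<alpha> ` {..n}"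
   using im[OF b, of \<alpha>] that by blast
  then show "act ?B m n \<beta> z \<in> A m"
   using i ss_act[OF K b i(3)] ss_act[OF ss_J b i(1)] ops_compose[OF b i(2)] subc_act[OF subc_ends b]
   by (auto simp: A_def simplex_simps zz)
 qed (auto simp: A_def simplex_simps)
 have FTs: "subc ?D (FT K i)" for i
  unfolding subc_def
 proof (intro conjI allI ballI)
  fix m n \<beta> z assume b: "\<beta> \<in> ops m n" and z: "z \<in> FT K i n"
  then show "act ?D m n \<beta> z \<in> FT K i m"
   using ss_act[OF K b] ss_act[OF ss_J b] subc_act[OF subc_ends b] subc_act[OF subc_T1 b] Tr_act[OF b]
   by (auto simp: FT_def)
 qed (auto simp: FT_def)
 have FTm: "FT K r' n \<subseteq> FT K r n" for n by (auto simp: FT_def Tr_def r_def)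
 have cT: "cm r n y \<alpha> \<in> Tr r n" if "\<alpha> \<in> ops n r" for n y \<alpha>
  using cm_T1[OF that] cm_cnt(1)[OF that] by (auto simp: Tr_def)
 have "lft E Y q (res ?D (FT K r)) (FT K r')"
 proof (rule lft_attach[where \<chi> = \<chi> and P = "cyl ?B" and ?P0.0 = "box ?B A"])
  show "ss (cyl ?B)" using B by simp
  show "lft E Y q (cyl ?B) (box ?B A)" by (rule box_lft[OF q B A])
  show "subc (cyl ?B) (box ?B A)" by (rule subc_box[OF B A])
  show "shom (cyl ?B) (res ?D (FT K r)) \<chi>"
   by (rule shomI) (use cT in "auto simp: \<chi>_def FT_def Tr_def simplex_simps cm_act")
  show "subc (res ?D (FT K r)) (FT K r')" by (rule subc_res[OF FTs FTs FTm])
  show "\<chi> n z \<in> FT K r' n" if z: "z \<in> box ?B A n" for n z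
  proof -
   obtain y s \<alpha> k where zz: "z = (y, s, \<alpha>, k)" by (cases z) auto
   then have i: "y \<in> smp J n" "s \<in> smp J n" "\<alpha> \<in> ops n r" "k \<in> smp K n" "s \<in> ends n \<or> \<not> {1..r} \<subseteq> \<alpha> ` {..n} \<or> y = zero n"
    using z by (auto simp: box_def A_def simplex_simps)
   have "cm r n y \<alpha> \<in> Tr r' n" if "s \<notin> ends n"
   proof -
    have "cnt (%k. cm r n y \<alpha> (j, k)) n \<le> r'" if j: "j \<le> n" for j
    proof (cases "y j = 0")
     case True then show ?thesis using cm_cnt(2)[OF i(3) j, of y] r by simp
    next
     case False
     then have "\<not> {1..r} \<subseteq> \<alpha> ` {..n}" using i(5) \<open>s \<notin> ends n\<close> j by auto
     then have "cnt (%k. cm r n y \<alpha> (j, k)) n \<noteq> r" using cm_cnt(3)[OF i(3) j, of y] False by blast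
     then show ?thesis using cm_cnt(1)[OF i(3) j, of y] r by linarith
    qed
    then show ?thesis using cm_T1[OF i(3)] by (simp add: Tr_def)
   qed
   then show ?thesis using i cm_T1[OF i(3)] by (auto simp: zz \<chi>_def FT_def)
  qed
  have off: "fst z \<in> smp J n \<and> fst (snd (snd z)) \<in> ops n r \<and> {1..r} \<subseteq> fst (snd (snd z)) ` {..n} \<and> fst (snd z) \<notin> ends n \<and>
     (\<exists>j\<le>n. fst z j \<noteq> 0)"
   if z: "z \<in> smp (cyl ?B) n" "z \<notin> box ?B A n" for z n
  proof -
   obtain y s \<alpha> k where zz: "z = (y, s, \<alpha>, k)" by (cases z) auto
   have 1: "y \<in> smp J n" "\<alpha> \<in> ops n r" "{1..r} \<subseteq> \<alpha> ` {..n}" "s \<notin> ends n" "y \<noteq> zero n"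
    using z by (auto simp: zz box_def A_def simplex_simps)
   have "\<exists>j\<le>n. y j \<noteq> 0" using J_eqI[OF 1(1) zero_J] 1(5) by auto
   then show ?thesis using 1 by (simp add: zz)
  qed
  show "z = z'" if z: "z \<in> smp (cyl ?B) n" "z \<notin> box ?B A n" "z' \<in> smp (cyl ?B) n" "z' \<notin> box ?B A n" "\<chi> n z = \<chi> n z'" for n z z'
  proof -
   obtain y s \<alpha> k where zz: "z = (y, s, \<alpha>, k)" by (cases z) auto
   obtain y' s' \<alpha>' k' where zz': "z' = (y', s', \<alpha>', k')" by (cases z') auto
   note o = off[OF z(1,2), unfolded zz, simplified] and o' = off[OF z(3,4), unfolded zz', simplified]
   have e: "s = s'" "k = k'" "cm r n y \<alpha> = cm r n y' \<alpha>'" using z(5) by (auto simp: zz zz' \<chi>_def)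
   have yy: "y j = 0 \<longleftrightarrow> cnt (%k. cm r n y \<alpha> (j, k)) n \<noteq> r" if j: "j \<le> n" and 1: "\<alpha> \<in> ops n r" "{1..r} \<subseteq> \<alpha> ` {..n}" for y j \<alpha>
   proof (cases "y j = 0")
    case False
    have "\<alpha> n = r"
    proof -
     have "r \<in> \<alpha> ` {..n}" using 1 r by auto
     then obtain i where "i \<le> n" "\<alpha> i = r" by auto
     then show ?thesis using ops_mono[OF 1(1), of i n] ops_le[OF 1(1), of n] by simp
    qed
    then show ?thesis using cm_cnt(4)[OF 1(1) j, of y n] 1 False by simp
   next
    case True
    then show ?thesis using cm_cnt(2)[OF 1(1) j, of y] r(1) by simp
   qed
   have "y = y'"
   proof (rule J_eqI)
    fix j assume j: "j \<le> n"
    have "y j = 0 \<longleftrightarrow> y' j = 0" using yy[OF j, of \<alpha> y] yy[OF j, of \<alpha>' y'] o o' e(3) by simp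
    then show "y j = y' j" using J_cases[of y n j] J_cases[of y' n j] o o' j by auto
   qed (use o o' in auto)
   obtain j where j: "j \<le> n" "y j \<noteq> 0" using o by auto
   have "\<alpha> = \<alpha>'"
   proof (rule ops_eqI)
    show "\<alpha> \<in> ops n r" "\<alpha>' \<in> ops n r" using o o' by auto
    fix i assume "i \<le> n"
    then show "\<alpha> i = \<alpha>' i" using cm_cnt(4)[of \<alpha> n r j y i] cm_cnt(4)[of \<alpha>' n r j y' i] j o o' e(3) \<open>y = y'\<close> by simp
   qed
   then show ?thesis using e \<open>y = y'\<close> by (simp add: zz zz')
  qed
  show "\<chi> n z \<notin> FT K r' n" if z: "z \<in> smp (cyl ?B) n" "z \<notin> box ?B A n" for n z
  proof
   obtain y s \<alpha> k where zz: "z = (y, s, \<alpha>, k)" by (cases z) auto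
   note o = off[OF z, unfolded zz, simplified]
   assume "\<chi> n z \<in> FT K r' n"
   then have "cm r n y \<alpha> \<in> Tr r' n" using o by (auto simp: zz \<chi>_def FT_def)
   obtain j where j: "j \<le> n" "y j \<noteq> 0" using o by auto
   have "r \<in> \<alpha> ` {..n}" using o r by auto
   then obtain i where "i \<le> n" "\<alpha> i = r" by auto
   then have "cnt (%k. cm r n y \<alpha> (j, k)) n \<ge> r"
    using cm_cnt(4)[of \<alpha> n r j y i] cnt_mono[of i n "%k. cm r n y \<alpha> (j, k)"] j o by simp
   then show False using \<open>cm r n y \<alpha> \<in> Tr r' n\<close> j r by (auto simp: Tr_def)
  qed
  show "x \<in> FT K r' n \<or> x \<in> \<chi> n ` smp (cyl ?B) n" if x: "x \<in> smp (res ?D (FT K r)) n" for n x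
  proof (cases "x \<in> FT K r' n")
   case False
   obtain s M k where xx: "x = (s, M, k)" by (cases x) auto
   have M: "M \<in> Tr r n" "M \<notin> Tr r' n" "s \<in> smp J n" "k \<in> smp K n" using x False by (auto simp: xx FT_def)
   then obtain j where "j \<le> n" "\<not> cnt (%k. M (j, k)) n \<le> r'" by (auto simp: Tr_def)
   moreover from this have "cnt (%k. M (j, k)) n = r" using M(1) r by (force simp: Tr_def)
   ultimately obtain y \<alpha> where "y \<in> smp J n" "\<alpha> \<in> ops n r" "M = cm r n y \<alpha>" using cm_cover[OF M(1) _ _ r(1)] by metis
   then have "x = \<chi> n (y, s, \<alpha>, k)" "(y, s, \<alpha>, k) \<in> smp (cyl ?B) n" using M by (auto simp: xx \<chi>_def simplex_simps)
   then show ?thesis by blast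
  qed auto
 qed
 then show ?thesis by (simp add: r_def)
qed

text \<open>Multiplication of row j by s j contracts all matrices to the zero matrix. It does not
  preserve \<open>T1\<close>, since columns that were constant become proportional to s.\<close>

definition hT :: "nat => (nat => nat) \<times> (nat \<times> nat => nat) => nat \<times> nat => nat" where
 "hT n z = restrict (%p. fst z (fst p) * snd z p) ({..n} \<times> {..n})"

lemma shom_hT: "shom (cyl TT) TT hT"
proof (rule shomI)
 fix n z assume "z \<in> smp (cyl TT) n"
 then show "hT n z \<in> smp TT n"
  unfolding hT_def using J_cases[of "fst z" n] TT_val[of "snd z" n] by (intro TT_intro) fastforce
next
 fix m n \<alpha> z assume "\<alpha> \<in> ops m n"
 then show "hT m (act (cyl TT) m n \<alpha> z) = act TT m n \<alpha> (hT n z)"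
  by (auto simp: hT_def TT_def fun_eq_iff J_act_at ops_le)
qed

definition zm :: "nat => nat \<times> nat => nat" where
 "zm n = restrict (%p. 0) ({..n} \<times> {..n})"

lemma zm: "zm n \<in> smp TT n" "zm n \<in> T1 n" "\<alpha> \<in> ops m n ==> act TT m n \<alpha> (zm n) = zm m" "thr n (zm n) 0"
proof -
 show a: "zm n \<in> smp TT n" by (auto simp: zm_def TT_def)
 show t: "thr n (zm n) 0" by (auto simp: zm_def thr_def)
 show "zm n \<in> T1 n" using a t by (auto simp: T1_def)
qed (auto simp: zm_def TT_def fun_eq_iff ops_le)

lemma Tr0: "M \<in> Tr 0 n ==> M = zm n"
proof (rule TT_eqI[OF _ zm(1)])
 assume M: "M \<in> Tr 0 n"
 then show MT: "M \<in> smp TT n" by (auto simp: Tr_def T1_def)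
 fix j k assume j: "j \<le> n" and k: "k \<le> n"
 have "cnt (%k. M (j, k)) k \<le> 0" using M j cnt_mono[OF k, of "%k. M (j, k)"] by (auto simp: Tr_def)
 moreover have "cnt (%k. M (j, k)) k mod 2 = M (j, k)" by (rule cnt_mod) (use TT_val[OF MT j] k in auto)
 ultimately show "M (j, k) = zm n (j, k)" using j k by (simp add: zm_def)
qed

lemma hT_simps: "M \<in> smp TT n ==> hT n (one n, M) = M" "hT n (zero n, M) = zm n" "hT n (s, zm n) = zm n"
 by (auto simp: hT_def zm_def fun_eq_iff TT_def PiE_iff extensional_def)

text \<open>As \<open>hT\<close> leaves \<open>T1\<close>, \<open>lft_deformation\<close> does not
  apply to it. Instead a path of lifts over \<open>hT\<close> is built on \<open>T1\<close>: it is g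
  at time 1, the value of g at the zero matrix at time 0, and extends through the filtration
  \<open>FT\<close>. A box filling extends this path to all matrices, and time 1 is the
  lift.\<close>

lemma lft_T1:
 assumes q: "nfib E Y q" and K: "ss K"
 shows "lft E Y q (sset_prod TT K) (%n. T1 n \<times> smp K n)"
proof (rule lftI)
 fix g w assume g: "shom (res (sset_prod TT K) (%n. T1 n \<times> smp K n)) E g" and w: "shom (sset_prod TT K) Y w"
  and gw: "!!n x. x \<in> T1 n \<times> smp K n ==> q n (g n x) = w n x"
 let ?D = "cyl (sset_prod (res TT T1) K)"
 have T1s: "x \<in> smp TT n" if "x \<in> T1 n" for x n using subc_sub[OF subc_T1 that] .
 have FTs: "subc ?D (FT K i)" for i
  unfolding subc_def
 proof (intro conjI allI ballI)
  fix m n \<beta> z assume b: "\<beta> \<in> ops m n" and z: "z \<in> FT K i n"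
  then show "act ?D m n \<beta> z \<in> FT K i m"
   using ss_act[OF K b] ss_act[OF ss_J b] subc_act[OF subc_ends b] subc_act[OF subc_T1 b] Tr_act[OF b]
   by (auto simp: FT_def)
 qed (auto simp: FT_def)
 have l: "lft E Y q ?D (FT K 0)"
 proof (rule lft_omega[where C = "FT K"])
  show "lft E Y q (res ?D (FT K (Suc r))) (FT K r)" for r by (rule FT_step[OF q K])
  show "subc ?D (FT K r)" for r by (rule FTs)
  show "FT K r n \<subseteq> FT K (Suc r) n" for r n by (auto simp: FT_def Tr_def)
  fix n x assume x: "x \<in> smp ?D n"
  obtain s M k where xx: "x = (s, M, k)" by (cases x) auto
  let ?R = "Max ((%j. cnt (%k. M (j, k)) n) ` {..n})"
  have "M \<in> Tr ?R n" using x by (auto simp: xx Tr_def)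
  then show "\<exists>r. x \<in> FT K r n" using x by (auto simp: xx FT_def)
 qed
 have w1: "shom (cyl (sset_prod TT K)) Y (%n z. w n (hT n (fst z, fst (snd z)), snd (snd z)))"
 proof (rule shom_comp[OF _ w], rule shom_pair)
  show "shom (cyl (sset_prod TT K)) TT (%n x. hT n (fst x, fst (snd x)))"
   by (rule shom_comp[OF _ shom_hT]) (auto simp: shom_def)
 qed (auto simp: shom_def)
 have w2: "shom ?D Y (%n z. w n (hT n (fst z, fst (snd z)), snd (snd z)))"
  using w1 T1s by (auto simp: shom_def)
 define g1 where "g1 n z = (if fst z = one n then g n (fst (snd z), snd (snd z)) else g n (zm n, snd (snd z)))"
  for n and z :: "(nat => nat) \<times> (nat \<times> nat => nat) \<times> 'c"
 have FT0: "s = one n \<or> s = zero n \<or> M = zm n" if "(s, M, k) \<in> FT K 0 n" for s M k n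
  using that Tr0 by (auto simp: FT_def ends_def)
 have g1: "shom (res ?D (FT K 0)) E g1"
 proof (rule shomI)
  fix m n \<alpha> z assume a: "\<alpha> \<in> ops m n" and z: "z \<in> smp (res ?D (FT K 0)) n"
  obtain s M k where zz: "z = (s, M, k)" by (cases z) auto
  have i: "M \<in> T1 n" "k \<in> smp K n" "s = one n \<or> s = zero n \<or> M = zm n" using z FT0[of s M k n] by (auto simp: zz FT_def)
  then show "g1 m (act (res ?D (FT K 0)) m n \<alpha> z) = act E m n \<alpha> (g1 n z)"
   using shom_act[OF g a, of "(M, k)"] shom_act[OF g a, of "(zm n, k)"] zm a by (auto simp: zz g1_def)
 next
  fix n z assume "z \<in> smp (res ?D (FT K 0)) n"
  then show "g1 n z \<in> smp E n" using shom_in[OF g] zm(2) by (auto simp: FT_def g1_def)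
 qed
 have qg1: "q n (g1 n z) = w n (hT n (fst z, fst (snd z)), snd (snd z))" if z: "z \<in> FT K 0 n" for n z
 proof -
  obtain s M k where zz: "z = (s, M, k)" by (cases z) auto
  have "M \<in> T1 n" "k \<in> smp K n" "s = one n \<or> s = zero n \<or> M = zm n" using z FT0[of s M k n] by (auto simp: zz FT_def)
  then show ?thesis using gw zm(2) T1s by (auto simp: zz g1_def hT_simps)
 qed
 obtain G where G: "shom ?D E G" "!!n z. z \<in> smp ?D n ==> q n (G n z) = w n (hT n (fst z, fst (snd z)), snd (snd z))"
  "!!n z. z \<in> FT K 0 n ==> G n z = g1 n z"
  using lft_ex[OF l g1 w2 qg1] by blast
 have z0: "shom (sset_prod TT K) E (%n z. g n (zm n, snd z))"
 proof (rule shomI)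
  fix m n \<alpha> z assume a: "\<alpha> \<in> ops m n" and z: "z \<in> smp (sset_prod TT K) n"
  then show "g m (zm m, snd (act (sset_prod TT K) m n \<alpha> z)) = act E m n \<alpha> (g n (zm n, snd z))"
   using shom_act[OF g a, of "(zm n, snd z)"] zm(2,3) by auto
 next
  fix n z assume "z \<in> smp (sset_prod TT K) n"
  then show "g n (zm n, snd z) \<in> smp E n" using shom_in[OF g] zm(2) by auto
 qed
 have sub: "subc (sset_prod TT K) (%n. T1 n \<times> smp K n)" by (rule subc_prod1[OF subc_T1 K])
 have G': "shom (cyl (res (sset_prod TT K) (%n. T1 n \<times> smp K n))) E G"
  using G(1) by (auto simp: shom_def)
 obtain h where h: "shom (cyl (sset_prod TT K)) E h"
  "!!n t x. t \<in> smp J n ==> x \<in> smp (sset_prod TT K) n ==> q n (h n (t, x)) = w n (hT n (t, fst x), snd x)"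
  "!!n t x. t \<in> smp J n ==> x \<in> T1 n \<times> smp K n ==> h n (t, x) = G n (t, x)"
 proof (rule box_use[OF q _ sub w1 G' z0])
  show "ss (sset_prod TT K)" using ss_TT K by simp
  fix n x assume "x \<in> T1 n \<times> smp K n"
  then show "G n (zero n, x) = g n (zm n, snd x)" using G(3)[of "(zero n, x)" n] by (auto simp: FT_def ends_def g1_def)
 qed (use G(2) gw zm(2) in "auto simp: hT_simps")
 have o: "shom (sset_prod TT K) (cyl (sset_prod TT K)) (%n x. (one n, x))" by (auto simp: shom_def)
 show "\<exists>h. shom (sset_prod TT K) E h \<and> (\<forall>n. \<forall>x\<in>smp (sset_prod TT K) n. q n (h n x) = w n x) \<and> (\<forall>n. \<forall>x\<in>T1 n \<times> smp K n. h n x = g n x)"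
 proof (intro exI conjI allI ballI)
  show "shom (sset_prod TT K) E (%n x. h n (one n, x))" using shom_comp[OF o h(1)] .
  show "q n (h n (one n, x)) = w n x" if "x \<in> smp (sset_prod TT K) n" for n x
   using h(2)[OF one_J that] that by (auto simp: hT_simps)
  show "h n (one n, x) = g n x" if "x \<in> T1 n \<times> smp K n" for n x
   using h(3)[OF one_J that] G(3)[of "(one n, x)" n] that by (auto simp: FT_def ends_def g1_def)
 qed
qed

definition tmat :: "nat => (nat => nat) \<times> (nat => nat) => nat \<times> nat => nat" where
 "tmat n z = restrict (%p. snd z (fst p) * fst z (snd p)) ({..n} \<times> {..n})"

lemma shom_tmat: "shom (cyl J) TT tmat"
proof (rule shomI)
 fix n z assume "z \<in> smp (cyl J) n"
 then show "tmat n z \<in> smp TT n"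
  unfolding tmat_def using J_cases[of "fst z" n] J_cases[of "snd z" n] by (intro TT_intro) fastforce
next
 fix m n \<alpha> z assume "\<alpha> \<in> ops m n"
 then show "tmat m (act (cyl J) m n \<alpha> z) = act TT m n \<alpha> (tmat n z)"
  by (auto simp: tmat_def TT_def fun_eq_iff J_act_at ops_le)
qed

text \<open>The four sides of the square under outer products. One of them reads as the path itself,
  the other three read as constantly 0, with thresholds at either extreme.\<close>

lemma tmat_thr:
 assumes "x \<in> smp J n"
 shows "thr n (tmat n (one n, x)) 0" "mu n (tmat n (one n, x)) 0 = x"
  "thr n (tmat n (zero n, x)) 0" "mu n (tmat n (zero n, x)) 0 = zero n"
  "thr n (tmat n (x, zero n)) 0" "mu n (tmat n (x, zero n)) 0 = zero n"
  "thr n (tmat n (x, one n)) (Suc n)" "mu n (tmat n (x, one n)) (Suc n) = zero n"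
 using assms by (auto simp: thr_def tmat_def mu_def fun_eq_iff J_simps PiE_iff extensional_def zero_def)

text \<open>The extension of \<open>Psi c\<close> to all matrices, restricted to outer products, is
  a square with c on one side and y0 on the three others.\<close>

lemma null_homotopy:
 assumes q: "nfib E Y q" and K: "ss K"
  and c: "shom (cyl K) E c" and y0: "\<forall>n. \<forall>t\<in>mon n. \<forall>k\<in>smp K n. c n (t, k) = y0 n k"
  and w: "shom (sset_prod TT K) Y w" and cw: "!!n z. z \<in> T1 n \<times> smp K n ==> q n (Psi c n z) = w n z"
 obtains h where "shom (sset_prod TT K) E h" "!!n z. z \<in> smp (sset_prod TT K) n ==> q n (h n z) = w n z"
   "!!n z. z \<in> T1 n \<times> smp K n ==> h n z = Psi c n z"
   "!!n t k. t \<in> smp J n ==> k \<in> smp K n ==> h n (tmat n (one n, t), k) = c n (t, k)"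
   "!!n t k. t \<in> smp J n ==> k \<in> smp K n ==> h n (tmat n (zero n, t), k) = y0 n k"
   "!!n t e k. t \<in> smp J n ==> e \<in> ends n ==> k \<in> smp K n ==> h n (tmat n (t, e), k) = y0 n k"
proof -
 have P: "shom (res (sset_prod TT K) (%n. T1 n \<times> smp K n)) E (Psi c)"
  using shom_Psi[OF y0 c K] by (auto simp: shom_def)
 obtain h where h: "shom (sset_prod TT K) E h" "!!n z. z \<in> smp (sset_prod TT K) n ==> q n (h n z) = w n z"
   "!!n z. z \<in> T1 n \<times> smp K n ==> h n z = Psi c n z"
  using lft_ex[OF lft_T1[OF q K] P w cw] by blast
 have tT: "tmat n (x, y) \<in> smp TT n" if "x \<in> smp J n" "y \<in> smp J n" for x y n
  using shom_in[OF shom_tmat, of "(x,y)" n] that by simp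
 have key: "h n (tmat n (x, y), k) = c n (mu n (tmat n (x, y)) i, k)"
  if "x \<in> smp J n" "y \<in> smp J n" "k \<in> smp K n" "thr n (tmat n (x, y)) i" for x y n k i
  using h(3)[of "(tmat n (x, y), k)" n] Psi_eq[OF y0 tT[OF that(1,2)] that(3,4)] that tT[OF that(1,2)] by (auto simp: T1_def)
 have zmon: "zero n \<in> mon n" for n by (auto simp: mon_def)
 show ?thesis
 proof (rule that[OF h])
  show "h n (tmat n (one n, t), k) = c n (t, k)" if "t \<in> smp J n" "k \<in> smp K n" for n t k
   using key[OF one_J that tmat_thr(1)[OF that(1)]] tmat_thr(2)[OF that(1)] by simp
  show "h n (tmat n (zero n, t), k) = y0 n k" if "t \<in> smp J n" "k \<in> smp K n" for n t k
   using key[OF zero_J that tmat_thr(3)[OF that(1)]] tmat_thr(4)[OF that(1)] y0 zmon that(2) by simp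
  show "h n (tmat n (t, e), k) = y0 n k" if "t \<in> smp J n" "e \<in> ends n" "k \<in> smp K n" for n t e k
   using key[OF that(1) zero_J that(3) tmat_thr(5)[OF that(1)]] key[OF that(1) one_J that(3) tmat_thr(7)[OF that(1)]]
    tmat_thr(6,8)[OF that(1)] y0 zmon that(2,3) by (auto simp: ends_def)
 qed
qed

text \<open>
 A map J x K \<rightarrow> E over w is determined by its restriction to monotone simplices up to homotopy relative to the ends.
 Composing with the inverse of p1 gives a path that is constant on monotone simplices.
\<close>

lemma path_transport:
 fixes K :: "'k sset" and E :: "'e sset" and Y :: "'y sset"
 assumes q: "nfib E Y q" and Y: "jfib Y" and K: "ss K" and K0: "subc K K0"
  and w: "shom (cyl K) Y w" and p1: "shom (cyl K) E p1" and p2: "shom (cyl (res K K0)) E p2"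
  and w1: "!!n t k. t \<in> mon n ==> k \<in> smp K n ==> q n (p1 n (t, k)) = w n (t, k)"
  and p2w: "!!n t k. t \<in> smp J n ==> k \<in> K0 n ==> q n (p2 n (t, k)) = w n (t, k)"
  and p21: "!!n t k. t \<in> mon n ==> k \<in> K0 n ==> p2 n (t, k) = p1 n (t, k)"
 obtains p where "shom (cyl K) E p" "!!n t k. t \<in> smp J n ==> k \<in> smp K n ==> q n (p n (t, k)) = w n (t, k)"
  "!!n t k. t \<in> smp J n ==> k \<in> K0 n ==> p n (t, k) = p2 n (t, k)"
  "!!n t k. t \<in> ends n ==> k \<in> smp K n ==> p n (t, k) = p1 n (t, k)"
proof -
 have qE: "shom E Y q" using nfib_ss(3)[OF q] .
 have monJ: "t \<in> smp J n" if "t \<in> mon n" for t n using that by (auto simp: mon_def)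
 have K0s: "k \<in> smp K n" if "k \<in> K0 n" for k n using subc_sub[OF K0 that] .
 let ?KA = "res K K0"
 have KK: "ss ?KA" by (rule ss_res[OF K K0])
 let ?JK = "cyl K" and ?JJK = "cyl (cyl K)"
 let ?JA = "cyl ?KA" and ?JJA = "cyl (cyl ?KA)"
 have JK: "ss ?JK" "ss ?JA" using K KK by auto
 have p1z: "shom ?JK E (%n z. p1 n (zero n, snd z))"
  by (rule shom_comp[OF _ p1, of _ "%n z. (zero n, snd z)"]) (auto simp: shom_def)
 \<comment> \<open>At outer time 0 this is the whole path, at time 1 only its start. On
   nondecreasing simplices it prescribes how w and p2 get composed with the inverse of p1; the paths
   \<open>cY\<close> and \<open>cE\<close> reached at time 1 are constant there.\<close>
 define a where "a n z = (jand n (fst (snd z)) (jnot n (fst z)), snd (snd z))"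
  for n and z :: "(nat => nat) \<times> (nat => nat) \<times> 'k"
 define b where "b n z = (jand n (fst (snd z)) (fst z), snd (snd z))"
  for n and z :: "(nat => nat) \<times> (nat => nat) \<times> 'k"
 have a: "shom ?JJK ?JK a" by (auto simp: shom_def a_def jand_act jnot_act)
 have b: "shom ?JJK ?JK b" by (auto simp: shom_def b_def jand_act)
 have p1a: "shom ?JJK E (%n z. p1 n (a n z))" by (rule shom_comp[OF a p1])
 have qp1a: "shom ?JJK Y (%n z. q n (p1 n (a n z)))" by (rule shom_comp[OF p1a qE])
 have mK: "subc ?JK (%n. mon n \<times> smp K n)" "subc ?JA (%n. mon n \<times> smp ?KA n)"
  by (rule subc_prod1[OF subc_mon K], rule subc_prod1[OF subc_mon KK])
 have to0: "shom ?JJA X f" if "shom ?JJK X f" for X :: "'x sset" and f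
  using that by (auto simp: shom_def K0s)
 have to0': "shom ?JA X f" if "shom ?JK X f" for X :: "'x sset" and f
  using that by (auto simp: shom_def K0s)
 have cut: "shom (cyl (res ?JK (%n. S n \<times> smp K n))) X f" if "shom ?JJK X f" "!!n t. t \<in> S n ==> t \<in> smp J n" for X :: "'x sset" and f S
  using that by (auto simp: shom_def)
 have cut0: "shom (cyl (res ?JA (%n. mon n \<times> smp ?KA n))) X f" if "shom ?JJA X f" for X :: "'x sset" and f
  using that monJ by (auto simp: shom_def)
 obtain GY where GY: "shom ?JJK Y GY"
  "!!n s z. s \<in> smp J n ==> z \<in> mon n \<times> smp K n ==> GY n (s, z) = q n (p1 n (a n (s, z)))"
  "!!n z. z \<in> smp ?JK n ==> GY n (zero n, z) = w n z"
 proof (rule box_use[OF Y[unfolded jfib_def] JK(1) mK(1) shom_pt cut[OF qp1a monJ] w])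
  fix n z assume z: "z \<in> mon n \<times> smp K n"
  then show "q n (p1 n (a n (zero n, z))) = w n z" using w1 monJ by (auto simp: a_def)
 qed auto
 have GY1: "GY n (s, t, k) = q n (p1 n (a n (s, t, k)))" if "s \<in> smp J n" "t \<in> mon n" "k \<in> smp K n" for n s t k
  using GY(2)[OF that(1), of "(t, k)"] that by simp
 obtain GE where GE: "shom ?JJA E GE"
  "!!n s z. s \<in> smp J n ==> z \<in> smp ?JA n ==> q n (GE n (s, z)) = GY n (s, z)"
  "!!n s z. s \<in> smp J n ==> z \<in> mon n \<times> smp ?KA n ==> GE n (s, z) = p1 n (a n (s, z))"
  "!!n z. z \<in> smp ?JA n ==> GE n (zero n, z) = p2 n z"
 proof (rule box_use[OF q JK(2) mK(2) to0[OF GY(1)] cut0[OF to0[OF p1a]] p2])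
  fix n z assume z: "z \<in> mon n \<times> smp ?KA n"
  then show "p1 n (a n (zero n, z)) = p2 n z" using p21 monJ by (auto simp: a_def)
 next
  fix n t z assume "t \<in> smp J n" "z \<in> mon n \<times> smp ?KA n"
  then show "q n (p1 n (a n (t, z))) = GY n (t, z)" using GY1 K0s by auto
 next
  fix n z assume "z \<in> smp ?JA n"
  then show "q n (p2 n z) = GY n (zero n, z)" using GY(3)[of z n] p2w K0s by auto
 qed auto
 have GE1: "GE n (s, t, k) = p1 n (a n (s, t, k))" if "s \<in> smp J n" "t \<in> mon n" "k \<in> K0 n" for n s t k
  using GE(3)[OF that(1), of "(t, k)"] that by simp
 have o: "shom ?JK ?JJK (%n z. (one n, z))" "shom ?JA ?JJA (%n z. (one n, z))" by (auto simp: shom_def)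
 define cY where "cY n z = GY n (one n, z)" for n z
 define cE where "cE n z = GE n (one n, z)" for n z
 have cY: "shom ?JK Y cY" unfolding cY_def by (rule shom_comp[OF o(1) GY(1)])
 have cE: "shom ?JA E cE" unfolding cE_def by (rule shom_comp[OF o(2) GE(1)])
 have a1: "a n (one n, t, k) = (zero n, k)" for n t k by (simp add: a_def)
 have cY0: "\<forall>n. \<forall>t\<in>mon n. \<forall>k\<in>smp K n. cY n (t, k) = q n (p1 n (zero n, k))"
  using GY1[OF one_J] by (simp add: cY_def a1)
 have cE0: "\<forall>n. \<forall>t\<in>mon n. \<forall>k\<in>smp ?KA n. cE n (t, k) = p1 n (zero n, k)"
  using GE1[OF one_J] by (simp add: cE_def a1)
 let ?TK = "sset_prod TT K" and ?TA = "sset_prod TT ?KA"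
 \<comment> \<open>The composed path in the base and its lift over K0 are both contracted, the
   second over the first, so that the contractions fit together.\<close>
 obtain hY where hY: "shom ?TK Y hY" "!!n z. z \<in> T1 n \<times> smp K n ==> hY n z = Psi cY n z"
   "!!n t k. t \<in> smp J n ==> k \<in> smp K n ==> hY n (tmat n (one n, t), k) = cY n (t, k)"
   "!!n t k. t \<in> smp J n ==> k \<in> smp K n ==> hY n (tmat n (zero n, t), k) = q n (p1 n (zero n, k))"
   "!!n t e k. t \<in> smp J n ==> e \<in> ends n ==> k \<in> smp K n ==> hY n (tmat n (t, e), k) = q n (p1 n (zero n, k))"
  by (rule null_homotopy[OF Y[unfolded jfib_def] K cY cY0 shom_pt]) auto
 have hY0: "shom ?TA Y hY" using hY(1) K0s by (auto simp: shom_def)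
 have PsiE: "q n (Psi cE n z) = hY n z" if z: "z \<in> T1 n \<times> smp ?KA n" for n z
 proof -
  have "q n (Psi cE n z) = Psi cY n z"
   using GE(2)[OF one_J] z mu_J by (auto simp: Psi_def cE_def cY_def T1_def)
  then show ?thesis using hY(2)[of z n] z K0s by auto
 qed
 obtain hE where hE: "shom ?TA E hE" "!!n z. z \<in> smp ?TA n ==> q n (hE n z) = hY n z"
   "!!n z. z \<in> T1 n \<times> smp ?KA n ==> hE n z = Psi cE n z"
   "!!n t k. t \<in> smp J n ==> k \<in> smp ?KA n ==> hE n (tmat n (one n, t), k) = cE n (t, k)"
   "!!n t k. t \<in> smp J n ==> k \<in> smp ?KA n ==> hE n (tmat n (zero n, t), k) = p1 n (zero n, k)"
   "!!n t e k. t \<in> smp J n ==> e \<in> ends n ==> k \<in> smp ?KA n ==> hE n (tmat n (t, e), k) = p1 n (zero n, k)"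
  by (rule null_homotopy[OF q KK cE cE0 hY0 PsiE]) auto
 define th where "th n z = (tmat n (fst z, fst (snd z)), snd (snd z))" for n and z :: "(nat => nat) \<times> (nat => nat) \<times> 'k"
 have ff: "shom ?JJK (cyl J) (%n z. (fst z, fst (snd z)))" "shom ?JJA (cyl J) (%n z. (fst z, fst (snd z)))"
  by (auto simp: shom_def)
 note tm = shom_comp[OF ff(1) shom_tmat] shom_comp[OF ff(2) shom_tmat]
 have th1: "shom ?JJK ?TK th" unfolding th_def by (rule shom_pair[OF tm(1)]) (auto simp: shom_def)
 have th2: "shom ?JJA ?TA th" unfolding th_def by (rule shom_pair[OF tm(2)]) (auto simp: shom_def)
 note th = th1 th2
 have tT: "tmat n (x, y) \<in> smp TT n" if "x \<in> smp J n" "y \<in> smp J n" for x y n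
  using shom_in[OF shom_tmat, of "(x,y)" n] that by simp
 have sK0: "subc ?JK (%n. smp J n \<times> K0 n)" by (rule subc_prod2[OF K0 ss_J])
 have seK: "subc ?JK (%n. ends n \<times> smp K n)" by (rule subc_prod1[OF subc_ends K])
 have fr0: "shom (cyl (res ?JK (%n. smp J n \<times> K0 n))) X f" if "shom ?JJA X f" for X :: "'x sset" and f
  using that by (auto simp: shom_def)
 have p1z3: "shom ?JJK E (%n z. p1 n (zero n, snd (snd z)))"
  by (rule shom_comp[OF shom_snd p1z])
 \<comment> \<open>Lifts the contraction to all of K, starting from the constant path. At time 1
   this is a path over \<open>cY\<close> that agrees with \<open>cE\<close> on K0 and has constant
   ends.\<close>
 obtain H where H: "shom ?JJK E H"
  "!!n u z. u \<in> smp J n ==> z \<in> smp ?JK n ==> q n (H n (u, z)) = hY n (th n (u, z))"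
  "!!n u z. u \<in> smp J n ==> z \<in> smp J n \<times> K0 n ==> H n (u, z) = hE n (th n (u, z))"
  "!!n u z. u \<in> smp J n ==> z \<in> ends n \<times> smp K n ==> H n (u, z) = p1 n (zero n, snd z)"
 proof (rule box_use2[OF q JK(1) sK0 seK shom_comp[OF th(1) hY(1)] fr0[OF shom_comp[OF th(2) hE(1)]] cut[OF p1z3 ends_J] p1z])
 qed (use hE hY K0s ends_J tT in "auto simp: th_def")
 define ct where "ct n z = H n (one n, z)" for n z
 have ct: "shom ?JK E ct" unfolding ct_def by (rule shom_comp[OF o(1) H(1)])
 have qct: "q n (ct n (t, k)) = GY n (one n, t, k)" if "t \<in> smp J n" "k \<in> smp K n" for n t k
  using H(2)[OF one_J, of "(t,k)" n] hY(3)[OF that] that by (simp add: ct_def th_def cY_def)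
 have ctK0: "ct n (t, k) = GE n (one n, t, k)" if "t \<in> smp J n" "k \<in> K0 n" for n t k
  using H(3)[OF one_J, of "(t,k)" n] hE(4)[OF that(1)] that by (simp add: ct_def th_def cE_def)
 have cte: "ct n (t, k) = p1 n (zero n, k)" if "t \<in> ends n" "k \<in> smp K n" for n t k
  using H(4)[OF one_J, of "(t,k)" n] that by (simp add: ct_def)
 have fl: "shom ?JJK ?JJK (%n z. (jnot n (fst z), snd z))" "shom ?JJA ?JJA (%n z. (jnot n (fst z), snd z))"
  by (auto simp: shom_def jnot_act)
 \<comment> \<open>Undoes the composition: time is reversed, so the homotopy leads from
   \<open>ct\<close> to a path over w. The ends follow p1 forward through b, which restores the ends
   of p1.\<close>
 obtain P where P: "shom ?JJK E P"
  "!!n s z. s \<in> smp J n ==> z \<in> smp ?JK n ==> q n (P n (s, z)) = GY n (jnot n s, z)"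
  "!!n s z. s \<in> smp J n ==> z \<in> smp J n \<times> K0 n ==> P n (s, z) = GE n (jnot n s, z)"
  "!!n s z. s \<in> smp J n ==> z \<in> ends n \<times> smp K n ==> P n (s, z) = p1 n (b n (s, z))"
 proof (rule box_use2[OF q JK(1) sK0 seK shom_comp[OF fl(1) GY(1)] fr0[OF shom_comp[OF fl(2) GE(1)]] cut[OF shom_comp[OF b p1] ends_J] ct])
  fix n t z assume t: "t \<in> smp J n" and z: "z \<in> smp J n \<times> K0 n" "z \<in> ends n \<times> smp K n"
  then show "GE n (jnot n (fst (t, z)), snd (t, z)) = p1 n (b n (t, z))"
   using GE1[of "jnot n t" n "fst z" "snd z"] ends_mon by (auto simp: a_def b_def)
 next
  fix n z assume "z \<in> smp J n \<times> K0 n"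
  then show "GE n (jnot n (fst (zero n, z)), snd (zero n, z)) = ct n z" using ctK0 by auto
 next
  fix n z assume "z \<in> ends n \<times> smp K n"
  then show "p1 n (b n (zero n, z)) = ct n z" using cte by (auto simp: b_def)
 next
  fix n t z assume "t \<in> smp J n" "z \<in> smp J n \<times> K0 n"
  then show "q n (GE n (jnot n (fst (t, z)), snd (t, z))) = GY n (jnot n (fst (t, z)), snd (t, z))"
   using GE(2)[of "jnot n t" n z] by auto
 next
  fix n t z assume "t \<in> smp J n" "z \<in> ends n \<times> smp K n"
  then show "q n (p1 n (b n (t, z))) = GY n (jnot n (fst (t, z)), snd (t, z))"
   using GY1[of "jnot n t" n "fst z" "snd z"] ends_mon by (auto simp: a_def b_def)
 next
  fix n z assume "z \<in> smp ?JK n"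
  then show "q n (ct n z) = GY n (jnot n (fst (zero n, z)), snd (zero n, z))" using qct by auto
 qed auto
 show ?thesis
 proof (rule that[OF shom_comp[OF o(1) P(1)]])
  fix n t k assume t: "t \<in> smp J n"
  show "q n (P n (one n, t, k)) = w n (t, k)" if "k \<in> smp K n"
   using P(2)[OF one_J, of "(t,k)" n] GY(3)[of "(t,k)" n] t that by simp
  show "P n (one n, t, k) = p2 n (t, k)" if "k \<in> K0 n"
   using P(3)[OF one_J, of "(t,k)" n] GE(4)[of "(t,k)" n] t that by simp
 next
  fix n t k assume "t \<in> ends n" "k \<in> smp K n"
  then show "P n (one n, t, k) = p1 n (t, k)"
   using P(4)[OF one_J, of "(t,k)" n] ends_J[of t n] by (simp add: b_def)
 qed
qed

section \<open>Continuous choice of fillers\<close>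

text \<open>The decomposition of a prism into simplices. The operator \<gamma> = \<alpha> + s sends
  the pair into the (d+1)-simplex of the prism that switches from 0 to 1 after vertex b.\<close>

lemma mono_prism:
 assumes s: "s \<in> mon n" and a: "\<alpha> \<in> ops n d"
 obtains \<gamma> s' \<alpha>' where "\<gamma> \<in> ops n (Suc d)" "s' \<in> mon (Suc d)" "\<alpha>' \<in> ops (Suc d) d"
  "s = act J n (Suc d) \<gamma> s'" "\<alpha> = compose {..n} \<alpha>' \<gamma>"
proof -
 have sJ: "s \<in> smp J n" and sm: "!!i j. i \<le> j ==> j \<le> n ==> s i \<le> s j" using s by (auto simp: mon_def)
 have s01: "s i = 0 \<or> s i = 1" if "i \<le> n" for i using J_cases[OF sJ that] .
 \<comment> \<open>The value of \<alpha> at which s jumps to 1; if s never jumps, the default d puts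
   all values of \<alpha> before the jump.\<close>
 define b where "b = (if \<exists>i\<le>n. s i = 1 then \<alpha> (LEAST i. i \<le> n \<and> s i = 1) else d)"
 have b1: "b \<le> \<alpha> i" if i: "i \<le> n" "s i = 1" for i
 proof -
  have "(LEAST i. i \<le> n \<and> s i = 1) \<le> i" by (rule Least_le) (use i in simp)
  then show ?thesis using ops_mono[OF a] i by (auto simp: b_def)
 qed
 have b0: "\<alpha> i \<le> b" if i: "i \<le> n" "s i = 0" for i
 proof (cases "\<exists>i\<le>n. s i = 1")
  case True
  let ?l = "LEAST i. i \<le> n \<and> s i = 1"
  have l: "?l \<le> n \<and> s ?l = 1" using True by (metis (mono_tags, lifting) LeastI_ex)
  then have "i \<le> ?l" using sm[of ?l i] i by (metis le_numeral_extra(2) nle_le)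
  then show ?thesis using True ops_mono[OF a] l by (simp add: b_def)
 next
  case False
  then have "b = d" unfolding b_def by (simp only: if_False)
  then show ?thesis using ops_le[OF a i(1)] by simp
 qed
 define \<gamma> where "\<gamma> = (\<lambda>i\<in>{..n}. \<alpha> i + s i)"
 define s' where "s' = (\<lambda>x\<in>{..Suc d}. if b < x then 1 else (0::nat))"
 define \<alpha>' where "\<alpha>' = (\<lambda>x\<in>{..Suc d}. if x \<le> b then min x d else x - 1)"
 have g: "\<gamma> \<in> ops n (Suc d)"
 proof (rule opsI)
  fix i assume "i \<le> n" then show "\<gamma> i \<le> Suc d" using ops_le[OF a, of i] s01[of i] by (auto simp: \<gamma>_def)
 next
  fix i j assume "i \<le> j" "j \<le> n" then show "\<gamma> i \<le> \<gamma> j" using ops_mono[OF a, of i j] sm[of i j] by (auto simp: \<gamma>_def)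
 qed (auto simp: \<gamma>_def)
 have s': "s' \<in> mon (Suc d)" by (auto simp: s'_def mon_def J_simps PiE_iff)
 have al': "\<alpha>' \<in> ops (Suc d) d" by (rule opsI) (auto simp: \<alpha>'_def)
 have gi: "\<gamma> i \<le> b \<longleftrightarrow> s i = 0" if "i \<le> n" for i
  using b0[OF that] b1[OF that] s01[OF that] that by (auto simp: \<gamma>_def)
 have gd: "\<gamma> i \<le> Suc d" if "i \<le> n" for i using ops_le[OF g that] .
 have "s = act J n (Suc d) \<gamma> s'"
 proof (rule J_eqI[OF sJ])
  show "act J n (Suc d) \<gamma> s' \<in> smp J n" by (rule ss_act[OF ss_J g]) (use s' in "auto simp: mon_def")
  fix i assume i: "i \<le> n"
  then show "s i = act J n (Suc d) \<gamma> s' i" using gi[OF i] gd[OF i] s01[OF i] by (auto simp: J_act_at s'_def)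
 qed
 moreover have "\<alpha> = compose {..n} \<alpha>' \<gamma>"
 proof (rule ops_eqI[OF a ops_compose[OF g al']])
  fix i assume i: "i \<le> n"
  then show "\<alpha> i = compose {..n} \<alpha>' \<gamma> i"
   using gi[OF i] gd[OF i] s01[OF i] ops_le[OF a i] by (auto simp: compose_def \<alpha>'_def \<gamma>_def)
 qed
 ultimately show ?thesis using that g s' al' by blast
qed

lemma jcon_mono:
 assumes s: "s \<in> mon n" and a: "\<alpha> \<in> ops n d" and z: "z \<in> smp (JS j) d"
 obtains \<gamma> s' \<alpha>' where "\<gamma> \<in> ops n (Suc d)" "s' \<in> smp J (Suc d)" "\<alpha>' \<in> ops (Suc d) d"
  "jcon n (s, act (JS j) n d \<alpha> z) = act (JS j) n (Suc d) \<gamma> (jcon (Suc d) (s', act (JS j) (Suc d) d \<alpha>' z))"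
proof -
 obtain \<gamma> s' \<alpha>' where g: "\<gamma> \<in> ops n (Suc d)" "s' \<in> mon (Suc d)" "\<alpha>' \<in> ops (Suc d) d"
  "s = act J n (Suc d) \<gamma> s'" "\<alpha> = compose {..n} \<alpha>' \<gamma>" using mono_prism[OF s a] .
 have s': "s' \<in> smp J (Suc d)" using g(2) by (auto simp: mon_def)
 have z': "act (JS j) (Suc d) d \<alpha>' z \<in> smp (JS j) (Suc d)" by (rule ss_act[OF ss_JS g(3) z])
 have "act (JS j) n d \<alpha> z = act (JS j) n (Suc d) \<gamma> (act (JS j) (Suc d) d \<alpha>' z)"
  using ss_comp[OF ss_JS g(1,3) z] g(5) by simp
 then have "jcon n (s, act (JS j) n d \<alpha> z) = jcon n (act (cyl (JS j)) n (Suc d) \<gamma> (s', act (JS j) (Suc d) d \<alpha>' z))"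
  unfolding g(4) by simp
 also have "\<dots> = act (JS j) n (Suc d) \<gamma> (jcon (Suc d) (s', act (JS j) (Suc d) d \<alpha>' z))"
  by (rule shom_act[OF jcon(1) g(1)]) (use s' z' in auto)
 finally show ?thesis using that g(1,3) s' by blast
qed

text \<open>
 The filler v1 is moved to a filler of the horn v2 without changing its m-skeleton.
 A prism on a simplex of dimension d has dimension d + 1; this is why the base maps have to agree up to dimension m + 1.
\<close>

lemma filler_transport:
 fixes E :: "'e sset" and Y :: "'y sset"
 assumes q: "nfib E Y q" and Y: "jfib Y"
  and v1: "shom (JS j) E v1" and w2: "shom (JS j) Y w2" and v2: "shom (res (JS j) (HB j)) E v2"
  and qv2: "!!n y. y \<in> HB j n ==> q n (v2 n y) = w2 n y"
  and agY: "!!n y. n \<le> Suc m ==> y \<in> smp (JS j) n ==> q n (v1 n y) = w2 n y"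
  and agE: "!!n y. n \<le> m ==> y \<in> HB j n ==> v1 n y = v2 n y"
 shows "\<exists>v. shom (JS j) E v \<and> (\<forall>n. \<forall>y\<in>smp (JS j) n. q n (v n y) = w2 n y) \<and> (\<forall>n. \<forall>y\<in>HB j n. v n y = v2 n y) \<and>
   (\<forall>n\<le>m. \<forall>y\<in>smp (JS j) n. v n y = v1 n y)"
proof -
 let ?P = "JS j" and ?H = "HB j"
 have P: "ss ?P" by (rule ss_JS)
 have qE: "shom E Y q" using nfib_ss(3)[OF q] .
 have Hs: "y \<in> smp ?P n" if "y \<in> ?H n" for y n using subc_sub[OF subc_HB that] .
 \<comment> \<open>On the horn v1 and v2 agree up to dimension m only, so prisms on m-simplices of
   the horn must be avoided: in dimension m only simplices off the horn generate. By
   \<open>LH\<close> the simplices of L in the horn come from horn simplices of dimension below m,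
   whose prisms have dimension at most m.\<close>
 define L where "L n = {act ?P n d \<alpha> z | d \<alpha> z. \<alpha> \<in> ops n d \<and> z \<in> smp ?P d \<and> (d < m \<or> d = m \<and> z \<notin> ?H d)}" for n
 have L: "subc ?P L"
  unfolding subc_def
 proof (intro conjI allI ballI subsetI)
  fix n y assume "y \<in> L n"
  then show "y \<in> smp ?P n" unfolding L_def using ss_act[OF P] by blast
 next
  fix k n \<beta> y assume b: "\<beta> \<in> ops k n" and "y \<in> L n"
  then obtain d \<alpha> z where y: "y = act ?P n d \<alpha> z" "\<alpha> \<in> ops n d" "z \<in> smp ?P d" "d < m \<or> d = m \<and> z \<notin> ?H d" unfolding L_def by blast
  have "act ?P k n \<beta> y = act ?P k d (compose {..k} \<alpha> \<beta>) z" unfolding y(1) by (rule ss_comp[OF P b y(2,3)])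
  then show "act ?P k n \<beta> y \<in> L k" unfolding L_def using ops_compose[OF b y(2)] y(3,4) by blast
 qed
 have Ls: "y \<in> smp ?P n" if "y \<in> L n" for y n using subc_sub[OF L that] .
 let ?K = "res ?P L" and ?KA = "%n. ?H n \<inter> L n"
 have K: "ss ?K" by (rule ss_res[OF P L])
 have K0: "subc ?K ?KA" by (rule subc_res[OF subc_Int[OF subc_HB L] L]) auto
 have LH: "\<exists>d \<alpha> z. \<alpha> \<in> ops n d \<and> z \<in> ?H d \<and> d < m \<and> y = act ?P n d \<alpha> z" if y: "y \<in> ?H n" "y \<in> L n" for n y
 proof -
  obtain d0 \<alpha>0 z0 where r: "y = act ?P n d0 \<alpha>0 z0" "\<alpha>0 \<in> ops n d0" "z0 \<in> smp ?P d0" "d0 < m \<or> d0 = m \<and> z0 \<notin> ?H d0"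
   using y(2) unfolding L_def by blast
  obtain d \<alpha> \<sigma> z where e: "\<alpha> \<in> ops n d" "\<sigma> \<in> ops d n" "y = act ?P n d \<alpha> z" "z = act ?P d n \<sigma> y"
   "!!k \<beta> x. \<beta> \<in> ops n k ==> x \<in> smp ?P k ==> y = act ?P n k \<beta> x ==> d \<le> k"
   using ez_exists[OF P Hs[OF y(1)]] by metis
  have zH: "z \<in> ?H d" unfolding e(4) by (rule subc_act[OF subc_HB e(2) y(1)])
  have "d < m"
  proof (rule ccontr)
   assume n: "\<not> d < m"
   have "d \<le> d0" by (rule e(5)[OF r(2,3,1)])
   then have d: "d = m" "d0 = m" "z0 \<notin> ?H d0" using r(4) n by auto
   show False
   proof (cases "\<alpha>0 ` {..n} = {..d0}")
    case True
    then obtain \<tau> where t: "\<tau> \<in> ops d0 n" "compose {..d0} \<alpha>0 \<tau> = (\<lambda>k\<in>{..d0}. k)"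
     using section_through[OF r(2)] by (metis zero_le)
    have "z0 = act ?P d0 n \<tau> y" unfolding r(1) using ss_comp[OF P t(1) r(2,3)] t(2) ss_id[OF P r(3)] by simp
    then show False using subc_act[OF subc_HB t(1) y(1)] d(3) by simp
   next
    case False
    then obtain \<beta> \<delta> where b: "d0 > 0" "\<beta> \<in> ops n (d0-1)" "\<delta> \<in> ops (d0-1) d0" "\<alpha>0 = compose {..n} \<delta> \<beta>"
     using nonsurj_factor[OF r(2)] by metis
    have "y = act ?P n (d0-1) \<beta> (act ?P (d0-1) d0 \<delta> z0)" unfolding r(1) b(4) by (rule ss_comp[OF P b(2,3) r(3), symmetric])
    then have "d \<le> d0 - 1" by (rule e(5)[OF b(2) ss_act[OF P b(3) r(3)]])
    then show False using d b(1) by simp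
   qed
  qed
  then show ?thesis using e(1,3) zH by blast
 qed
 have jc: "shom (cyl ?K) ?P jcon" using jcon(1)[of j] Ls by (auto simp: shom_def)
 have jcH: "shom (cyl (res ?P ?H)) (res ?P ?H) jcon"
  using jcon(1)[of j] jcon(2) Hs unfolding shom_def by (simp del: sset_prod_simps(2) add: sset_prod_simps(2)[of J "JS j"]) (auto simp: Hs)
 have jc0: "shom (cyl (res ?K ?KA)) (res ?P ?H) jcon"
  using jcH by (auto simp: shom_def)
 have lowY: "q n (v1 n (act ?P n d \<gamma> x)) = w2 n (act ?P n d \<gamma> x)" if "\<gamma> \<in> ops n d" "x \<in> smp ?P d" "d \<le> Suc m" for n d \<gamma> x
  using agY[OF that(3,2)] shom_act[OF v1 that(1,2)] shom_act[OF w2 that(1,2)] shom_act[OF qE that(1) shom_in[OF v1 that(2)]] by simp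
 have lowE: "v1 n (act ?P n d \<gamma> x) = v2 n (act ?P n d \<gamma> x)" if "\<gamma> \<in> ops n d" "x \<in> ?H d" "d \<le> m" for n d \<gamma> x
  using agE[OF that(3,2)] shom_act[OF v1 that(1) Hs[OF that(2)]] shom_act[OF v2 that(1), of x] that(2) by simp
 obtain p where p: "shom (cyl ?K) E p"
  "!!n t k. t \<in> smp J n ==> k \<in> smp ?K n ==> q n (p n (t, k)) = w2 n (jcon n (t, k))"
  "!!n t k. t \<in> smp J n ==> k \<in> ?KA n ==> p n (t, k) = v2 n (jcon n (t, k))"
  "!!n t k. t \<in> ends n ==> k \<in> smp ?K n ==> p n (t, k) = v1 n (jcon n (t, k))"
 proof (rule path_transport[OF q Y K K0 shom_comp[OF jc w2] shom_comp[OF jc v1] shom_comp[OF jc0 v2]])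
  fix n t k assume t: "t \<in> mon n" and "k \<in> smp ?K n"
  then obtain d \<alpha> z where y: "k = act ?P n d \<alpha> z" "\<alpha> \<in> ops n d" "z \<in> smp ?P d" "d \<le> m" unfolding L_def by auto
  obtain \<gamma> s' \<alpha>' where g: "\<gamma> \<in> ops n (Suc d)" "s' \<in> smp J (Suc d)" "\<alpha>' \<in> ops (Suc d) d"
   "jcon n (t, k) = act ?P n (Suc d) \<gamma> (jcon (Suc d) (s', act ?P (Suc d) d \<alpha>' z))"
   unfolding y(1) by (rule jcon_mono[OF t y(2,3)])
  show "q n (v1 n (jcon n (t, k))) = w2 n (jcon n (t, k))"
   unfolding g(4)
  proof (rule lowY[OF g(1)])
   show "jcon (Suc d) (s', act ?P (Suc d) d \<alpha>' z) \<in> smp ?P (Suc d)"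
    by (rule shom_in[OF jcon(1)]) (use g(2) ss_act[OF P g(3) y(3)] in auto)
  qed (use y(4) in auto)
 next
  fix n t k assume t: "t \<in> smp J n" and k: "k \<in> ?KA n"
  then show "q n (v2 n (jcon n (t, k))) = w2 n (jcon n (t, k))" using qv2 jcon(2) by auto
 next
  fix n t k assume t: "t \<in> mon n" and "k \<in> ?KA n"
  then obtain d \<alpha> z where y: "\<alpha> \<in> ops n d" "z \<in> ?H d" "d < m" "k = act ?P n d \<alpha> z" using LH by blast
  obtain \<gamma> s' \<alpha>' where g: "\<gamma> \<in> ops n (Suc d)" "s' \<in> smp J (Suc d)" "\<alpha>' \<in> ops (Suc d) d"
   "jcon n (t, k) = act ?P n (Suc d) \<gamma> (jcon (Suc d) (s', act ?P (Suc d) d \<alpha>' z))"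
   unfolding y(4) by (rule jcon_mono[OF t y(1) Hs[OF y(2)]])
  show "v2 n (jcon n (t, k)) = v1 n (jcon n (t, k))"
   unfolding g(4)
   by (rule lowE[symmetric, OF g(1) jcon(2)[OF g(2) subc_act[OF subc_HB g(3) y(2)]]]) (use y(3) in simp)
 qed blast
 have z: "shom ?P (cyl ?P) (%n x. (zero n, x))" "shom ?P (cyl ?P) (%n x. (one n, x))" by (auto simp: shom_def)
 have g0: "shom ?P E (%n x. v2 n (jcon n (zero n, x)))"
  by (rule shom_comp[OF _ v2], rule shom_into_res[OF shom_comp[OF z(1) jcon(1)]]) (use jcon(3) in auto)
 have pK: "shom (cyl (res ?P L)) E p" using p(1) .
 \<comment> \<open>A lift of the contraction of the cell, starting and running along v2 on the horn.
   On L it is prescribed by p, which ends at v1. At time 1 it is a filler of v2 that agrees with v1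
   on L.\<close>
 obtain h where h: "shom (cyl ?P) E h" "!!n t x. t \<in> smp J n ==> x \<in> smp ?P n ==> q n (h n (t, x)) = w2 n (jcon n (t, x))"
  "!!n t x. t \<in> smp J n ==> x \<in> ?H n ==> h n (t, x) = v2 n (jcon n (t, x))"
  "!!n t x. t \<in> smp J n ==> x \<in> L n ==> h n (t, x) = p n (t, x)"
 proof (rule box_use2[OF q P subc_HB L shom_comp[OF jcon(1) w2] shom_comp[OF jcH v2] pK g0])
  fix n x assume x: "x \<in> L n"
  then obtain d \<alpha> z where y: "x = act ?P n d \<alpha> z" "\<alpha> \<in> ops n d" "z \<in> smp ?P d" "d \<le> m" unfolding L_def by auto
  have "jcon n (zero n, x) = act ?P n d \<alpha> (jcon d (zero d, z))"
   using shom_act[OF jcon(1) y(2), of "(zero d, z)"] y by simp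
  then have "v1 n (jcon n (zero n, x)) = v2 n (jcon n (zero n, x))" using lowE[OF y(2) jcon(3)[OF y(3)] y(4)] by simp
  then show "p n (zero n, x) = v2 n (jcon n (zero n, x))" using p(4)[of "zero n" n x] x by (simp add: ends_def)
 qed (use p qv2 jcon(2,3) in auto)
 have "h n (one n, y) = v1 n y" if n: "n \<le> m" and y: "y \<in> smp ?P n" for n y
 proof (cases "y \<in> ?H n")
  case True then show ?thesis using h(3)[OF one_J True] agE[OF n True] jcon(4)[OF y] by simp
 next
  case False
  have "y = act ?P n n (\<lambda>i\<in>{..n}. i) y" using ss_id[OF P y] by simp
  then have "y \<in> L n" unfolding L_def using ops_id n y False by (metis (mono_tags, lifting) CollectI le_neq_implies_less)
  then show ?thesis using h(4)[OF one_J] p(4)[of "one n" n y] jcon(4)[OF y] by (simp add: ends_def)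
 qed
 moreover have "h n (one n, y) = v2 n y" if "y \<in> ?H n" for n y using h(3)[OF one_J that] jcon(4)[OF Hs[OF that]] by simp
 moreover have "q n (h n (one n, y)) = w2 n y" if "y \<in> smp ?P n" for n y using h(2)[OF one_J that] jcon(4)[OF that] by simp
 ultimately show ?thesis using shom_comp[OF z(2) h(1)] by (intro exI[of _ "%n y. h n (one n, y)"]) blast
qed

text \<open>Level m solves a representative \<open>c m p\<close> that depends on
  \<open>key m p\<close> only. At level m + 1 the old solution is transported to the finer
  representative, staying \<open>A m\<close>-close to itself, so that values of the levels
  stabilise.\<close>

lemma continuous_choice:
 fixes key :: "nat => 'p => 'c" and Sol :: "'p => 'v => bool" and A :: "nat => 'v => 'v => bool"
 assumes ex: "!!p. p \<in> H ==> \<exists>v. Sol p v"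
  and key: "!!m p p'. key (Suc m) p = key (Suc m) p' ==> key m p = key m p'"
  and tr: "!!m p p' v. p \<in> H ==> p' \<in> H ==> key m p = key m p' ==> Sol p v ==> \<exists>v'. Sol p' v' \<and> A m v' v"
 obtains F where "!!m p. p \<in> H ==> \<exists>p'\<in>H. key m p' = key m p \<and> Sol p' (F m p)"
  "!!m p. p \<in> H ==> A m (F (Suc m) p) (F m p)" "!!m p p'. key m p = key m p' ==> F m p = F m p'"
proof -
 define c where "c m p = (SOME p'. p' \<in> H \<and> key m p' = key m p)" for m p
 have c: "c m p \<in> H \<and> key m (c m p) = key m p" if "p \<in> H" for m p
  unfolding c_def by (rule someI[of _ p]) (use that in simp)
 define F where "F = rec_nat (%p. SOME v. Sol (c 0 p) v) (%m f p. SOME v. Sol (c (Suc m) p) v \<and> A m v (f p))"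
 have F0: "F 0 p = (SOME v. Sol (c 0 p) v)" and FS: "F (Suc m) p = (SOME v. Sol (c (Suc m) p) v \<and> A m v (F m p))" for m p
  by (simp_all add: F_def)
 have S: "Sol (c m p) (F m p)" if "p \<in> H" for m p
 proof (induction m)
  case 0 show ?case unfolding F0 by (rule someI_ex) (use ex c that in blast)
 next
  case (Suc m)
  have "key m (c m p) = key m (c (Suc m) p)" using c[OF that] key by metis
  then have "\<exists>v. Sol (c (Suc m) p) v \<and> A m v (F m p)" using tr Suc c[OF that] by blast
  then show ?case unfolding FS by (rule someI2_ex) simp
 qed
 have A: "A m (F (Suc m) p) (F m p)" if "p \<in> H" for m p
 proof -
  have "key m (c m p) = key m (c (Suc m) p)" using c[OF that] key by metis
  then have "\<exists>v. Sol (c (Suc m) p) v \<and> A m v (F m p)" using tr S[OF that] c[OF that] by blast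
  then show ?thesis unfolding FS by (rule someI2_ex) simp
 qed
 have "F m p = F m p'" if "key m p = key m p'" for m p p'
  using that
 proof (induction m)
  case 0 then show ?case by (simp add: F0 c_def)
 next
  case (Suc m)
  then have "F m p = F m p'" using key by blast
  then show ?case using Suc.prems by (simp add: FS c_def)
 qed
 then show ?thesis using that[of F] S A c by blast
qed

definition hprob :: "'e sset => 'y sset => (nat => 'e => 'y) => nat => (nat => js => 'e) => (nat => js => 'y) => bool" where
 "hprob E Y q j u w \<longleftrightarrow> shom (res (JS j) (HB j)) E u \<and> shom (JS j) Y w \<and> (\<forall>n. \<forall>z\<in>HB j n. q n (u n z) = w n z)"

text \<open>The last clause is the continuity of the choice F of fillers.\<close>

definition cfill :: "'e sset => 'y sset => (nat => 'e => 'y) => (nat => (nat => js => 'e) => (nat => js => 'y) => nat => js => 'e) => bool" where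
 "cfill E Y q F \<longleftrightarrow> (\<forall>j u w. hprob E Y q j u w --> shom (JS j) E (F j u w) \<and>
    (\<forall>n. \<forall>z\<in>smp (JS j) n. q n (F j u w n z) = w n z) \<and> (\<forall>n. \<forall>z\<in>HB j n. F j u w n z = u n z) \<and>
    (\<forall>u' w' m. hprob E Y q j u' w' --> (\<forall>n\<le>m. \<forall>z\<in>HB j n. u n z = u' n z) -->
     (\<forall>n\<le>Suc m. \<forall>z\<in>smp (JS j) n. w n z = w' n z) --> (\<forall>z\<in>smp (JS j) m. F j u w m z = F j u' w' m z)))"

lemma cfill_exists:
 fixes E :: "'e sset" and Y :: "'y sset"
 assumes q: "nfib E Y q" and Y: "jfib Y"
 obtains F where "cfill E Y q F"
proof -
 have qE: "shom E Y q" using nfib_ss(3)[OF q] .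
 define key where "key j m p = ((%n z. if n \<le> m \<and> z \<in> HB j n then fst p n z else undefined), (%n z. if n \<le> Suc m \<and> z \<in> smp (JS j) n then snd p n z else undefined))"
  for j m and p :: "(nat => js => 'e) \<times> (nat => js => 'y)"
 have keyD: "(\<forall>n\<le>m. \<forall>z\<in>HB j n. fst p n z = fst p' n z) \<and> (\<forall>n\<le>Suc m. \<forall>z\<in>smp (JS j) n. snd p n z = snd p' n z)" if "key j m p = key j m p'" for j m p p'
  using that unfolding key_def by (auto simp: fun_eq_iff simp del: sset_prod_simps) meson+
 have keyI: "key j m p = key j m p'" if "(\<forall>n\<le>m. \<forall>z\<in>HB j n. fst p n z = fst p' n z) \<and> (\<forall>n\<le>Suc m. \<forall>z\<in>smp (JS j) n. snd p n z = snd p' n z)" for j m p p'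
  using that unfolding key_def by (auto simp: fun_eq_iff simp del: sset_prod_simps)
 define Sol where "Sol j p v \<longleftrightarrow> shom (JS j) E v \<and> (\<forall>n. \<forall>z\<in>smp (JS j) n. q n (v n z) = snd p n z) \<and> (\<forall>n. \<forall>z\<in>HB j n. v n z = fst p n z)"
  for j and p :: "(nat => js => 'e) \<times> (nat => js => 'y)" and v
 define A where "A j m v v' \<longleftrightarrow> (\<forall>n\<le>m. \<forall>y\<in>smp (JS j) n. v n y = v' n y)" for j m and v v' :: "nat => js => 'e"
 define H where "H j = {p. hprob E Y q j (fst p) (snd p)}" for j
 have "\<exists>F. (\<forall>m. \<forall>p\<in>H j. \<exists>p'\<in>H j. key j m p' = key j m p \<and> Sol j p' (F m p)) \<and> (\<forall>m. \<forall>p\<in>H j. A j m (F (Suc m) p) (F m p)) \<and>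
   (\<forall>m p p'. key j m p = key j m p' --> F m p = F m p')" for j
 proof (rule continuous_choice[of "H j" "Sol j" "key j" "A j"])
  fix p assume p: "p \<in> H j"
  have l: "lft E Y q (JS j) (HB j)" using q by (simp add: nfib_def)
  have "shom (res (JS j) (HB j)) E (fst p)" "shom (JS j) Y (snd p)" "!!n z. z \<in> HB j n ==> q n (fst p n z) = snd p n z"
   using p by (auto simp: H_def hprob_def simp del: sset_prod_simps)
  from lft_ex[OF l this] show "\<exists>v. Sol j p v" unfolding Sol_def .
 next
  fix m p p' assume "key j (Suc m) p = key j (Suc m) p'"
  from keyD[OF this] show "key j m p = key j m p'" by (intro keyI) (auto simp del: sset_prod_simps)
 next
  fix m p p' v assume p: "p \<in> H j" "p' \<in> H j" "key j m p = key j m p'" "Sol j p v"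
  have p': "shom (res (JS j) (HB j)) E (fst p')" "shom (JS j) Y (snd p')" "!!n z. z \<in> HB j n ==> q n (fst p' n z) = snd p' n z"
   using p(2) by (auto simp: H_def hprob_def simp del: sset_prod_simps)
  have v: "shom (JS j) E v" "!!n z. z \<in> smp (JS j) n ==> q n (v n z) = snd p n z" "!!n z. z \<in> HB j n ==> v n z = fst p n z"
   using p(4) by (auto simp: Sol_def simp del: sset_prod_simps)
  have "q n (v n y) = snd p' n y" if "n \<le> Suc m" "y \<in> smp (JS j) n" for n y
   using v(2)[OF that(2)] keyD[OF p(3)] that by (simp del: sset_prod_simps)
  moreover have "v n y = fst p' n y" if "n \<le> m" "y \<in> HB j n" for n y
   using v(3)[OF that(2)] keyD[OF p(3)] that by (simp del: sset_prod_simps)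
  ultimately show "\<exists>v'. Sol j p' v' \<and> A j m v' v"
   using filler_transport[OF q Y v(1) p'(2,1,3), of m] unfolding Sol_def A_def by blast
 qed blast
 then have ex: "\<forall>j. \<exists>F. (\<forall>m. \<forall>p\<in>H j. \<exists>p'\<in>H j. key j m p' = key j m p \<and> Sol j p' (F m p)) \<and> (\<forall>m. \<forall>p\<in>H j. A j m (F (Suc m) p) (F m p)) \<and>
   (\<forall>m p p'. key j m p = key j m p' --> F m p = F m p')" by blast
 from choice[OF ex] obtain F where F: "!!j m p. p \<in> H j ==> \<exists>p'\<in>H j. key j m p' = key j m p \<and> Sol j p' (F j m p)"
   "!!j m p. p \<in> H j ==> A j m (F j (Suc m) p) (F j m p)"
   "!!j m p p'. key j m p = key j m p' ==> F j m p = F j m p'" by blast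
 \<comment> \<open>The diagonal: in dimension n the n-th level is taken, which later levels do not
   change, and which sees the horn up to dimension n only.\<close>
 define G where "G j u w n z = F j n (u, w) n z" for j u w n z
 have st: "F j (m + k) p n z = F j m p n z" if "p \<in> H j" "n \<le> m" "z \<in> smp (JS j) n" for j m k p n z
 proof (induction k)
  case (Suc k)
  have "F j (Suc (m + k)) p n z = F j (m + k) p n z" using F(2)[OF that(1), of "m+k"] that(2,3) unfolding A_def by auto
  then show ?case using Suc by simp
 qed simp
 have st': "F j m p n z = F j n p n z" if "p \<in> H j" "n \<le> m" "z \<in> smp (JS j) n" for j m p n z
  using st[OF that(1) order_refl that(3), of "m - n"] that(2) by simp
 have "cfill E Y q G"
  unfolding cfill_def
 proof (intro allI impI conjI ballI)
  fix j u w assume hp: "hprob E Y q j u w"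
  then have p: "(u, w) \<in> H j" by (simp add: H_def)
  have F1: "shom (JS j) E (F j m (u, w)) \<and> (\<forall>n\<le>Suc m. \<forall>z\<in>smp (JS j) n. q n (F j m (u, w) n z) = w n z) \<and> (\<forall>n\<le>m. \<forall>z\<in>HB j n. F j m (u, w) n z = u n z)" for m
  proof -
   obtain p' where p': "p' \<in> H j" "key j m p' = key j m (u, w)" "Sol j p' (F j m (u, w))" using F(1)[OF p] by blast
   then show ?thesis using keyD[OF p'(2)] unfolding Sol_def by simp
  qed
  show "shom (JS j) E (G j u w)"
  proof (rule shomI)
   fix n z assume "z \<in> smp (JS j) n"
   then show "G j u w n z \<in> smp E n" unfolding G_def by (rule shom_in[OF conjunct1[OF F1]])
  next
   fix m n \<alpha> z assume a: "\<alpha> \<in> ops m n" and z: "z \<in> smp (JS j) n"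
   let ?N = "max m n"
   have "G j u w m (act (JS j) m n \<alpha> z) = F j ?N (u, w) m (act (JS j) m n \<alpha> z)"
    unfolding G_def by (rule st'[OF p _ ss_act[OF ss_JS a z], symmetric]) simp
   also have "\<dots> = act E m n \<alpha> (F j ?N (u, w) n z)" using shom_act[OF conjunct1[OF F1] a z] .
   also have "F j ?N (u, w) n z = G j u w n z" unfolding G_def by (rule st'[OF p _ z]) simp
   finally show "G j u w m (act (JS j) m n \<alpha> z) = act E m n \<alpha> (G j u w n z)" .
  qed
  show "q n (G j u w n z) = w n z" if "z \<in> smp (JS j) n" for n z unfolding G_def using F1[of n] that by (simp del: sset_prod_simps)
  show "G j u w n z = u n z" if "z \<in> HB j n" for n z unfolding G_def using F1[of n] that by simp
  fix u' w' m z assume "hprob E Y q j u' w'" and e: "\<forall>n\<le>m. \<forall>z\<in>HB j n. u n z = u' n z" "\<forall>n\<le>Suc m. \<forall>z\<in>smp (JS j) n. w n z = w' n z"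
  have "F j m (u, w) = F j m (u', w')" by (rule F(3), rule keyI) (use e in simp)
  then show "G j u w m z = G j u' w' m z" by (simp add: G_def)
 qed
 then show ?thesis using that by blast
qed

section \<open>Cardinalities\<close>

lemma lepoll_total: "A \<lesssim> B \<or> B \<lesssim> A"
 using ordLeq_total[OF card_of_Well_order card_of_Well_order, of A B] unfolding lepoll_def card_of_ordLeq .

lemma lepoll_infinite: "A \<lesssim> B ==> infinite A ==> infinite B"
 unfolding infinite_le_lepoll using lepoll_trans by blast

lemma small_lepoll: "small U I ==> K \<lesssim> I ==> small U K"
 unfolding small_def using lepoll_trans by blast

lemma small_mem: "A \<in> U ==> small U A"
 unfolding small_def using lepoll_refl by blast

lemma small_image: "small U A ==> small U (f ` A)"
 by (rule small_lepoll[OF _ image_lepoll])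

lemma lepoll_image: "A \<subseteq> f ` B ==> B \<lesssim> L ==> A \<lesssim> L"
 by (meson image_lepoll lepoll_trans subset_imp_lepoll)

text \<open>A set that absorbs its countable powers, and with them countable unions and binary
  products. Every small set is bounded by one in U by \<open>idem_exists\<close>.\<close>

definition idem :: "'a set => bool" where
 "idem L \<longleftrightarrow> infinite L \<and> ((UNIV :: nat set) \<rightarrow>\<^sub>E L) \<lesssim> L"

lemma idem_nat: "idem L ==> (UNIV :: nat set) \<lesssim> L"
 by (simp add: idem_def infinite_le_lepoll)

lemma idem_PiE:
 assumes L: "idem L" and X: "countable X" and S: "S \<lesssim> L"
 shows "(X \<rightarrow>\<^sub>E S) \<lesssim> L"
proof -
 obtain g where g: "inj_on g S" "g ` S \<subseteq> L" using S by (auto simp: lepoll_def)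
 obtain l0 where l0: "l0 \<in> L" using L by (metis idem_def infinite_imp_nonempty ex_in_conv)
 let ?c = "%f n. if n \<in> to_nat_on X ` X then g (f (from_nat_into X n)) else l0"
 have "inj_on ?c (X \<rightarrow>\<^sub>E S)"
 proof (rule inj_onI)
  fix f f' assume f: "f \<in> X \<rightarrow>\<^sub>E S" "f' \<in> X \<rightarrow>\<^sub>E S" "?c f = ?c f'"
  show "f = f'"
  proof (rule PiE_ext[OF f(1,2)])
   fix x assume x: "x \<in> X"
   have "g (f x) = g (f' x)" using fun_cong[OF f(3), of "to_nat_on X x"] x X by simp
   then show "f x = f' x" using g(1) f(1,2) x by (meson PiE_mem inj_onD)
  qed
 qed
 moreover have "?c ` (X \<rightarrow>\<^sub>E S) \<subseteq> UNIV \<rightarrow>\<^sub>E L"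
 proof (intro image_subsetI PiE_I)
  fix f n assume f: "f \<in> X \<rightarrow>\<^sub>E S"
  show "?c f n \<in> L"
  proof (cases "n \<in> to_nat_on X ` X")
   case True
   then obtain x where "x \<in> X" "n = to_nat_on X x" by auto
   then show ?thesis using f g(2) X by auto
  qed (use l0 in auto)
 qed auto
 ultimately have "(X \<rightarrow>\<^sub>E S) \<lesssim> ((UNIV :: nat set) \<rightarrow>\<^sub>E L)" unfolding lepoll_def by blast
 then show ?thesis using L lepoll_trans unfolding idem_def by blast
qed

lemma idem_prod:
 assumes L: "idem L" and S: "S \<lesssim> L" and T: "T \<lesssim> L"
 shows "S \<times> T \<lesssim> L"
proof -
 obtain g h where g: "inj_on g S" "g ` S \<subseteq> L" and h: "inj_on h T" "h ` T \<subseteq> L" using S T by (auto simp: lepoll_def)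
 let ?c = "%p n. if n = (0::nat) then g (fst p) else h (snd p)"
 have "inj_on ?c (S \<times> T)"
 proof (rule inj_onI)
  fix p p' assume p: "p \<in> S \<times> T" "p' \<in> S \<times> T" "?c p = ?c p'"
  have "g (fst p) = g (fst p')" "h (snd p) = h (snd p')" using fun_cong[OF p(3), of 0] fun_cong[OF p(3), of 1] by auto
  then have "fst p = fst p'" "snd p = snd p'" using inj_onD[OF g(1)] inj_onD[OF h(1)] p(1,2) by auto
  then show "p = p'" by (rule prod_eqI)
 qed
 moreover have "?c ` (S \<times> T) \<subseteq> UNIV \<rightarrow>\<^sub>E L" using g(2) h(2) by (auto simp: image_subset_iff)
 ultimately have "S \<times> T \<lesssim> ((UNIV :: nat set) \<rightarrow>\<^sub>E L)" unfolding lepoll_def by blast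
 then show ?thesis using L lepoll_trans unfolding idem_def by blast
qed

lemma idem_countable: "idem L ==> countable X ==> X \<lesssim> L"
 by (rule lepoll_trans[OF _ idem_nat]) (auto simp: lepoll_def countable_def)

lemma idem_UN:
 assumes L: "idem L" and S: "!!i. i \<in> I ==> S i \<lesssim> L" and I: "countable I"
 shows "(\<Union>i\<in>I. S i) \<lesssim> L"
proof -
 have "\<forall>i\<in>I. \<exists>g. inj_on g (S i) \<and> g ` S i \<subseteq> L" using S by (auto simp: lepoll_def)
 then obtain g where g: "!!i. i \<in> I ==> inj_on (g i) (S i)" "!!i. i \<in> I ==> g i ` S i \<subseteq> L" by metis
 have "(\<Union>i\<in>I. S i) \<subseteq> (%(i, l). inv_into (S i) (g i) l) ` (I \<times> L)"
 proof
  fix x assume "x \<in> (\<Union>i\<in>I. S i)"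
  then obtain i where i: "i \<in> I" "x \<in> S i" by blast
  then have "x = (%(i, l). inv_into (S i) (g i) l) (i, g i x)" "(i, g i x) \<in> I \<times> L" using g[OF i(1)] by auto
  then show "x \<in> (%(i, l). inv_into (S i) (g i) l) ` (I \<times> L)" by blast
 qed
 then show ?thesis by (rule lepoll_image) (rule idem_prod[OF L idem_countable[OF L I] lepoll_refl])
qed

lemma idem_Un: "idem L ==> S \<lesssim> L ==> T \<lesssim> L ==> S \<union> T \<lesssim> L"
 using idem_UN[of L "{True, False}" "%b. if b then S else T"] by (simp add: Un_commute)

text \<open>The countable power of an infinite set above A, copied into U. It absorbs its own
  countable powers by pairing of natural numbers.\<close>

lemma idem_exists:
 assumes U: "set_universe U" and A: "small U A"
 obtains L where "L \<in> U" "idem L" "A \<lesssim> L"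
proof -
 obtain B where B: "B \<in> U" "A \<lesssim> B" using A by (auto simp: small_def)
 obtain I where I: "I \<in> U" "infinite I" using U by (auto simp: set_universe_def)
 obtain C where C: "C \<in> U" "infinite C" "A \<lesssim> C"
  using lepoll_total[of B I] B I lepoll_infinite lepoll_trans by metis
 let ?P = "(UNIV :: nat set) \<rightarrow>\<^sub>E C"
 obtain D where D: "D \<in> U" "?P \<lesssim> D" using U C(1) unfolding set_universe_def by metis
 obtain g where g: "inj_on g ?P" "g ` ?P \<subseteq> D" using D(2) by (auto simp: lepoll_def)
 define L where "L = g ` ?P"
 have PL: "?P \<approx> L" unfolding L_def using g(1) by (metis eqpoll_sym inj_on_image_eqpoll_self)
 have "L \<lesssim> D" using g(2) by (simp add: L_def subset_imp_lepoll)
 then have "L \<in> U" using U D(1) unfolding set_universe_def by blast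
 have CL: "C \<lesssim> ?P"
  unfolding lepoll_def by (rule exI[of _ "%c n. c"]) (auto simp: inj_on_def fun_eq_iff)
 have CL': "C \<lesssim> L" using CL PL lepoll_trans1 lepoll_trans2 by blast
 then have inf: "infinite L" using C(2) lepoll_infinite by blast
 obtain h where h: "inj_on h L" "h ` L \<subseteq> ?P" using eqpoll_sym[OF PL] eqpoll_imp_lepoll by (meson lepoll_def)
 let ?c = "%f k. h (f (fst (prod_decode k))) (snd (prod_decode k))"
 have "inj_on ?c ((UNIV :: nat set) \<rightarrow>\<^sub>E L)"
 proof (rule inj_onI, rule ext)
  fix f f' i assume f: "f \<in> (UNIV :: nat set) \<rightarrow>\<^sub>E L" "f' \<in> (UNIV :: nat set) \<rightarrow>\<^sub>E L" "?c f = ?c f'"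
  have "h (f i) j = h (f' i) j" for j using fun_cong[OF f(3), of "prod_encode (i, j)"] by simp
  then have "h (f i) = h (f' i)" by blast
  then show "f i = f' i" using h(1) f(1,2) by (auto simp: inj_on_def PiE_iff)
 qed
 moreover have "?c ` ((UNIV :: nat set) \<rightarrow>\<^sub>E L) \<subseteq> ?P" using h(2) by (fastforce simp: PiE_iff)
 ultimately have "((UNIV :: nat set) \<rightarrow>\<^sub>E L) \<lesssim> ?P" unfolding lepoll_def by blast
 then have "idem L" using inf PL lepoll_trans2 unfolding idem_def by blast
 moreover have "A \<lesssim> L" using C(3) CL' lepoll_trans by blast
 ultimately show ?thesis using that \<open>L \<in> U\<close> by blast
qed

lemma idem_common:
 assumes U: "set_universe U" and I: "finite I" and S: "!!i. i \<in> I ==> small U (S i)"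
 shows "\<exists>L\<in>U. idem L \<and> (\<forall>i\<in>I. S i \<lesssim> L)"
 using I S
proof (induction rule: finite_induct)
 case empty
 obtain A where "A \<in> U" using U by (auto simp: set_universe_def)
 then obtain L where "L \<in> U" "idem L" using idem_exists[OF U small_mem] by metis
 then show ?case by blast
next
 case (insert i I)
 then obtain L where L: "L \<in> U" "idem L" "\<forall>i\<in>I. S i \<lesssim> L" by auto
 obtain L' where L': "L' \<in> U" "idem L'" "S i \<lesssim> L'" using idem_exists[OF U, of "S i"] insert.prems by auto
 show ?case using lepoll_total[of L L'] L L' lepoll_trans by (metis insert_iff)
qed

section \<open>Small fibrant subcomplexes\<close>

text \<open>One step adds degeneracies, values of the homotopy H and chosen fillers. Operators are
  applied from dimensions d \<le> n only, so that the n-simplices of a stage depend on A up to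
  dimension n; otherwise sets of unbounded size would be united. Faces appear by themselves one
  stage later, by \<open>stage_act\<close>.\<close>

primrec stage :: "'e sset => 'y sset => (nat => 'e => 'y) => (nat => (nat => js => 'e) => (nat => js => 'y) => nat => js => 'e) =>
  (nat => (nat => nat) \<times> 'e => 'e) => (nat => 'e set) => nat => nat => 'e set" where
 "stage E Y q F H A 0 n = A n"
| "stage E Y q F H A (Suc k) n = stage E Y q F H A k n \<union>
   (\<Union>d\<in>{..n}. \<Union>\<beta>\<in>ops n d. act E n d \<beta> ` stage E Y q F H A k d) \<union>
   (\<Union>t\<in>smp J n. (%s. H n (t, s)) ` stage E Y q F H A k n) \<union>
   (\<Union>j. \<Union>z\<in>{z \<in> smp (JS j) n. z \<notin> HB j n}. {F j u w n z | u w. hprob E Y q j u w \<and> (\<forall>d\<le>n. \<forall>y\<in>HB j d. u d y \<in> stage E Y q F H A k d)})"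

lemma finite_ops: "finite (ops m n)"
proof -
 have "finite ({..m} \<rightarrow>\<^sub>E {..n})" by (rule finite_PiE) auto
 then show ?thesis unfolding ops_def by (rule rev_finite_subset) auto
qed

lemma finite_J: "finite (smp J n)"
 unfolding J_simps by (rule finite_PiE) auto

lemma finite_JS: "finite (smp (JS j) n)"
 by (simp add: finite_J simplex_simps finite_ops)

lemma finite_HB: "finite (HB j n)"
 by (rule finite_subset[OF _ finite_JS[of j n]]) (auto dest: subc_sub[OF subc_HB])

context
 fixes E :: "'e sset" and Y :: "'y sset" and q F H A
 assumes q: "nfib E Y q" and F: "cfill E Y q F" and H: "shom (cyl E) E H" and A: "subc E A"
begin

abbreviation "St == stage E Y q F H A"

lemma cfillD:
 assumes "hprob E Y q j u w"
 shows "shom (JS j) E (F j u w)" "z \<in> smp (JS j) n ==> q n (F j u w n z) = w n z" "z \<in> HB j n ==> F j u w n z = u n z"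
  "hprob E Y q j u' w' ==> (\<forall>n\<le>m. \<forall>z\<in>HB j n. u n z = u' n z) ==>
     (\<forall>n\<le>Suc m. \<forall>z\<in>smp (JS j) n. w n z = w' n z) ==> z' \<in> smp (JS j) m ==> F j u w m z' = F j u' w' m z'"
 using F assms unfolding cfill_def by blast+

lemma stage_mono1: "x \<in> St k n ==> x \<in> St (Suc k) n"
 by simp

lemma stage_mono: "x \<in> St k n ==> k \<le> l ==> x \<in> St l n"
 by (induction l) (auto simp: le_Suc_eq simp del: stage.simps(2) intro: stage_mono1)

lemma stage_deg: "s \<in> St k d ==> d \<le> n ==> \<beta> \<in> ops n d ==> act E n d \<beta> s \<in> St (Suc k) n"
 unfolding stage.simps Un_iff UN_iff by (meson atMost_iff imageI)

lemma stage_H: "s \<in> St k n ==> t \<in> smp J n ==> H n (t, s) \<in> St (Suc k) n"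
 unfolding stage.simps Un_iff UN_iff by (meson imageI)

lemma stage_F:
 assumes "hprob E Y q j u w" "z \<in> smp (JS j) n" "z \<notin> HB j n" "!!d y. d \<le> n ==> y \<in> HB j d ==> u d y \<in> St k d"
 shows "F j u w n z \<in> St (Suc k) n"
proof -
 have "F j u w n z \<in> {F j u w n z | u w. hprob E Y q j u w \<and> (\<forall>d\<le>n. \<forall>y\<in>HB j d. u d y \<in> St k d)}"
  by (rule CollectI, rule exI[of _ u], rule exI[of _ w]) (use assms in simp)
 moreover have "z \<in> {z \<in> smp (JS j) n. z \<notin> HB j n}" using assms(2,3) by (simp del: sset_prod_simps)
 ultimately show ?thesis unfolding stage.simps by (intro UnI2 UN_I[of j] UN_I[of z] UNIV_I)
qed

lemma stage_cases:
 assumes "s \<in> St (Suc k) n"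
 obtains "s \<in> St k n" | d \<beta> s' where "d \<le> n" "\<beta> \<in> ops n d" "s' \<in> St k d" "s = act E n d \<beta> s'"
 | t s' where "t \<in> smp J n" "s' \<in> St k n" "s = H n (t, s')"
 | j u w z where "hprob E Y q j u w" "z \<in> smp (JS j) n" "z \<notin> HB j n" "!!d y. d \<le> n ==> y \<in> HB j d ==> u d y \<in> St k d" "s = F j u w n z"
proof -
 from assms consider (a) "s \<in> St k n" | (b) "s \<in> (\<Union>d\<in>{..n}. \<Union>\<beta>\<in>ops n d. act E n d \<beta> ` St k d)"
  | (c) "s \<in> (\<Union>t\<in>smp J n. (%s. H n (t, s)) ` St k n)"
  | (d) "s \<in> (\<Union>j. \<Union>z\<in>{z \<in> smp (JS j) n. z \<notin> HB j n}. {F j u w n z | u w. hprob E Y q j u w \<and> (\<forall>d\<le>n. \<forall>y\<in>HB j d. u d y \<in> St k d)})"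
  unfolding stage.simps Un_iff by argo
 then show ?thesis
 proof cases
  case a then show ?thesis by (rule that(1))
 next
  case b
  then obtain d \<beta> s' where "d \<in> {..n}" "\<beta> \<in> ops n d" "s' \<in> St k d" "s = act E n d \<beta> s'" by (elim UN_E imageE)
  then show ?thesis using that(2)[of d \<beta> s'] by simp
 next
  case c
  then obtain t s' where "t \<in> smp J n" "s' \<in> St k n" "s = H n (t, s')" by (elim UN_E imageE)
  then show ?thesis by (rule that(3))
 next
  case d
  then obtain j z where z: "z \<in> {z \<in> smp (JS j) n. z \<notin> HB j n}"
   "s \<in> {F j u w n z | u w. hprob E Y q j u w \<and> (\<forall>d\<le>n. \<forall>y\<in>HB j d. u d y \<in> St k d)}" by (elim UN_E)
  from z(2) obtain u w where "s = F j u w n z" "hprob E Y q j u w" "\<forall>d\<le>n. \<forall>y\<in>HB j d. u d y \<in> St k d" by blast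
  then show ?thesis using that(4)[of j u w z] z(1) by (simp del: sset_prod_simps)
 qed
qed

lemma stage_sub: "s \<in> St k n ==> s \<in> smp E n"
proof (induction k arbitrary: n s)
 case 0 then show ?case using subc_sub[OF A] by simp
next
 case (Suc k)
 from Suc.prems show ?case
 proof (cases rule: stage_cases)
  case 1 then show ?thesis by (rule Suc.IH)
 next
  case (2 d \<beta> s') then show ?thesis using ss_act[OF nfib_ss(1)[OF q] 2(2) Suc.IH[OF 2(3)]] by simp
 next
  case (3 t s') then show ?thesis using shom_in[OF H, of "(t, s')" n] Suc.IH by simp
 next
  case (4 j u w z) then show ?thesis using shom_in[OF cfillD(1)[OF 4(1)] 4(2)] by simp
 qed
qed

text \<open>Operators that do not lower the dimension are a clause of the closure. The others pass
  through each clause; a face of a filler is another value of that filler or lies in the horn, hence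
  in an earlier stage.\<close>

lemma stage_act: "s \<in> St k n ==> \<beta> \<in> ops m n ==> act E m n \<beta> s \<in> St (Suc k) m"
proof (induction k arbitrary: n m s \<beta>)
 case 0
 then have "act E m n \<beta> s \<in> St 0 m" using subc_act[OF A] by simp
 then show ?case by (rule stage_mono1)
next
 case (Suc k)
 have E: "ss E" using nfib_ss(1)[OF q] .
 show ?case
 proof (cases "n \<le> m")
  case True then show ?thesis using stage_deg Suc.prems by blast
 next
  case False
  then have mn: "m \<le> n" by simp
  from Suc.prems(1) show ?thesis
  proof (cases rule: stage_cases)
   case 1 then show ?thesis using stage_mono1[OF Suc.IH[OF 1 Suc.prems(2)]] by blast
  next
   case (2 d \<beta>' s')
   have "act E m n \<beta> s = act E m d (compose {..m} \<beta>' \<beta>) s'"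
    unfolding 2(4) by (rule ss_comp[OF E Suc.prems(2) 2(2) stage_sub[OF 2(3)]])
   then show ?thesis using stage_mono1[OF Suc.IH[OF 2(3) ops_compose[OF Suc.prems(2) 2(2)]]] by simp
  next
   case (3 t s')
   have "act E m n \<beta> s = H m (act J m n \<beta> t, act E m n \<beta> s')"
    unfolding 3(3) using shom_act[OF H Suc.prems(2), of "(t, s')"] 3(1) stage_sub[OF 3(2)] by simp
   then show ?thesis using stage_H[OF Suc.IH[OF 3(2) Suc.prems(2)] ss_act[OF ss_J Suc.prems(2) 3(1)]] by simp
  next
   case (4 j u w z)
   let ?z = "act (JS j) m n \<beta> z"
   have z: "?z \<in> smp (JS j) m" by (rule ss_act[OF ss_JS Suc.prems(2) 4(2)])
   have e: "act E m n \<beta> s = F j u w m ?z" unfolding 4(5) using shom_act[OF cfillD(1)[OF 4(1)] Suc.prems(2) 4(2)] by simp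
   show ?thesis
   proof (cases "?z \<in> HB j m")
    case True
    then have "act E m n \<beta> s \<in> St k m" using e cfillD(3)[OF 4(1) True] 4(4)[OF mn True] by simp
    then show ?thesis by (intro stage_mono1)
   next
    case False
    have "F j u w m ?z \<in> St (Suc k) m" by (rule stage_F[OF 4(1) z False]) (use 4(4) mn in auto)
    then show ?thesis unfolding e by (rule stage_mono1)
   qed
  qed
 qed
qed

definition "clo n = (\<Union>k. St k n)"

lemma clo: "subc E clo" "A n \<subseteq> clo n" "t \<in> smp J n ==> s \<in> clo n ==> H n (t, s) \<in> clo n"
proof -
 show "subc E clo"
  unfolding subc_def
 proof (intro conjI allI ballI subsetI)
  fix n x assume "x \<in> clo n"
  then obtain k where "x \<in> St k n" by (auto simp: clo_def simp del: stage.simps)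
  then show "x \<in> smp E n" by (rule stage_sub)
 next
  fix m n \<alpha> x assume a: "\<alpha> \<in> ops m n" and "x \<in> clo n"
  then obtain k where "x \<in> St k n" by (auto simp: clo_def simp del: stage.simps)
  then have "act E m n \<alpha> x \<in> St (Suc k) m" using a by (rule stage_act)
  then show "act E m n \<alpha> x \<in> clo m" unfolding clo_def by (rule UN_I[OF UNIV_I])
 qed
 have "A n = St 0 n" by simp
 then show "A n \<subseteq> clo n" unfolding clo_def by blast
 show "H n (t, s) \<in> clo n" if t: "t \<in> smp J n" and s: "s \<in> clo n"
 proof -
  obtain k where "s \<in> St k n" using s by (auto simp: clo_def simp del: stage.simps)
  then have "H n (t, s) \<in> St (Suc k) n" using t by (rule stage_H)
  then show ?thesis unfolding clo_def by (rule UN_I[OF UNIV_I])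
 qed
qed

text \<open>Up to dimension n a horn has finitely many simplices, so they lie in one common stage
  and the n-simplices of the chosen filler in the next one.\<close>

lemma clo_nfib: "nfib (res E clo) Y q"
 unfolding nfib_def
proof (intro conjI allI)
 show "ss (res E clo)" by (rule ss_res[OF nfib_ss(1)[OF q] clo(1)])
 show "ss Y" using nfib_ss(2)[OF q] .
 show "shom (res E clo) Y q" by (rule shom_res[OF nfib_ss(3)[OF q]]) (use subc_sub[OF clo(1)] in auto)
 fix j
 show "lft (res E clo) Y q (JS j) (HB j)"
 proof (rule lftI)
  fix u w assume u: "shom (res (JS j) (HB j)) (res E clo) u" and w: "shom (JS j) Y w" and uw: "!!n z. z \<in> HB j n ==> q n (u n z) = w n z"
  have hp: "hprob E Y q j u w" unfolding hprob_def using shom_from_res[OF u clo(1)] w uw by blast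
  have inc: "F j u w n z \<in> clo n" if z: "z \<in> smp (JS j) n" for n z
  proof (cases "z \<in> HB j n")
   case True
   then show ?thesis using cfillD(3)[OF hp True] shom_in[OF u, of z n] by simp
  next
   case False
   let ?I = "Sigma {..n} (HB j)"
   have "\<forall>p\<in>?I. \<exists>k. u (fst p) (snd p) \<in> St k (fst p)"
    using shom_in[OF u] by (fastforce simp: clo_def)
   then obtain k where k: "!!p. p \<in> ?I ==> u (fst p) (snd p) \<in> St (k p) (fst p)" by metis
   have fin: "finite ?I" by (intro finite_SigmaI finite_HB) auto
   let ?K = "Max (insert 0 (k ` ?I))"
   have kK: "k p \<le> ?K" if "p \<in> ?I" for p by (rule Max_ge) (use fin that in auto)
   have "u d y \<in> St ?K d" if "d \<le> n" "y \<in> HB j d" for d y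
   proof -
    have p: "(d, y) \<in> ?I" using that by auto
    show ?thesis using stage_mono[OF _ kK[OF p]] k[OF p] by simp
   qed
   then have "F j u w n z \<in> St (Suc ?K) n" by (rule stage_F[OF hp z False])
   then show ?thesis unfolding clo_def by (rule UN_I[OF UNIV_I])
  qed
  have "shom (JS j) (res E clo) (F j u w)" by (rule shom_into_res[OF cfillD(1)[OF hp] inc])
  then show "\<exists>h. shom (JS j) (res E clo) h \<and> (\<forall>n. \<forall>x\<in>smp (JS j) n. q n (h n x) = w n x) \<and> (\<forall>n. \<forall>x\<in>HB j n. h n x = u n x)"
   using cfillD(2,3)[OF hp] by blast
 qed
qed

text \<open>Here continuity is used: an n-simplex of a chosen filler is determined by the horn up to
  dimension n and the base up to \<open>Suc n\<close>, which is finitely many values in sets bounded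
  by L.\<close>

lemma stage_small:
 assumes L: "idem L" and AL: "!!n. n \<le> N ==> A n \<lesssim> L" and YL: "!!n. n \<le> Suc N ==> smp Y n \<lesssim> L"
 shows "n \<le> N ==> St k n \<lesssim> L"
proof (induction k arbitrary: n)
 case 0 then show ?case using AL by simp
next
 case (Suc k)
 have 1: "St k n \<lesssim> L" by (rule Suc.IH[OF Suc.prems])
 have 2: "(\<Union>d\<in>{..n}. \<Union>\<beta>\<in>ops n d. act E n d \<beta> ` St k d) \<lesssim> L"
  by (intro idem_UN[OF L] lepoll_image[OF order_refl] Suc.IH) (use Suc.prems countable_finite[OF finite_ops] in auto)
 have 3: "(\<Union>t\<in>smp J n. (%s. H n (t, s)) ` St k n) \<lesssim> L"
  by (intro idem_UN[OF L] lepoll_image[OF order_refl] 1) (use countable_finite[OF finite_J] in auto)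
 have 4: "{F j u w n z | u w. hprob E Y q j u w \<and> (\<forall>d\<le>n. \<forall>y\<in>HB j d. u d y \<in> St k d)} \<lesssim> L" if z: "z \<in> smp (JS j) n" for j z
 proof -
  let ?I = "Sigma {..n} (HB j)" and ?I' = "Sigma {..Suc n} (smp (JS j))"
  let ?S = "\<Union>d\<in>{..n}. St k d" and ?T = "\<Union>d\<in>{..Suc n}. smp Y d"
  have c: "countable ?I" "countable ?I'"
   by (intro countable_finite finite_SigmaI finite_HB finite_JS finite_atMost)+
  have S: "?S \<lesssim> L" by (intro idem_UN[OF L] Suc.IH) (use Suc.prems in auto)
  have T: "?T \<lesssim> L" by (intro idem_UN[OF L] YL) (use Suc.prems in auto)
  let ?R = "%u w. (restrict (%p. u (fst p) (snd p)) ?I, restrict (%p. w (fst p) (snd p)) ?I')"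
  let ?G = "%ab. let p = (SOME p. hprob E Y q j (fst p) (snd p) \<and> ?R (fst p) (snd p) = ab) in F j (fst p) (snd p) n z"
  have "{F j u w n z | u w. hprob E Y q j u w \<and> (\<forall>d\<le>n. \<forall>y\<in>HB j d. u d y \<in> St k d)} \<subseteq> ?G ` ((?I \<rightarrow>\<^sub>E ?S) \<times> (?I' \<rightarrow>\<^sub>E ?T))"
  proof
   fix x assume "x \<in> {F j u w n z | u w. hprob E Y q j u w \<and> (\<forall>d\<le>n. \<forall>y\<in>HB j d. u d y \<in> St k d)}"
   then obtain u w where x: "x = F j u w n z" "hprob E Y q j u w" "\<forall>d\<le>n. \<forall>y\<in>HB j d. u d y \<in> St k d" by blast
   let ?P = "%p. hprob E Y q j (fst p) (snd p) \<and> ?R (fst p) (snd p) = ?R u w"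
   define p where "p = (SOME p. ?P p)"
   have "?P (u, w)" unfolding fst_conv snd_conv by (rule conjI[OF x(2) refl])
   from someI[of ?P "(u, w)", OF this] have p: "?P p" unfolding p_def .
   note pp = conjunct2[OF p, unfolded prod.inject]
   note p1 = conjunct1[OF pp] and p2 = conjunct2[OF pp]
   have e1: "fst p d y = u d y" if "d \<le> n" "y \<in> HB j d" for d y
    using fun_cong[OF p1, of "(d, y)"] that by (simp only: restrict_def mem_Sigma_iff atMost_iff fst_conv snd_conv) simp
   have e2: "snd p d y = w d y" if "d \<le> Suc n" "y \<in> smp (JS j) d" for d y
    using fun_cong[OF p2, of "(d, y)"] that by (simp only: restrict_def mem_Sigma_iff atMost_iff fst_conv snd_conv) simp
   have "F j (fst p) (snd p) n z = x" unfolding x(1)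
    by (rule cfillD(4)[OF conjunct1[OF p] x(2) _ _ z]) (use e1 e2 in blast)+
   then have "?G (?R u w) = x" by (simp only: Let_def p_def)
   moreover have "restrict (%p. u (fst p) (snd p)) ?I \<in> ?I \<rightarrow>\<^sub>E ?S"
   proof (rule restrict_PiE_iff[THEN iffD2], rule ballI)
    fix p assume "p \<in> ?I"
    then have "fst p \<le> n" "snd p \<in> HB j (fst p)" by auto
    then show "u (fst p) (snd p) \<in> ?S" using x(3) by blast
   qed
   moreover have "restrict (%p. w (fst p) (snd p)) ?I' \<in> ?I' \<rightarrow>\<^sub>E ?T"
   proof (rule restrict_PiE_iff[THEN iffD2], rule ballI)
    fix p assume "p \<in> ?I'"
    then have "fst p \<le> Suc n" "snd p \<in> smp (JS j) (fst p)" by (auto simp del: sset_prod_simps)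
    then show "w (fst p) (snd p) \<in> ?T" using x(2) shom_in[of "JS j" Y w] unfolding hprob_def by blast
   qed
   ultimately show "x \<in> ?G ` ((?I \<rightarrow>\<^sub>E ?S) \<times> (?I' \<rightarrow>\<^sub>E ?T))"
    by (intro image_eqI[of x ?G "?R u w"] SigmaI) (simp only:)
  qed
  then show ?thesis by (rule lepoll_image) (intro idem_prod[OF L] idem_PiE[OF L] c S T)
 qed
 have 5: "(\<Union>j. \<Union>z\<in>{z \<in> smp (JS j) n. z \<notin> HB j n}. {F j u w n z | u w. hprob E Y q j u w \<and> (\<forall>d\<le>n. \<forall>y\<in>HB j d. u d y \<in> St k d)}) \<lesssim> L"
  by (intro idem_UN[OF L] 4) (auto intro!: countable_finite finite_subset[OF _ finite_JS] simp del: sset_prod_simps)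
 show ?case unfolding stage.simps by (intro idem_Un[OF L] 1 2 3 5)
qed

lemma clo_small:
 assumes U: "set_universe U" and "!!n. small U (A n)" "!!n. small U (smp Y n)"
 shows "small U (clo n)"
proof -
 have "\<exists>L\<in>U. idem L \<and> (\<forall>i\<in>{..n} <+> {..Suc n}. (case i of Inl i => Inl ` A i | Inr i => Inr ` smp Y i) \<lesssim> L)"
  by (rule idem_common[OF U]) (auto split: sum.splits intro!: small_image assms)
 then obtain L where L: "L \<in> U" "idem L" "\<forall>i\<in>{..n} <+> {..Suc n}. (case i of Inl i => Inl ` A i | Inr i => Inr ` smp Y i) \<lesssim> L" by blast
 have 1: "A i \<lesssim> L" if "i \<le> n" for i
  using bspec[OF L(3), of "Inl i"] that by auto
 have 2: "smp Y i \<lesssim> L" if "i \<le> Suc n" for i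
  using bspec[OF L(3), of "Inr i"] that by auto
 have "clo n \<lesssim> L" unfolding clo_def
  by (rule idem_UN[OF L(2)]) (use stage_small[OF L(2) 1 2, of n] in auto)
 then show ?thesis using L(1) by (auto simp: small_def)
qed

end

text \<open>S is a small replacement for the free fibrant object on A over Y; H deforms the latter into S.\<close>

definition srep :: "'a sset => 'y sset => (nat => 'a => 'y) => (nat => ('a, 'y) tm set) => bool" where
 "srep A Y f S \<longleftrightarrow> subc (free A Y f) S \<and> (\<forall>n. Leaf ` smp A n \<subseteq> S n) \<and> nfib (res (free A Y f) S) Y (tq f) \<and>
   (\<exists>H. shom (cyl (free A Y f)) (free A Y f) H \<and> (\<forall>n. \<forall>e\<in>smp (free A Y f) n. H n (zero n, e) \<in> S n \<and> H n (one n, e) = e) \<and>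
    (\<forall>n. \<forall>t\<in>smp J n. \<forall>a\<in>smp A n. H n (t, Leaf a) = Leaf a) \<and> (\<forall>n. \<forall>t\<in>smp J n. \<forall>s\<in>S n. H n (t, s) \<in> S n))"

text \<open>Two closures are taken. The first, S0, is a fibrant target for a retraction r of the
  free object. By uniqueness r is homotopic to the identity, and the second closure includes this
  homotopy H among its operations, so that H restricts to S.\<close>

lemma srep_exists:
 fixes A :: "'a sset" and Y :: "'y sset"
 assumes U: "set_universe U" and A: "ss A" and f: "shom A Y f" and Y: "jfib Y"
  and As: "!!n. small U (smp A n)" and Ys: "!!n. small U (smp Y n)"
 obtains S where "srep A Y f S" "!!n. small U (S n)"
proof -
 let ?E = "free A Y f"
 have q: "nfib ?E Y (tq f)" by (rule nfib_free[OF A jfib_ss[OF Y] f])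
 have E: "ss ?E" using nfib_ss(1)[OF q] .
 obtain F where F: "cfill ?E Y (tq f) F" using cfill_exists[OF q Y] .
 have A0: "subc ?E (%n. Leaf ` smp A n)" by (rule subc_Leaf[OF A])
 have A0s: "small U (Leaf ` smp A n :: ('a, 'y) tm set)" for n using small_lepoll[OF As image_lepoll] .
 have sH: "shom (cyl ?E) ?E (%n. snd)" by (rule shom_snd)
 define S0 where "S0 = clo ?E Y (tq f) F (%n. snd) (%n. Leaf ` smp A n)"
 have S0: "subc ?E S0" "!!n. Leaf ` smp A n \<subseteq> S0 n" "nfib (res ?E S0) Y (tq f)" "!!n. small U (S0 n)"
  unfolding S0_def using clo(1,2)[OF q F sH A0] clo_nfib[OF q F sH A0] clo_small[OF q F sH A0 U A0s Ys] by auto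
 have L: "lft (res ?E S0) pt (%_ _. ()) ?E (%n. {s \<in> smp ?E n. s \<in> Leaf ` smp A n})"
  by (rule free_ext[OF A nfib_id[OF E] A0 _ csat_Leaf]) (use nfib_jfib[OF S0(3) Y] in "auto simp: jfib_def")
 have seq: "(%n. {s \<in> smp ?E n. s \<in> Leaf ` smp A n}) = (%n. Leaf ` smp A n)"
  using subc_sub[OF A0] by auto
 have id0: "shom (res ?E (%n. Leaf ` smp A n)) (res ?E S0) (%n x. x)"
  using S0(2) by (auto simp: shom_def)
 obtain r where r: "shom ?E (res ?E S0) r" "!!n x. x \<in> Leaf ` smp A n ==> r n x = x"
  using lft_ex[OF L[unfolded seq] id0 shom_pt] by auto
 have "htp ?E (%n. {s \<in> smp ?E n. s \<in> Leaf ` smp A n}) ?E r (%n x. x)"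
  by (rule free_unique[OF A nfib_id[OF E] A0 _ csat_Leaf nfib_jfib[OF q Y] shom_from_res[OF r(1) S0(1)] shom_ident])
    (use r(2) in auto)
 then have hh: "htp ?E (%n. Leaf ` smp A n) ?E r (%n x. x)" unfolding seq .
 obtain H where H: "shom (cyl ?E) ?E H" "!!n x. x \<in> smp ?E n ==> H n (zero n, x) = r n x"
  "!!n x. x \<in> smp ?E n ==> H n (one n, x) = x" "!!n t x. t \<in> smp J n ==> x \<in> Leaf ` smp A n ==> H n (t, x) = r n x"
  using htpE[OF hh] by metis
 define S where "S = clo ?E Y (tq f) F H S0"
 have S: "subc ?E S" "!!n. S0 n \<subseteq> S n" "!!n t s. t \<in> smp J n ==> s \<in> S n ==> H n (t, s) \<in> S n" "nfib (res ?E S) Y (tq f)" "!!n. small U (S n)"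
  unfolding S_def using clo[OF q F H(1) S0(1)] clo_nfib[OF q F H(1) S0(1)] clo_small[OF q F H(1) S0(1) U S0(4) Ys] by auto
 have "srep A Y f S"
  unfolding srep_def
 proof (intro conjI exI[of _ H] allI ballI)
  show "Leaf ` smp A n \<subseteq> S n" for n using S(2) S0(2) by blast
  show "H n (zero n, e) \<in> S n" if "e \<in> smp ?E n" for n e using H(2)[OF that] shom_in[OF r(1) that] S(2) by auto
  show "H n (t, Leaf a) = Leaf a" if "t \<in> smp J n" "a \<in> smp A n" for n t a using H(4)[OF that(1)] r(2) that(2) by auto
 qed (use S H in auto)
 then show ?thesis using that S(5) by blast
qed

lemma srep_ext:
 assumes A: "ss A" and f: "shom A Y f" and S: "srep A Y f S" and Z: "jfib Z" and g: "shom A Z g"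
 obtains h where "shom (res (free A Y f) S) Z h" "!!n a. a \<in> smp A n ==> h n (Leaf a) = g n a"
proof -
 let ?E = "free A Y f"
 have A0: "subc ?E (%n. Leaf ` smp A n)" by (rule subc_Leaf[OF A])
 have seq: "(%n. {s \<in> smp ?E n. s \<in> Leaf ` smp A n}) = (%n. Leaf ` smp A n)"
  using subc_sub[OF A0] by auto
 have L: "lft Z pt (%_ _. ()) ?E (%n. Leaf ` smp A n)"
  using free_ext[OF A nfib_id[OF ss_free[OF A]] A0 _ csat_Leaf Z[unfolded jfib_def]] unfolding seq by blast
 have g': "shom (res ?E (%n. Leaf ` smp A n)) Z (%n t. case t of Leaf a => g n a | _ => undefined)"
  using g by (auto simp: shom_def)
 obtain h where h: "shom ?E Z h" "!!n a. a \<in> smp A n ==> h n (Leaf a) = g n a"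
  using lft_ex[OF L g' shom_pt] by auto
 show ?thesis
  by (rule that[of h]) (use shom_res[OF h(1)] subc_sub S h(2) in "auto simp: srep_def subc_def")
qed

text \<open>f1 and f2 are compared after the retraction r of the free object, where
  \<open>free_unique\<close> applies. Since S is invariant under H, each of them is homotopic to its
  composite with r.\<close>

lemma srep_unique:
 assumes A: "ss A" and f: "shom A Y f" and S: "srep A Y f S" and Z: "jfib Z"
  and f1: "shom (res (free A Y f) S) Z f1" and f2: "shom (res (free A Y f) S) Z f2"
  and eq: "!!n a. a \<in> smp A n ==> f1 n (Leaf a) = f2 n (Leaf a)"
 shows "htp (res (free A Y f) S) (%n. Leaf ` smp A n) Z f1 f2"
proof -
 let ?E = "free A Y f"
 have E: "ss ?E" by (rule ss_free[OF A])
 have A0: "subc ?E (%n. Leaf ` smp A n)" by (rule subc_Leaf[OF A])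
 have Ss: "subc ?E S" and SL: "!!n. Leaf ` smp A n \<subseteq> S n" using S by (auto simp: srep_def)
 have seq: "(%n. {s \<in> smp ?E n. s \<in> Leaf ` smp A n}) = (%n. Leaf ` smp A n)"
  using subc_sub[OF A0] by auto
 obtain H where H: "shom (cyl ?E) ?E H" "!!n e. e \<in> smp ?E n ==> H n (zero n, e) \<in> S n \<and> H n (one n, e) = e"
    "!!n t a. t \<in> smp J n ==> a \<in> smp A n ==> H n (t, Leaf a) = Leaf a" "!!n t s. t \<in> smp J n ==> s \<in> S n ==> H n (t, s) \<in> S n"
 proof -
  from S have "\<exists>H. shom (cyl ?E) ?E H \<and> (\<forall>n. \<forall>e\<in>smp ?E n. H n (zero n, e) \<in> S n \<and> H n (one n, e) = e) \<and>
    (\<forall>n. \<forall>t\<in>smp J n. \<forall>a\<in>smp A n. H n (t, Leaf a) = Leaf a) \<and> (\<forall>n. \<forall>t\<in>smp J n. \<forall>s\<in>S n. H n (t, s) \<in> S n)"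
   unfolding srep_def by (elim conjE)
  then show ?thesis using that by (elim exE conjE) (simp del: free_simps)
 qed
 let ?S = "res ?E S"
 have Sss: "ss ?S" by (rule ss_res[OF E Ss])
 have sub: "subc ?S (%n. Leaf ` smp A n)" by (rule subc_res[OF A0 Ss SL])
 have Se: "s \<in> smp ?E n" if "s \<in> S n" for s n using subc_sub[OF Ss that] .
 define r where "r n e = H n (zero n, e)" for n e
 have z: "shom ?E (cyl ?E) (%n e. (zero n, e))" by (auto simp: shom_def)
 have r: "shom ?E ?S r" unfolding r_def by (rule shom_into_res[OF shom_comp[OF z H(1)]]) (use H(2) in auto)
 have "htp ?E (%n. {s \<in> smp ?E n. s \<in> Leaf ` smp A n}) Z (%n x. f1 n (r n x)) (%n x. f2 n (r n x))"
  by (rule free_unique[OF A nfib_id[OF E] A0 _ csat_Leaf Z shom_comp[OF r f1] shom_comp[OF r f2]])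
    (use H(3) eq in "auto simp: r_def")
 then have "htp ?E (%n. Leaf ` smp A n) Z (%n x. f1 n (r n x)) (%n x. f2 n (r n x))" unfolding seq .
 then have mid: "htp ?S (%n. Leaf ` smp A n) Z (%n x. f1 n (r n x)) (%n x. f2 n (r n x))"
  by (rule htp_pre[where k = "%n x. x"]) (use Se in "auto simp: shom_def simp del: free_simps(1)")
 have HS: "shom (cyl ?S) ?S H" using H(1,4) Se by (auto simp: shom_def simp del: free_simps(1))
 have side: "htp ?S (%n. Leaf ` smp A n) Z (%n x. g n (r n x)) g" if "shom ?S Z g" for g
  by (rule htpI[OF shom_comp[OF HS that]]) (use H(2,3) Se in "auto simp: r_def simp del: free_simps(1)")
 show ?thesis
  by (rule htp_trans[OF Z Sss sub htp_sym[OF side[OF f1] sub] htp_trans[OF Z Sss sub mid side[OF f2]]])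
qed

section \<open>Weak equivalences\<close>

abbreviation no :: "nat => 'a set" where "no == %_. {}"

definition weqZ :: "'z sset => 'a sset => 'b sset => (nat => 'a => 'b) => bool" where
 "weqZ Z A B f \<longleftrightarrow> (\<forall>g. shom A Z g --> (\<exists>h. shom B Z h \<and> htp A no Z (%n x. h n (f n x)) g)) \<and>
   (\<forall>h1 h2. shom B Z h1 --> shom B Z h2 --> htp A no Z (%n x. h1 n (f n x)) (%n x. h2 n (f n x)) --> htp B no Z h1 h2)"

lemma weqZ_ex: "weqZ Z A B f ==> shom A Z g ==> \<exists>h. shom B Z h \<and> htp A no Z (%n x. h n (f n x)) g"
 by (auto simp: weqZ_def)

lemma weqZ_exE:
 assumes "weqZ Z A B f" "shom A Z g"
 obtains h where "shom B Z h" "htp A no Z (%n x. h n (f n x)) g"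
 using weqZ_ex[OF assms] by (elim exE conjE)

lemma weqZ_un: "weqZ Z A B f ==> shom B Z h1 ==> shom B Z h2 ==>
  htp A no Z (%n x. h1 n (f n x)) (%n x. h2 n (f n x)) ==> htp B no Z h1 h2"
 by (auto simp: weqZ_def)

lemma weqZ_I:
 assumes "!!g. shom A Z g ==> \<exists>h. shom B Z h \<and> htp A no Z (%n x. h n (f n x)) g"
  "!!h1 h2. shom B Z h1 ==> shom B Z h2 ==> htp A no Z (%n x. h1 n (f n x)) (%n x. h2 n (f n x)) ==> htp B no Z h1 h2"
 shows "weqZ Z A B f"
 using assms unfolding weqZ_def by blast

lemma htp_pre0: "htp X C Z f g ==> shom X' X k ==> htp X' no Z (%n x. f n (k n x)) (%n x. g n (k n x))"
 by (rule htp_pre) auto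

context
 fixes Z :: "'z sset" and A :: "'a sset" and B :: "'b sset" and C :: "'c sset" and f g
 assumes Z: "jfib Z" and A: "ss A" and B: "ss B" and C: "ss C"
  and f: "shom A B f" and g: "shom B C g"
begin

lemma weqZ_comp:
 assumes wf: "weqZ Z A B f" and wg: "weqZ Z B C g"
 shows "weqZ Z A C (%n x. g n (f n x))"
proof (rule weqZ_I)
 fix k assume k: "shom A Z k"
 obtain h where h: "shom B Z h" "htp A no Z (%n x. h n (f n x)) k" by (rule weqZ_exE[OF wf k])
 obtain l where l: "shom C Z l" "htp B no Z (%n x. l n (g n x)) h" by (rule weqZ_exE[OF wg h(1)])
 show "\<exists>h. shom C Z h \<and> htp A no Z (%n x. h n (g n (f n x))) k"
  using l(1) htp_trans[OF Z A subc_empty htp_pre0[OF l(2) f] h(2)] by blast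
next
 fix h1 h2 assume h: "shom C Z h1" "shom C Z h2" "htp A no Z (%n x. h1 n (g n (f n x))) (%n x. h2 n (g n (f n x)))"
 have "htp B no Z (%n x. h1 n (g n x)) (%n x. h2 n (g n x))"
  by (rule weqZ_un[OF wf shom_comp[OF g h(1)] shom_comp[OF g h(2)] h(3)])
 then show "htp C no Z h1 h2" by (rule weqZ_un[OF wg h(1,2)])
qed

lemma weqZ_left:
 assumes wf: "weqZ Z A B f" and wgf: "weqZ Z A C (%n x. g n (f n x))"
 shows "weqZ Z B C g"
proof (rule weqZ_I)
 fix k assume k: "shom B Z k"
 obtain h where h: "shom C Z h" "htp A no Z (%n x. h n (g n (f n x))) (%n x. k n (f n x))"
  by (rule weqZ_exE[OF wgf shom_comp[OF f k]])
 show "\<exists>h. shom C Z h \<and> htp B no Z (%n x. h n (g n x)) k"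
  using h(1) weqZ_un[OF wf shom_comp[OF g h(1)] k h(2)] by blast
next
 fix h1 h2 assume h: "shom C Z h1" "shom C Z h2" "htp B no Z (%n x. h1 n (g n x)) (%n x. h2 n (g n x))"
 show "htp C no Z h1 h2" by (rule weqZ_un[OF wgf h(1,2) htp_pre0[OF h(3) f]])
qed

lemma weqZ_right:
 assumes wg: "weqZ Z B C g" and wgf: "weqZ Z A C (%n x. g n (f n x))"
 shows "weqZ Z A B f"
proof (rule weqZ_I)
 fix k assume k: "shom A Z k"
 obtain h where h: "shom C Z h" "htp A no Z (%n x. h n (g n (f n x))) k" by (rule weqZ_exE[OF wgf k])
 show "\<exists>h. shom B Z h \<and> htp A no Z (%n x. h n (f n x)) k"
  by (intro exI[of _ "%n x. h n (g n x)"] conjI shom_comp[OF g h(1)] h(2))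
next
 fix h1 h2 assume h: "shom B Z h1" "shom B Z h2" "htp A no Z (%n x. h1 n (f n x)) (%n x. h2 n (f n x))"
 obtain l1 where l1: "shom C Z l1" "htp B no Z (%n x. l1 n (g n x)) h1" by (rule weqZ_exE[OF wg h(1)])
 obtain l2 where l2: "shom C Z l2" "htp B no Z (%n x. l2 n (g n x)) h2" by (rule weqZ_exE[OF wg h(2)])
 note t = htp_trans[OF Z A subc_empty] and s = htp_sym[OF _ subc_empty]
 have a: "htp A no Z (%n x. l1 n (g n (f n x))) (%n x. h1 n (f n x))" by (rule htp_pre0[OF l1(2) f])
 have b: "htp A no Z (%n x. l2 n (g n (f n x))) (%n x. h2 n (f n x))" by (rule htp_pre0[OF l2(2) f])
 have "htp A no Z (%n x. l1 n (g n (f n x))) (%n x. l2 n (g n (f n x)))"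
  by (rule t[OF a t[OF h(3) s[OF b]]])
 then have "htp C no Z l1 l2" by (rule weqZ_un[OF wgf l1(1) l2(1)])
 note t' = htp_trans[OF Z B subc_empty]
 have c: "htp B no Z (%n x. l1 n (g n x)) (%n x. l2 n (g n x))" by (rule htp_pre0[OF \<open>htp C no Z l1 l2\<close> g])
 show "htp B no Z h1 h2"
  by (rule t'[OF s[OF l1(2)] t'[OF c l2(2)]])
qed

end

lemma weqZ_cong:
 assumes w: "weqZ Z A B f" and e: "!!n x. x \<in> smp A n ==> f n x = f' n x"
 shows "weqZ Z A B f'"
proof (rule weqZ_I)
 fix g assume "shom A Z g"
 then obtain h where h: "shom B Z h" "htp A no Z (%n x. h n (f n x)) g" by (rule weqZ_exE[OF w])
 have "htp A no Z (%n x. h n (f' n x)) g" by (rule htp_cong[OF h(2) _ _ subc_empty]) (auto simp: e)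
 then show "\<exists>h. shom B Z h \<and> htp A no Z (%n x. h n (f' n x)) g" using h(1) by blast
next
 fix h1 h2 assume h: "shom B Z h1" "shom B Z h2" "htp A no Z (%n x. h1 n (f' n x)) (%n x. h2 n (f' n x))"
 show "htp B no Z h1 h2" by (rule weqZ_un[OF w h(1,2) htp_cong[OF h(3) _ _ subc_empty]]) (auto simp: e)
qed

lemma weqZ_hequiv:
 assumes Z: "jfib Z" and A: "ss A" and B: "ss B" and f: "shom A B f" and s: "shom B A s"
  and fs: "!!n x. x \<in> smp B n ==> f n (s n x) = x" and sf: "htp A no A (%n x. s n (f n x)) (%n x. x)"
 shows "weqZ Z A B f"
proof (rule weqZ_I)
 fix g assume g: "shom A Z g"
 show "\<exists>h. shom B Z h \<and> htp A no Z (%n x. h n (f n x)) g"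
  using shom_comp[OF s g] htp_post[OF sf g] by blast
next
 fix h1 h2 assume h: "shom B Z h1" "shom B Z h2" "htp A no Z (%n x. h1 n (f n x)) (%n x. h2 n (f n x))"
 show "htp B no Z h1 h2" by (rule htp_cong[OF htp_pre0[OF h(3) s] _ _ subc_empty]) (auto simp: fs)
qed

lemma weqZ_iso:
 assumes "jfib Z" "ss A" "ss B" "shom A B f" "shom B A s"
  "!!n x. x \<in> smp B n ==> f n (s n x) = x" "!!n x. x \<in> smp A n ==> s n (f n x) = x"
 shows "weqZ Z A B f"
proof -
 have "htp A no A (%n x. s n (f n x)) (%n x. x)"
  by (rule htp_cong[OF htp_refl[OF shom_ident] _ _ subc_empty]) (auto simp: assms(7))
 with assms(1-6) show ?thesis by (intro weqZ_hequiv[of Z A B f s])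
qed

lemma weqZ_retract:
 assumes Z: "jfib Z" and A: "ss A" and B: "ss B" and g: "weqZ Z A' B' g" and gs: "shom A' B' g" and fs: "shom A B f"
  and i: "shom A A' i" and r: "shom A' A r" and i': "shom B B' i'" and r': "shom B' B r'"
  and ri: "!!n x. x \<in> smp A n ==> r n (i n x) = x" and ri': "!!n x. x \<in> smp B n ==> r' n (i' n x) = x"
  and gi: "!!n x. x \<in> smp A n ==> g n (i n x) = i' n (f n x)" and fr: "!!n x. x \<in> smp A' n ==> f n (r n x) = r' n (g n x)"
 shows "weqZ Z A B f"
proof (rule weqZ_I)
 fix k assume k: "shom A Z k"
 obtain h where h: "shom B' Z h" "htp A' no Z (%n x. h n (g n x)) (%n x. k n (r n x))"
  by (rule weqZ_exE[OF g shom_comp[OF r k]])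
 have "htp A no Z (%n x. h n (i' n (f n x))) k"
  by (rule htp_cong[OF htp_pre0[OF h(2) i] _ _ subc_empty]) (auto simp: gi ri)
 then show "\<exists>h. shom B Z h \<and> htp A no Z (%n x. h n (f n x)) k" using shom_comp[OF i' h(1)] by blast
next
 fix h1 h2 assume h: "shom B Z h1" "shom B Z h2" "htp A no Z (%n x. h1 n (f n x)) (%n x. h2 n (f n x))"
 have "htp A' no Z (%n x. h1 n (r' n (g n x))) (%n x. h2 n (r' n (g n x)))"
  by (rule htp_cong[OF htp_pre0[OF h(3) r] _ _ subc_empty]) (auto simp: fr)
 then have "htp B' no Z (%n x. h1 n (r' n x)) (%n x. h2 n (r' n x))"
  by (rule weqZ_un[OF g shom_comp[OF r' h(1)] shom_comp[OF r' h(2)]])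
 from htp_pre0[OF this i'] show "htp B no Z h1 h2" by (rule htp_cong[OF _ _ _ subc_empty]) (auto simp: ri')
qed

lemma lft_pt_ex:
 assumes "lft Z pt (%_ _. ()) D C" "shom (res D C) Z g"
 shows "\<exists>h. shom D Z h \<and> (\<forall>n. \<forall>x\<in>C n. h n x = g n x)"
 using lft_ex[OF assms shom_pt[of _ "%_ _. ()"]] by auto

text \<open>Homotopy extension property: an extension of g up to homotopy can be corrected to a
  strict one.\<close>

lemma jfib_ext_box:
 assumes Z: "jfib Z" and B: "ss B" and A: "subc B A" and h: "shom B Z h" and g: "htp (res B A) no Z h g"
 obtains k where "shom B Z k" "htp B no Z h k" "!!n x. x \<in> A n ==> k n x = g n x"
proof -
 obtain G where G: "shom (cyl (res B A)) Z G" "!!n x. x \<in> smp (res B A) n ==> G n (zero n, x) = h n x"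
  "!!n x. x \<in> smp (res B A) n ==> G n (one n, x) = g n x" using htpE[OF g] by metis
 obtain K where K: "shom (cyl B) Z K" "!!n t x. t \<in> smp J n ==> x \<in> A n ==> K n (t, x) = G n (t, x)"
  "!!n x. x \<in> smp B n ==> K n (zero n, x) = h n x"
  by (rule box_use[OF Z[unfolded jfib_def] B A shom_pt G(1) h]) (use G(2) in auto)
 have o: "shom B (cyl B) (%n x. (one n, x))" by (auto simp: shom_def)
 show ?thesis
  by (rule that[OF shom_comp[OF o K(1)] htpI[OF K(1)]]) (use K(2,3) G(3) in auto)
qed

text \<open>Strict extension, and uniqueness for maps that agree strictly on A, are enough, since
  agreement up to homotopy is rectified by \<open>jfib_ext_box\<close>.\<close>

lemma mono_weqZ:
 assumes Z: "jfib Z" and B: "ss B" and A: "subc B A" and l: "lft Z pt (%_ _. ()) B A"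
  and u: "!!h1 h2. shom B Z h1 ==> shom B Z h2 ==> (!!n x. x \<in> A n ==> h1 n x = h2 n x) ==> htp B no Z h1 h2"
 shows "weqZ Z (res B A) B (%n x. x)"
proof (rule weqZ_I)
 fix g assume g: "shom (res B A) Z g"
 obtain h where h: "shom B Z h" "!!n x. x \<in> A n ==> h n x = g n x" using lft_ex[OF l g shom_pt] by auto
 have "htp (res B A) no Z h g" by (rule htp_cong[OF htp_refl[OF g] _ _ subc_empty]) (auto simp: h(2))
 then show "\<exists>h. shom B Z h \<and> htp (res B A) no Z h g" using h(1) by blast
next
 fix h1 h2 assume h: "shom B Z h1" "shom B Z h2" "htp (res B A) no Z h1 h2"
 obtain k where k: "shom B Z k" "htp B no Z h1 k" "!!n x. x \<in> A n ==> k n x = h2 n x"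
  using jfib_ext_box[OF Z B A h(1,3)] by blast
 show "htp B no Z h1 h2" by (rule htp_trans[OF Z B subc_empty k(2) u[OF k(1) h(2) k(3)]])
qed

lemma weqZ_lft:
 assumes Z: "jfib Z" and B: "ss B" and A: "subc B A" and w: "weqZ Z (res B A) B (%n x. x)"
 shows "lft Z pt (%_ _. ()) B A"
proof (rule lftI)
 fix g and w' :: "nat => 'b => unit" assume g: "shom (res B A) Z g"
 obtain h where h: "shom B Z h" "htp (res B A) no Z h g" by (rule weqZ_exE[OF w g])
 obtain k where "shom B Z k" "!!n x. x \<in> A n ==> k n x = g n x" using jfib_ext_box[OF Z B A h] by blast
 then show "\<exists>h. shom B Z h \<and> (\<forall>n. \<forall>x\<in>smp B n. () = w' n x) \<and> (\<forall>n. \<forall>x\<in>A n. h n x = g n x)" by auto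
qed

section \<open>Trivial cofibrations\<close>

abbreviation R :: "'a sset => ('a, unit) tm sset" where "R X == free X pt (%_ _. ())"

lemma jfib_R: "ss X ==> jfib (R X)"
proof -
 assume "ss X"
 then have "nfib (R X) pt (tq (%_ _. ()))" by (rule nfib_free) auto
 moreover have "tq (%_ _. ()) = (%(_::nat) (_::('a, unit) tm). ())" by (simp add: fun_eq_iff)
 ultimately show ?thesis unfolding jfib_def by simp
qed

lemma free_ext1:
 assumes A: "ss A" and q: "jfib Z" and g: "shom A Z g"
 obtains h where "shom (free A Y f) Z h" "!!n a. a \<in> smp A n ==> h n (Leaf a) = g n a"
proof -
 let ?E = "free A Y f"
 have A0: "subc ?E (%n. Leaf ` smp A n)" by (rule subc_Leaf[OF A])
 have seq: "(%n. {s \<in> smp ?E n. s \<in> Leaf ` smp A n}) = (%n. Leaf ` smp A n)" using subc_sub[OF A0] by auto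
 have L: "lft Z pt (%_ _. ()) ?E (%n. Leaf ` smp A n)"
  using free_ext[OF A nfib_id[OF ss_free[OF A]] A0 _ csat_Leaf q[unfolded jfib_def]] unfolding seq by blast
 have g': "shom (res ?E (%n. Leaf ` smp A n)) Z (%n t. case t of Leaf a => g n a | _ => undefined)"
  using g by (auto simp: shom_def)
 obtain h where "shom ?E Z h" "!!n a. a \<in> smp A n ==> h n (Leaf a) = g n a" using lft_ex[OF L g' shom_pt] by auto
 then show ?thesis using that by blast
qed

lemma free_unique1:
 assumes A: "ss A" and Z: "jfib Z" and f1: "shom (free A Y f) Z f1" and f2: "shom (free A Y f) Z f2"
  and eq: "!!n a. a \<in> smp A n ==> f1 n (Leaf a) = f2 n (Leaf a)"
 shows "htp (free A Y f) (%n. Leaf ` smp A n) Z f1 f2"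
proof -
 let ?E = "free A Y f"
 have A0: "subc ?E (%n. Leaf ` smp A n)" by (rule subc_Leaf[OF A])
 have seq: "(%n. {s \<in> smp ?E n. s \<in> Leaf ` smp A n}) = (%n. Leaf ` smp A n)" using subc_sub[OF A0] by auto
 have "htp ?E (%n. {s \<in> smp ?E n. s \<in> Leaf ` smp A n}) Z f1 f2"
  by (rule free_unique[OF A nfib_id[OF ss_free[OF A]] A0 _ csat_Leaf Z f1 f2]) (use eq in auto)
 then show ?thesis unfolding seq .
qed

lemma tact_res [simp]: "tact (res B C) = tact B"
 by (auto simp: tact_def fun_eq_iff split: tm.splits)

lemma wf_res_mono: "wf (res B C) Y f n t ==> (!!n. C n \<subseteq> C' n) ==> wf (res B C') Y f n t"
proof (induction rule: wf.induct)
 case (wf_Leaf a n)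
 then have "a \<in> C' n" by auto
 then show ?case by (auto intro: wf.wf_Leaf)
next
 case (wf_Cell j u w y n) show ?case by (rule wf.wf_Cell) (use wf_Cell in auto)
qed

text \<open>Terms over a subcomplex are themselves terms of B, so the free construction commutes
  with intersections. This is what makes the restriction of trivial cofibrations to subcomplexes in
  \<open>tc_countable\<close> possible.\<close>

lemma wf_res_Int: "wf (res B C) Y f n t ==> wf (res B C') Y f n t ==> wf (res B (%n. C n \<inter> C' n)) Y f n t"
proof (induction rule: wf.induct)
 case (wf_Leaf a n) then show ?case by (auto intro!: wf.wf_Leaf elim: wf.cases)
next
 case (wf_Cell j u w y n)
 from wf_Cell.prems have "!!d z. z \<in> HB j d ==> wf (res B C') Y f d (u d z)" by (auto elim: wf.cases)
 then show ?case by (intro wf.wf_Cell) (use wf_Cell in auto)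
qed

lemma wf_res_self: "wf (res B C) Y f n t ==> subc B C ==> wf B Y f n t"
 using wf_res_mono[of B C Y f n t "smp B"] by (simp add: subc_def)

lemma subc_R: "ss B ==> subc B A ==> subc (R B) (smp (R (res B A)))"
 using ss_act[OF ss_free[OF ss_res]] by (auto simp: subc_def[of "R B"] wf_res_self)

text \<open>In contrast to lifting against all J-fibrant objects, this is a single piece of data.
  Its values at one simplex are finitely many terms, which involve countably many simplices of B, so
  it restricts to suitable countable subcomplexes.\<close>

definition tcdata where
 "tcdata B A \<rho> H \<longleftrightarrow> shom B (R (res B A)) \<rho> \<and> (\<forall>n. \<forall>a\<in>A n. \<rho> n a = Leaf a) \<and> shom (cyl B) (R B) H \<and>
   (\<forall>n. \<forall>b\<in>smp B n. H n (zero n, b) = \<rho> n b \<and> H n (one n, b) = Leaf b) \<and> (\<forall>n. \<forall>t\<in>smp J n. \<forall>a\<in>A n. H n (t, a) = Leaf a)"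

definition tc :: "'a sset => (nat => 'a set) => bool" where
 "tc B A \<longleftrightarrow> ss B \<and> subc B A \<and> (\<exists>\<rho> H. tcdata B A \<rho> H)"

lemma shom_R_sub: "ss B ==> subc B A ==> shom (R (res B A)) (R B) (%n x. x)"
 by (auto simp: shom_def wf_res_self)

text \<open>Maps to Z extend to the free objects. Precomposing an extension to
  \<open>R (res B A)\<close> with \<rho> gives existence; uniqueness on that object, transported
  along H, gives the homotopy.\<close>

lemma tc_ext:
 assumes t: "tc B A" and Z: "jfib Z"
 shows "lft Z pt (%_ _. ()) B A" "shom B Z f1 ==> shom B Z f2 ==> (!!n x. x \<in> A n ==> f1 n x = f2 n x) ==> htp B A Z f1 f2"
proof -
 have B: "ss B" and A: "subc B A" using t by (auto simp: tc_def)
 obtain \<rho> H where d: "tcdata B A \<rho> H" using t by (auto simp: tc_def)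
 have \<rho>: "shom B (R (res B A)) \<rho>" "!!n a. a \<in> A n ==> \<rho> n a = Leaf a" using d by (auto simp: tcdata_def)
 have H: "shom (cyl B) (R B) H" "!!n b. b \<in> smp B n ==> H n (zero n, b) = \<rho> n b" "!!n b. b \<in> smp B n ==> H n (one n, b) = Leaf b"
  "!!n t a. t \<in> smp J n ==> a \<in> A n ==> H n (t, a) = Leaf a" using d by (auto simp: tcdata_def)
 have A': "ss (res B A)" by (rule ss_res[OF B A])
 have \<rho>': "shom B (R B) \<rho>" by (rule shom_comp[OF \<rho>(1) shom_R_sub[OF B A]])
 show "lft Z pt (%_ _. ()) B A"
 proof (rule lftI)
  fix g and w :: "nat => 'a => unit" assume g: "shom (res B A) Z g"
  obtain h where h: "shom (R (res B A)) Z h" "!!n a. a \<in> smp (res B A) n ==> h n (Leaf a) = g n a"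
   using free_ext1[OF A' Z g] by blast
  show "\<exists>h. shom B Z h \<and> (\<forall>n. \<forall>x\<in>smp B n. () = w n x) \<and> (\<forall>n. \<forall>x\<in>A n. h n x = g n x)"
   using shom_comp[OF \<rho>(1) h(1)] h(2) \<rho>(2) by (intro exI[of _ "%n x. h n (\<rho> n x)"]) auto
 qed
 assume f: "shom B Z f1" "shom B Z f2" "!!n x. x \<in> A n ==> f1 n x = f2 n x"
 obtain h1 where h1: "shom (R B) Z h1" "!!n a. a \<in> smp B n ==> h1 n (Leaf a) = f1 n a" using free_ext1[OF B Z f(1)] by blast
 obtain h2 where h2: "shom (R B) Z h2" "!!n a. a \<in> smp B n ==> h2 n (Leaf a) = f2 n a" using free_ext1[OF B Z f(2)] by blast
 have As: "x \<in> smp B n" if "x \<in> A n" for x n using subc_sub[OF A that] .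
 have "htp (R (res B A)) (%n. Leaf ` smp (res B A) n) Z h1 h2"
  by (rule free_unique1[OF A' Z shom_comp[OF shom_R_sub[OF B A] h1(1)] shom_comp[OF shom_R_sub[OF B A] h2(1)]])
    (use h1(2) h2(2) f(3) As in auto)
 then have m: "htp B A Z (%n x. h1 n (\<rho> n x)) (%n x. h2 n (\<rho> n x))"
  by (rule htp_pre[OF _ \<rho>(1)]) (use \<rho>(2) in auto)
 have side: "htp B A Z (%n x. h n (\<rho> n x)) k" if "shom (R B) Z h" "!!n a. a \<in> smp B n ==> h n (Leaf a) = k n a" for h k
  by (rule htpI[OF shom_comp[OF H(1) that(1)]]) (use H that(2) \<rho>(2) in auto)
 show "htp B A Z f1 f2"
  by (rule htp_trans[OF Z B A htp_sym[OF side[OF h1] A] htp_trans[OF Z B A m side[OF h2]]])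
qed

lemma tc_weqZ: "tc B A ==> jfib Z ==> weqZ Z (res B A) B (%n x. x)"
 by (rule mono_weqZ[OF _ _ _ tc_ext(1) htp_mono[OF tc_ext(2)]]) (auto simp: tc_def)

text \<open>E is itself J-fibrant, so g first extends to B regardless of w. The projection of this
  extension and w agree on A, hence are homotopic relative to A, and lifting that homotopy corrects
  the extension.\<close>

lemma tc_nfib:
 assumes t: "tc B A" and q: "nfib E Y q" and Y: "jfib Y"
 shows "lft E Y q B A"
proof (rule lftI)
 have B: "ss B" and A: "subc B A" using t by (auto simp: tc_def)
 fix g w assume g: "shom (res B A) E g" and w: "shom B Y w" and gw: "!!n x. x \<in> A n ==> q n (g n x) = w n x"
 obtain h where h: "shom B E h" "!!n x. x \<in> A n ==> h n x = g n x"
  using lft_ex[OF tc_ext(1)[OF t nfib_jfib[OF q Y]] g shom_pt] by auto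
 have hh: "htp B A Y (%n x. q n (h n x)) w"
  by (rule tc_ext(2)[OF t Y shom_comp[OF h(1) nfib_ss(3)[OF q]] w]) (use h(2) gw in auto)
 obtain G where G: "shom (cyl B) Y G" "!!n x. x \<in> smp B n ==> G n (zero n, x) = q n (h n x)"
  "!!n x. x \<in> smp B n ==> G n (one n, x) = w n x" "!!n t x. t \<in> smp J n ==> x \<in> A n ==> G n (t, x) = q n (h n x)"
  using htpE[OF hh] by metis
 have g': "shom (cyl (res B A)) E (%n z. g n (snd z))" by (rule shom_comp[OF shom_snd g])
 obtain K where K: "shom (cyl B) E K" "!!n t x. t \<in> smp J n ==> x \<in> smp B n ==> q n (K n (t, x)) = G n (t, x)"
   "!!n t x. t \<in> smp J n ==> x \<in> A n ==> K n (t, x) = g n (snd (t, x))"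
  by (rule box_use[OF q B A G(1) g' h(1)]) (use h(2) G in auto)
 have o: "shom B (cyl B) (%n x. (one n, x))" by (auto simp: shom_def)
 show "\<exists>h. shom B E h \<and> (\<forall>n. \<forall>x\<in>smp B n. q n (h n x) = w n x) \<and> (\<forall>n. \<forall>x\<in>A n. h n x = g n x)"
  by (rule exI[of _ "%n x. K n (one n, x)"]) (use shom_comp[OF o K(1)] K(2,3) G(3) in auto)
qed

text \<open>
 A deformation H of B into R(A) can be made constant on A: the path H(-, b) is followed by the reverse of H(-, \<rho> b),
 and on A the two cancel.
\<close>

lemma tcI:
 assumes B: "ss B" and A: "subc B A" and \<rho>: "shom B (R (res B A)) \<rho>" and \<rho>A: "!!n a. a \<in> A n ==> \<rho> n a = Leaf a"
  and h: "htp B no (R B) (%n. Leaf) \<rho>"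
 shows "tc B A"
proof -
 have As: "x \<in> smp B n" if "x \<in> A n" for x n using subc_sub[OF A that] .
 obtain H where H: "shom (cyl B) (R B) H" "!!n x. x \<in> smp B n ==> H n (zero n, x) = Leaf x"
  "!!n x. x \<in> smp B n ==> H n (one n, x) = \<rho> n x" using htpE[OF h] by metis
 have A': "ss (res B A)" by (rule ss_res[OF B A])
 have RB: "ss (R B)" by (rule ss_free[OF B])
 \<comment> \<open>On this subcomplex a map is prescribed by \<rho> on leaves and the identity on
   terms over A. Its extension r retracts \<open>R B\<close> onto
   \<open>R (res B A)\<close>.\<close>
 let ?C = "%n. Leaf ` smp B n \<union> smp (R (res B A)) n"
 have sC: "subc (R B) ?C" by (rule subc_Un[OF subc_Leaf[OF B] subc_R[OF B A]])
 have csC: "csat ?C"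
  unfolding csat_def by (auto intro: wf.intros elim!: wf.cases)
 have L: "lft (R (res B A)) pt (%_ _. ()) (R B) (%n. {s \<in> smp (R B) n. s \<in> ?C n})"
  by (rule free_ext[OF B nfib_id[OF RB] sC _ csC]) (use jfib_R[OF A'] in "auto simp: jfib_def")
 have Ce: "(%n. {s \<in> smp (R B) n. s \<in> ?C n}) = ?C" using subc_sub[OF sC] by blast
 have LA: "Leaf b \<in> smp (R (res B A)) n \<longleftrightarrow> b \<in> A n" for b n by (auto intro: wf_Leaf elim: wf.cases)
 define r0 where "r0 n s = (if s \<in> smp (R (res B A)) n then s else case s of Leaf b => \<rho> n b | _ => undefined)" for n s
 have r0: "r0 n (Leaf b) = \<rho> n b" for n b using \<rho>A LA[of b n] by (simp add: r0_def del: free_simps)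
 have "shom (res (R B) ?C) (R (res B A)) r0"
 proof (rule shomI)
  fix n x assume "x \<in> smp (res (R B) ?C) n"
  then show "r0 n x \<in> smp (R (res B A)) n" using r0 shom_in[OF \<rho>] by (auto simp: r0_def simp del: free_simps)
 next
  fix m n \<alpha> x assume a: "\<alpha> \<in> ops m n" and "x \<in> smp (res (R B) ?C) n"
  then consider (1) b where "x = Leaf b" "b \<in> smp B n" | (2) "x \<in> smp (R (res B A)) n" by (auto simp del: free_simps)
  then show "r0 m (act (res (R B) ?C) m n \<alpha> x) = act (R (res B A)) m n \<alpha> (r0 n x)"
  proof cases
   case 1 then show ?thesis using r0 shom_act[OF \<rho> a] by simp
  next
   case 2 then show ?thesis using ss_act[OF ss_free[OF A'] a 2] by (simp add: r0_def)
  qed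
 qed
 then have r0s: "shom (res (R B) ?C) (R (res B A)) r0" .
 obtain r where r: "shom (R B) (R (res B A)) r" "!!n x. x \<in> ?C n ==> r n x = r0 n x"
  using lft_pt_ex[OF L[unfolded Ce] r0s] by blast
 have r1: "r n (Leaf b) = \<rho> n b" if "b \<in> smp B n" for n b using r(2)[of "Leaf b" n] r0[of n b] that by simp
 have r2: "r n x = x" if "x \<in> smp (R (res B A)) n" for n x using r(2)[of x n] that by (simp add: r0_def)
 \<comment> \<open>The path to be reversed starts at the term \<rho> b, where H is not defined. So H
   is extended from leaves to a homotopy K on all of \<open>R B\<close> from the identity to r; at
   terms over A it is a loop.\<close>
 let ?D = "%n. {(s, l). s \<in> smp (R B) n \<and> l \<in> smp J n \<and> (s \<in> Leaf ` smp B n \<or> l \<in> ends n)}"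
 have L2: "lft (R B) pt (%_ _. ()) (sset_prod (R B) J) ?D"
  by (rule free_lft[OF B nfib_id[OF RB] subc_Leaf[OF B] _ csat_Leaf ss_J subc_ends jfib_R[OF B, unfolded jfib_def]]) auto
 define gg where "gg n z = (if snd z = zero n then fst z else if snd z = one n then r n (fst z) else case fst z of Leaf b => H n (snd z, b) | _ => undefined)" for n z
 have g1: "gg n (Leaf b, t) = H n (t, b)" if "b \<in> smp B n" for n b t using that H r1 by (auto simp: gg_def)
 have rB: "shom (R B) (R B) r" by (rule shom_comp[OF r(1) shom_R_sub[OF B A]])
 have "shom (res (sset_prod (R B) J) ?D) (R B) gg"
 proof (rule shomI)
  fix n x assume x: "x \<in> smp (res (sset_prod (R B) J) ?D) n"
  then show "gg n x \<in> smp (R B) n" using shom_in[OF rB] shom_in[OF H(1)] by (auto simp: gg_def ends_def simp del: free_simps)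
 next
  fix m n \<alpha> x assume a: "\<alpha> \<in> ops m n" and x: "x \<in> smp (res (sset_prod (R B) J) ?D) n"
  obtain s t where xx: "x = (s, t)" by (cases x)
  have "t = zero n \<or> t = one n \<or> (\<exists>b\<in>smp B n. s = Leaf b)" "s \<in> smp (R B) n" "t \<in> smp J n" using x by (auto simp: xx ends_def simp del: free_simps)
  then consider (1) "t = zero n" | (2) "t = one n" | (3) b where "b \<in> smp B n" "s = Leaf b" by blast
  then show "gg m (act (res (sset_prod (R B) J) ?D) m n \<alpha> x) = act (R B) m n \<alpha> (gg n x)"
  proof cases
   case 1 then show ?thesis using a by (simp add: xx gg_def)
  next
   case 2 then show ?thesis using a shom_act[OF rB a \<open>s \<in> smp (R B) n\<close>] by (simp add: xx gg_def)
  next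
   case 3
   have "gg m (Leaf (act B m n \<alpha> b), act J m n \<alpha> t) = H m (act J m n \<alpha> t, act B m n \<alpha> b)" by (rule g1[OF ss_act[OF B a 3(1)]])
   also have "\<dots> = act (R B) m n \<alpha> (H n (t, b))" using shom_act[OF H(1) a, of "(t, b)"] 3(1) \<open>t \<in> smp J n\<close> by simp
   also have "H n (t, b) = gg n (Leaf b, t)" using g1[OF 3(1)] by simp
   finally show ?thesis by (simp add: xx 3(2))
  qed
 qed
 then have gs: "shom (res (sset_prod (R B) J) ?D) (R B) gg" .
 obtain K where K: "shom (sset_prod (R B) J) (R B) K" "!!n x. x \<in> ?D n ==> K n x = gg n x"
  using lft_pt_ex[OF L2 gs] by blast
 have K0: "K n (s, zero n) = s" "K n (s, one n) = r n s" if "s \<in> smp (R B) n" for n s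
  using K(2)[of "(s, zero n)" n] K(2)[of "(s, one n)" n] that by (auto simp: gg_def ends_def)
 have KL: "K n (Leaf b, t) = H n (t, b)" if "b \<in> smp B n" "t \<in> smp J n" for n b t
  using K(2)[of "(Leaf b, t)" n] g1[OF that(1), of t] that by (auto intro: wf_Leaf)
 have \<rho>B: "shom B (R B) \<rho>" by (rule shom_comp[OF \<rho> shom_R_sub[OF B A]])
 let ?JB = "cyl B"
 have JB: "ss ?JB" using B by simp
 have k1: "shom (cyl B) (R B) (%n z. K n (\<rho> n (snd z), jnot n (fst z)))"
  by (rule shom_comp[OF _ K(1)], rule shom_pair[OF shom_comp[OF shom_snd \<rho>B]]) (auto simp: shom_def jnot_act)
 have e1: "shom (cyl (res ?JB (%n. ends n \<times> smp B n))) (R B)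
   (%n z. if fst (snd z) = zero n then Leaf (snd (fst z, snd (snd z))) else K n (\<rho> n (snd (fst z, snd (snd z))), jnot n (fst (fst z, snd (snd z)))))"
  by (rule shom_ends[OF shom_comp[OF shom_snd shom_Leaf] k1])
 have e2: "shom (cyl (res ?JB (%n. smp J n \<times> A n))) (R B) (%n z. H n (jand n (fst (snd z)) (jnot n (fst z)), snd (snd z)))"
  by (rule shom_comp[OF _ H(1)]) (use As in "auto simp: shom_def jand_act jnot_act")
 \<comment> \<open>Composition of H with the reverse of K at \<rho> b, which runs from the leaf b to
   \<rho> b. On A both are the same path in opposite directions, and shrinking H by
   \<open>jand\<close> contracts the composite to a constant.\<close>
 obtain P where P: "shom (cyl ?JB) (R B) P"
  "!!n s x. s \<in> smp J n ==> x \<in> ends n \<times> smp B n ==> P n (s, x) = (if fst x = zero n then Leaf (snd x) else K n (\<rho> n (snd x), jnot n s))"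
  "!!n s x. s \<in> smp J n ==> x \<in> smp J n \<times> A n ==> P n (s, x) = H n (jand n (fst x) (jnot n s), snd x)"
 proof (rule box_use2[OF jfib_R[OF B, unfolded jfib_def] JB subc_prod1[OF subc_ends B] subc_prod2[OF A ss_J] shom_pt e1 e2 H(1)])
  fix n t x assume "t \<in> smp J n" "x \<in> ends n \<times> smp B n" "x \<in> smp J n \<times> A n"
  then show "(if fst (snd (t, x)) = zero n then Leaf (snd (fst (t, x), snd (snd (t, x)))) else K n (\<rho> n (snd (fst (t, x), snd (snd (t, x)))), jnot n (fst (fst (t, x), snd (snd (t, x)))))) =
    H n (jand n (fst (snd (t, x))) (jnot n (fst (t, x))), snd (snd (t, x)))"
   using H(2) KL \<rho>A As by (auto simp: ends_def)
 next
  fix n x assume "x \<in> ends n \<times> smp B n"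
  then show "(if fst (snd (zero n, x)) = zero n then Leaf (snd (fst (zero n, x), snd (snd (zero n, x)))) else K n (\<rho> n (snd (fst (zero n, x), snd (snd (zero n, x)))), jnot n (fst (fst (zero n, x), snd (snd (zero n, x)))))) = H n x"
   using H K0(2)[OF shom_in[OF \<rho>B]] r2[OF shom_in[OF \<rho>]] by (auto simp: ends_def)
 qed auto
 have o: "shom ?JB (cyl ?JB) (%n z. (one n, (jnot n (fst z), snd z)))" by (auto simp: shom_def jnot_act)
 have "tcdata B A \<rho> (%n z. P n (one n, (jnot n (fst z), snd z)))"
  unfolding tcdata_def
 proof (intro conjI \<rho> allI ballI)
  show "shom ?JB (R B) (%n z. P n (one n, (jnot n (fst z), snd z)))" by (rule shom_comp[OF o P(1)])
  fix n b assume b: "b \<in> smp B n"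
  show "P n (one n, (jnot n (fst (zero n, b)), snd (zero n, b))) = \<rho> n b"
   using P(2)[OF one_J, of "(one n, b)" n] b K0(1)[OF shom_in[OF \<rho>B b]] by (simp add: ends_def)
  show "P n (one n, (jnot n (fst (one n, b)), snd (one n, b))) = Leaf b"
   using P(2)[OF one_J, of "(zero n, b)" n] b by (simp add: ends_def)
 next
  fix n t a assume "t \<in> smp J n" "a \<in> A n"
  then show "P n (one n, (jnot n (fst (t, a)), snd (t, a))) = Leaf a"
   using P(3)[OF one_J, of "(jnot n t, a)" n] H(2) As by simp
 qed (use \<rho>A in auto)
 then show ?thesis using B A by (auto simp: tc_def)
qed

section \<open>Copies of simplicial sets\<close>

definition copy :: "(nat => 'a => 'b) => 'a sset => 'b sset" where
 "copy e X = \<lparr>smp = %n. e n ` smp X n, act = %m n \<alpha> y. e m (act X m n \<alpha> (inv_into (smp X n) (e n) y))\<rparr>"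

lemma copy_simps: "smp (copy e X) n = e n ` smp X n"
 "inj_on (e n) (smp X n) ==> x \<in> smp X n ==> act (copy e X) m n \<alpha> (e n x) = e m (act X m n \<alpha> x)"
 by (auto simp: copy_def)

lemma ss_copy:
 assumes X: "ss X" and e: "!!n. inj_on (e n) (smp X n)"
 shows "ss (copy e X)"
 unfolding simplicial_set_def copy_simps(1)
 by (auto simp: copy_simps(2)[of e _ X, OF e] ss_act[OF X] ss_id[OF X] ss_comp[OF X])

lemma shom_copy:
 assumes X: "ss X" and e: "!!n. inj_on (e n) (smp X n)"
 shows "shom X (copy e X) e" "shom (copy e X) X (%n. inv_into (smp X n) (e n))"
 using e by (auto simp: shom_def copy_simps(1) copy_simps(2)[of e _ X, OF e] ss_act[OF X] inv_into_f_f)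

definition uni_emb :: "'u set set => 'a sset => nat => 'a => 'u" where
 "uni_emb U X n = (SOME e. inj_on e (smp X n) \<and> e ` smp X n \<in> U)"

definition usmall :: "'u set set => 'a sset => bool" where
 "usmall U X \<longleftrightarrow> ss X \<and> (\<forall>n. small U (smp X n))"

lemma set_universe_lepoll: "set_universe U ==> A \<in> U ==> B \<lesssim> A ==> B \<in> U"
 by (auto simp: set_universe_def)

lemma uni_emb:
 assumes U: "set_universe U" and X: "usmall U X"
 shows "inj_on (uni_emb U X n) (smp X n)" "uni_emb U X n ` smp X n \<in> U"
proof -
 obtain A where A: "A \<in> U" "smp X n \<lesssim> A" using X by (auto simp: usmall_def small_def)
 then obtain e where e: "inj_on e (smp X n)" "e ` smp X n \<subseteq> A" by (auto simp: lepoll_def)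
 have "e ` smp X n \<in> U" by (rule set_universe_lepoll[OF U A(1) subset_imp_lepoll[OF e(2)]])
 then have "inj_on (uni_emb U X n) (smp X n) \<and> uni_emb U X n ` smp X n \<in> U"
  unfolding uni_emb_def using e(1) by (intro someI[of "%e. inj_on e (smp X n) \<and> e ` smp X n \<in> U" e]) simp
 then show "inj_on (uni_emb U X n) (smp X n)" "uni_emb U X n ` smp X n \<in> U" by auto
qed

definition "ucopy U X = copy (uni_emb U X) X"
definition "uto U X = uni_emb U X"
definition "ufr U X n = inv_into (smp X n) (uni_emb U X n)"

lemma ucopy:
 assumes U: "set_universe U" and X: "usmall U X"
 shows "ucopy U X \<in> ssets U" "shom X (ucopy U X) (uto U X)" "shom (ucopy U X) X (ufr U X)"
  "x \<in> smp X n ==> ufr U X n (uto U X n x) = x" "y \<in> smp (ucopy U X) n ==> uto U X n (ufr U X n y) = y"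
  "ss (ucopy U X)"
proof -
 note e = uni_emb[OF U X]
 have Xs: "ss X" using X by (simp add: usmall_def)
 show "ss (ucopy U X)" unfolding ucopy_def by (rule ss_copy[OF Xs e(1)])
 then show "ucopy U X \<in> ssets U" using e(2) by (auto simp: ssets_def ucopy_def copy_simps(1))
 show "shom X (ucopy U X) (uto U X)" "shom (ucopy U X) X (ufr U X)"
  unfolding ucopy_def uto_def using shom_copy[OF Xs e(1)] by (auto simp: ufr_def[abs_def])
 show "x \<in> smp X n ==> ufr U X n (uto U X n x) = x" using e(1) by (simp add: ufr_def uto_def)
 show "y \<in> smp (ucopy U X) n ==> uto U X n (ufr U X n y) = y" by (auto simp: ufr_def uto_def ucopy_def copy_simps(1) f_inv_into_f)
qed

lemma ssets_usmall: "X \<in> ssets U ==> usmall U X"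
 by (auto simp: ssets_def usmall_def intro: small_mem)

lemma lft_iso_E:
 assumes l: "lft E Y q D C" and e: "shom E E' e" "shom E' E d" "!!n x. x \<in> smp E' n ==> e n (d n x) = x"
  and q: "!!n x. x \<in> smp E n ==> q' n (e n x) = q n x" and C: "!!n. C n \<subseteq> smp D n"
 shows "lft E' Y q' D C"
proof (rule lftI)
 fix g w assume g: "shom (res D C) E' g" and w: "shom D Y w" and gw: "!!n x. x \<in> C n ==> q' n (g n x) = w n x"
 have gE: "g n x \<in> smp E' n" if "x \<in> C n" for n x using shom_in[OF g] that by simp
 have "q n (d n (g n x)) = w n x" if x: "x \<in> C n" for n x
  using q[OF shom_in[OF e(2) gE[OF x]]] e(3)[OF gE[OF x]] gw[OF x] by simp
 then obtain h where h: "shom D E h" "!!n x. x \<in> smp D n ==> q n (h n x) = w n x" "!!n x. x \<in> C n ==> h n x = d n (g n x)"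
  using lft_ex[OF l shom_comp[OF g e(2)] w] by blast
 show "\<exists>h. shom D E' h \<and> (\<forall>n. \<forall>x\<in>smp D n. q' n (h n x) = w n x) \<and> (\<forall>n. \<forall>x\<in>C n. h n x = g n x)"
  by (rule exI[of _ "%n x. e n (h n x)"]) (use shom_comp[OF h(1) e(1)] h q e(3) gE shom_in[OF h(1)] in auto)
qed

lemma jfib_iso:
 assumes Z: "jfib Z" and Z': "ss Z'" and e: "shom Z Z' e" "shom Z' Z d" "!!n x. x \<in> smp Z' n ==> e n (d n x) = x"
 shows "jfib Z'"
 unfolding jfib_def nfib_def
proof (intro conjI allI Z' ss_pt shom_pt)
 fix n show "lft Z' pt (%_ _. ()) (JS n) (HB n)"
  by (rule lft_iso_E[OF _ e]) (use Z subc_HB[of n] in "auto simp: jfib_def nfib_def subc_def simp del: sset_prod_simps")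
qed

definition wq :: "'u set set => 'a sset => 'b sset => (nat => 'a => 'b) => bool" where
 "wq U A B f \<longleftrightarrow> (\<forall>Z\<in>ssets U. jfib Z --> weqZ Z A B f)"

text \<open>Weak equivalences are defined by objects over the type of U. Small replacements consist
  of terms, so they are tested through a copy in U.\<close>

lemma wq_any:
 assumes U: "set_universe U" and w: "wq U A B f" and Z: "usmall U Z" "jfib Z"
 shows "weqZ Z A B f"
proof -
 note c = ucopy[OF U Z(1)]
 have j: "jfib (ucopy U Z)" by (rule jfib_iso[OF Z(2) c(6,2,3,5)])
 then have w': "weqZ (ucopy U Z) A B f" using w c(1) by (auto simp: wq_def)
 have bk: "htp X no Z h1 h2" if "htp X no (ucopy U Z) (%n x. uto U Z n (h1 n x)) (%n x. uto U Z n (h2 n x))"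
  "!!n x. x \<in> smp X n ==> h1 n x \<in> smp Z n" "!!n x. x \<in> smp X n ==> h2 n x \<in> smp Z n" for X :: "'x sset" and h1 h2
  by (rule htp_cong[OF htp_post[OF that(1) c(3)] _ _ subc_empty]) (auto simp: c(4) that(2,3))
 show ?thesis
 proof (rule weqZ_I)
  fix g assume g: "shom A Z g"
  obtain h where h: "shom B (ucopy U Z) h" "htp A no (ucopy U Z) (%n x. h n (f n x)) (%n x. uto U Z n (g n x))"
   by (rule weqZ_exE[OF w' shom_comp[OF g c(2)]])
  have "htp A no Z (%n x. ufr U Z n (h n (f n x))) g"
   by (rule htp_cong[OF htp_post[OF h(2) c(3)] _ _ subc_empty]) (auto simp: c(4) shom_in[OF g])
  then show "\<exists>h. shom B Z h \<and> htp A no Z (%n x. h n (f n x)) g"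
   by (intro exI[of _ "%n x. ufr U Z n (h n x)"] conjI shom_comp[OF h(1) c(3)])
 next
  fix h1 h2 assume h: "shom B Z h1" "shom B Z h2" "htp A no Z (%n x. h1 n (f n x)) (%n x. h2 n (f n x))"
  have "htp B no (ucopy U Z) (%n x. uto U Z n (h1 n x)) (%n x. uto U Z n (h2 n x))"
   by (rule weqZ_un[OF w' shom_comp[OF h(1) c(2)] shom_comp[OF h(2) c(2)] htp_post[OF h(3) c(2)]])
  then show "htp B no Z h1 h2" by (rule bk) (rule shom_in[OF h(1)] shom_in[OF h(2)], assumption)+
 qed
qed

lemma small_pt: "set_universe U ==> small U (smp pt n)"
proof -
 assume U: "set_universe U"
 have "smp pt n \<lesssim> (UNIV :: nat set)" by (auto simp: pt_def lepoll_def)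
 moreover obtain I where "I \<in> U" "infinite I" using U by (auto simp: set_universe_def)
 ultimately show ?thesis unfolding small_def infinite_le_lepoll using lepoll_trans by blast
qed

section \<open>The trivial cofibrations are the monic weak equivalences\<close>

text \<open>The objects \<open>R (res B A)\<close> and \<open>R B\<close> may be too large to test
  against. A weak equivalence is tested against their small replacements: the first yields \<rho>,
  the second the homotopy, which is brought back to \<open>R B\<close> because \<kappa> is homotopic
  to the identity there.\<close>

lemma wq_tc:
 fixes B :: "'b sset" and U :: "'u set set"
 assumes U: "set_universe U" and B: "usmall U B" and A: "subc B A" and w: "wq U (res B A) B (%n x. x)"
 shows "tc B A"
proof -
 have Bs: "ss B" and Bsm: "!!n. small U (smp B n)" using B by (auto simp: usmall_def)
 have A': "ss (res B A)" by (rule ss_res[OF Bs A])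
 have Asm: "small U (smp (res B A) n)" for n
  using small_lepoll[OF Bsm, of "A n" n] A by (simp add: subc_def subset_imp_lepoll)
 have jpt: "jfib pt" using nfib_id[OF ss_pt] by (simp add: jfib_def)
 obtain SA where SA: "srep (res B A) pt (%_ _. ()) SA" "!!n. small U (SA n)" using srep_exists[OF U A' shom_pt jpt Asm small_pt[OF U]] by blast
 obtain SB where SB: "srep B pt (%_ _. ()) SB" "!!n. small U (SB n)" using srep_exists[OF U Bs shom_pt jpt Bsm small_pt[OF U]] by blast
 have tqp: "tq (%_ _. ()) = (%(_::nat) (_::('x, unit) tm). ())" by (simp add: fun_eq_iff)
 have SA1: "subc (R (res B A)) SA" "jfib (res (R (res B A)) SA)" "!!n a. a \<in> A n ==> Leaf a \<in> SA n"
  using SA(1) by (auto simp: srep_def jfib_def tqp)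
 have SB1: "subc (R B) SB" "jfib (res (R B) SB)" "!!n b. b \<in> smp B n ==> Leaf b \<in> SB n"
  using SB(1) by (auto simp: srep_def jfib_def tqp)
 have uA: "usmall U (res (R (res B A)) SA)" using jfib_ss[OF SA1(2)] SA(2) by (simp add: usmall_def)
 have uB: "usmall U (res (R B) SB)" using jfib_ss[OF SB1(2)] SB(2) by (simp add: usmall_def)
 have lA: "lft (res (R (res B A)) SA) pt (%_ _. ()) B A"
  by (rule weqZ_lft[OF SA1(2) Bs A wq_any[OF U w uA SA1(2)]])
 have "shom (res B A) (res (R (res B A)) SA) (%n. Leaf)" using SA1(3) by (auto simp: shom_def)
 then obtain \<rho> where \<rho>: "shom B (res (R (res B A)) SA) \<rho>" "!!n a. a \<in> A n ==> \<rho> n a = Leaf a"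
  using lft_pt_ex[OF lA] by blast
 have \<rho>R: "shom B (R (res B A)) \<rho>" by (rule shom_from_res[OF \<rho>(1) SA1(1)])
 have \<rho>B: "shom B (R B) \<rho>" by (rule shom_comp[OF \<rho>R shom_R_sub[OF Bs A]])
 have LB: "shom B (res (R B) SB) (%n. Leaf)" using SB1(3) by (auto simp: shom_def)
 obtain \<kappa> where \<kappa>: "shom (R B) (res (R B) SB) \<kappa>" "!!n b. b \<in> smp B n ==> \<kappa> n (Leaf b) = Leaf b"
  using free_ext1[OF Bs SB1(2) LB] by blast
 have As: "x \<in> smp B n" if "x \<in> A n" for x n using subc_sub[OF A that] .
 have eqA: "htp (res B A) no (res (R B) SB) (%n x. \<kappa> n (\<rho> n x)) (%n. Leaf)"
  by (rule htp_cong[OF htp_refl[OF shom_res_mono[of B "smp B", simplified, OF LB]] _ _ subc_empty])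
    (use As \<rho>(2) \<kappa>(2) in auto)
 have h1: "htp B no (res (R B) SB) (%n x. \<kappa> n (\<rho> n x)) (%n. Leaf)"
  by (rule weqZ_un[OF wq_any[OF U w uB SB1(2)] shom_comp[OF \<rho>B \<kappa>(1)] LB eqA])
 have sbR: "shom (res (R B) SB) (R B) (%n x. x)" by (rule shom_res[OF shom_ident]) (use SB1(1) in "auto simp: subc_def")
 have h1': "htp B no (R B) (%n x. \<kappa> n (\<rho> n x)) (%n. Leaf)" by (rule htp_post[OF h1 sbR])
 have "htp (R B) (%n. Leaf ` smp B n) (R B) \<kappa> (%n x. x)"
  by (rule free_unique1[OF Bs jfib_R[OF Bs] shom_comp[OF \<kappa>(1) sbR] shom_ident]) (use \<kappa>(2) in auto)
 then have h2: "htp B no (R B) (%n x. \<kappa> n (\<rho> n x)) \<rho>" by (rule htp_pre0[OF _ \<rho>B])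
 have "htp B no (R B) (%n. Leaf) \<rho>"
  by (rule htp_trans[OF jfib_R[OF Bs] Bs subc_empty htp_sym[OF h1' subc_empty] h2])
 from tcI[OF Bs A \<rho>R \<rho>(2) this] show ?thesis .
qed

section \<open>Factorization into a trivial cofibration and a fibration\<close>

text \<open>
 Right properness for B \<rightarrow> S_B: the fibration p over S_B is pulled back along a retraction R(B) \<rightarrow> S_B,
 where free_ext and free_unique apply.
\<close>

lemma srep_proper:
 fixes S :: "'s sset" and B :: "'b sset"
 assumes B: "ss B" and SB: "srep B pt (%_ _. ()) SB"
  and p: "nfib S (res (R B) SB) p" and Z: "jfib Z"
 shows "weqZ Z (res S (%n. {s \<in> smp S n. p n s \<in> Leaf ` smp B n})) S (%n x. x)"
proof -
 let ?Y = "res (R B) SB" and ?C = "%n. {s \<in> smp S n. p n s \<in> Leaf ` smp B n}"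
 have Ss: "ss S" and Ys: "ss ?Y" and ps: "shom S ?Y p" using nfib_ss[OF p] by auto
 have sSB: "subc (R B) SB" using SB by (auto simp: srep_def)
 have RB: "ss (R B)" by (rule ss_free[OF B])
 have LB: "subc (R B) (%n. Leaf ` smp B n)" by (rule subc_Leaf[OF B])
 have LS: "!!n. Leaf ` smp B n \<subseteq> SB n" using SB by (auto simp: srep_def)
 have LY: "subc ?Y (%n. Leaf ` smp B n)" by (rule subc_res[OF LB sSB LS])
 have C: "subc S ?C" by (rule subc_preimage[OF ps LY Ss])
 obtain H where H: "shom (cyl (R B)) (R B) H" "!!n e. e \<in> smp (R B) n ==> H n (zero n, e) \<in> SB n"
   "!!n e. e \<in> smp (R B) n ==> H n (one n, e) = e"
   "!!n t a. t \<in> smp J n ==> a \<in> smp B n ==> H n (t, Leaf a) = Leaf a" "!!n t s. t \<in> smp J n ==> s \<in> SB n ==> H n (t, s) \<in> SB n"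
 proof -
  from SB have "\<exists>H. shom (cyl (R B)) (R B) H \<and> (\<forall>n. \<forall>e\<in>smp (R B) n. H n (zero n, e) \<in> SB n \<and> H n (one n, e) = e) \<and>
    (\<forall>n. \<forall>t\<in>smp J n. \<forall>a\<in>smp B n. H n (t, Leaf a) = Leaf a) \<and> (\<forall>n. \<forall>t\<in>smp J n. \<forall>s\<in>SB n. H n (t, s) \<in> SB n)"
   unfolding srep_def by (elim conjE)
  then show ?thesis using that by (elim exE conjE) (simp del: free_simps)
 qed
 have YR: "x \<in> smp (R B) n" if "x \<in> SB n" for x n using subc_sub[OF sSB that] .
 have HY: "shom (cyl ?Y) ?Y H" using H(1,5) YR by (auto simp: shom_def simp del: free_simps(1))
 define r where "r n e = H n (zero n, e)" for n e
 have zs: "shom (R B) (cyl (R B)) (%n e. (zero n, e))" by (auto simp: shom_def)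
 have r: "shom (R B) ?Y r" unfolding r_def by (rule shom_into_res[OF shom_comp[OF zs H(1)]]) (use H(2) in auto)
 have rL: "r n (Leaf b) = Leaf b" if "b \<in> smp B n" for n b unfolding r_def by (rule H(4)[OF zero_J that])
 let ?T = "pull S p (R B) r"
 have T: "nfib ?T (R B) (%n. fst)" by (rule nfib_pull[OF p RB r])
 let ?TC = "%n. {x \<in> smp ?T n. fst x \<in> Leaf ` smp B n}"
 have TCin: "snd x \<in> ?C n" if x: "x \<in> ?TC n" for x n
 proof -
  from x obtain b where b: "fst x = Leaf b" "b \<in> smp B n" by auto
  have "p n (snd x) = r n (fst x)" "snd x \<in> smp S n" using x by auto
  then show ?thesis using rL[OF b(2)] b by auto
 qed
 have w: "shom (cyl S) ?Y (%n z. H n (jnot n (fst z), p n (snd z)))"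
  by (rule shom_comp[OF _ HY], rule shom_pair) (use ps in "auto simp: shom_def jnot_act")
 have gC: "shom (cyl (res S ?C)) S (%n. snd)" by (auto simp: shom_def)
 have pY: "p n s \<in> SB n" if "s \<in> smp S n" for n s using shom_in[OF ps that] by simp
 obtain G where G: "shom (cyl S) S G" "!!n t s. t \<in> smp J n ==> s \<in> smp S n ==> p n (G n (t, s)) = H n (jnot n t, p n s)"
  "!!n t s. t \<in> smp J n ==> s \<in> ?C n ==> G n (t, s) = s" "!!n s. s \<in> smp S n ==> G n (zero n, s) = s"
 proof -
  obtain G where G: "shom (cyl S) S G" "!!n t s. t \<in> smp J n ==> s \<in> smp S n ==> p n (G n (t, s)) = H n (jnot n (fst (t, s)), p n (snd (t, s)))"
  "!!n t s. t \<in> smp J n ==> s \<in> ?C n ==> G n (t, s) = snd (t, s)" "!!n s. s \<in> smp S n ==> G n (zero n, s) = s"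
   by (rule box_use[OF p Ss C w gC shom_ident]) (use H(3,4) YR pY in "auto simp del: free_simps(1)")
  then show ?thesis using that by simp
 qed
 \<comment> \<open>S is compared with the pullback along r: s is moved along the lifted homotopy G
   to a simplex over \<open>r n (p n s)\<close>, and this together with \<open>p n s\<close> is a
   simplex of \<open>?T\<close>.\<close>
 define k where "k n s = (p n s, G n (one n, s))" for n s
 have o: "shom S (cyl S) (%n s. (one n, s))" by (auto simp: shom_def)
 have G1: "shom S S (%n s. G n (one n, s))" by (rule shom_comp[OF o G(1)])
 have k: "shom S ?T k"
 proof (rule shomI)
  fix n s assume s: "s \<in> smp S n"
  have "p n (G n (one n, s)) = r n (p n s)" using G(2)[OF one_J s] by (simp add: r_def)
  then show "k n s \<in> smp ?T n" using shom_in[OF G1 s] YR[OF pY[OF s]] by (simp add: k_def del: free_simps(1))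
 next
  fix m n \<alpha> s assume a: "\<alpha> \<in> ops m n" and s: "s \<in> smp S n"
  show "k m (act S m n \<alpha> s) = act ?T m n \<alpha> (k n s)"
   using shom_act[OF G1 a s] shom_act[OF ps a s] by (simp add: k_def)
 qed
 have kC: "k n s = (p n s, s)" "k n s \<in> ?TC n" if s: "s \<in> ?C n" for n s
 proof -
  show "k n s = (p n s, s)" using G(3)[OF one_J s] by (simp add: k_def)
  moreover have "k n s \<in> smp ?T n" using shom_in[OF k] s by blast
  ultimately show "k n s \<in> ?TC n" using s by auto
 qed
 have LL: "!!n b. b \<in> smp B n ==> Leaf b \<in> Leaf ` smp B n" by auto
 show ?thesis
 proof (rule mono_weqZ[OF Z Ss C])
  have lT: "lft Z pt (%_ _. ()) ?T ?TC" by (rule free_ext[OF B T LB LL csat_Leaf Z[unfolded jfib_def]])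
  show "lft Z pt (%_ _. ()) S ?C"
  proof (rule lftI)
   fix g and w :: "nat => 's => unit" assume g: "shom (res S ?C) Z g"
   have "shom (res ?T ?TC) (res S ?C) (%n. snd)" using TCin by (auto simp: shom_def)
   from shom_comp[OF this g] obtain h where h: "shom ?T Z h" "!!n x. x \<in> ?TC n ==> h n x = g n (snd x)"
    using lft_pt_ex[OF lT] by blast
   have "h n (k n s) = g n s" if "s \<in> ?C n" for n s using h(2)[OF kC(2)[OF that]] kC(1)[OF that] by simp
   then show "\<exists>h. shom S Z h \<and> (\<forall>n. \<forall>x\<in>smp S n. () = w n x) \<and> (\<forall>n. \<forall>x\<in>?C n. h n x = g n x)"
    using shom_comp[OF k h(1)] by (intro exI[of _ "%n s. h n (k n s)"]) auto
  qed
  fix h1 h2 assume h: "shom S Z h1" "shom S Z h2" "!!n x. x \<in> ?C n ==> h1 n x = h2 n x"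
  have sT: "shom ?T S (%n. snd)" by (auto simp: shom_def)
  have "htp ?T ?TC Z (%n x. h1 n (snd x)) (%n x. h2 n (snd x))"
   by (rule free_unique[OF B T LB LL csat_Leaf Z shom_comp[OF sT h(1)] shom_comp[OF sT h(2)]]) (use h(3) TCin in auto)
  from htp_pre0[OF this k] have m: "htp S no Z (%n s. h1 n (G n (one n, s))) (%n s. h2 n (G n (one n, s)))"
   by (rule htp_cong[OF _ _ _ subc_empty]) (auto simp: k_def)
  have side: "htp S no Z f (%n s. f n (G n (one n, s)))" if "shom S Z f" for f
   by (rule htpI[OF shom_comp[OF G(1) that]]) (auto simp: G(4))
  show "htp S no Z h1 h2"
   by (rule htp_trans[OF Z Ss subc_empty side[OF h(1)] htp_trans[OF Z Ss subc_empty m htp_sym[OF side[OF h(2)] subc_empty]]])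
 qed
qed

text \<open>\<open>srep_exists\<close> and \<open>tc_nfib\<close> are available over the J-fibrant
  S_B, not over B. So A is factored through S over S_B, and E is the part of S over B. By
  \<open>srep_proper\<close> the inclusion of E in S is a weak equivalence, and hence so is the map
  from A to E.\<close>

lemma factor_tc:
 fixes A :: "'a sset" and B :: "'b sset" and U :: "'u set set"
 assumes U: "set_universe U" and A: "usmall U A" and B: "usmall U B" and f: "shom A B f"
 shows "\<exists>(E :: ('a, ('b, unit) tm) tm sset) i p. usmall U E \<and> shom A E i \<and> shom E B p \<and> (\<forall>n. \<forall>a\<in>smp A n. p n (i n a) = f n a) \<and>
  (\<forall>n. inj_on (i n) (smp A n)) \<and> wq U A E i \<and> (\<forall>(D :: 'd sset) C. tc D C --> lft E B p D C)"
proof -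
 have As: "ss A" "!!n. small U (smp A n)" and Bs: "ss B" "!!n. small U (smp B n)"
  using A B by (auto simp: usmall_def)
 have jpt: "jfib pt" using nfib_id[OF ss_pt] by (simp add: jfib_def)
 obtain SB where SB: "srep B pt (%_ _. ()) SB" "!!n. small U (SB n)" using srep_exists[OF U Bs(1) shom_pt jpt Bs(2) small_pt[OF U]] by blast
 let ?Y = "res (R B) SB"
 have tqp: "tq (%_ _. ()) = (%(_::nat) (_::('b, unit) tm). ())" by (simp add: fun_eq_iff)
 have SB1: "subc (R B) SB" "jfib ?Y" "!!n b. b \<in> smp B n ==> Leaf b \<in> SB n"
  using SB(1) by (auto simp: srep_def jfib_def tqp)
 have Ys: "!!n. small U (smp ?Y n)" using SB(2) by simp
 have LB: "shom B ?Y (%n. Leaf)" using SB1(3) by (auto simp: shom_def)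
 let ?f = "%n a. Leaf (f n a) :: ('b, unit) tm"
 have fY: "shom A ?Y ?f" by (rule shom_comp[OF f LB])
 obtain S where S: "srep A ?Y ?f S" "!!n. small U (S n)" using srep_exists[OF U As(1) fY SB1(2) As(2) Ys] by blast
 let ?S = "res (free A ?Y ?f) S" and ?q = "tq ?f"
 have q: "nfib ?S ?Y ?q" and LS: "!!n a. a \<in> smp A n ==> Leaf a \<in> S n" using S(1) by (auto simp: srep_def)
 have Sss: "ss ?S" using nfib_ss(1)[OF q] .
 let ?LB = "%n. Leaf ` smp B n :: ('b, unit) tm set"
 have sLB: "subc ?Y ?LB" by (rule subc_res[OF subc_Leaf[OF Bs(1)] SB1(1)]) (use SB1(3) in auto)
 let ?C = "%n. {s \<in> smp ?S n. ?q n s \<in> ?LB n}"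
 have C: "subc ?S ?C" by (rule subc_preimage[OF nfib_ss(3)[OF q] sLB Sss])
 let ?E = "res ?S ?C"
 have Ess: "ss ?E" by (rule ss_res[OF Sss C])
 define p where "p n s = (case ?q n s of Leaf b => b | _ => undefined)" for n s
 have pL: "Leaf (p n s) = ?q n s" "p n s \<in> smp B n" if "s \<in> ?C n" for n s using that by (auto simp: p_def)
 have p: "shom ?E B p"
 proof (rule shomI)
  fix m n \<alpha> s assume a: "\<alpha> \<in> ops m n" and s: "s \<in> smp ?E n"
  then have sC: "s \<in> ?C n" by simp
  have "Leaf (p m (act ?S m n \<alpha> s)) = act ?Y m n \<alpha> (Leaf (p n s))"
   using pL(1)[OF subc_act[OF C a sC]] pL(1)[OF sC] shom_act[OF nfib_ss(3)[OF q] a, of s] sC by simp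
  then show "p m (act ?E m n \<alpha> s) = act B m n \<alpha> (p n s)" by simp
 qed (use pL in auto)
 have LC: "Leaf a \<in> ?C n" if "a \<in> smp A n" for n a using LS[OF that] shom_in[OF f that] by simp
 have i: "shom A ?E (%n. Leaf)" by (rule shomI) (use LC in auto)
 have w: "wq U A ?E (%n. Leaf)"
  unfolding wq_def
 proof (intro ballI impI)
  fix Z :: "'u sset" assume Z: "jfib Z"
  have AS: "weqZ Z A ?S (%n. Leaf)"
  proof -
   have SL: "subc ?S (%n. Leaf ` smp A n)"
    by (rule subc_res[OF subc_Leaf[OF As(1)]]) (use S(1) in "auto simp: srep_def")
   have "weqZ Z (res ?S (%n. Leaf ` smp A n)) ?S (%n x. x)"
   proof (rule mono_weqZ[OF Z Sss SL])
    show "lft Z pt (%_ _. ()) ?S (%n. Leaf ` smp A n)"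
    proof (rule lftI)
     fix g and w :: "nat => _ => unit" assume g: "shom (res ?S (%n. Leaf ` smp A n)) Z g"
     have "shom A Z (%n a. g n (Leaf a))" by (rule shom_comp[OF _ g]) (auto simp: shom_def)
     then obtain h where "shom ?S Z h" "!!n a. a \<in> smp A n ==> h n (Leaf a) = g n (Leaf a)"
      using srep_ext[OF As(1) fY S(1) Z] by blast
     then show "\<exists>h. shom ?S Z h \<and> (\<forall>n. \<forall>x\<in>smp ?S n. () = w n x) \<and> (\<forall>n. \<forall>x\<in>Leaf ` smp A n. h n x = g n x)" by auto
    qed
    fix h1 h2 assume h: "shom ?S Z h1" "shom ?S Z h2" "!!n x. x \<in> Leaf ` smp A n ==> h1 n x = h2 n x"
    show "htp ?S no Z h1 h2"
     by (rule htp_mono[OF srep_unique[OF As(1) fY S(1) Z h(1,2)]]) (use h(3) in auto)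
   qed
   moreover have "weqZ Z A (res ?S (%n. Leaf ` smp A n)) (%n. Leaf)"
    by (rule weqZ_iso[OF Z As(1) ss_res[OF Sss SL], where s = "%n t. case t of Leaf a => a | _ => undefined"])
      (auto simp: shom_def)
   ultimately show ?thesis
    using weqZ_comp[OF Z As(1) ss_res[OF Sss SL] Sss, of "%n. Leaf" "%n x. x"] SL by (auto simp: shom_def subc_def)
  qed
  show "weqZ Z A ?E (%n. Leaf)"
   by (rule weqZ_right[OF Z As(1) Ess Sss i _ srep_proper[OF Bs(1) SB(1) q Z] AS]) (auto simp: shom_def)
 qed
 have l: "lft ?E B p D C" if t: "tc D C" for D :: "'d sset" and C
 proof (rule lftI)
  have Cs: "!!n x. x \<in> C n ==> x \<in> smp D n" using t by (auto simp: tc_def subc_def)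
  fix g w assume g: "shom (res D C) ?E g" and w: "shom D B w" and gw: "!!n x. x \<in> C n ==> p n (g n x) = w n x"
  have gC: "g n x \<in> ?C n" if "x \<in> C n" for n x using shom_in[OF g, of x n] that by simp
  have g': "shom (res D C) ?S g" by (rule shom_from_res[OF g \<open>subc ?S ?C\<close>])
  have "?q n (g n x) = Leaf (w n x)" if "x \<in> C n" for n x using pL(1)[OF gC[OF that]] gw[OF that] by simp
  then obtain h where h: "shom D ?S h" "!!n x. x \<in> smp D n ==> ?q n (h n x) = Leaf (w n x)" "!!n x. x \<in> C n ==> h n x = g n x"
   using lft_ex[OF tc_nfib[OF t q SB1(2)] g' shom_comp[OF w LB]] by blast
  have "shom D ?E h" by (rule shom_into_res[OF h(1)]) (use h(2) shom_in[OF h(1)] shom_in[OF w] in auto)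
  moreover have "p n (h n x) = w n x" if "x \<in> smp D n" for n x using h(2)[OF that] by (simp add: p_def)
  ultimately show "\<exists>h. shom D ?E h \<and> (\<forall>n. \<forall>x\<in>smp D n. p n (h n x) = w n x) \<and> (\<forall>n. \<forall>x\<in>C n. h n x = g n x)" using h(3) by blast
 qed
 have "smp ?E n \<subseteq> S n" for n by auto
 note SE = this
 have sm: "usmall U ?E" using Ess small_lepoll[OF S(2) subset_imp_lepoll[OF SE]] by (simp add: usmall_def)
 have pi: "p n (Leaf a) = f n a" for n a by (simp add: p_def)
 show ?thesis
  by (intro exI[of _ ?E] exI[of _ "%n. Leaf"] exI[of _ p] conjI sm i p w allI impI ballI pi l) (auto simp: inj_on_def)
qed

section \<open>Reduction to countable simplicial sets\<close>

lemma lft_iso_D: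
 assumes l: "lft E Y q X C'" and X: "ss X" and C': "subc X C'" and C: "subc D C"
  and e: "shom D X e" and d: "shom X D d" and de: "!!n x. x \<in> smp D n ==> d n (e n x) = x" and ed: "!!n x. x \<in> smp X n ==> e n (d n x) = x"
  and CC: "!!n. C' n = e n ` C n"
 shows "lft E Y q D C"
proof (rule lft_attach[OF X d l C' C])
 fix n x assume "x \<in> C' n" then show "d n x \<in> C n" using CC de subc_sub[OF C] by auto
next
 fix n x x' assume "x \<in> smp X n" "x' \<in> smp X n" "d n x = d n x'" then show "x = x'" using ed by metis
next
 fix n x assume "x \<in> smp X n" "x \<notin> C' n" then show "d n x \<notin> C n" using ed[of x n] CC[of n] by (metis imageI)
next
 fix n x assume "x \<in> smp D n" then show "x \<in> C n \<or> x \<in> d n ` smp X n" using de[of x n] shom_in[OF e, of x n] by (metis imageI)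
qed

definition ncl :: "'b sset => (nat \<times> 'b => (nat \<times> 'b) set) => (nat => 'b set) => bool" where
 "ncl B N D \<longleftrightarrow> (\<forall>n. D n \<subseteq> smp B n) \<and> (\<forall>n. \<forall>b\<in>D n. \<forall>m c. (m, c) \<in> N (n, b) --> c \<in> D m)"

lemma nclD: "ncl B N D ==> b \<in> D n ==> b \<in> smp B n" "ncl B N D ==> b \<in> D n ==> (m, c) \<in> N (n, b) ==> c \<in> D m"
 unfolding ncl_def by blast+

lemma nclI: "(!!n b. b \<in> D n ==> b \<in> smp B n) ==> (!!n b m c. b \<in> D n ==> (m, c) \<in> N (n, b) ==> c \<in> D m) ==> ncl B N D"
 unfolding ncl_def by blast

text \<open>N (n, b) lists what must accompany b. The closure of one simplex under N is countable,
  and B is exhausted from A by adjoining such closures one at a time, each glued along its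
  intersection with the part already reached.\<close>

lemma lft_countable:
 fixes N :: "nat \<times> 'b => (nat \<times> 'b) set" and A :: "nat => 'b set"
 assumes B: "ss B"
  and Nc: "!!n b. b \<in> smp B n ==> countable (N (n, b))"
  and NB: "!!n b m c. b \<in> smp B n ==> (m, c) \<in> N (n, b) ==> c \<in> smp B m"
  and Na: "!!m n \<alpha> b. \<alpha> \<in> ops m n ==> b \<in> smp B n ==> (m, act B m n \<alpha> b) \<in> N (n, b)"
  and A: "ncl B N A"
  and st: "!!D B'. ncl B N D ==> ncl B N B' ==> (!!n. A n \<subseteq> B' n) ==> (!!n. countable (D n)) ==> lft E Y q (res B D) (%n. D n \<inter> B' n)"
 shows "lft E Y q B A"
proof -
 have sub: "subc B D" if "ncl B N D" for D
  unfolding subc_def using nclD[OF that] Na by (intro conjI allI ballI subsetI) blast+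
 let ?F = "%C n. {b. (n, b) \<in> (C :: (nat \<times> 'b) set)}"
 let ?A = "{(n, b). b \<in> A n}"
 have FA: "?F ?A = A" by (auto simp: fun_eq_iff)
 have "lft E Y q B (?F ?A)"
 proof (rule lft_zorn[where Q = "{C. ncl B N (?F C)}"])
  show "?A \<in> {C. ncl B N (?F C)}" using A FA by simp
 next
  fix K assume "K \<subseteq> {C. ncl B N (?F C)}"
  then have k: "ncl B N (?F C)" if "C \<in> K" for C using that by blast
  have "ncl B N (?F (\<Union>K))"
  proof (rule nclI)
   fix n b assume "b \<in> ?F (\<Union>K) n"
   then obtain C where C: "C \<in> K" "b \<in> ?F C n" by auto
   show "b \<in> smp B n" by (rule nclD(1)[OF k[OF C(1)] C(2)])
   fix m c assume "(m, c) \<in> N (n, b)"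
   with nclD(2)[OF k[OF C(1)] C(2) this] C(1) show "c \<in> ?F (\<Union>K) m" by auto
  qed
  then show "\<Union>K \<in> {C. ncl B N (?F C)}" by simp
 next
  fix C assume "C \<in> {C. ncl B N (?F C)}" then show "subc B (?F C)" using sub by simp
 next
  fix C assume C: "C \<in> {C. ncl B N (?F C)}" and AC: "?A \<subseteq> C" and Cn: "?F C \<noteq> smp B"
  have nC: "ncl B N (?F C)" using C by simp
  obtain n b where b: "b \<in> smp B n" "(n, b) \<notin> C" using Cn nclD(1)[OF nC] unfolding fun_eq_iff by blast
  let ?R = "{(x, y). y \<in> N x \<and> snd x \<in> smp B (fst x)}"
  let ?T = "?R\<^sup>* `` {(n, b)}"
  have T: "c \<in> smp B m" if "((n, b), (m, c)) \<in> ?R\<^sup>*" for m c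
   using that
  proof (induction "(m, c)" arbitrary: m c rule: rtrancl_induct)
   case base then show ?case using b(1) by simp
  next
   case (step y) then show ?case using NB by (cases y) auto
  qed
  have "countable ?T"
  proof (rule countable_rtrancl)
   fix Z assume "countable (Z :: (nat \<times> 'b) set)"
   moreover have "?R `` Z = (\<Union>x\<in>{x\<in>Z. snd x \<in> smp B (fst x)}. N x)" by auto
   ultimately show "countable (?R `` Z)" using Nc by (auto intro!: countable_UN)
  qed simp
  then have cT: "countable (?F ?T m)" for m
   by (rule countable_subset[rotated, OF countable_image[of _ snd]]) force
  have nT: "ncl B N (?F ?T)"
  proof (rule nclI)
   fix m c assume c: "c \<in> ?F ?T m"
   then show cB: "c \<in> smp B m" using T by simp
   fix k a assume "(k, a) \<in> N (m, c)"
   then have "((m, c), (k, a)) \<in> ?R" using cB by simp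
   with c show "a \<in> ?F ?T k" by (simp add: rtrancl_into_rtrancl)
  qed
  have nCT: "ncl B N (?F (C \<union> ?T))"
  proof (rule nclI)
   fix m c assume "c \<in> ?F (C \<union> ?T) m"
   then consider "c \<in> ?F C m" | "c \<in> ?F ?T m" by blast
   note cc = this
   show "c \<in> smp B m" using cc nclD(1)[OF nC, of c m] nclD(1)[OF nT, of c m] by argo
   fix k a assume ka: "(k, a) \<in> N (m, c)"
   show "a \<in> ?F (C \<union> ?T) k" using cc nclD(2)[OF nC _ ka] nclD(2)[OF nT _ ka] by (metis (lifting) UnCI mem_Collect_eq)
  qed
  have l: "lft E Y q (res B (?F ?T)) (%n. ?F ?T n \<inter> ?F C n)"
   by (rule st[OF nT nC _ cT]) (use AC in auto)
  have "lft E Y q (res B (?F (C \<union> ?T))) (?F C)"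
  proof (rule lft_attach[OF ss_res[OF B sub[OF nT]] _ l, where \<chi> = "%_ x. x"])
   show "shom (res B (?F ?T)) (res B (?F (C \<union> ?T))) (%_ x. x)" by (auto simp: shom_def)
   show "subc (res B (?F ?T)) (%n. ?F ?T n \<inter> ?F C n)" by (rule subc_res[OF subc_Int[OF sub[OF nT] sub[OF nC]] sub[OF nT]]) auto
   show "subc (res B (?F (C \<union> ?T))) (?F C)" by (rule subc_res[OF sub[OF nC] sub[OF nCT]]) auto
  qed auto
  moreover have "C \<subset> C \<union> ?T" using b(2) by auto
  ultimately show "\<exists>C'\<in>{C. ncl B N (?F C)}. C \<subset> C' \<and> lft E Y q (res B (?F C')) (?F C)"
   using nCT by (intro bexI[of _ "C \<union> ?T"]) auto
 qed auto
 then show ?thesis unfolding FA .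
qed

lemma countable_lepoll_infinite: "countable A ==> infinite B ==> A \<lesssim> B"
 unfolding infinite_le_lepoll using lepoll_trans[of A "UNIV :: nat set" B] by (auto simp: countable_def lepoll_def)

definition faces :: "'b sset => nat => 'b => (nat \<times> 'b) set" where
 "faces B n b = (\<Union>m. (%\<alpha>. (m, act B m n \<alpha> b)) ` ops m n)"

lemma faces: "countable (faces B n b)" "\<alpha> \<in> ops m n ==> (m, act B m n \<alpha> b) \<in> faces B n b"
 "ss B ==> b \<in> smp B n ==> (m, c) \<in> faces B n b ==> c \<in> smp B m"
 "subc B S ==> b \<in> S n ==> (m, c) \<in> faces B n b ==> c \<in> S m"
 unfolding faces_def by (rule countable_UN[OF countableI_type countable_image[OF countable_finite[OF finite_ops]]])
  (auto simp: ss_act subc_act)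

lemma mono_countable:
 assumes B: "ss B" and A: "subc B A"
  and l: "!!D C. ss (D :: 'b sset) ==> subc D C ==> (!!n. countable (smp D n)) ==> lft E Y q D C"
 shows "lft E Y q (B :: 'b sset) A"
proof (rule lft_countable[OF B, where N = "%(n, b). faces B n b"])
 have n: "subc B D" if "ncl B (%(n, b). faces B n b) D" for D
  unfolding subc_def using nclD[OF that] faces(2)[where B = B] by (intro conjI allI ballI subsetI) simp_all
 fix D B' assume "ncl B (%(n, b). faces B n b) D" "ncl B (%(n, b). faces B n b) B'" and c: "!!n. countable (D n)"
 then show "lft E Y q (res B D) (%n. D n \<inter> B' n)"
  using n[of D] n[of B'] by (intro l ss_res[OF B] subc_res subc_Int) (auto simp: c)
next
 show "ncl B (%(n, b). faces B n b) A" by (rule nclI) (use subc_sub[OF A] faces(4)[OF A] in auto)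
next
 fix n b m c assume "b \<in> smp B n" "(m, c) \<in> (case (n, b) of (n, b) => faces B n b)"
 then show "c \<in> smp B m" using faces(3)[OF B, of b n m c] by simp
qed (simp_all add: faces(1,2))

text \<open>The generators occurring in a term. A cell branches over the simplices of one horn,
  which are countable in number, so supports are countable.\<close>

primrec supp :: "('a, 'y) tm => nat => (nat \<times> 'a) set" where
 "supp (Leaf a) = (%n. {(n, a)})"
| "supp (Cell j u w y) = (%n. \<Union>d. \<Union>z\<in>HB j d. supp (u d z) d)"

lemma supp: "wf B Y f n t ==> countable (supp t n) \<and> (\<forall>m c. (m, c) \<in> supp t n --> c \<in> smp B m) \<and>
  (\<forall>C. (\<forall>m c. (m, c) \<in> supp t n --> c \<in> C m) --> wf (res B C) Y f n t)"
proof (induction rule: wf.induct)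
 case (wf_Leaf a n) then show ?case by (auto intro: wf.wf_Leaf)
next
 case (wf_Cell j u w y n)
 have "countable (supp (Cell j u w y) n)"
  using wf_Cell.IH finite_HB by (auto intro!: countable_UN dest: countable_finite simp: countable_finite)
 moreover have "\<forall>m c. (m, c) \<in> supp (Cell j u w y) n --> c \<in> smp B m" using wf_Cell.IH by fastforce
 moreover have "wf (res B C) Y f n (Cell j u w y)" if C: "\<forall>m c. (m, c) \<in> supp (Cell j u w y) n --> c \<in> C m" for C
 proof (rule wf.wf_Cell)
  fix d z assume z: "z \<in> HB j d"
  then have "\<forall>m c. (m, c) \<in> supp (u d z) d --> c \<in> C m" using C by (auto simp del: mem_Collect_eq)
  then show "wf (res B C) Y f d (u d z)" using wf_Cell.IH[OF z] by blast
 qed (use wf_Cell in auto)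
 ultimately show ?case by blast
qed

text \<open>If B' is a closed subcomplex and D a countable closed one, then D \<inter> B' \<rightarrow> D is again a trivial cofibration by two out of three applied
 to A \<inter> D, D \<inter> B' and D.\<close>

lemma tc_countable:
 assumes U: "set_universe U" and t: "tc B A"
  and l: "!!D C. tc (D :: 'b sset) C ==> (!!n. countable (smp D n)) ==> lft E Y q D C"
 shows "lft E Y q (B :: 'b sset) A"
proof -
 have B: "ss B" and A: "subc B A" using t by (auto simp: tc_def)
 obtain \<rho> H where d: "tcdata B A \<rho> H" using t by (auto simp: tc_def)
 have \<rho>: "shom B (R (res B A)) \<rho>" "!!n a. a \<in> A n ==> \<rho> n a = Leaf a" using d by (auto simp: tcdata_def)
 have H: "shom (cyl B) (R B) H" "!!n b. b \<in> smp B n ==> H n (zero n, b) = \<rho> n b" "!!n b. b \<in> smp B n ==> H n (one n, b) = Leaf b"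
  "!!n t a. t \<in> smp J n ==> a \<in> A n ==> H n (t, a) = Leaf a" using d by (auto simp: tcdata_def)
 have w\<rho>: "wf (res B A) pt (%_ _. ()) n (\<rho> n b)" if "b \<in> smp B n" for n b using shom_in[OF \<rho>(1) that] by simp
 have wH: "wf B pt (%_ _. ()) n (H n (t, b))" if "b \<in> smp B n" "t \<in> smp J n" for n b t using shom_in[OF H(1), of "(t, b)" n] that by simp
 \<comment> \<open>A subset closed under N is a subcomplex, and the terms \<rho> b and H (t, b) of
   its simplices b have their generators in it; hence the deformation data restrict.\<close>
 define N where "N z = (case z of (n, b) => faces B n b \<union> supp (\<rho> n b) n \<union> (\<Union>t\<in>smp J n. supp (H n (t, b)) n))" for z
 have Nin: "\<alpha> \<in> ops m n ==> (m, act B m n \<alpha> b) \<in> N (n, b)" "(m, c) \<in> supp (\<rho> n b) n ==> (m, c) \<in> N (n, b)"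
  "t \<in> smp J n ==> (m, c) \<in> supp (H n (t, b)) n ==> (m, c) \<in> N (n, b)" for m n \<alpha> b c t
  unfolding N_def using faces(2)[of \<alpha> m n B b] by auto
 have sub: "subc B D" if "ncl B N D" for D
  unfolding subc_def using nclD[OF that] Nin(1) by (intro conjI allI ballI subsetI) blast+
 have n\<rho>: "wf (res B (%n. A n \<inter> D n)) pt (%_ _. ()) n (\<rho> n b)" if D: "ncl B N D" "b \<in> D n" for D n b
 proof -
  have b: "b \<in> smp B n" and c: "\<forall>m c. (m, c) \<in> supp (\<rho> n b) n --> c \<in> D m" using nclD[OF D] Nin(2) by blast+
  have "wf (res (res B A) (%n. A n \<inter> D n)) pt (%_ _. ()) n (\<rho> n b)"
   using conjunct2[OF conjunct2[OF supp[OF w\<rho>[OF b]]]] conjunct1[OF conjunct2[OF supp[OF w\<rho>[OF b]]]] c by simp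
  then show ?thesis by simp
 qed
 have nH: "wf (res B D) pt (%_ _. ()) n (H n (t, b))" if D: "ncl B N D" "b \<in> D n" "t \<in> smp J n" for D n b t
 proof -
  have b: "b \<in> smp B n" and c: "\<forall>m c. (m, c) \<in> supp (H n (t, b)) n --> c \<in> D m" using nclD[OF D(1,2)] Nin(3)[OF D(3)] by blast+
  show ?thesis using supp[OF wH[OF b D(3)]] c by blast
 qed
 have tcD: "tc (res B D) (%n. A n \<inter> D n)"
  if D: "subc B D" "!!n b. b \<in> D n ==> wf (res B (%n. A n \<inter> D n)) pt (%_ _. ()) n (\<rho> n b)"
   "!!n t b. t \<in> smp J n ==> b \<in> D n ==> wf (res B D) pt (%_ _. ()) n (H n (t, b))" for D
 proof -
  note s = subc_sub[OF D(1)]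
  have "tcdata (res B D) (%n. A n \<inter> D n) \<rho> H"
   unfolding tcdata_def
  proof (intro conjI allI ballI)
   show "shom (res B D) (R (res (res B D) (%n. A n \<inter> D n))) \<rho>"
    by (rule shomI) (use D shom_act[OF \<rho>(1)] s in auto)
   show "shom (cyl (res B D)) (R (res B D)) H"
    by (rule shomI) (use D shom_act[OF H(1)] s in auto)
  qed (use s \<rho>(2) H in auto)
  then show ?thesis using ss_res[OF B D(1)] subc_res[OF subc_Int[OF A D(1)] D(1)] unfolding tc_def by auto
 qed
 show ?thesis
 proof (rule lft_countable[OF B, where N = N])
  show "ncl B N A"
   by (rule nclI) (use subc_sub[OF A] \<rho>(2) H(4) faces(4)[OF A] in "auto simp: N_def split: if_splits")
  fix D B' assume D: "ncl B N D" and B': "ncl B N B'" and AB: "!!n. A n \<subseteq> B' n" and cD: "!!n. countable (D n)"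
  let ?I = "%n. D n \<inter> B' n"
  have sI: "subc B ?I" by (rule subc_Int[OF sub[OF D] sub[OF B']])
  have t1: "tc (res B D) (%n. A n \<inter> D n)" by (rule tcD[OF sub[OF D] n\<rho>[OF D] nH[OF D]])
  have t2: "tc (res B ?I) (%n. A n \<inter> ?I n)"
  proof (rule tcD[OF sI])
   fix n b assume "b \<in> ?I n"
   then have "wf (res B (%n. (A n \<inter> D n) \<inter> (A n \<inter> B' n))) pt (%_ _. ()) n (\<rho> n b)"
    by (intro wf_res_Int[OF n\<rho>[OF D] n\<rho>[OF B']]) auto
   moreover have "(%n. (A n \<inter> D n) \<inter> (A n \<inter> B' n)) = (%n. A n \<inter> ?I n)" by auto
   ultimately show "wf (res B (%n. A n \<inter> ?I n)) pt (%_ _. ()) n (\<rho> n b)" by simp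
   fix t assume "t \<in> smp J n"
   then show "wf (res B ?I) pt (%_ _. ()) n (H n (t, b))"
    using \<open>b \<in> ?I n\<close> by (intro wf_res_Int[OF nH[OF D] nH[OF B']]) auto
  qed
  have e: "(%n. A n \<inter> ?I n) = (%n. A n \<inter> D n)" using AB by blast
  have sAD: "subc B (%n. A n \<inter> D n)" by (rule subc_Int[OF A sub[OF D]])
  have w: "wq U (res (res B D) ?I) (res B D) (%n x. x)"
   unfolding wq_def
  proof (intro ballI impI)
   fix Z assume Z: "jfib Z"
   have "weqZ Z (res B (%n. A n \<inter> D n)) (res B ?I) (%n x. x)" using tc_weqZ[OF t2 Z] e by simp
   moreover have "weqZ Z (res B (%n. A n \<inter> D n)) (res B D) (%n x. x)" using tc_weqZ[OF t1 Z] by simp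
   ultimately show "weqZ Z (res (res B D) ?I) (res B D) (%n x. x)"
    using weqZ_left[OF Z ss_res[OF B sAD] ss_res[OF B sI] ss_res[OF B sub[OF D]], of "%n x. x" "%n x. x"] AB
    by (auto simp: shom_def)
  qed
  obtain L where L: "L \<in> U" "infinite L" using U by (auto simp: set_universe_def)
  have "smp (res B D) n \<lesssim> L" for n using countable_lepoll_infinite[OF cD L(2)] by simp
  then have "usmall U (res B D)" using L(1) ss_res[OF B sub[OF D]] by (auto simp: usmall_def small_def)
  from wq_tc[OF U this subc_res[OF sI sub[OF D]] w] show "lft E Y q (res B D) ?I"
   using l cD by auto
 next
  fix n b assume "b \<in> smp B n" then show "countable (N (n, b))"
   unfolding N_def prod.case using faces(1)[of B n b] supp[OF w\<rho>] supp[OF wH]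
   by (intro countable_Un countable_UN countable_finite[OF finite_J]) auto
 next
  fix n b m c assume b: "b \<in> smp B n" "(m, c) \<in> N (n, b)"
  then show "c \<in> smp B m"
   using faces(3)[OF B b(1)] supp[OF w\<rho>[OF b(1)]] supp[OF wH[OF b(1)]] subc_sub[OF A] by (auto simp: N_def)
 qed (rule Nin(1))
qed

section \<open>Codes for countable simplicial sets\<close>

text \<open>Values of act outside its domain are fixed in a code, so that there is only a small set of codes.\<close>

definition codes :: "'u set => 'u sset set" where
 "codes N = {X. ss X \<and> (\<forall>n. smp X n \<subseteq> N) \<and>
   (\<forall>m n \<alpha> y. \<not> (\<alpha> \<in> ops m n \<and> y \<in> smp X n) --> act X m n \<alpha> y = undefined)}"

lemma lepoll_countable_PiE:
 assumes K: "countable K" and V: "V \<lesssim> N" and v0: "v0 \<in> N"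
 shows "(K \<rightarrow>\<^sub>E V) \<lesssim> ((UNIV :: nat set) \<rightarrow>\<^sub>E (N :: 'u set))"
proof -
 obtain v where v: "inj_on v V" "v ` V \<subseteq> N" using V by (auto simp: lepoll_def)
 let ?c = "%g k. if k \<in> to_nat_on K ` K then v (g (from_nat_into K k)) else v0"
 have f: "from_nat_into K (to_nat_on K x) = x" if "x \<in> K" for x using K that by simp
 have "inj_on ?c (K \<rightarrow>\<^sub>E V)"
 proof (rule inj_onI)
  fix g h assume g: "g \<in> K \<rightarrow>\<^sub>E V" "h \<in> K \<rightarrow>\<^sub>E V" and e: "?c g = ?c h"
  show "g = h"
  proof (rule PiE_ext[OF g])
   fix x assume x: "x \<in> K"
   have "v (g x) = v (h x)" using fun_cong[OF e, of "to_nat_on K x"] f[OF x] x by simp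
   then show "g x = h x" using inj_onD[OF v(1)] PiE_mem[OF g(1) x] PiE_mem[OF g(2) x] by blast
  qed
 qed
 moreover have "?c ` (K \<rightarrow>\<^sub>E V) \<subseteq> UNIV \<rightarrow>\<^sub>E N"
 proof (clarsimp simp: PiE_iff v0)
  fix g x assume "\<forall>i\<in>K. g i \<in> V" "x \<in> K" then show "v (g (from_nat_into K (to_nat_on K x))) \<in> N" using f v(2) by auto
 qed
 ultimately show ?thesis unfolding lepoll_def by blast
qed

text \<open>A code with a subcomplex is determined by countably many values in a countable set: for
  each operator and each element of N whether it is a simplex, its image and its membership in C.
  Identity operators recover the simplices and C.\<close>

lemma small_codes:
 fixes U :: "'u set set"
 assumes U: "set_universe U" and N: "N \<in> U" "infinite N" "countable N"
 shows "small U {(X, C). X \<in> codes N \<and> subc X C}"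
proof -
 let ?K = "{(m, n, \<alpha>, y). \<alpha> \<in> ops m n \<and> y \<in> N}" and ?V = "insert None (Some ` (N \<times> (UNIV :: bool set)))"
 let ?c = "%(X, C). \<lambda>(m, n, \<alpha>, y)\<in>?K. if y \<in> smp X n then Some (act X m n \<alpha> y, y \<in> C n) else None"
 have "?K = (\<Union>m. \<Union>n. (%(\<alpha>, y). (m, n, \<alpha>, y)) ` (ops m n \<times> N))" by auto
 then have K: "countable ?K" using N(3) finite_ops countable_finite by (auto intro!: countable_UN countable_image countable_SIGMA countable_finite[OF finite_ops])
 have "countable ?V" using N(3) by (auto intro!: countable_image countable_SIGMA)
 then have V: "?V \<lesssim> N" by (rule countable_lepoll_infinite[OF _ N(2)])
 have inj: "inj_on ?c {(X, C). X \<in> codes N \<and> subc X C}"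
 proof (rule inj_onI)
  fix p p' assume "p \<in> {(X :: 'u sset, C). X \<in> codes N \<and> subc X C}" "p' \<in> {(X :: 'u sset, C). X \<in> codes N \<and> subc X C}"
   and e': "?c p = ?c p'"
  then obtain X C X' C' where p: "p = (X, C)" "p' = (X', C')" and X: "X \<in> codes N" "X' \<in> codes N" and C: "subc X C" "subc X' C'" by blast
  have e: "?c (X, C) = ?c (X', C')" using e' unfolding p .
  have ev: "(if y \<in> smp X n then Some (act X m n \<alpha> y, y \<in> C n) else None) = (if y \<in> smp X' n then Some (act X' m n \<alpha> y, y \<in> C' n) else None)"
   if "\<alpha> \<in> ops m n" "y \<in> N" for m n \<alpha> y
   using fun_cong[OF e, of "(m, n, \<alpha>, y)"] that by simp
  have XN: "smp X n \<subseteq> N" "smp X' n \<subseteq> N" for n using X by (auto simp: codes_def)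
  have "y \<in> smp X n \<longleftrightarrow> y \<in> smp X' n" if "y \<in> N" for y n
   using ev[OF ops_id that, of n] by (auto split: if_splits)
  then have s: "smp X n = smp X' n" for n using XN[of n] by blast
  have "y \<in> C n \<longleftrightarrow> y \<in> C' n" if "y \<in> N" "y \<in> smp X n" for y n
   using ev[OF ops_id that(1), of n] that(2) s[of n] by simp
  then have c: "C n = C' n" for n using XN[of n] subc_sub[OF C(1)] subc_sub[OF C(2)] s[of n] by blast
  have a: "act X m n \<alpha> y = act X' m n \<alpha> y" for m n \<alpha> y
  proof (cases "\<alpha> \<in> ops m n \<and> y \<in> smp X n")
   case True then show ?thesis using ev[of \<alpha> m n y] XN[of n] s[of n] by auto
  next
   case False then show ?thesis using X s[of n] by (auto simp: codes_def)
  qed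
  have "X = X'" using s a by (intro sset.equality) (auto simp: fun_eq_iff)
  then show "p = p'" using c unfolding p by auto
 qed
 have "?c ` {(X, C). X \<in> codes N \<and> subc X C} \<subseteq> ?K \<rightarrow>\<^sub>E ?V"
 proof (rule image_subsetI)
  fix p assume "p \<in> {(X :: 'u sset, C). X \<in> codes N \<and> subc X C}"
  then obtain X C where p: "p = (X, C)" and X: "X \<in> codes N" by blast
  then have "act X m n \<alpha> y \<in> N" if "\<alpha> \<in> ops m n" "y \<in> smp X n" for m n \<alpha> y
   using ss_act[of X \<alpha> m n y] that by (auto simp: codes_def)
  then show "?c p \<in> ?K \<rightarrow>\<^sub>E ?V" unfolding p(1) by auto
 qed
 with inj have l1: "{(X, C). X \<in> codes N \<and> subc X C} \<lesssim> (?K \<rightarrow>\<^sub>E ?V)" unfolding lepoll_def by (intro exI conjI)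
 have "N \<noteq> {}" using N(2) by auto
 then obtain v0 where v0: "v0 \<in> N" by blast
 obtain L where L: "L \<in> U" "((UNIV :: nat set) \<rightarrow>\<^sub>E N) \<lesssim> L" using U N(1) unfolding set_universe_def by meson
 have "{(X, C). X \<in> codes N \<and> subc X C} \<lesssim> L" by (rule lepoll_trans[OF l1 lepoll_trans[OF lepoll_countable_PiE[OF K V v0] L(2)]])
 with L(1) show ?thesis unfolding small_def by (rule bexI[rotated])
qed

lemma code_exists:
 assumes D: "ss D" and cD: "!!n. countable (smp D n)" and N: "infinite N"
 obtains X e d where "X \<in> codes N" "shom D X e" "shom X D d" "!!n x. x \<in> smp D n ==> d n (e n x) = x" "!!n x. x \<in> smp X n ==> e n (d n x) = x"
proof -
 have "smp D n \<lesssim> N" for n by (rule countable_lepoll_infinite[OF cD N])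
 then have "\<exists>e. \<forall>n. inj_on (e n) (smp D n) \<and> e n ` smp D n \<subseteq> N" unfolding lepoll_def by (intro choice) blast
 then obtain e where e: "!!n. inj_on (e n) (smp D n)" "!!n. e n ` smp D n \<subseteq> N" by blast
 let ?Y = "copy e D"
 let ?X = "\<lparr>smp = smp ?Y, act = %m n \<alpha> y. if \<alpha> \<in> ops m n \<and> y \<in> smp ?Y n then act ?Y m n \<alpha> y else undefined\<rparr>"
 have Y: "ss ?Y" by (rule ss_copy[OF D e(1)])
 have X: "ss ?X" unfolding simplicial_set_def using ss_act[OF Y] ss_id[OF Y] ss_comp[OF Y] ops_compose by (auto simp: ops_id)
 have "?X \<in> codes N" using X e(2) by (auto simp: codes_def copy_simps(1))
 moreover have "shom D ?X e" using shom_copy(1)[OF D e(1)] by (auto simp: shom_def)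
 moreover have "shom ?X D (%n. inv_into (smp D n) (e n))" using shom_copy(2)[OF D e(1)] by (auto simp: shom_def)
 ultimately show ?thesis using that[of ?X e "%n. inv_into (smp D n) (e n)"] e(1) by (auto simp: copy_simps(1) f_inv_into_f)
qed

lemma mono_codes:
 fixes B :: "'c sset"
 assumes N: "infinite N" and B: "ss B" and A: "subc B A"
  and l: "!!X C. X \<in> codes N ==> subc X C ==> lft E Y q X C"
 shows "lft E Y q B A"
proof (rule mono_countable[OF B A])
 fix D :: "'c sset" and C assume D: "ss D" and C: "subc D C" and c: "!!n. countable (smp D n)"
 obtain X e d where X: "X \<in> codes N" "shom D X e" "shom X D d" "!!n x. x \<in> smp D n ==> d n (e n x) = x" "!!n x. x \<in> smp X n ==> e n (d n x) = x"
  using code_exists[OF D c N] by blast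
 have eC: "subc X (%n. e n ` C n)"
  using shom_in[OF X(2)] subc_sub[OF C] subc_act[OF C] by (fastforce simp: subc_def[of X] shom_act[OF X(2), symmetric])
 have "ss X" using X(1) by (simp add: codes_def)
 then show "lft E Y q D C" by (rule lft_iso_D[OF l[OF X(1) eC] _ eC C X(2-5)]) auto
qed

text \<open>\<open>tc\<close> is transported to an isomorphic code by way of weak equivalences,
  which are visibly invariant, instead of renaming generators inside terms.\<close>

lemma tc_codes:
 fixes B :: "'c sset" and U :: "'a set set"
 assumes U: "set_universe U" and N: "infinite N" "N \<in> U" and t: "tc B A"
  and l: "!!X C. X \<in> codes N ==> tc X C ==> lft E Y q X C"
 shows "lft E Y q B A"
proof (rule tc_countable[OF U t])
 fix D :: "'c sset" and C assume t: "tc D C" and c: "!!n. countable (smp D n)"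
 have D: "ss D" and C: "subc D C" using t by (auto simp: tc_def)
 obtain X e d where X: "X \<in> codes N" "shom D X e" "shom X D d" "!!n x. x \<in> smp D n ==> d n (e n x) = x" "!!n x. x \<in> smp X n ==> e n (d n x) = x"
  using code_exists[OF D c N(1)] by blast
 have eC: "subc X (%n. e n ` C n)"
  using shom_in[OF X(2)] subc_sub[OF C] subc_act[OF C] by (fastforce simp: subc_def[of X] shom_act[OF X(2), symmetric])
 have Xs: "ss X" using X(1) by (simp add: codes_def)
 have dC: "d n y \<in> C n" if "y \<in> e n ` C n" for n y using that X(4) subc_sub[OF C] by auto
 have "smp X n \<lesssim> N" for n using X(1) by (auto simp: codes_def intro: subset_imp_lepoll)
 then have u: "usmall U X" using N(2) Xs by (auto simp: usmall_def small_def)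
 have "wq U (res X (%n. e n ` C n)) X (%n x. x)"
  unfolding wq_def
 proof (intro ballI impI)
  fix Z :: "'a sset" assume Z: "jfib Z"
  show "weqZ Z (res X (%n. e n ` C n)) X (%n x. x)"
   by (rule weqZ_retract[OF Z ss_res[OF Xs eC] Xs tc_weqZ[OF t Z], where i = d and r = e and i' = d and r' = e])
     (use X dC eC subc_sub[OF C] subc_sub[OF eC] in "auto simp: shom_def")
 qed
 from lft_iso_D[OF l[OF X(1) wq_tc[OF U u eC this]] Xs eC C X(2-5)] show "lft E Y q D C" by simp
qed

section \<open>Cofree simplicial sets\<close>

text \<open>
 The nondegenerate simplices of the n-simplex are its faces. An n-simplex of cofree A assigns to each face of
 the n-simplex a simplex of A of the same dimension or a base point. Only finitely many faces occur, so that no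
 infinite products of sets of simplices of different dimensions are needed (these need not be small). Maps D \<rightarrow> cofree A are
 families of maps of sets that vanish on degenerate simplices.
\<close>

definition idx :: "nat => (nat \<times> (nat => nat)) set" where
 "idx n = {(k, \<alpha>). nondeg (simplex n) k \<alpha>}"

definition cofree :: "'a sset => (nat \<times> (nat => nat) => 'a option) sset" where
 "cofree A = \<lparr>smp = %n. PiE (idx n) (%(k, \<alpha>). insert None (Some ` smp A k)),
   act = %m n \<beta> \<phi>. \<lambda>(k, \<alpha>)\<in>idx m. if (k, compose {..k} \<beta> \<alpha>) \<in> idx n then \<phi> (k, compose {..k} \<beta> \<alpha>) else None\<rparr>"

lemma cofree_simps: "smp (cofree A) n = PiE (idx n) (%(k, \<alpha>). insert None (Some ` smp A k))"
 "act (cofree A) m n \<beta> \<phi> = (\<lambda>(k, \<alpha>)\<in>idx m. if (k, compose {..k} \<beta> \<alpha>) \<in> idx n then \<phi> (k, compose {..k} \<beta> \<alpha>) else None)"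
 by (auto simp: cofree_def)

lemma compose_assoc_ops: "\<alpha> \<in> ops l k ==> compose {..l} (compose {..k} \<gamma> \<beta>) \<alpha> = compose {..l} \<gamma> (compose {..l} \<beta> \<alpha>)"
 by (auto simp: compose_def fun_eq_iff dest: ops_le)

lemma idx_ops: "(k, \<alpha>) \<in> idx n ==> \<alpha> \<in> ops k n"
 by (simp add: idx_def nondeg_def simplex_simps)

lemma idx_not: "\<alpha> \<in> ops k n ==> (k, \<alpha>) \<notin> idx n ==> \<exists>m<k. \<exists>\<gamma>\<in>ops k m. \<exists>z\<in>ops m n. \<alpha> = compose {..k} z \<gamma>"
 by (simp add: idx_def nondeg_def simplex_simps)

lemma idx_notI: "m < k ==> \<gamma> \<in> ops k m ==> z \<in> ops m n ==> (k, compose {..k} z \<gamma>) \<notin> idx n"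
 unfolding idx_def nondeg_def simplex_simps by blast

lemma idx_low: "\<alpha> \<in> ops k d ==> d < k ==> (k, \<alpha>) \<notin> idx d"
 using idx_notI[of d k \<alpha> "\<lambda>i\<in>{..d}. i" d] by (simp add: ops_id compose_id_left)

lemma idx_le: "(k, \<alpha>) \<in> idx n ==> k \<le> n"
 using idx_low[of \<alpha> k n] idx_ops[of k \<alpha> n] by linarith

lemma idx_pre:
 assumes a: "\<alpha> \<in> ops m n" and b: "\<beta> \<in> ops k m" and i: "(k, compose {..k} \<alpha> \<beta>) \<in> idx n"
 shows "(k, \<beta>) \<in> idx m"
proof (rule ccontr)
 assume "(k, \<beta>) \<notin> idx m"
 then obtain p \<gamma> z where p: "p < k" "\<gamma> \<in> ops k p" "z \<in> ops p m" "\<beta> = compose {..k} z \<gamma>" using idx_not[OF b] by blast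
 then have "compose {..k} \<alpha> \<beta> = compose {..k} (compose {..p} \<alpha> z) \<gamma>" using compose_assoc_ops[OF p(2), of \<alpha> z] by simp
 with idx_notI[OF p(1,2) ops_compose[OF p(3) a]] i show False by simp
qed

lemma idx_id: "(n, \<lambda>i\<in>{..n}. i) \<in> idx n"
proof (rule ccontr)
 assume "(n, \<lambda>i\<in>{..n}. i) \<notin> idx n"
 then obtain m \<gamma> z where m: "m < n" "\<gamma> \<in> ops n m" "(\<lambda>i\<in>{..n}. i) = compose {..n} z \<gamma>" using idx_not[OF ops_id] by blast
 have "z (\<gamma> i) = i" if "i \<le> n" for i using fun_cong[OF m(3), of i] that by (simp add: compose_def)
 then have "inj_on \<gamma> {..n}" by (intro inj_on_inverseI[of _ z]) simp
 moreover have "\<gamma> ` {..n} \<subseteq> {..m}" using ops_le[OF m(2)] by auto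
 ultimately have "card {..n} \<le> card {..m}" by (intro card_inj_on_le) auto
 with m(1) show False by simp
qed

lemma finite_idx: "finite (idx n)"
 by (rule finite_subset[of _ "SIGMA k:{..n}. ops k n"]) (auto dest: idx_le idx_ops intro: finite_ops)

lemma ss_cofree: "ss (cofree A)"
 unfolding simplicial_set_def cofree_simps
proof (intro conjI allI ballI)
 fix m n \<alpha> \<phi> assume a: "\<alpha> \<in> ops m n" and p: "\<phi> \<in> PiE (idx n) (%(k, \<alpha>). insert None (Some ` smp A k))"
 have "(if (k, \<beta>) \<in> idx n then \<phi> (k, \<beta>) else None) \<in> insert None (Some ` smp A k)" for k \<beta> using PiE_mem[OF p, of "(k, \<beta>)"] by simp
 then show "(\<lambda>(k, \<beta>)\<in>idx m. if (k, compose {..k} \<alpha> \<beta>) \<in> idx n then \<phi> (k, compose {..k} \<alpha> \<beta>) else None) \<in> PiE (idx m) (%(k, \<alpha>). insert None (Some ` smp A k))"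
  by (auto simp only: restrict_PiE_iff split_beta)
next
 fix n \<phi> assume p: "\<phi> \<in> PiE (idx n) (%(k, \<alpha>). insert None (Some ` smp A k))"
 show "(\<lambda>(k, \<alpha>)\<in>idx n. if (k, compose {..k} (\<lambda>i\<in>{..n}. i) \<alpha>) \<in> idx n then \<phi> (k, compose {..k} (\<lambda>i\<in>{..n}. i) \<alpha>) else None) = \<phi>"
 proof
  fix z :: "nat \<times> (nat => nat)" obtain k \<alpha> where z: "z = (k, \<alpha>)" by (cases z)
  show "(\<lambda>(k, \<alpha>)\<in>idx n. if (k, compose {..k} (\<lambda>i\<in>{..n}. i) \<alpha>) \<in> idx n then \<phi> (k, compose {..k} (\<lambda>i\<in>{..n}. i) \<alpha>) else None) z = \<phi> z"
   using PiE_arb[OF p, of z] compose_id_left[OF idx_ops, of k \<alpha> n] unfolding z by (auto simp del: restrict_apply simp: restrict_def[of _ "idx n"])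
 qed
next
 fix k m n \<beta> \<alpha> \<phi> assume b: "\<beta> \<in> ops k m" and a: "\<alpha> \<in> ops m n"
 have e: "compose {..l} (compose {..k} \<alpha> \<beta>) \<gamma> = compose {..l} \<alpha> (compose {..l} \<beta> \<gamma>)" if "(l, \<gamma>) \<in> idx k" for l \<gamma>
  by (rule compose_assoc_ops[OF idx_ops[OF that]])
 have i: "(l, compose {..l} \<beta> \<gamma>) \<in> idx m" if "(l, \<gamma>) \<in> idx k" "(l, compose {..l} \<alpha> (compose {..l} \<beta> \<gamma>)) \<in> idx n" for l \<gamma>
  by (rule idx_pre[OF a ops_compose[OF idx_ops[OF that(1)] b] that(2)])
 show "(\<lambda>(l, \<gamma>)\<in>idx k. if (l, compose {..l} (compose {..k} \<alpha> \<beta>) \<gamma>) \<in> idx n then \<phi> (l, compose {..l} (compose {..k} \<alpha> \<beta>) \<gamma>) else None) =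
   (\<lambda>(l, \<gamma>)\<in>idx k. if (l, compose {..l} \<beta> \<gamma>) \<in> idx m then
     (\<lambda>(l, \<gamma>)\<in>idx m. if (l, compose {..l} \<alpha> \<gamma>) \<in> idx n then \<phi> (l, compose {..l} \<alpha> \<gamma>) else None) (l, compose {..l} \<beta> \<gamma>) else None)"
  by (rule restrict_ext) (use i in "auto simp: e")
qed

definition cofree_map :: "'d sset => (nat => 'd => 'a option) => nat => 'd => nat \<times> (nat => nat) => 'a option" where
 "cofree_map D f n x = (\<lambda>(k, \<alpha>)\<in>idx n. f k (act D k n \<alpha> x))"

lemma cofree_map_at: "(k, \<alpha>) \<in> idx n ==> cofree_map D f n x (k, \<alpha>) = f k (act D k n \<alpha> x)"
 by (simp add: cofree_map_def)

lemma shom_cofree_map: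
 assumes D: "ss D" and f: "!!k x. x \<in> smp D k ==> f k x \<in> insert None (Some ` smp A k)"
  and z: "!!k m \<gamma> y. m < k ==> \<gamma> \<in> ops k m ==> y \<in> smp D m ==> f k (act D k m \<gamma> y) = None"
 shows "shom D (cofree A) (cofree_map D f)"
proof (rule shomI)
 fix n x assume x: "x \<in> smp D n"
 have "f k (act D k n \<alpha> x) \<in> insert None (Some ` smp A k)" if "(k, \<alpha>) \<in> idx n" for k \<alpha>
  by (rule f[OF ss_act[OF D idx_ops[OF that] x]])
 then show "cofree_map D f n x \<in> smp (cofree A) n"
  unfolding cofree_simps cofree_map_def by (intro PiE_I) (auto simp: restrict_def)
next
 fix m n \<beta> x assume b: "\<beta> \<in> ops m n" and x: "x \<in> smp D n"
 show "cofree_map D f m (act D m n \<beta> x) = act (cofree A) m n \<beta> (cofree_map D f n x)"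
  unfolding cofree_simps cofree_map_def[of D f m]
 proof (rule restrict_ext, clarify)
  fix k \<alpha> assume i: "(k, \<alpha>) \<in> idx m"
  note a = idx_ops[OF i]
  have e: "act D k m \<alpha> (act D m n \<beta> x) = act D k n (compose {..k} \<beta> \<alpha>) x" by (rule ss_comp[OF D a b x])
  show "f k (act D k m \<alpha> (act D m n \<beta> x)) =
    (if (k, compose {..k} \<beta> \<alpha>) \<in> idx n then cofree_map D f n x (k, compose {..k} \<beta> \<alpha>) else None)"
  proof (cases "(k, compose {..k} \<beta> \<alpha>) \<in> idx n")
   case False
   then obtain p \<gamma> y where p: "p < k" "\<gamma> \<in> ops k p" "y \<in> ops p n" "compose {..k} \<beta> \<alpha> = compose {..k} y \<gamma>"
    using idx_not[OF ops_compose[OF a b]] by blast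
   have "f k (act D k n (compose {..k} y \<gamma>) x) = None"
    using z[OF p(1,2) ss_act[OF D p(3) x]] ss_comp[OF D p(2,3) x] by simp
   with False show ?thesis by (simp add: e p(4))
  qed (simp add: e cofree_map_at)
 qed
qed

definition ndeg_part :: "'a sset => nat => 'a => 'a option" where
 "ndeg_part A k x = (if nondeg A k x then Some x else None)"

text \<open>Only nondegenerate faces are recorded, and they still determine x. Its nondegenerate
  part z is one of them, and the sections along which z is seen determine the degeneracy that leads
  back to x.\<close>

lemma cofree_unit:
 assumes A: "ss A"
 shows "shom A (cofree A) (cofree_map A (ndeg_part A))" "inj_on (cofree_map A (ndeg_part A) n) (smp A n)"
proof -
 show "shom A (cofree A) (cofree_map A (ndeg_part A))"
  by (rule shom_cofree_map[OF A]) (auto simp: ndeg_part_def nondeg_def)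
 show "inj_on (cofree_map A (ndeg_part A) n) (smp A n)"
 proof (rule inj_onI)
  fix x y assume x: "x \<in> smp A n" and y: "y \<in> smp A n" and e: "cofree_map A (ndeg_part A) n x = cofree_map A (ndeg_part A) n y"
  have k: "ndeg_part A k (act A k n \<gamma> x) = ndeg_part A k (act A k n \<gamma> y)" if "(k, \<gamma>) \<in> idx n" for k \<gamma>
   using fun_cong[OF e, of "(k, \<gamma>)"] that by (simp add: cofree_map_at)
  have sec: "(d, \<sigma>) \<in> idx n" if "\<alpha> \<in> ops n d" "\<sigma> \<in> ops d n" "compose {..d} \<alpha> \<sigma> = (\<lambda>k\<in>{..d}. k)" for d \<alpha> \<sigma>
   by (rule idx_pre[OF that(1,2)]) (simp add: that(3) idx_id)
  obtain d \<alpha> \<sigma> z where X: "\<alpha> \<in> ops n d" "\<alpha> ` {..n} = {..d}" "nondeg A d z" "x = act A n d \<alpha> z"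
   using ez_exists[OF A x] by metis
  obtain d' \<alpha>' \<sigma>' z' where Y: "\<alpha>' \<in> ops n d'" "\<sigma>' \<in> ops d' n" "compose {..d'} \<alpha>' \<sigma>' = (\<lambda>k\<in>{..d'}. k)"
    "nondeg A d' z'" "y = act A n d' \<alpha>' z'" "z' = act A d' n \<sigma>' y"
   using ez_exists[OF A y] by metis
  have zA: "z \<in> smp A d" using X(3) by (simp add: nondeg_def)
  have "act A d' n \<sigma>' x = z'"
   using k[OF sec[OF Y(1-3)]] Y(4,6) by (simp add: ndeg_part_def split: if_splits)
  then have z': "z' = act A d' d (compose {..d'} \<alpha> \<sigma>') z" using ss_comp[OF A Y(2) X(1) zA] X(4) by simp
  let ?\<epsilon> = "compose {..n} (compose {..d'} \<alpha> \<sigma>') \<alpha>'"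
  have o: "compose {..d'} \<alpha> \<sigma>' \<in> ops d' d" by (rule ops_compose[OF Y(2) X(1)])
  have \<epsilon>: "?\<epsilon> \<in> ops n d" by (rule ops_compose[OF Y(1) o])
  have y': "y = act A n d ?\<epsilon> z" using Y(5) ss_comp[OF A Y(1) o zA] by (simp add: z')
  have "?\<epsilon> = \<alpha>"
  proof (rule ops_eqI[OF \<epsilon> X(1)])
   fix i assume i: "i \<le> n"
   obtain \<tau> where t: "\<tau> \<in> ops d n" "compose {..d} \<alpha> \<tau> = (\<lambda>k\<in>{..d}. k)" "\<tau> (\<alpha> i) = i"
    by (rule section_through[OF X(1,2) i])
   have "act A d n \<tau> x = z" using ss_comp[OF A t(1) X(1) zA] ss_id[OF A zA] X(4) t(2) by simp
   then have "act A d n \<tau> y = z" using k[OF sec[OF X(1) t(1,2)]] X(3) by (simp add: ndeg_part_def split: if_splits)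
   then have "z = act A d d (compose {..d} ?\<epsilon> \<tau>) z" using ss_comp[OF A t(1) \<epsilon> zA] y' by simp
   from nondeg_endo[OF A X(3) ops_compose[OF t(1) \<epsilon>] this ops_le[OF X(1) i]]
   show "?\<epsilon> i = \<alpha> i" using ops_le[OF X(1) i] t(3) by (simp add: compose_at)
  qed
  then show "x = y" using y' X(4) by simp
 qed
qed

lemma small_cofree:
 assumes U: "set_universe U" and A: "usmall U A"
 shows "usmall U (cofree A)"
proof -
 have "small U (smp (cofree A) n)" for n
 proof -
  obtain L where L: "L \<in> U" "idem L" "!!k. k \<le> n ==> smp A k \<lesssim> L"
   using idem_common[OF U, of "{..n}" "smp A"] A by (auto simp: usmall_def)
  have "insert None (Some ` (\<Union>k\<in>{..n}. smp A k)) = {None} \<union> Some ` (\<Union>k\<in>{..n}. smp A k)" by simp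
  also have "\<dots> \<lesssim> L"
   by (intro idem_Un[OF L(2)] idem_countable[OF L(2)] lepoll_trans[OF image_lepoll] idem_UN[OF L(2)] L(3)) auto
  finally have V: "insert None (Some ` (\<Union>k\<in>{..n}. smp A k)) \<lesssim> L" .
  have "infinite L" using L(2) by (simp add: idem_def)
  then have "L \<noteq> {}" by auto
  then obtain v0 where v0: "v0 \<in> L" by blast
  obtain L' where L': "L' \<in> U" "((UNIV :: nat set) \<rightarrow>\<^sub>E L) \<lesssim> L'" using U L(1) unfolding set_universe_def by meson
  have "smp (cofree A) n \<subseteq> idx n \<rightarrow>\<^sub>E insert None (Some ` (\<Union>k\<in>{..n}. smp A k))"
   unfolding cofree_simps by (rule PiE_mono) (auto dest: idx_le)
  then have "smp (cofree A) n \<lesssim> L'"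
   by (rule lepoll_trans[OF subset_imp_lepoll lepoll_trans[OF lepoll_countable_PiE[OF countable_finite[OF finite_idx] V v0] L'(2)]])
  then show ?thesis using L'(1) unfolding small_def by (rule bexI)
 qed
 then show ?thesis using ss_cofree by (simp add: usmall_def)
qed

lemma small_prod:
 assumes U: "set_universe U" and A: "usmall U A" and B: "usmall U B"
 shows "usmall U (sset_prod A B)"
proof -
 have "small U (smp (sset_prod A B) n)" for n
 proof -
  have a: "small U (smp A n)" and b: "small U (smp B n)" using A B by (auto simp: usmall_def)
  obtain L1 where L1: "L1 \<in> U" "smp A n \<lesssim> L1" using a unfolding small_def by blast
  obtain L2 where L2: "L2 \<in> U" "smp B n \<lesssim> L2" using b unfolding small_def by blast
  have "\<exists>L\<in>U. idem L \<and> (\<forall>i\<in>{L1, L2}. i \<lesssim> L)" by (rule idem_common[OF U]) (use L1 L2 small_mem in auto)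
  then obtain L where L: "L \<in> U" "idem L" "L1 \<lesssim> L" "L2 \<lesssim> L" by auto
  have "smp (sset_prod A B) n \<lesssim> L" unfolding sset_prod_simps
   by (rule idem_prod[OF L(2) lepoll_trans[OF L1(2) L(3)] lepoll_trans[OF L2(2) L(4)]])
  then show ?thesis using L(1) unfolding small_def by (rule bexI)
 qed
 then show ?thesis using A B by (simp add: usmall_def)
qed

lemma factor_mono:
 fixes A :: "'a sset" and B :: "'b sset"
 assumes U: "set_universe U" and A: "usmall U A" and B: "usmall U B" and f: "shom A B f"
 shows "\<exists>(E :: ('b \<times> (nat \<times> (nat => nat) => 'a option)) sset) i p. usmall U E \<and> shom A E i \<and> shom E B p \<and>
  (\<forall>n. \<forall>a\<in>smp A n. p n (i n a) = f n a) \<and> (\<forall>n. inj_on (i n) (smp A n)) \<and>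
  (\<forall>(D :: 'd sset) C. ss D --> subc D C --> lft E B p D C)"
proof -
 have As: "ss A" using A by (simp add: usmall_def)
 let ?E = "sset_prod B (cofree A)" and ?i = "%n a. (f n a, cofree_map A (ndeg_part A) n a)"
 note u = cofree_unit[OF As]
 have i: "shom A ?E ?i" by (rule shom_pair[OF f u(1)])
 have inj: "inj_on (?i n) (smp A n)" for n using u(2)[of n] by (auto simp: inj_on_def)
 have l: "lft ?E B (%n. fst) D C" if D: "ss D" and C: "subc D C" for D :: "'d sset" and C
 proof (rule lftI)
  fix g w assume g: "shom (res D C) ?E g" and w: "shom D B w" and gw: "!!n x. x \<in> C n ==> fst (g n x) = w n x"
  have gc: "shom (res D C) (cofree A) (%n x. snd (g n x))" by (rule shom_comp[OF g shom_snd])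
  \<comment> \<open>Simplices off C get the base point. A degenerate simplex of C also gets it: its
    nondegenerate part lies in C in a lower dimension d, and the top face of a simplex pulled back
    from dimension d is the base point.\<close>
  let ?f = "%k x. if x \<in> C k then snd (g k x) (k, \<lambda>i\<in>{..k}. i) else None"
  have ev: "snd (g k (act D k n \<alpha> x)) (k, \<lambda>i\<in>{..k}. i) = (if (k, \<alpha>) \<in> idx n then snd (g n x) (k, \<alpha>) else None)"
   if a: "\<alpha> \<in> ops k n" and x: "x \<in> C n" for k n \<alpha> x
  proof -
   have "snd (g k (act D k n \<alpha> x)) = act (cofree A) k n \<alpha> (snd (g n x))" using shom_act[OF gc a] x by simp
   then show ?thesis by (simp add: cofree_simps idx_id compose_id_right[OF a])
  qed
  have h: "shom D (cofree A) (cofree_map D ?f)"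
  proof (rule shom_cofree_map[OF D])
   fix k x assume "x \<in> smp D k"
   show "?f k x \<in> insert None (Some ` smp A k)"
   proof (cases "x \<in> C k")
    case True
    then have "snd (g k x) \<in> smp (cofree A) k" using shom_in[OF gc] by simp
    then have "snd (g k x) (k, \<lambda>i\<in>{..k}. i) \<in> (case (k, \<lambda>i\<in>{..k}. i) of (k, \<alpha> :: nat => nat) => insert None (Some ` smp A k))"
     unfolding cofree_simps by (rule PiE_mem) (rule idx_id)
    with True show ?thesis by simp
   qed simp
  next
   fix k m \<gamma> y assume m: "m < k" "\<gamma> \<in> ops k m" "y \<in> smp D m"
   let ?x = "act D k m \<gamma> y"
   show "?f k ?x = None"
   proof (cases "?x \<in> C k")
    case True
    obtain d \<alpha> \<sigma> z where z: "\<alpha> \<in> ops k d" "\<sigma> \<in> ops d k" "?x = act D k d \<alpha> z" "z = act D d k \<sigma> ?x"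
      "!!m \<beta> y. \<beta> \<in> ops k m ==> y \<in> smp D m ==> ?x = act D k m \<beta> y ==> d \<le> m"
     using ez_exists[OF D ss_act[OF D m(2,3)]] by metis
    have "d < k" using z(5)[OF m(2,3) refl] m(1) by simp
    moreover have "z \<in> C d" using subc_act[OF C z(2) True] z(4) by simp
    ultimately have "snd (g k (act D k d \<alpha> z)) (k, \<lambda>i\<in>{..k}. i) = None" using ev[OF z(1)] idx_low[OF z(1)] by simp
    then show ?thesis using z(3) by simp
   qed simp
  qed
  have "cofree_map D ?f n x = snd (g n x)" if x: "x \<in> C n" for n x
  proof (rule PiE_ext)
   show "cofree_map D ?f n x \<in> PiE (idx n) (%(k, \<alpha>). insert None (Some ` smp A k))"
    using shom_in[OF h subc_sub[OF C x]] by (simp add: cofree_simps)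
   show "snd (g n x) \<in> PiE (idx n) (%(k, \<alpha>). insert None (Some ` smp A k))"
    using shom_in[OF gc] x by (simp add: cofree_simps)
   fix z assume z: "z \<in> idx n"
   obtain k \<alpha> where zz: "z = (k, \<alpha>)" by (cases z)
   have i: "(k, \<alpha>) \<in> idx n" using z zz by simp
   show "cofree_map D ?f n x z = snd (g n x) z"
    using ev[OF idx_ops[OF i] x] i subc_act[OF C idx_ops[OF i] x] by (simp add: zz cofree_map_at)
  qed
  then show "\<exists>h. shom D ?E h \<and> (\<forall>n. \<forall>x\<in>smp D n. fst (h n x) = w n x) \<and> (\<forall>n. \<forall>x\<in>C n. h n x = g n x)"
   using shom_pair[OF w h] gw by (intro exI[of _ "%n x. (w n x, cofree_map D ?f n x)"]) (auto simp: prod_eq_iff)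
 qed
 show ?thesis
  by (intro exI[of _ ?E] exI[of _ ?i] exI[of _ "%n. fst"] conjI small_prod[OF U B small_cofree[OF U A]] i shom_fst inj allI impI ballI l) auto
qed

section \<open>Maps as records\<close>

definition mkm :: "'a sset => 'b sset => (nat => 'a => 'b) => ('a, 'b) smap" where
 "mkm X Y f = \<lparr>src = X, tgt = Y, fn = %n. \<lambda>x\<in>smp X n. f n x\<rparr>"

lemma mkm_simps [simp]: "src (mkm X Y f) = X" "tgt (mkm X Y f) = Y" "x \<in> smp X n ==> fn (mkm X Y f) n x = f n x"
 by (auto simp: mkm_def)

lemma simplicial_mapD:
 assumes "simplicial_map f"
 shows "ss (src f)" "ss (tgt f)" "shom (src f) (tgt f) (fn f)"
 using assms by (auto simp: simplicial_map_def shom_def)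

lemma mkm_map: "ss X ==> ss Y ==> shom X Y f ==> simplicial_map (mkm X Y f)"
 unfolding simplicial_map_def mkm_def by (auto simp: shom_def ss_act)

lemma smap_eqI:
 assumes "simplicial_map f" "simplicial_map g" "src f = src g" "tgt f = tgt g" "!!n x. x \<in> smp (src f) n ==> fn f n x = fn g n x"
 shows "f = g"
proof -
 have "fn f n = fn g n" for n
 proof (rule PiE_ext)
  show "fn f n \<in> smp (src f) n \<rightarrow>\<^sub>E smp (tgt f) n" using assms(1) by (simp add: simplicial_map_def)
  show "fn g n \<in> smp (src f) n \<rightarrow>\<^sub>E smp (tgt f) n" using assms(2-4) by (simp add: simplicial_map_def)
 qed (rule assms(5))
 then show ?thesis using assms(3,4) by (intro smap.equality) auto
qed

lemma comp_simps [simp]: "src (g \<circ>\<^sub>s f) = src f" "tgt (g \<circ>\<^sub>s f) = tgt g"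
 "x \<in> smp (src f) n ==> fn (g \<circ>\<^sub>s f) n x = fn g n (fn f n x)"
 by (auto simp: comp_map_def compose_def)

lemma comp_map: "simplicial_map f ==> simplicial_map g ==> tgt f = src g ==> simplicial_map (g \<circ>\<^sub>s f)"
 unfolding simplicial_map_def by (auto simp: comp_map_def compose_def ss_act PiE_iff)

lemma inclusion_simps [simp]: "src (inclusion X Y) = X" "tgt (inclusion X Y) = Y" "x \<in> smp X n ==> fn (inclusion X Y) n x = x"
 by (auto simp: inclusion_def)

lemma inclusion_map:
 assumes XY: "subcomplex X Y"
 shows "simplicial_map (inclusion X Y)"
proof -
 have "ss X" "ss Y" "shom X Y (%n x. x)" using XY by (auto simp: subcomplex_def shom_def)
 then have "simplicial_map (mkm X Y (%n x. x))" by (rule mkm_map)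
 then show ?thesis by (simp add: mkm_def inclusion_def)
qed

lemma inclusion_res: "ss X ==> subc X C ==> simplicial_map (inclusion (res X C) X)"
 by (rule inclusion_map) (auto simp: subcomplex_def ss_res subc_sub)

lemma id_map_simps [simp]: "src (id_map X) = X" "tgt (id_map X) = X" "x \<in> smp X n ==> fn (id_map X) n x = x"
 by (auto simp: id_map_def)

lemma id_map_map: "ss X ==> simplicial_map (id_map X)"
 unfolding id_map_def by (rule inclusion_map) (simp add: subcomplex_def)

abbreviation img :: "('a, 'b) smap => nat => 'b set" where "img i == %n. fn i n ` smp (src i) n"

definition linj :: "('a, 'b) smap => bool" where
 "linj i \<longleftrightarrow> (\<forall>n. inj_on (fn i n) (smp (src i) n))"

lemma subc_img: "simplicial_map i ==> subc (tgt i) (img i)"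
proof -
 assume i: "simplicial_map i"
 note s = simplicial_mapD[OF i]
 show "subc (tgt i) (img i)"
  using shom_in[OF s(3)] ss_act[OF s(1)] unfolding subc_def by (auto simp: shom_act[OF s(3), symmetric])
qed

lemma shom_inv:
 assumes i: "simplicial_map i" and j: "linj i"
 shows "shom (res (tgt i) (img i)) (src i) (%n. inv_into (smp (src i) n) (fn i n))"
proof -
 note S = simplicial_mapD[OF i]
 have inv: "inv_into (smp (src i) n) (fn i n) (fn i n x) = x" if "x \<in> smp (src i) n" for n x
  using j that by (simp add: linj_def)
 show ?thesis
 proof (rule shomI)
  fix m n \<alpha> y assume a: "\<alpha> \<in> ops m n" and "y \<in> smp (res (tgt i) (img i)) n"
  then obtain x where x: "x \<in> smp (src i) n" "y = fn i n x" by auto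
  have "act (tgt i) m n \<alpha> y = fn i m (act (src i) m n \<alpha> x)" using shom_act[OF S(3) a x(1)] x(2) by simp
  then show "inv_into (smp (src i) m) (fn i m) (act (res (tgt i) (img i)) m n \<alpha> y) = act (src i) m n \<alpha> (inv_into (smp (src i) n) (fn i n) y)"
   by (simp add: inv[OF ss_act[OF S(1) a x(1)]] inv[OF x(1)] x(2))
 qed (auto simp: inv)
qed

lemma rlp_lft:
 assumes p: "simplicial_map p" and i: "simplicial_map i" and j: "linj i"
 shows "rlp p i \<longleftrightarrow> lft (src p) (tgt p) (fn p) (tgt i) (img i)"
proof
 note P = simplicial_mapD[OF p] and S = simplicial_mapD[OF i]
 have inv: "inv_into (smp (src i) n) (fn i n) (fn i n x) = x" if "x \<in> smp (src i) n" for n x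
  using j that by (simp add: linj_def)
 assume r: "rlp p i"
 show "lft (src p) (tgt p) (fn p) (tgt i) (img i)"
 proof (rule lftI)
  fix g w assume g: "shom (res (tgt i) (img i)) (src p) g" and w: "shom (tgt i) (tgt p) w"
   and gw: "!!n x. x \<in> img i n ==> fn p n (g n x) = w n x"
  let ?u = "mkm (src i) (src p) (%n x. g n (fn i n x))" and ?v = "mkm (tgt i) (tgt p) w"
  have "shom (src i) (res (tgt i) (img i)) (fn i)" by (rule shom_into_res[OF S(3)]) auto
  then have u: "simplicial_map ?u" by (intro mkm_map S P shom_comp[OF _ g])
  have v: "simplicial_map ?v" by (intro mkm_map S P w)
  have e: "p \<circ>\<^sub>s ?u = ?v \<circ>\<^sub>s i"
   by (rule smap_eqI[OF comp_map[OF u p] comp_map[OF i v]]) (auto simp: gw shom_in[OF S(3)])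
  have "\<exists>h. simplicial_map h \<and> src h = tgt i \<and> tgt h = src p \<and> h \<circ>\<^sub>s i = ?u \<and> p \<circ>\<^sub>s h = ?v"
   by (rule r[unfolded rlp_def, rule_format]) (simp add: u v e)
  then obtain h where h: "simplicial_map h" "src h = tgt i" "tgt h = src p" "h \<circ>\<^sub>s i = ?u" "p \<circ>\<^sub>s h = ?v" by blast
  have "fn p n (fn h n x) = w n x" if "x \<in> smp (tgt i) n" for n x
   using arg_cong[OF h(5), of "%f. fn f n x"] that h(2) by simp
  moreover have "fn h n (fn i n x) = g n (fn i n x)" if "x \<in> smp (src i) n" for n x
   using arg_cong[OF h(4), of "%f. fn f n x"] that by simp
  ultimately show "\<exists>h. shom (tgt i) (src p) h \<and> (\<forall>n. \<forall>x\<in>smp (tgt i) n. fn p n (h n x) = w n x) \<and> (\<forall>n. \<forall>x\<in>img i n. h n x = g n x)"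
   using simplicial_mapD(3)[OF h(1)] h(2,3) by auto
 qed
next
 note P = simplicial_mapD[OF p] and S = simplicial_mapD[OF i]
 have inv: "inv_into (smp (src i) n) (fn i n) (fn i n x) = x" if "x \<in> smp (src i) n" for n x
  using j that by (simp add: linj_def)
 assume l: "lft (src p) (tgt p) (fn p) (tgt i) (img i)"
 show "rlp p i"
  unfolding rlp_def
 proof (intro allI impI, elim conjE)
  fix u v assume u: "simplicial_map u" "src u = src i" "tgt u = src p" and v: "simplicial_map v" "src v = tgt i" "tgt v = tgt p"
   and e: "p \<circ>\<^sub>s u = v \<circ>\<^sub>s i"
  have us: "shom (src i) (src p) (fn u)" and vs: "shom (tgt i) (tgt p) (fn v)" using simplicial_mapD(3)[OF u(1)] simplicial_mapD(3)[OF v(1)] u v by auto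
  have pu: "fn p n (fn u n x) = fn v n (fn i n x)" if "x \<in> smp (src i) n" for n x
   using arg_cong[OF e, of "%f. fn f n x"] that u(2) by simp
  obtain h where h: "shom (tgt i) (src p) h" "!!n x. x \<in> smp (tgt i) n ==> fn p n (h n x) = fn v n x"
   "!!n x. x \<in> img i n ==> h n x = fn u n (inv_into (smp (src i) n) (fn i n) x)"
   by (rule lftD[OF l shom_comp[OF shom_inv[OF i j] us] vs]) (use pu inv in auto)
  let ?h = "mkm (tgt i) (src p) h"
  have hm: "simplicial_map ?h" by (intro mkm_map S P h)
  have "?h \<circ>\<^sub>s i = u" by (rule smap_eqI[OF comp_map[OF i hm] u(1)]) (auto simp: u h(3) inv shom_in[OF S(3)])
  moreover have "p \<circ>\<^sub>s ?h = v" by (rule smap_eqI[OF comp_map[OF hm p] v(1)]) (auto simp: v h(2))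
  ultimately show "\<exists>h. simplicial_map h \<and> src h = tgt i \<and> tgt h = src p \<and> h \<circ>\<^sub>s i = u \<and> p \<circ>\<^sub>s h = v" using hm by auto
 qed
qed

lemma usmall_simplex: "set_universe U ==> usmall U (simplex n)"
proof -
 assume U: "set_universe U"
 then obtain L where L: "L \<in> U" "infinite L" by (auto simp: set_universe_def)
 have "ops m n \<lesssim> L" for m using countable_lepoll_infinite[OF countable_finite[OF finite_ops] L(2)] .
 then show "usmall U (simplex n)" using L(1) simplicial_set_simplex by (auto simp: usmall_def small_def simplex_simps)
qed

lemma smapsD: "f \<in> smaps U ==> simplicial_map f" "f \<in> smaps U ==> src f \<in> ssets U" "f \<in> smaps U ==> tgt f \<in> ssets U"
 by (auto simp: smaps_def)

lemma comp_smaps: "f \<in> smaps U ==> g \<in> smaps U ==> tgt f = src g ==> g \<circ>\<^sub>s f \<in> smaps U"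
 by (auto simp: smaps_def comp_map)

lemma mkm_smaps: "X \<in> ssets U ==> Y \<in> ssets U ==> shom X Y f ==> mkm X Y f \<in> smaps U"
 by (auto simp: smaps_def mkm_map ssets_def)

text \<open>Simplices are maps from copies in U of standard simplices, so cancelling f on such maps
  is injectivity in each dimension.\<close>

lemma monic_linj:
 assumes U: "set_universe U"
 shows "monic U f \<longleftrightarrow> f \<in> smaps U \<and> linj f"
proof
 assume m: "monic U f"
 then have f: "f \<in> smaps U" by (simp add: monic_def)
 note fm = smapsD(1)[OF f] and F = simplicial_mapD[OF smapsD(1)[OF f]]
 have "inj_on (fn f n) (smp (src f) n)" for n
 proof (rule inj_onI)
  fix x y assume x: "x \<in> smp (src f) n" "y \<in> smp (src f) n" and e: "fn f n x = fn f n y"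
  note c = ucopy[OF U usmall_simplex[OF U, of n]]
  let ?D = "ucopy U (simplex n)"
  let ?g = "%x. mkm ?D (src f) (%m z. act (src f) m n (ufr U (simplex n) m z) x)"
  have g: "?g z \<in> smaps U" if z: "z \<in> smp (src f) n" for z
  proof (rule mkm_smaps[OF c(1) smapsD(2)[OF f] shom_comp[OF c(3)]])
   show "shom (simplex n) (src f) (%m \<alpha>. act (src f) m n \<alpha> z)"
    using z ss_act[OF F(1)] ss_comp[OF F(1)] by (auto simp: shom_def simplex_simps)
  qed
  have "f \<circ>\<^sub>s ?g x = f \<circ>\<^sub>s ?g y"
  proof (rule smap_eqI)
   fix m z assume "z \<in> smp (src (f \<circ>\<^sub>s ?g x)) m"
   then have z: "z \<in> smp ?D m" "ufr U (simplex n) m z \<in> ops m n" using shom_in[OF c(3), of z m] by (simp_all add: simplex_simps)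
   then show "fn (f \<circ>\<^sub>s ?g x) m z = fn (f \<circ>\<^sub>s ?g y) m z"
    using shom_act[OF F(3) z(2)] x e by simp
  qed (auto intro!: comp_map smapsD(1)[OF g] fm x)
  moreover have "\<forall>g\<in>smaps U. \<forall>h\<in>smaps U. src g = src h \<and> tgt g = src f \<and> tgt h = src f \<and> f \<circ>\<^sub>s g = f \<circ>\<^sub>s h --> g = h"
   using m by (simp add: monic_def)
  ultimately have "?g x = ?g y" using g[OF x(1)] g[OF x(2)] by (metis (no_types, lifting) mkm_simps(1,2))
  moreover have i: "(\<lambda>i\<in>{..n}. i) \<in> smp (simplex n) n" by (simp add: simplex_simps ops_id)
  ultimately have "fn (?g x) n (uto U (simplex n) n (\<lambda>i\<in>{..n}. i)) = fn (?g y) n (uto U (simplex n) n (\<lambda>i\<in>{..n}. i))" by simp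
  then show "x = y" using shom_in[OF c(2) i] c(4)[OF i] ss_id[OF F(1)] x by simp
 qed
 then show "f \<in> smaps U \<and> linj f" using f by (simp add: linj_def)
next
 assume f: "f \<in> smaps U \<and> linj f"
 show "monic U f"
  unfolding monic_def
 proof (intro conjI ballI impI, use f in simp, elim conjE)
  fix g h assume g: "g \<in> smaps U" "h \<in> smaps U" "src g = src h" "tgt g = src f" "tgt h = src f" and e: "f \<circ>\<^sub>s g = f \<circ>\<^sub>s h"
  show "g = h"
  proof (rule smap_eqI)
   fix n x assume x: "x \<in> smp (src g) n"
   have "fn f n (fn g n x) = fn f n (fn h n x)" using arg_cong[OF e, of "%f. fn f n x"] x g(3) by simp
   then show "fn g n x = fn h n x"
    using f x g shom_in[OF simplicial_mapD(3)[OF smapsD(1)[OF g(1)]] x] shom_in[OF simplicial_mapD(3)[OF smapsD(1)[OF g(2)]], of x n]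
    unfolding linj_def by (metis inj_onD)
  qed (use g smapsD in auto)
 qed
qed

section \<open>The retract argument and retracts of lifting problems\<close>

lemma retract_fib:
 assumes q: "q \<in> smaps U" "j \<in> smaps U" "p \<in> smaps U" "tgt j = src q" "q \<circ>\<^sub>s j = p" and r: "rlp p j"
 shows "retract_of U p q"
proof -
 note m = smapsD(1)[OF q(1)] smapsD(1)[OF q(2)] smapsD(1)[OF q(3)]
 have st: "src p = src j" "tgt p = tgt q" using q(5) by auto
 note ss = simplicial_mapD[OF m(1)] simplicial_mapD[OF m(2)] simplicial_mapD[OF m(3)]
 note id = id_map_map[OF ss(7)] id_map_map[OF ss(8)]
 have "p \<circ>\<^sub>s id_map (src p) = q \<circ>\<^sub>s j" by (rule smap_eqI[OF comp_map[OF id(1) m(3)] comp_map[OF m(2,1)]]) (use q st in auto)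
 then have "\<exists>h. simplicial_map h \<and> src h = tgt j \<and> tgt h = src p \<and> h \<circ>\<^sub>s j = id_map (src p) \<and> p \<circ>\<^sub>s h = q"
  by (intro r[unfolded rlp_def, rule_format]) (simp add: id[unfolded st] m st q(4))
 then obtain h where h: "simplicial_map h" "src h = tgt j" "tgt h = src p" "h \<circ>\<^sub>s j = id_map (src p)" "p \<circ>\<^sub>s h = q" by blast
 have hU: "h \<in> smaps U" using h q smapsD[OF q(1)] smapsD[OF q(3)] by (simp add: smaps_def)
 have iU: "id_map (tgt p) \<in> smaps U" using smapsD(3)[OF q(3)] id(2) by (simp add: smaps_def)
 have e1: "id_map (tgt p) \<circ>\<^sub>s id_map (tgt p) = id_map (tgt p)" by (rule smap_eqI[OF comp_map[OF id(2,2)] id(2)]) auto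
 have e2: "q \<circ>\<^sub>s j = id_map (tgt p) \<circ>\<^sub>s p" unfolding q(5)
  by (rule smap_eqI[OF m(3) comp_map[OF m(3) id(2)]]) (auto simp: shom_in[OF ss(9)])
 have e3: "p \<circ>\<^sub>s h = id_map (tgt p) \<circ>\<^sub>s q" unfolding h(5)
  by (rule smap_eqI[OF m(1) comp_map[OF m(1) id(2)]]) (auto simp: st(2) shom_in[OF ss(3)])
 show ?thesis
  unfolding retract_of_def
  by (intro conjI q(1,3) bexI[of _ j] bexI[of _ h] bexI[of _ "id_map (tgt p)"]) (rule q h hU iU e1 e2 e3 | simp add: q(4) h st)+
qed

lemma retract_cof:
 assumes q: "q \<in> smaps U" "j \<in> smaps U" "i \<in> smaps U" "tgt j = src q" "q \<circ>\<^sub>s j = i" and r: "rlp q i"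
 shows "retract_of U i j"
proof -
 note m = smapsD(1)[OF q(1)] smapsD(1)[OF q(2)] smapsD(1)[OF q(3)]
 have st: "src i = src j" "tgt i = tgt q" using q(5) by auto
 note ss = simplicial_mapD[OF m(1)] simplicial_mapD[OF m(2)] simplicial_mapD[OF m(3)]
 note id = id_map_map[OF ss(7)] id_map_map[OF ss(8)]
 have "q \<circ>\<^sub>s j = id_map (tgt i) \<circ>\<^sub>s i" unfolding q(5)
  by (rule smap_eqI[OF m(3) comp_map[OF m(3) id(2)]]) (auto simp: shom_in[OF ss(9)])
 then have "\<exists>h. simplicial_map h \<and> src h = tgt i \<and> tgt h = src q \<and> h \<circ>\<^sub>s i = j \<and> q \<circ>\<^sub>s h = id_map (tgt i)"
  by (intro r[unfolded rlp_def, rule_format]) (simp add: id[unfolded st] m st q(4))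
 then obtain h where h: "simplicial_map h" "src h = tgt i" "tgt h = src q" "h \<circ>\<^sub>s i = j" "q \<circ>\<^sub>s h = id_map (tgt i)" by blast
 have hU: "h \<in> smaps U" using h q smapsD[OF q(1)] smapsD[OF q(3)] by (simp add: smaps_def)
 have iU: "id_map (src i) \<in> smaps U" using smapsD(2)[OF q(3)] id(1) by (simp add: smaps_def)
 have e1: "id_map (src i) \<circ>\<^sub>s id_map (src i) = id_map (src i)" by (rule smap_eqI[OF comp_map[OF id(1,1)] id(1)]) auto
 have e2: "j \<circ>\<^sub>s id_map (src i) = h \<circ>\<^sub>s i" unfolding h(4)
  by (rule smap_eqI[OF comp_map[OF id(1) m(2)] m(2)]) (auto simp: st)
 have e3: "i \<circ>\<^sub>s id_map (src i) = q \<circ>\<^sub>s j" unfolding q(5)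
  by (rule smap_eqI[OF comp_map[OF id(1) m(3)] m(3)]) auto
 show ?thesis
  unfolding retract_of_def
  by (intro conjI q(2,3) bexI[of _ "id_map (src i)"] bexI[of _ h] bexI[of _ q]) (rule q h hU iU e1 e2 e3 | simp add: q(4) h st)+
qed

lemma lft_retract:
 assumes l: "lft E' Y' q' D C" and i: "shom E E' i" and r: "shom E' E r" and i': "shom Y Y' i'" and q: "shom E Y q"
  and ri: "!!n x. x \<in> smp E n ==> r n (i n x) = x" and ri': "!!n x. x \<in> smp Y n ==> r' n (i' n x) = x"
  and qi: "!!n x. x \<in> smp E n ==> q' n (i n x) = i' n (q n x)" and qr: "!!n x. x \<in> smp E' n ==> q n (r n x) = r' n (q' n x)"
 shows "lft E Y q D C"
proof (rule lftI)
 fix g w assume g: "shom (res D C) E g" and w: "shom D Y w" and gw: "!!n x. x \<in> C n ==> q n (g n x) = w n x"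
 have gE: "g n x \<in> smp E n" if "x \<in> C n" for n x using shom_in[OF g] that by simp
 obtain h where h: "shom D E' h" "!!n x. x \<in> smp D n ==> q' n (h n x) = i' n (w n x)" "!!n x. x \<in> C n ==> h n x = i n (g n x)"
  by (rule lftD[OF l shom_comp[OF g i] shom_comp[OF w i']]) (use qi gE gw in auto)
 show "\<exists>h. shom D E h \<and> (\<forall>n. \<forall>x\<in>smp D n. q n (h n x) = w n x) \<and> (\<forall>n. \<forall>x\<in>C n. h n x = g n x)"
  by (rule exI[of _ "%n x. r n (h n x)"]) (use shom_comp[OF h(1) r] h shom_in[OF h(1)] shom_in[OF w] qr ri ri' gE in auto)
qed

lemma retract_maps:
 assumes "retract_of U f g"
 obtains i r i' r' where "shom (src f) (src g) i" "shom (src g) (src f) r" "shom (tgt f) (tgt g) i'" "shom (tgt g) (tgt f) r'"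
  "!!n x. x \<in> smp (src f) n ==> r n (i n x) = x" "!!n x. x \<in> smp (tgt f) n ==> r' n (i' n x) = x"
  "!!n x. x \<in> smp (src f) n ==> fn g n (i n x) = i' n (fn f n x)" "!!n x. x \<in> smp (src g) n ==> fn f n (r n x) = r' n (fn g n x)"
proof -
 obtain i r i' r' where m: "i \<in> smaps U" "r \<in> smaps U" "i' \<in> smaps U" "r' \<in> smaps U"
  and s: "src i = src f" "tgt i = src g" "src r = src g" "tgt r = src f" "src i' = tgt f" "tgt i' = tgt g" "src r' = tgt g" "tgt r' = tgt f"
  and e: "r \<circ>\<^sub>s i = id_map (src f)" "r' \<circ>\<^sub>s i' = id_map (tgt f)" "g \<circ>\<^sub>s i = i' \<circ>\<^sub>s f" "f \<circ>\<^sub>s r = r' \<circ>\<^sub>s g"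
  using assms unfolding retract_of_def by blast
 note S = simplicial_mapD(3)[OF smapsD(1)]
 show ?thesis
 proof (rule that[of "fn i" "fn r" "fn i'" "fn r'"])
  fix n x assume x: "x \<in> smp (src f) n"
  show "fn r n (fn i n x) = x" using arg_cong[OF e(1), of "%f. fn f n x"] x s by simp
  show "fn g n (fn i n x) = fn i' n (fn f n x)" using arg_cong[OF e(3), of "%f. fn f n x"] x s by simp
 next
  fix n x assume x: "x \<in> smp (tgt f) n"
  show "fn r' n (fn i' n x) = x" using arg_cong[OF e(2), of "%f. fn f n x"] x s by simp
 next
  fix n x assume x: "x \<in> smp (src g) n"
  show "fn f n (fn r n x) = fn r' n (fn g n x)" using arg_cong[OF e(4), of "%f. fn f n x"] x s by simp
 qed (use S[OF m(1)] S[OF m(2)] S[OF m(3)] S[OF m(4)] s in auto)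
qed

section \<open>The model structure\<close>

definition weq0 :: "'u set set => ('u, 'u) smap set" where
 "weq0 U = {f \<in> smaps U. wq U (src f) (tgt f) (fn f)}"

definition fib0 :: "'u set set => ('u, 'u) smap set" where
 "fib0 U = {p \<in> smaps U. \<forall>i\<in>{f. monic U f} \<inter> weq0 U. rlp p i}"

lemma mono_rlp:
 assumes U: "set_universe U" and p: "p \<in> smaps U" and i: "monic U i"
 shows "rlp p i \<longleftrightarrow> lft (src p) (tgt p) (fn p) (tgt i) (img i)"
 using rlp_lft[OF smapsD(1)[OF p]] i smapsD(1) unfolding monic_linj[OF U] by blast

lemma weq0_tc:
 assumes U: "set_universe U" and m: "monic U i" and w: "i \<in> weq0 U"
 shows "tc (tgt i) (img i)"
proof -
 have i: "i \<in> smaps U" "linj i" using m by (auto simp: monic_linj[OF U])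
 note im = smapsD(1)[OF i(1)] and S = simplicial_mapD[OF smapsD(1)[OF i(1)]]
 have r: "ss (res (tgt i) (img i))" by (rule ss_res[OF S(2) subc_img[OF im]])
 have s: "shom (src i) (res (tgt i) (img i)) (fn i)" by (rule shom_into_res[OF S(3)]) auto
 have inv: "inv_into (smp (src i) n) (fn i n) (fn i n x) = x" if "x \<in> smp (src i) n" for n x
  using i(2) that by (simp add: linj_def)
 have "wq U (res (tgt i) (img i)) (tgt i) (%n x. x)"
  unfolding wq_def
 proof (intro ballI impI)
  fix Z assume Z: "Z \<in> ssets U" "jfib Z"
  have a: "weqZ Z (src i) (res (tgt i) (img i)) (fn i)"
   by (rule weqZ_iso[OF Z(2) S(1) r s shom_inv[OF im i(2)]]) (auto simp: inv)
  have "weqZ Z (src i) (tgt i) (fn i)" using w Z by (simp add: weq0_def wq_def)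
  then show "weqZ Z (res (tgt i) (img i)) (tgt i) (%n x. x)"
   using weqZ_left[OF Z(2) S(1) r S(2) s _ a, of "%n x. x"] subc_sub[OF subc_img[OF im]] by (auto simp: shom_def)
 qed
 then show ?thesis by (rule wq_tc[OF U ssets_usmall[OF smapsD(3)[OF i(1)]] subc_img[OF im]])
qed

lemma tc_weq0:
 assumes U: "set_universe U" and X: "X \<in> ssets U" and t: "tc X C"
 shows "inclusion (res X C) X \<in> weq0 U" "monic U (inclusion (res X C) X)"
proof -
 have s: "ss X" "subc X C" using t by (auto simp: tc_def)
 have "smp (res X C) n \<in> U" for n
  using set_universe_lepoll[OF U _ subset_imp_lepoll, of "smp X n" "C n"] X s(2) by (auto simp: ssets_def subc_def)
 then have i: "inclusion (res X C) X \<in> smaps U"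
  using inclusion_res[OF s] X ss_res[OF s] by (simp add: smaps_def ssets_def)
 then show "monic U (inclusion (res X C) X)" unfolding monic_linj[OF U] by (auto simp: linj_def inj_on_def)
 have "wq U (res X C) X (fn (inclusion (res X C) X))"
  unfolding wq_def by (intro ballI impI weqZ_cong[OF tc_weqZ[OF t]]) auto
 with i show "inclusion (res X C) X \<in> weq0 U" by (simp add: weq0_def)
qed

lemma monic_inclusion:
 assumes U: "set_universe U" and X: "X \<in> ssets U" and C: "subc X C"
 shows "monic U (inclusion (res X C) X)"
proof -
 have s: "ss X" using X by (simp add: ssets_def)
 have "smp (res X C) n \<in> U" for n
  using set_universe_lepoll[OF U _ subset_imp_lepoll, of "smp X n" "C n"] X C by (auto simp: ssets_def subc_def)
 then have "inclusion (res X C) X \<in> smaps U"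
  using inclusion_res[OF s C] X ss_res[OF s C] by (simp add: smaps_def ssets_def)
 then show ?thesis unfolding monic_linj[OF U] by (auto simp: linj_def inj_on_def)
qed

lemma img_inclusion [simp]: "img (inclusion (res X C) X) = C"
 by (auto simp: inclusion_def fun_eq_iff)

lemma weq0_two_of_three: "two_of_three U (weq0 U)"
 unfolding two_of_three_def
proof (intro ballI impI)
 fix f g assume f: "f \<in> smaps U" and g: "g \<in> smaps U" and fg: "tgt f = src g"
 note F = simplicial_mapD[OF smapsD(1)[OF f]] and G = simplicial_mapD[OF smapsD(1)[OF g]]
 have gf: "g \<circ>\<^sub>s f \<in> smaps U" by (rule comp_smaps[OF f g fg])
 have c: "weqZ Z (src f) (tgt g) (fn (g \<circ>\<^sub>s f)) \<longleftrightarrow> weqZ Z (src f) (tgt g) (%n x. fn g n (fn f n x))" for Z :: "'a sset"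
  by (rule iffI; erule weqZ_cong) auto
 have gs: "shom (tgt f) (tgt g) (fn g)" using G(3) fg by simp
 note w = weqZ_comp[OF _ F(1,2) G(2) F(3) gs] weqZ_left[OF _ F(1,2) G(2) F(3) gs] weqZ_right[OF _ F(1,2) G(2) F(3) gs]
 show "(f \<in> weq0 U \<and> g \<in> weq0 U --> g \<circ>\<^sub>s f \<in> weq0 U) \<and> (f \<in> weq0 U \<and> g \<circ>\<^sub>s f \<in> weq0 U --> g \<in> weq0 U) \<and>
   (g \<in> weq0 U \<and> g \<circ>\<^sub>s f \<in> weq0 U --> f \<in> weq0 U)"
  unfolding weq0_def wq_def using w f g gf fg by (simp add: c) blast
qed

lemma weq0_retract: "retract_closed U (weq0 U)"
 unfolding retract_closed_def
proof (intro ballI allI impI)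
 fix g f assume g: "g \<in> weq0 U" and r: "retract_of U f g"
 have f: "f \<in> smaps U" and gU: "g \<in> smaps U" using r by (auto simp: retract_of_def)
 note F = simplicial_mapD[OF smapsD(1)[OF f]] and G = simplicial_mapD[OF smapsD(1)[OF gU]]
 obtain i s i' s' where m: "shom (src f) (src g) i" "shom (src g) (src f) s" "shom (tgt f) (tgt g) i'" "shom (tgt g) (tgt f) s'"
  "!!n x. x \<in> smp (src f) n ==> s n (i n x) = x" "!!n x. x \<in> smp (tgt f) n ==> s' n (i' n x) = x"
  "!!n x. x \<in> smp (src f) n ==> fn g n (i n x) = i' n (fn f n x)" "!!n x. x \<in> smp (src g) n ==> fn f n (s n x) = s' n (fn g n x)"
  by (rule retract_maps[OF r]) (rule that)
 have "wq U (src f) (tgt f) (fn f)"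
  unfolding wq_def
 proof (intro ballI impI)
  fix Z assume Z: "Z \<in> ssets U" "jfib Z"
  have "weqZ Z (src g) (tgt g) (fn g)" using g Z by (simp add: weq0_def wq_def)
  from weqZ_retract[where f = "fn f" and g = "fn g" and i = i and r = s and i' = i' and r' = s', OF Z(2) F(1,2) this G(3) F(3) m] show "weqZ Z (src f) (tgt f) (fn f)" .
 qed
 with f show "f \<in> weq0 U" by (simp add: weq0_def)
qed

lemma monic_retract:
 assumes U: "set_universe U" shows "retract_closed U {f. monic U f}"
 unfolding retract_closed_def
proof (intro ballI allI impI)
 fix g f assume g: "g \<in> {f. monic U f}" and r: "retract_of U f g"
 have f: "f \<in> smaps U" and gj: "linj g" using r g by (auto simp: retract_of_def monic_linj[OF U])
 obtain i s i' s' where m: "shom (src f) (src g) i" "shom (src g) (src f) s" "shom (tgt f) (tgt g) i'" "shom (tgt g) (tgt f) s'"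
  "!!n x. x \<in> smp (src f) n ==> s n (i n x) = x" "!!n x. x \<in> smp (tgt f) n ==> s' n (i' n x) = x"
  "!!n x. x \<in> smp (src f) n ==> fn g n (i n x) = i' n (fn f n x)" "!!n x. x \<in> smp (src g) n ==> fn f n (s n x) = s' n (fn g n x)"
  by (rule retract_maps[OF r]) (rule that)
 have "inj_on (fn f n) (smp (src f) n)" for n
 proof (rule inj_onI)
  fix x y assume x: "x \<in> smp (src f) n" "y \<in> smp (src f) n" "fn f n x = fn f n y"
  then have "i n x = i n y"
   using inj_onD[of "fn g n" "smp (src g) n" "i n x" "i n y"] gj m(7) shom_in[OF m(1)] by (auto simp: linj_def)
  then show "x = y" using m(5) x by metis
 qed
 with f show "f \<in> {f. monic U f}" by (simp add: monic_linj[OF U] linj_def)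
qed

lemma rlp_retract:
 assumes U: "set_universe U" and r: "retract_of U f g" and i: "monic U i" and l: "rlp g i"
 shows "rlp f i"
proof -
 have f: "f \<in> smaps U" and g: "g \<in> smaps U" using r by (auto simp: retract_of_def)
 obtain j s j' s' where m: "shom (src f) (src g) j" "shom (src g) (src f) s" "shom (tgt f) (tgt g) j'" "shom (tgt g) (tgt f) s'"
  "!!n x. x \<in> smp (src f) n ==> s n (j n x) = x" "!!n x. x \<in> smp (tgt f) n ==> s' n (j' n x) = x"
  "!!n x. x \<in> smp (src f) n ==> fn g n (j n x) = j' n (fn f n x)" "!!n x. x \<in> smp (src g) n ==> fn f n (s n x) = s' n (fn g n x)"
  by (rule retract_maps[OF r]) (rule that)
 have "lft (src g) (tgt g) (fn g) (tgt i) (img i)" using l mono_rlp[OF U g i] by simp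
 from lft_retract[where q = "fn f" and q' = "fn g" and i = j and r = s and i' = j' and r' = s', OF this m(1-3) simplicial_mapD(3)[OF smapsD(1)[OF f]] m(5-8)]
 show ?thesis unfolding mono_rlp[OF U f i] .
qed

lemma factor_mono_smap:
 assumes U: "set_universe U" and f: "f \<in> smaps U"
 obtains j q where "monic U j" "q \<in> smaps U" "!!i. monic U i ==> rlp q i" "tgt j = src q" "q \<circ>\<^sub>s j = f"
proof -
 note m = smapsD(1)[OF f] and F = simplicial_mapD[OF smapsD(1)[OF f]]
 note u = ssets_usmall[OF smapsD(2)[OF f]] ssets_usmall[OF smapsD(3)[OF f]]
 obtain E :: "('a \<times> (nat \<times> (nat => nat) => 'a option)) sset" and i p where E: "usmall U E" "shom (src f) E i" "shom E (tgt f) p"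
  "\<forall>n. \<forall>a\<in>smp (src f) n. p n (i n a) = fn f n a" "\<forall>n. inj_on (i n) (smp (src f) n)"
  "\<forall>(D :: 'a sset) C. ss D --> subc D C --> lft E (tgt f) p D C"
  using factor_mono[OF U u F(3), where 'd = 'a] by (elim exE conjE) blast
 note c = ucopy[OF U E(1)]
 let ?j = "mkm (src f) (ucopy U E) (%n x. uto U E n (i n x))" and ?q = "mkm (ucopy U E) (tgt f) (%n x. p n (ufr U E n x))"
 have j: "?j \<in> smaps U" by (rule mkm_smaps[OF smapsD(2)[OF f] c(1) shom_comp[OF E(2) c(2)]])
 have q: "?q \<in> smaps U" by (rule mkm_smaps[OF c(1) smapsD(3)[OF f] shom_comp[OF c(3) E(3)]])
 have "inj_on (fn ?j n) (smp (src ?j) n)" for n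
 proof (rule inj_onI)
  fix x y assume x: "x \<in> smp (src ?j) n" "y \<in> smp (src ?j) n" "fn ?j n x = fn ?j n y"
  then have x': "x \<in> smp (src f) n" "y \<in> smp (src f) n" and e: "uto U E n (i n x) = uto U E n (i n y)" by simp_all
  have "i n x = i n y"
   using arg_cong[OF e, of "ufr U E n"] unfolding c(4)[OF shom_in[OF E(2) x'(1)]] c(4)[OF shom_in[OF E(2) x'(2)]] .
  then show "x = y" by (rule inj_onD[OF E(5)[rule_format] _ x'])
 qed
 then have mj: "monic U ?j" using j by (simp add: monic_linj[OF U] linj_def)
 have l: "rlp ?q k" if k: "monic U k" for k
 proof -
  have km: "simplicial_map k" using k smapsD(1) by (auto simp: monic_linj[OF U])
  have "lft E (tgt f) p (tgt k) (img k)" using E(6) simplicial_mapD(2)[OF km] subc_img[OF km] by blast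
  then show ?thesis unfolding mono_rlp[OF U q k] mkm_simps(1,2)
   by (rule lft_iso_E[OF _ c(2,3,5)]) (use c(4) subc_img[OF km] shom_in[OF c(2)] in "auto simp: subc_def")
 qed
 have "?q \<circ>\<^sub>s ?j = f"
  by (rule smap_eqI[OF comp_map[OF smapsD(1)[OF j] smapsD(1)[OF q]] m]) (use E(4) c(4)[OF shom_in[OF E(2)]] shom_in[OF c(2) shom_in[OF E(2)]] in auto)
 then show ?thesis using that[OF mj q l] by simp
qed

lemma factor_tc_smap:
 assumes U: "set_universe U" and f: "f \<in> smaps U"
 obtains j q where "monic U j" "j \<in> weq0 U" "q \<in> fib0 U" "tgt j = src q" "q \<circ>\<^sub>s j = f"
proof -
 note m = smapsD(1)[OF f] and F = simplicial_mapD[OF smapsD(1)[OF f]]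
 note u = ssets_usmall[OF smapsD(2)[OF f]] ssets_usmall[OF smapsD(3)[OF f]]
 obtain E :: "('a, ('a, unit) tm) tm sset" and i p where E: "usmall U E" "shom (src f) E i" "shom E (tgt f) p"
  "\<forall>n. \<forall>a\<in>smp (src f) n. p n (i n a) = fn f n a" "\<forall>n. inj_on (i n) (smp (src f) n)" "wq U (src f) E i"
  "\<forall>(D :: 'a sset) C. tc D C --> lft E (tgt f) p D C"
  using factor_tc[OF U u F(3), where 'd = 'a] by (elim exE conjE) blast
 note c = ucopy[OF U E(1)]
 have Es: "ss E" using E(1) by (simp add: usmall_def)
 let ?j = "mkm (src f) (ucopy U E) (%n x. uto U E n (i n x))" and ?q = "mkm (ucopy U E) (tgt f) (%n x. p n (ufr U E n x))"
 have j: "?j \<in> smaps U" by (rule mkm_smaps[OF smapsD(2)[OF f] c(1) shom_comp[OF E(2) c(2)]])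
 have q: "?q \<in> smaps U" by (rule mkm_smaps[OF c(1) smapsD(3)[OF f] shom_comp[OF c(3) E(3)]])
 have "inj_on (fn ?j n) (smp (src ?j) n)" for n
 proof (rule inj_onI)
  fix x y assume x: "x \<in> smp (src ?j) n" "y \<in> smp (src ?j) n" "fn ?j n x = fn ?j n y"
  then have x': "x \<in> smp (src f) n" "y \<in> smp (src f) n" and e: "uto U E n (i n x) = uto U E n (i n y)" by simp_all
  have "i n x = i n y"
   using arg_cong[OF e, of "ufr U E n"] unfolding c(4)[OF shom_in[OF E(2) x'(1)]] c(4)[OF shom_in[OF E(2) x'(2)]] .
  then show "x = y" by (rule inj_onD[OF E(5)[rule_format] _ x'])
 qed
 then have mj: "monic U ?j" using j by (simp add: monic_linj[OF U] linj_def)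
 have wj: "?j \<in> weq0 U"
  unfolding weq0_def wq_def
 proof (simp add: j[simplified], intro ballI impI)
  fix Z assume Z: "Z \<in> ssets U" "jfib Z"
  have "weqZ Z E (ucopy U E) (uto U E)" by (rule weqZ_iso[OF Z(2) Es c(6,2,3)]) (auto simp: c(4,5))
  then have "weqZ Z (src f) (ucopy U E) (%n x. uto U E n (i n x))"
   using weqZ_comp[OF Z(2) F(1) Es c(6) E(2) c(2)] E(6) Z by (simp add: wq_def)
  then show "weqZ Z (src f) (ucopy U E) (fn ?j)" by (rule weqZ_cong) simp
 qed
 have l: "rlp ?q k" if k: "monic U k" "k \<in> weq0 U" for k
 proof -
  have km: "simplicial_map k" using k smapsD(1) by (auto simp: monic_linj[OF U])
  have "lft E (tgt f) p (tgt k) (img k)" using E(7) weq0_tc[OF U k] by blast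
  then show ?thesis unfolding mono_rlp[OF U q k(1)] mkm_simps(1,2)
   by (rule lft_iso_E[OF _ c(2,3,5)]) (use c(4) subc_img[OF km] shom_in[OF c(2)] in "auto simp: subc_def")
 qed
 then have qf: "?q \<in> fib0 U" using q by (simp add: fib0_def)
 have "?q \<circ>\<^sub>s ?j = f"
  by (rule smap_eqI[OF comp_map[OF smapsD(1)[OF j] smapsD(1)[OF q]] m]) (use E(4) c(4)[OF shom_in[OF E(2)]] shom_in[OF c(2) shom_in[OF E(2)]] in auto)
 then show ?thesis using that[OF mj wj qf] by simp
qed

text \<open>Lifting against the empty subcomplex gives a section s of p, and lifting against the
  ends of the cylinder a homotopy from s p to the identity.\<close>

lemma trivial_weq0:
 assumes U: "set_universe U" and p: "p \<in> smaps U" and l: "!!i. monic U i ==> rlp p i"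
 shows "p \<in> weq0 U"
proof -
 note P = simplicial_mapD[OF smapsD(1)[OF p]]
 have lm: "lft (src p) (tgt p) (fn p) D C" if D: "usmall U D" and C: "subc D C" for D :: "'d sset" and C
 proof -
  note c = ucopy[OF U D]
  let ?C = "%n. uto U D n ` C n"
  have C': "subc (ucopy U D) ?C"
   using shom_in[OF c(2)] subc_sub[OF C] subc_act[OF C] unfolding subc_def by (fastforce simp: shom_act[OF c(2), symmetric])
  have "lft (src p) (tgt p) (fn p) (ucopy U D) ?C"
   using l[OF monic_inclusion[OF U c(1) C']] mono_rlp[OF U p monic_inclusion[OF U c(1) C']] by simp
  then show ?thesis by (rule lft_iso_D[OF _ c(6) C' C c(2-5)]) auto
 qed
 note us = ssets_usmall[OF smapsD(2)[OF p]] ssets_usmall[OF smapsD(3)[OF p]]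
 obtain s where s: "shom (tgt p) (src p) s" "!!n x. x \<in> smp (tgt p) n ==> fn p n (s n x) = x"
  by (rule lftD[OF lm[OF us(2) subc_empty], of "%_ _. undefined" "%n x. x"]) (auto simp: shom_def)
 have uJ: "usmall U J"
 proof -
  obtain L where L: "L \<in> U" "infinite L" using U by (auto simp: set_universe_def)
  have "smp J n \<lesssim> L" for n by (rule countable_lepoll_infinite[OF countable_finite[OF finite_J] L(2)])
  then show ?thesis using L(1) by (auto simp: usmall_def small_def)
 qed
 let ?C = "%n. ends n \<times> smp (src p) n"
 have sp: "shom (src p) (src p) (%n x. s n (fn p n x))" by (rule shom_comp[OF P(3) s(1)])
 have g: "shom (res (cyl (src p)) ?C) (src p) (%n z. if fst z = zero n then s n (fn p n (snd z)) else snd z)"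
  using sp shom_in[OF P(3)] by (auto simp: shom_def ends_def)
 have w: "shom (cyl (src p)) (tgt p) (%n z. fn p n (snd z))" by (rule shom_comp[OF shom_snd P(3)])
 obtain G where G: "shom (cyl (src p)) (src p) G"
  "!!n x. x \<in> ?C n ==> G n x = (if fst x = zero n then s n (fn p n (snd x)) else snd x)"
  by (rule lftD[OF lm[OF small_prod[OF U uJ us(1)] subc_prod1[OF subc_ends P(1)]] g w]) (use s(2) shom_in[OF P(3)] in auto)
 have h: "htp (src p) no (src p) (%n x. s n (fn p n x)) (%n x. x)"
  by (rule htpI[OF G(1)]) (auto simp: G(2) ends_def)
 show ?thesis
  unfolding weq0_def wq_def by (intro CollectI conjI p ballI impI weqZ_hequiv[OF _ P s(1) s(2) h])
qed

text \<open>Factor p as q j with j monic and q lifting against all monomorphisms. By two out of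
  three j is a trivial cofibration, so p lifts against it and is a retract of q.\<close>

lemma trivial_fib0:
 assumes U: "set_universe U"
 shows "fib0 U \<inter> weq0 U = {p \<in> smaps U. \<forall>i. monic U i --> rlp p i}"
proof
 show "{p \<in> smaps U. \<forall>i. monic U i --> rlp p i} \<subseteq> fib0 U \<inter> weq0 U"
  using trivial_weq0[OF U] by (auto simp: fib0_def)
 show "fib0 U \<inter> weq0 U \<subseteq> {p \<in> smaps U. \<forall>i. monic U i --> rlp p i}"
 proof
  fix p assume p: "p \<in> fib0 U \<inter> weq0 U"
  then have pU: "p \<in> smaps U" by (simp add: fib0_def)
  obtain j q where j: "monic U j" and q: "q \<in> smaps U" and l: "!!i. monic U i ==> rlp q i" and jq: "tgt j = src q" "q \<circ>\<^sub>s j = p"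
   using factor_mono_smap[OF U pU] by metis
  have jU: "j \<in> smaps U" using j by (simp add: monic_def)
  have "j \<in> weq0 U" using weq0_two_of_three[of U] trivial_weq0[OF U q l] jU q jq p unfolding two_of_three_def by blast
  then have "rlp p j" using p j by (auto simp: fib0_def)
  then show "p \<in> {p \<in> smaps U. \<forall>i. monic U i --> rlp p i}"
   using rlp_retract[OF U retract_fib[OF q jU pU jq]] l pU by auto
 qed
qed

lemma cisinski0:
 fixes U :: "'u set set"
 assumes U: "set_universe U"
 shows "cisinski U \<lparr>weq = weq0 U, cof = {f. monic U f}, fib = fib0 U\<rparr>"
proof -
 obtain L where L: "L \<in> U" "infinite L" using U by (auto simp: set_universe_def)
 then obtain e :: "nat => 'u" where e: "inj e" "range e \<subseteq> L" using infinite_countable_subset by metis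
 \<comment> \<open>Codes on one countably infinite set in U represent all countable simplicial sets
   up to isomorphism. Their subcomplexes give the generating cofibrations, those satisfying
   \<open>tc\<close> the generating trivial cofibrations.\<close>
 let ?N = "range e"
 have N: "?N \<in> U" "infinite ?N" "countable ?N"
  using set_universe_lepoll[OF U L(1) subset_imp_lepoll[OF e(2)]] range_inj_infinite[OF e(1)] by auto
 let ?P = "{(X, C). X \<in> codes ?N \<and> subc X C}" and ?inc = "%(X, C). inclusion (res X C) X :: ('u, 'u) smap"
 let ?I = "?inc ` ?P" and ?K = "?inc ` {z \<in> ?P. tc (fst z) (snd z)}"
 have sP: "small U ?P" by (rule small_codes[OF U N])
 have cU: "X \<in> ssets U" if "X \<in> codes ?N" for X
  using that set_universe_lepoll[OF U N(1) subset_imp_lepoll] by (auto simp: codes_def ssets_def)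
 have Im: "monic U i" if "i \<in> ?I" for i using that monic_inclusion[OF U cU] by auto
 have Km: "monic U i" "i \<in> weq0 U" if "i \<in> ?K" for i using that tc_weq0[OF U cU] by auto
 have mU: "monic U i ==> i \<in> smaps U" for i by (simp add: monic_def)
 have gI: "rlp p i" if p: "p \<in> smaps U" and a: "!!i. i \<in> ?I ==> rlp p i" and i: "monic U i" for p i
  unfolding mono_rlp[OF U p i]
 proof (rule mono_codes[OF N(2)])
  note im = smapsD(1)[OF mU[OF i]]
  show "ss (tgt i)" "subc (tgt i) (img i)" by (rule simplicial_mapD(2)[OF im] subc_img[OF im])+
  fix X C assume X: "X \<in> codes ?N" "subc X C"
  have "rlp p (inclusion (res X C) X)" by (rule a) (use X in force)
  then show "lft (src p) (tgt p) (fn p) X C" using mono_rlp[OF U p monic_inclusion[OF U cU[OF X(1)] X(2)]] by simp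
 qed
 have gK: "rlp p i" if p: "p \<in> smaps U" and a: "!!i. i \<in> ?K ==> rlp p i" and i: "monic U i" "i \<in> weq0 U" for p i
  unfolding mono_rlp[OF U p i(1)]
 proof (rule tc_codes[OF U N(2,1) weq0_tc[OF U i]])
  fix X C assume X: "X \<in> codes ?N" "tc X C"
  then have C: "subc X C" by (simp add: tc_def)
  have "rlp p (inclusion (res X C) X)" by (rule a) (use X C in force)
  then show "lft (src p) (tgt p) (fn p) X C" using mono_rlp[OF U p monic_inclusion[OF U cU[OF X(1)] C]] by simp
 qed
 have "cofibrantly_generated U \<lparr>weq = weq0 U, cof = {f. monic U f}, fib = fib0 U\<rparr>"
  unfolding cofibrantly_generated_def
 proof (rule exI[of _ ?I], rule exI[of _ ?K], intro conjI)
  show "?I \<subseteq> smaps U" "?K \<subseteq> smaps U" using Im Km mU by blast+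
  show "small U ?I" by (rule small_image[OF sP])
  show "small U ?K" by (rule small_image[OF small_lepoll[OF sP subset_imp_lepoll]]) auto
  show "fib \<lparr>weq = weq0 U, cof = {f. monic U f}, fib = fib0 U\<rparr> \<inter> weq \<lparr>weq = weq0 U, cof = {f. monic U f}, fib = fib0 U\<rparr> = {p \<in> smaps U. \<forall>i\<in>?I. rlp p i}"
   unfolding model_str.simps trivial_fib0[OF U]
  proof (rule Collect_cong, rule conj_cong[OF refl], rule iffI)
   fix p assume p: "p \<in> smaps U" "\<forall>i\<in>?I. rlp p i"
   show "\<forall>i. monic U i --> rlp p i" by (intro allI impI gI[OF p(1) bspec[OF p(2)]])
  next
   fix p assume "\<forall>i. monic U i --> rlp p i"
   then show "\<forall>i\<in>?I. rlp p i" using Im by blast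
  qed
  show "fib \<lparr>weq = weq0 U, cof = {f. monic U f}, fib = fib0 U\<rparr> = {p \<in> smaps U. \<forall>i\<in>?K. rlp p i}"
   unfolding model_str.simps fib0_def
  proof (rule Collect_cong, rule conj_cong[OF refl], rule iffI)
   fix p assume p: "p \<in> smaps U" "\<forall>i\<in>?K. rlp p i"
   have "rlp p i" if "monic U i" "i \<in> weq0 U" for i by (rule gK[OF p(1) bspec[OF p(2)] that])
   then show "\<forall>i\<in>{f. monic U f} \<inter> weq0 U. rlp p i" by simp
  next
   fix p assume a: "\<forall>i\<in>{f. monic U f} \<inter> weq0 U. rlp p i"
   show "\<forall>i\<in>?K. rlp p i" by (intro ballI bspec[OF a] IntI CollectI Km)
  qed
 qed
 moreover have "retract_closed U (fib0 U)"
  unfolding retract_closed_def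
 proof (intro ballI allI impI)
  fix g f assume "g \<in> fib0 U" "retract_of U f g"
  moreover from this have "f \<in> smaps U" by (simp add: retract_of_def)
  ultimately show "f \<in> fib0 U" using rlp_retract[OF U] unfolding fib0_def by blast
 qed
 moreover have "factors U ({f. monic U f} \<inter> weq0 U) (fib0 U)"
  unfolding factors_def
 proof
  fix f assume "f \<in> smaps U"
  then obtain j q where "monic U j" "j \<in> weq0 U" "q \<in> fib0 U" "tgt j = src q" "q \<circ>\<^sub>s j = f" by (rule factor_tc_smap[OF U])
  then show "\<exists>i\<in>{f. monic U f} \<inter> weq0 U. \<exists>p\<in>fib0 U. tgt i = src p \<and> p \<circ>\<^sub>s i = f" by blast
 qed
 moreover have "factors U {f. monic U f} (fib0 U \<inter> weq0 U)"
  unfolding factors_def trivial_fib0[OF U]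
 proof
  fix f assume "f \<in> smaps U"
  then obtain j q where "monic U j" "q \<in> smaps U" "!!i. monic U i ==> rlp q i" "tgt j = src q" "q \<circ>\<^sub>s j = f"
   by (rule factor_mono_smap[OF U]) (rule that)
  then show "\<exists>i\<in>{f. monic U f}. \<exists>p\<in>{p \<in> smaps U. \<forall>i. monic U i --> rlp p i}. tgt i = src p \<and> p \<circ>\<^sub>s i = f" by blast
 qed
 moreover have "\<forall>i\<in>{f. monic U f}. \<forall>p\<in>fib0 U \<inter> weq0 U. rlp p i" unfolding trivial_fib0[OF U] by blast
 moreover have "\<forall>i\<in>{f. monic U f} \<inter> weq0 U. \<forall>p\<in>fib0 U. rlp p i" by (simp add: fib0_def)
 moreover have "weq0 U \<subseteq> smaps U" "{f. monic U f} \<subseteq> smaps U" "fib0 U \<subseteq> smaps U" using mU by (auto simp: weq0_def fib0_def)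
 ultimately show ?thesis
  using weq0_two_of_three[of U] weq0_retract[of U] monic_retract[OF U] unfolding cisinski_def model_structure_def by simp
qed

section \<open>Widenings and iso-horns\<close>

lemma vertex_J: "i \<le> n ==> vertex J n i x = J_vertex e \<longleftrightarrow> x i = e"
proof -
 have "vertex J n i x = (\<lambda>k\<in>{..0}. x i)" by (auto simp: vertex_def J_simps compose_def)
 then show ?thesis by (auto simp: J_vertex_def fun_eq_iff)
qed

lemma vertex_simplex: "vertex (simplex m) k j \<alpha> = simplex_vertex (\<alpha> j)"
 by (auto simp: vertex_def simplex_simps simplex_vertex_def compose_def)

lemma simplex_vertex_inject: "simplex_vertex i = simplex_vertex j \<longleftrightarrow> i = j"
 by (auto simp: simplex_vertex_def fun_eq_iff)

lemma const_ops: "i \<le> n ==> (\<lambda>k\<in>{..0}. i) \<in> ops 0 n"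
 by (rule opsI) auto

lemma widening_smp:
 assumes Y: "ss Y"
 shows "smp (widening \<nu> Y) n = {(x, y). x \<in> smp J n \<and> y \<in> smp Y n \<and> (\<forall>i\<le>n. x i = 0 \<or> vertex Y n i y \<in> \<nu>)}"
proof -
 have v: "vertex (cyl Y) n i z = (vertex J n i (fst z), vertex Y n i (snd z))" for i z by (simp add: vertex_def)
 have "vertex Y n i y \<in> smp Y 0" if "y \<in> smp Y n" "i \<le> n" for i y
  unfolding vertex_def by (rule ss_act[OF Y const_ops[OF that(2)] that(1)])
 then have "vertex (cyl Y) n i (x, y) \<in> {J_vertex 0} \<times> smp Y 0 \<union> {J_vertex 1} \<times> \<nu> \<longleftrightarrow> x i = 0 \<or> vertex Y n i y \<in> \<nu>"
  if "x \<in> smp J n" "y \<in> smp Y n" "i \<le> n" for x y i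
  using that J_cases[OF that(1,3)] by (auto simp: v vertex_J)
 then show ?thesis by (auto simp: widening_def full_subcomplex_def)
qed

lemma widening_act: "act (widening \<nu> Y) = act (cyl Y)"
 by (simp add: widening_def full_subcomplex_def)

lemma J0_smp: "smp J0 n = {zero n}"
 by (simp add: J0_def zero_def)

lemma widened_source_smp:
 assumes XY: "subcomplex X Y"
 shows "smp (widened_source X Y \<nu>) n = {(x, y). (x, y) \<in> smp (widening \<nu> Y) n \<and> (x = zero n \<or> y \<in> smp X n)}"
proof -
 have X: "ss X" and Y: "ss Y" and s: "!!n. smp X n \<subseteq> smp Y n" using XY by (auto simp: subcomplex_def)
 have v: "vertex X n i y = vertex Y n i y" "vertex X n i y \<in> smp X 0" if "y \<in> smp X n" "i \<le> n" for i y
  using XY that const_ops[OF that(2)] ss_act[OF X const_ops[OF that(2)] that(1)] by (auto simp: vertex_def subcomplex_def)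
 have "(x, y) \<in> smp (widened_source X Y \<nu>) n \<longleftrightarrow> (x, y) \<in> smp (widening \<nu> Y) n \<and> (x = zero n \<or> y \<in> smp X n)" for x y
  using v s[of n] by (auto simp: widened_source_def J0_smp widening_smp[OF X] widening_smp[OF Y])
 then show ?thesis by auto
qed

lemma widening_lft:
 assumes q: "nfib E B q" and XY: "subcomplex X Y"
 shows "lft E B q (widening \<nu> Y) (smp (widened_source X Y \<nu>))"
proof -
 have Y: "ss Y" using XY by (auto simp: subcomplex_def)
 have W: "ss (widening \<nu> Y)" using subcomplex_widening[OF Y] by (simp add: subcomplex_def)
 note sm = widened_source_smp[OF XY] widening_smp[OF Y]
 have S: "subc (widening \<nu> Y) (smp (widened_source X Y \<nu>))"
  using subcomplex_widened_source[OF XY, of \<nu>] unfolding subcomplex_def subc_def by (metis (no_types, lifting) ss_act)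
 show ?thesis
 proof (rule lft_deformation[OF q W S])
  have j: "jand n t x i = t i * x i" if "i \<le> n" for n t x i using that by (simp add: jand_def)
  show "shom (cyl (widening \<nu> Y)) (widening \<nu> Y) (%n z. (jand n (fst z) (fst (snd z)), snd (snd z)))"
   by (rule shomI) (auto simp: widening_act sm(2) jand_act j)
  show "(jand n (fst (t, x)) (fst (snd (t, x))), snd (snd (t, x))) \<in> smp (widened_source X Y \<nu>) n"
   if "t \<in> smp J n" "x \<in> smp (widened_source X Y \<nu>) n" for n t x
   using that by (auto simp: sm j)
 qed (auto simp: sm)
qed

text \<open>\<open>to_point X\<close> ends in a point over the type of X, while J-fibrancy uses the
  point over \<open>unit\<close>; neither target constrains a lift.\<close>

lemma lft_to_point:
 fixes X :: "'a sset" and D :: "'b sset"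
 assumes C: "!!n. C n \<subseteq> smp D n"
 shows "lft X point (fn (to_point X)) D C \<longleftrightarrow> lft X pt (%_ _. ()) D C"
proof
 assume l: "lft X point (fn (to_point X)) D C"
 show "lft X pt (%_ _. ()) D C"
 proof (rule lftI)
  fix g and w :: "nat => 'b => unit" assume g: "shom (res D C) X g"
  obtain h where "shom D X h" "!!n x. x \<in> C n ==> h n x = g n x"
   by (rule lftD[OF l g, of "%_ _. undefined"]) (use shom_in[OF g] in "auto simp: shom_def point_def to_point_def")
  then show "\<exists>h. shom D X h \<and> (\<forall>n. \<forall>x\<in>smp D n. () = w n x) \<and> (\<forall>n. \<forall>x\<in>C n. h n x = g n x)" by auto
 qed
next
 assume l: "lft X pt (%_ _. ()) D C"
 show "lft X point (fn (to_point X)) D C"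
 proof (rule lftI)
  fix g w assume g: "shom (res D C) X g" and w: "shom D (point :: 'a sset) w"
  obtain h where h: "shom D X h" "!!n x. x \<in> C n ==> h n x = g n x" using lft_pt_ex[OF l g] by blast
  have "w n x = undefined" if "x \<in> smp D n" for n x using shom_in[OF w that] by (simp add: point_def)
  then show "\<exists>h. shom D X h \<and> (\<forall>n. \<forall>x\<in>smp D n. fn (to_point X) n (h n x) = w n x) \<and> (\<forall>n. \<forall>x\<in>C n. h n x = g n x)"
   using h shom_in[OF h(1)] by (intro exI[of _ h]) (auto simp: to_point_def)
 qed
qed

lemma to_point_map: "ss X ==> simplicial_map (to_point X)"
 unfolding simplicial_map_def by (auto simp: to_point_def point_def simplicial_set_def)

lemma rlp_to_point:
 assumes X: "ss X" and AB: "subcomplex A B"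
 shows "rlp (to_point X) (inclusion A B) \<longleftrightarrow> lft X pt (%_ _. ()) B (smp A)"
proof -
 have s: "!!n. smp A n \<subseteq> smp B n" using AB by (simp add: subcomplex_def)
 have "rlp (to_point X) (inclusion A B) \<longleftrightarrow> lft (src (to_point X)) (tgt (to_point X)) (fn (to_point X)) B (img (inclusion A B))"
  using rlp_lft[OF to_point_map[OF X] inclusion_map[OF AB]] by (simp add: linj_def inj_on_def)
 moreover have "img (inclusion A B) = smp A" by (auto simp: fun_eq_iff)
 moreover have "src (to_point X) = X" "tgt (to_point X) = point" by (auto simp: to_point_def)
 ultimately show ?thesis using lft_to_point[OF s] by simp
qed

section \<open>Isoplexes and iso-horns inside prisms\<close>

definition ip :: "nat => nat => nat => js set" where
 "ip p m d = {(x, \<beta>). x \<in> smp J d \<and> \<beta> \<in> ops d m \<and> (\<forall>j\<le>d. x j = 0 \<or> \<beta> j = p)}"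

definition ih :: "nat => nat => nat => js set" where
 "ih p m d = {(x, \<beta>). (x, \<beta>) \<in> ip p m d \<and> (x = zero d \<or> \<beta> ` {..d} \<noteq> {..m})}"

lemma isoplex_ip: "isoplex p (Suc m) = res (JS m) (ip p m)"
proof -
 have "smp (isoplex p (Suc m)) d = ip p m d" for d
  unfolding isoplex_def widening_smp[OF simplicial_set_simplex]
  by (auto simp: ip_def simplex_simps vertex_simplex simplex_vertex_inject)
 then have "smp (isoplex p (Suc m)) = ip p m" by auto
 moreover have "isoplex p (Suc m) = res (JS m) (smp (isoplex p (Suc m)))"
  by (simp add: isoplex_def widening_def full_subcomplex_def res_def)
 ultimately show ?thesis by simp
qed

lemma iso_horn_ih: "smp (iso_horn p (Suc m)) = ih p m"
proof
 fix d show "smp (iso_horn p (Suc m)) d = ih p m d"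
  unfolding iso_horn_def widened_source_smp[OF subcomplex_boundary] widening_smp[OF simplicial_set_simplex]
  by (auto simp: ih_def ip_def simplex_simps boundary_simps vertex_simplex simplex_vertex_inject)
qed

lemma iso_horn_sub: "subcomplex (iso_horn i n) (isoplex i n)"
 unfolding iso_horn_def isoplex_def by (rule subcomplex_widened_source[OF subcomplex_boundary])

lemma iso_horn_rlp:
 assumes X: "ss X"
 shows "(\<forall>i\<in>iso_horn_inclusions. rlp (to_point X) i) \<longleftrightarrow> (\<forall>m p. p \<le> m --> lft X pt (%_ _. ()) (res (JS m) (ip p m)) (ih p m))"
proof -
 have r: "rlp (to_point X) (inclusion (iso_horn p n) (isoplex p n)) \<longleftrightarrow> lft X pt (%_ _. ()) (isoplex p n) (smp (iso_horn p n))" for p n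
  by (rule rlp_to_point[OF X iso_horn_sub])
 have r': "rlp (to_point X) (inclusion (iso_horn p (Suc m)) (isoplex p (Suc m))) \<longleftrightarrow> lft X pt (%_ _. ()) (res (JS m) (ip p m)) (ih p m)" for p m
  unfolding r unfolding isoplex_ip iso_horn_ih ..
 show ?thesis
 proof (intro iffI allI impI ballI)
  fix m p :: nat assume a: "\<forall>i\<in>iso_horn_inclusions. rlp (to_point X) i" and p: "p \<le> m"
  have "inclusion (iso_horn p (Suc m)) (isoplex p (Suc m)) \<in> iso_horn_inclusions"
   unfolding iso_horn_inclusions_def using p by (intro CollectI exI[of _ p] exI[of _ "Suc m"]) simp
  with a show "lft X pt (%_ _. ()) (res (JS m) (ip p m)) (ih p m)" using r' by blast
 next
  fix i assume a: "\<forall>m p. p \<le> m --> lft X pt (%_ _. ()) (res (JS m) (ip p m)) (ih p m)" and "i \<in> iso_horn_inclusions"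
  then obtain p n where i: "i = inclusion (iso_horn p n) (isoplex p n)" "1 \<le> n" "p \<le> n - 1" unfolding iso_horn_inclusions_def by blast
  then have n: "n = Suc (n - 1)" by simp
  have "rlp (to_point X) (inclusion (iso_horn p (Suc (n - 1))) (isoplex p (Suc (n - 1))))"
   unfolding r' using a i(3) by blast
  then show "rlp (to_point X) i" unfolding i(1) using n by simp
 qed
qed

lemma jfib_iso_horn: "jfib X ==> \<forall>i\<in>iso_horn_inclusions. rlp (to_point X) i"
proof -
 assume X: "jfib X"
 have "lft X pt (%_ _. ()) (isoplex p n) (smp (iso_horn p n))" for p n
  unfolding isoplex_def iso_horn_def by (rule widening_lft[OF X[unfolded jfib_def] subcomplex_boundary])
 then show ?thesis using rlp_to_point[OF jfib_ss[OF X] iso_horn_sub] by (auto simp: iso_horn_inclusions_def)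
qed

lemma jfib_widened:
 assumes X: "jfib X" and i: "i \<in> widened_inclusions U"
 shows "rlp (to_point X) i"
proof -
 obtain A B \<nu> where i: "i = widened_inclusion A B \<nu>" "subcomplex A B" using i by (auto simp: widened_inclusions_def)
 show ?thesis unfolding i(1) widened_inclusion_def rlp_to_point[OF jfib_ss[OF X] subcomplex_widened_source[OF i(2)]]
  by (rule widening_lft[OF X[unfolded jfib_def] i(2)])
qed

text \<open>Iso-horns have operators as simplices, whereas widened inclusions are taken over the
  type of U. The iso-horn is identified with the boundary inclusion of a copy of the m-simplex,
  widened at the copy of the vertex p.\<close>

lemma widened_iso_horn:
 fixes X :: "'x sset" and U :: "'u set set"
 assumes U: "set_universe U" and X: "ss X" and w: "\<forall>i\<in>widened_inclusions U. rlp (to_point X) i" and p: "p \<le> m"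
 shows "lft X pt (%_ _. ()) (res (JS m) (ip p m)) (ih p m)"
proof -
 note c = ucopy[OF U usmall_simplex[OF U, of m]]
 let ?Y = "ucopy U (simplex m)" and ?e = "uto U (simplex m)" and ?d = "ufr U (simplex m)"
 let ?b = "%n. ?e n ` smp (boundary m) n"
 have bs: "x \<in> smp (simplex m) n" if "x \<in> smp (boundary m) n" for x n using subc_sub[OF subc_boundary that] .
 have b: "subc ?Y ?b"
  using shom_in[OF c(2)] bs subc_act[OF subc_boundary] unfolding subc_def by (fastforce simp: shom_act[OF c(2), symmetric])
 have BY: "subcomplex (res ?Y ?b) ?Y" using ss_res[OF c(6) b] c(6) subc_sub[OF b] by (auto simp: subcomplex_def)
 have Bu: "res ?Y ?b \<in> ssets U"
  using ss_res[OF c(6) b] c(1) set_universe_lepoll[OF U _ subset_imp_lepoll, of "smp ?Y n" "?b n" for n] subc_sub[OF b]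
  by (auto simp: ssets_def subset_iff)
 let ?v = "?e 0 (simplex_vertex p)"
 have sv: "simplex_vertex j \<in> smp (simplex m) 0" if "j \<le> m" for j
  using const_ops[OF that] by (simp add: simplex_simps simplex_vertex_def)
 have "widened_inclusion (res ?Y ?b) ?Y {?v} \<in> widened_inclusions U"
  unfolding widened_inclusions_def using Bu c(1) BY shom_in[OF c(2) sv[OF p]] by blast
 from bspec[OF w this] have l: "lft X pt (%_ _. ()) (widening {?v} ?Y) (smp (widened_source (res ?Y ?b) ?Y {?v}))"
  unfolding widened_inclusion_def rlp_to_point[OF X subcomplex_widened_source[OF BY]] .
 have ve: "vertex ?Y n j (?e n \<alpha>) = ?v \<longleftrightarrow> \<alpha> j = p" if a: "\<alpha> \<in> ops n m" and j: "j \<le> n" for n j \<alpha>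
 proof -
  have "vertex ?Y n j (?e n \<alpha>) = ?e 0 (vertex (simplex m) n j \<alpha>)"
   unfolding vertex_def using shom_act[OF c(2) const_ops[OF j]] a by (simp add: simplex_simps)
  also have "\<dots> = ?e 0 (simplex_vertex (\<alpha> j))" by (simp add: vertex_simplex)
  finally have e: "vertex ?Y n j (?e n \<alpha>) = ?e 0 (simplex_vertex (\<alpha> j))" .
  show ?thesis
  proof
   assume "vertex ?Y n j (?e n \<alpha>) = ?v"
   then have "?e 0 (simplex_vertex (\<alpha> j)) = ?v" unfolding e .
   from arg_cong[OF this, of "?d 0"] show "\<alpha> j = p"
    unfolding c(4)[OF sv[OF ops_le[OF a j]]] c(4)[OF sv[OF p]] simplex_vertex_inject .
  qed (simp add: e)
 qed
 have dO: "?d n y \<in> ops n m" if "y \<in> smp ?Y n" for n y using shom_in[OF c(3) that] by (simp add: simplex_simps)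
 have eY: "?e n \<alpha> \<in> smp ?Y n" if "\<alpha> \<in> ops n m" for n \<alpha> using shom_in[OF c(2), of \<alpha> n] that by (simp add: simplex_simps)
 have ed: "?d n (?e n \<alpha>) = \<alpha>" if "\<alpha> \<in> ops n m" for n \<alpha> using c(4)[of \<alpha> n] that by (simp add: simplex_simps)
 have ebd: "?e n \<alpha> \<in> ?b n \<longleftrightarrow> \<alpha> \<in> smp (boundary m) n" if "\<alpha> \<in> ops n m" for n \<alpha>
 proof
  assume "?e n \<alpha> \<in> ?b n"
  then obtain \<beta> where b: "\<beta> \<in> smp (boundary m) n" "?e n \<alpha> = ?e n \<beta>" by blast
  have bo: "\<beta> \<in> ops n m" using bs[OF b(1)] by (simp add: simplex_simps)
  from arg_cong[OF b(2), of "?d n"] have "\<alpha> = \<beta>" unfolding ed[OF that] ed[OF bo] .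
  with b(1) show "\<alpha> \<in> smp (boundary m) n" by simp
 qed simp
 note W = widening_smp[OF c(6)] and S = widened_source_smp[OF BY]
 have W1: "(x, ?e n \<alpha>) \<in> smp (widening {?v} ?Y) n \<longleftrightarrow> (x, \<alpha>) \<in> ip p m n" if "\<alpha> \<in> ops n m" for n x \<alpha>
  unfolding W ip_def using ve[OF that] eY[OF that] that by auto
 have S1: "(x, ?e n \<alpha>) \<in> smp (widened_source (res ?Y ?b) ?Y {?v}) n \<longleftrightarrow> (x, \<alpha>) \<in> ih p m n" if "\<alpha> \<in> ops n m" for n x \<alpha>
  unfolding S ih_def using W1[OF that] ebd[OF that] that by (simp add: boundary_simps)
 have WY: "y \<in> smp ?Y n" if "(x, y) \<in> smp (widening {?v} ?Y) n" for x y n using that by (simp add: W)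
 have ipO: "\<alpha> \<in> ops n m" if "(x, \<alpha>) \<in> ip p m n" for x \<alpha> n using that by (simp add: ip_def)
 have Ws: "ss (widening {?v} ?Y)" using subcomplex_widening[OF c(6)] by (simp add: subcomplex_def)
 have Ss: "subc (widening {?v} ?Y) (smp (widened_source (res ?Y ?b) ?Y {?v}))"
  using subcomplex_widened_source[OF BY, of "{?v}"] unfolding subcomplex_def subc_def by (metis (no_types, lifting) ss_act)
 have iso: "ss (isoplex p (Suc m))" and sub: "subcomplex (iso_horn p (Suc m)) (isoplex p (Suc m))"
  using iso_horn_sub by (auto simp: subcomplex_def)
 have ihs: "subc (res (JS m) (ip p m)) (ih p m)"
  using sub unfolding subcomplex_def subc_def isoplex_ip[symmetric] iso_horn_ih[symmetric] by (metis (no_types, lifting) ss_act)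
 show ?thesis
 proof (rule lft_iso_D[OF l Ws Ss ihs, where e = "%n z. (fst z, ?e n (snd z))" and d = "%n z. (fst z, ?d n (snd z))"])
  show "shom (res (JS m) (ip p m)) (widening {?v} ?Y) (%n z. (fst z, ?e n (snd z)))"
   by (rule shomI) (use W1 ipO shom_act[OF c(2)] in "auto simp: widening_act simplex_simps")
  show "shom (widening {?v} ?Y) (res (JS m) (ip p m)) (%n z. (fst z, ?d n (snd z)))"
  proof (rule shomI)
   fix n z assume z: "z \<in> smp (widening {?v} ?Y) n"
   obtain x y where zz: "z = (x, y)" by (cases z)
   show "(fst z, ?d n (snd z)) \<in> smp (res (JS m) (ip p m)) n"
    using W1[OF dO[OF WY[OF z[unfolded zz]]], of x] c(5)[OF WY[OF z[unfolded zz]]] z zz by simp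
  qed (use WY shom_act[OF c(3)] in "auto simp: widening_act")
  show "smp (widened_source (res ?Y ?b) ?Y {?v}) n = (%z. (fst z, ?e n (snd z))) ` ih p m n" for n
  proof
   show "(%z. (fst z, ?e n (snd z))) ` ih p m n \<subseteq> smp (widened_source (res ?Y ?b) ?Y {?v}) n"
   proof (rule image_subsetI)
    fix z assume z: "z \<in> ih p m n"
    obtain x \<alpha> where zz: "z = (x, \<alpha>)" by (cases z)
    have "\<alpha> \<in> ops n m" using z by (auto simp: zz ih_def ip_def)
    from S1[OF this, of x] z show "(fst z, ?e n (snd z)) \<in> smp (widened_source (res ?Y ?b) ?Y {?v}) n" by (simp add: zz)
   qed
   show "smp (widened_source (res ?Y ?b) ?Y {?v}) n \<subseteq> (%z. (fst z, ?e n (snd z))) ` ih p m n"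
   proof
    fix z assume z: "z \<in> smp (widened_source (res ?Y ?b) ?Y {?v}) n"
    obtain x y where zz: "z = (x, y)" by (cases z)
    have y: "y \<in> smp ?Y n" using z WY by (auto simp: zz S)
    have "(x, ?d n y) \<in> ih p m n" using S1[OF dO[OF y], of x] c(5)[OF y] z zz by simp
    then show "z \<in> (%z. (fst z, ?e n (snd z))) ` ih p m n" using c(5)[OF y] zz by force
   qed
  qed
 qed (use ipO ed WY c(5) in auto)
qed

section \<open>Filling prisms by isoplexes\<close>

definition Wd :: "nat => nat => nat => js set" where
 "Wd n k d = {(x, \<alpha>). x \<in> smp J d \<and> \<alpha> \<in> ops d n \<and> (\<forall>j\<le>d. x j = 0 \<or> \<alpha> j < k)}"

definition Bd :: "nat => nat => js set" where
 "Bd n d = {(x, \<alpha>). x \<in> smp J d \<and> \<alpha> \<in> ops d n \<and> \<alpha> ` {..d} \<noteq> {..n}}"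

definition colk :: "nat => nat => js => js" where
 "colk k d z = ((\<lambda>j\<in>{..d}. if snd z j = k then 0 else fst z j), snd z)"

lemma JS_act: "act (JS n) m d \<beta> (x, \<alpha>) = (act J m d \<beta> x, compose {..m} \<alpha> \<beta>)"
 by (simp add: simplex_simps)

lemma Wd_sub: "subc (JS n) (Wd n k)"
 unfolding subc_def Wd_def by (auto simp: simplex_simps ops_compose ss_act[OF ss_J] J_act_at compose_at ops_le)

lemma Bd_sub: "subc (JS n) (Bd n)"
proof -
 have "Bd n = (%d. smp J d \<times> smp (boundary n) d)" by (auto simp: Bd_def boundary_simps fun_eq_iff)
 then show ?thesis using subc_prod2[OF subc_boundary ss_J] by simp
qed

lemma colk_J: "x \<in> smp J d ==> (\<lambda>j\<in>{..d}. if \<alpha> j = k then 0 else x j) \<in> smp J d"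
 unfolding J_simps by (auto simp: PiE_iff)

lemma colk_act: "\<beta> \<in> ops m d ==> colk k m (act (JS n) m d \<beta> z) = act (JS n) m d \<beta> (colk k d z)"
 by (auto simp: colk_def simplex_simps J_simps compose_def fun_eq_iff ops_le)

lemma colk_Wd: "z \<in> Wd n (Suc k) d ==> colk k d z \<in> Wd n k d"
 by (cases z) (auto simp: Wd_def colk_def colk_J less_Suc_eq)

text \<open>Wd n k is the part of J \<times> simplex n over 1 with vertices below k. A missing cell of Wd n (Suc k) collapses under colk to a simplex \<sigma> of Wd n k;
 if \<sigma> passes through the vertex k, it does so once, at p, and all cells over \<sigma> form an isoplex glued along the iso-horn at p.\<close>

lemma prism_step:
 fixes X :: "'x sset"
 assumes H: "!!m p. p \<le> m ==> lft X pt (%_ _. ()) (res (JS m) (ip p m)) (ih p m)" and k: "k \<le> n"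
 shows "lft X pt (%_ _. ()) (res (JS n) (%d. Bd n d \<union> Wd n (Suc k) d)) (%d. Bd n d \<union> Wd n k d)"
proof -
 let ?A = "JS n" and ?D = "res (JS n) (%d. Bd n d \<union> Wd n (Suc k) d)"
 let ?fam = "%C d. {z. (d, z) \<in> (C :: (nat \<times> js) set)}"
 \<comment> \<open>The state C is a subcomplex of collapsed simplices, and all cells that collapse
   into C are present. Enlarging C by one simplex thus attaches a whole fibre of \<open>colk\<close>
   at once.\<close>
 let ?F = "%C d. Bd n d \<union> Wd n k d \<union> {z \<in> Wd n (Suc k) d. (d, colk k d z) \<in> C}"
 let ?Q = "{C. subc ?A (?fam C)}"
 have Wm: "Wd n k d \<subseteq> Wd n (Suc k) d" for d by (auto simp: Wd_def)
 note sB = Bd_sub[of n] and sW = Wd_sub[of n k] and sW' = Wd_sub[of n "Suc k"]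
 have sD: "subc ?A (%d. Bd n d \<union> Wd n (Suc k) d)" by (rule subc_Un[OF sB sW'])
 have sF: "subc ?A (?F C)" if C: "subc ?A (?fam C)" for C
 proof -
  have "subc ?A (%d. {z \<in> Wd n (Suc k) d. (d, colk k d z) \<in> C})"
   unfolding subc_def
  proof (intro conjI allI ballI subsetI)
   fix d z assume "z \<in> {z \<in> Wd n (Suc k) d. (d, colk k d z) \<in> C}"
   then show "z \<in> smp ?A d" using subc_sub[OF sW'] by blast
  next
   fix m d \<alpha> z assume a: "\<alpha> \<in> ops m d" and z: "z \<in> {z \<in> Wd n (Suc k) d. (d, colk k d z) \<in> C}"
   then have "act ?A m d \<alpha> (colk k d z) \<in> ?fam C m" by (intro subc_act[OF C a]) simp
   then show "act ?A m d \<alpha> z \<in> {z \<in> Wd n (Suc k) m. (m, colk k m z) \<in> C}"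
    using subc_act[OF sW' a] z colk_act[OF a, of k n z] by simp
  qed
  from subc_Un[OF subc_Un[OF sB sW] this] show ?thesis .
 qed
 have FD: "?F C d \<subseteq> Bd n d \<union> Wd n (Suc k) d" for C d using Wm by auto
 have "lft X pt (%_ _. ()) ?D (?F {})"
 proof (rule lft_zorn[where Q = ?Q])
  show "{} \<in> ?Q" by (simp add: subc_def)
 next
  fix K :: "(nat \<times> js) set set" assume "K \<subseteq> ?Q"
  then have "subc ?A (%n. \<Union>C\<in>K. ?fam C n)" by (intro subc_UN) blast
  moreover have "(%n. \<Union>C\<in>K. ?fam C n) = ?fam (\<Union>K)" by auto
  ultimately show "\<Union>K \<in> ?Q" by simp
 next
  fix C assume "C \<in> ?Q" then show "subc ?D (?F C)" by (intro subc_res[OF sF sD FD]) simp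
 next
  fix C assume C: "C \<in> ?Q" and ne: "?F C \<noteq> smp ?D"
  have sC: "subc ?A (?fam C)" using C by simp
  have ex: "\<exists>m. \<exists>\<sigma>. \<sigma> \<in> Wd n k m \<and> (m, \<sigma>) \<notin> C"
  proof (rule ccontr)
   assume "\<not> (\<exists>m \<sigma>. \<sigma> \<in> Wd n k m \<and> (m, \<sigma>) \<notin> C)"
   then have "(d, colk k d z) \<in> C" if "z \<in> Wd n (Suc k) d" for d z using colk_Wd[OF that] by blast
   then have "?F C d = smp ?D d" for d using Wm[of d] by auto
   with ne show False by blast
  qed
  define m where "m = (LEAST m. \<exists>\<sigma>. \<sigma> \<in> Wd n k m \<and> (m, \<sigma>) \<notin> C)"
  obtain \<sigma> where \<sigma>: "\<sigma> \<in> Wd n k m" "(m, \<sigma>) \<notin> C" using LeastI_ex[OF ex] unfolding m_def by blast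
  have least: "(l, z) \<in> C" if "l < m" "z \<in> Wd n k l" for l z
   using not_less_Least[of l "%m. \<exists>\<sigma>. \<sigma> \<in> Wd n k m \<and> (m, \<sigma>) \<notin> C"] that unfolding m_def by blast
  have \<sigma>A: "\<sigma> \<in> smp ?A m" using subc_sub[OF sW \<sigma>(1)] .
  obtain y \<gamma> where yg: "\<sigma> = (y, \<gamma>)" by (cases \<sigma>)
  have y: "y \<in> smp J m" and \<gamma>: "\<gamma> \<in> ops m n" and yk: "!!j. j \<le> m ==> y j = 0 \<or> \<gamma> j < k"
   using \<sigma>(1) by (auto simp: yg Wd_def)
  have nd: "nondeg ?A m \<sigma>"
  proof -
   obtain d \<alpha> \<tau> z where z: "\<alpha> \<in> ops m d" "\<tau> \<in> ops d m" "\<sigma> = act ?A m d \<alpha> z" "z = act ?A d m \<tau> \<sigma>" "d \<le> m"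
     "!!l \<beta> y. \<beta> \<in> ops m l ==> y \<in> smp ?A l ==> \<sigma> = act ?A m l \<beta> y ==> d \<le> l"
    by (rule ez_exists[OF ss_JS \<sigma>A]) (rule that)
   have "\<not> d < m"
   proof
    assume "d < m"
    moreover have "z \<in> Wd n k d" using subc_act[OF sW z(2) \<sigma>(1)] z(4) by simp
    ultimately have "z \<in> ?fam C d" using least by simp
    with subc_act[OF sC z(1) this] z(3) \<sigma>(2) show False by simp
   qed
   then have d: "d = m" using z(5) by simp
   show ?thesis unfolding nondeg_def
   proof (intro conjI allI ballI impI notI \<sigma>A)
    fix l \<beta> z' assume "l < m" "\<beta> \<in> ops m l" "z' \<in> smp ?A l" "\<sigma> = act ?A m l \<beta> z'"
    then show False using z(6)[of \<beta> l z'] d by linarith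
   qed
  qed
  let ?G = "{(d, act ?A d m \<beta> \<sigma>) | d \<beta>. \<beta> \<in> ops d m}"
  let ?C = "C \<union> ?G"
  have sG: "subc ?A (?fam ?G)"
   unfolding subc_def
  proof (intro conjI allI ballI subsetI)
   fix d z assume "z \<in> ?fam ?G d" then show "z \<in> smp ?A d" using ss_act[OF ss_JS _ \<sigma>A] by blast
  next
   fix l d \<alpha> z assume a: "\<alpha> \<in> ops l d" and "z \<in> ?fam ?G d"
   then obtain \<beta> where b: "\<beta> \<in> ops d m" "z = act ?A d m \<beta> \<sigma>" by blast
   then have "act ?A l d \<alpha> z = act ?A l m (compose {..l} \<beta> \<alpha>) \<sigma>" using ss_comp[OF ss_JS a b(1) \<sigma>A] by simp
   then show "act ?A l d \<alpha> z \<in> ?fam ?G l" using ops_compose[OF a b(1)] by blast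
  qed
  have "subc ?A (%d. ?fam C d \<union> ?fam ?G d)" by (rule subc_Un[OF sC sG])
  moreover have "(%d. ?fam C d \<union> ?fam ?G d) = ?fam ?C" by auto
  ultimately have sC': "subc ?A (?fam ?C)" by simp
  have "(m, \<sigma>) \<in> ?G" using ss_id[OF ss_JS \<sigma>A] ops_id[of m] by (metis (mono_tags, lifting) mem_Collect_eq)
  then have lt: "C \<subset> ?C" using \<sigma>(2) by blast
  have cz: "colk k d (x, \<alpha>) = act ?A d m \<beta> \<sigma> \<longleftrightarrow> \<alpha> = compose {..d} \<gamma> \<beta> \<and> (\<forall>j\<le>d. (if \<alpha> j = k then 0 else x j) = y (\<beta> j))"
   if "\<beta> \<in> ops d m" for d x \<alpha> \<beta>
   unfolding yg JS_act colk_def by (auto simp: fun_eq_iff J_simps compose_def restrict_def)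
  have "lft X pt (%_ _. ()) (res ?D (?F ?C)) (?F C)"
  \<comment> \<open>If \<sigma> misses a vertex of simplex n, every cell over it lies in
    \<open>Bd\<close> already, and only the state grows.\<close>
  proof (cases "\<gamma> ` {..m} = {..n}")
   case False
   have "z \<in> Bd n d" if zW: "z \<in> Wd n (Suc k) d" "(d, colk k d z) \<in> ?G" for d z
   proof -
    obtain \<beta> where b: "\<beta> \<in> ops d m" "colk k d z = act ?A d m \<beta> \<sigma>" using zW(2) by blast
    obtain x \<alpha> where z: "z = (x, \<alpha>)" by (cases z)
    have x: "x \<in> smp J d" "\<alpha> \<in> ops d n" using zW(1) by (auto simp: z Wd_def)
    have "\<alpha> = compose {..d} \<gamma> \<beta>" using b(2) cz[OF b(1), of x \<alpha>] by (simp add: z)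
    then have "\<alpha> ` {..d} \<subseteq> \<gamma> ` {..m}" using ops_le[OF b(1)] by (auto simp: compose_def)
    moreover have "\<gamma> ` {..m} \<subseteq> {..n}" using ops_le[OF \<gamma>] by auto
    ultimately have "\<alpha> ` {..d} \<noteq> {..n}" using False by blast
    then show ?thesis using x by (simp add: z Bd_def)
   qed
   then have "?F ?C d = ?F C d" for d by blast
   then have e: "?F C = smp (res ?D (?F ?C))" by auto
   show ?thesis by (subst e) (rule lft_refl)
  next
   case True
   then obtain p where p: "p \<le> m" "\<gamma> p = k" using k by (auto simp: image_iff set_eq_iff) (metis atMost_iff)
   have yp: "y j = 0" if "j \<le> m" "\<gamma> j = k" for j using yk[OF that(1)] that(2) by simp
   \<comment> \<open>Two vertices of \<sigma> over k could be taken adjacent, both with J-coordinate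
     0. Then \<sigma> would be fixed by an operator merging them, against nondegeneracy.\<close>
   have uniq: "q = p" if q: "q \<le> m" "\<gamma> q = k" for q
   proof -
    have no: False if ab: "a < b" "b \<le> m" "\<gamma> a = k" "\<gamma> b = k" for a b
    proof -
     let ?\<tau> = "\<lambda>j\<in>{..m}. if j = Suc a then a else j"
     have t: "?\<tau> \<in> ops m m" by (rule opsI) auto
     have "\<gamma> (Suc a) = k" using ops_mono[OF \<gamma>, of a "Suc a"] ops_mono[OF \<gamma>, of "Suc a" b] ab by simp
     then have "\<gamma> (?\<tau> j) = \<gamma> j \<and> y (?\<tau> j) = y j" if "j \<le> m" for j using that ab yp[of a] yp[of "Suc a"] by auto
     then have "compose {..m} \<gamma> ?\<tau> = \<gamma>" "act J m m ?\<tau> y = y"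
      using J_eqI[OF ss_act[OF ss_J t y] y] ops_eqI[OF ops_compose[OF t \<gamma>] \<gamma>] by (auto simp: J_act_at compose_at)
     then have "\<sigma> = act ?A m m ?\<tau> \<sigma>" unfolding yg JS_act by simp
     from nondeg_endo[OF ss_JS nd t this, of "Suc a"] ab show False by simp
    qed
    show ?thesis using no[of p q] no[of q p] p q by (metis linorder_neqE_nat)
   qed
   let ?P = "res (JS m) (ip p m)"
   \<comment> \<open>The isoplex doubles the vertex p, the only one over k: coordinate 1 lifts it to
     1 in J, coordinate 0 leaves it at its value in y, which is 0.\<close>
   define \<chi> where "\<chi> d z = ((\<lambda>j\<in>{..d}. if fst z j = 1 then 1 else y (snd z j)), compose {..d} \<gamma> (snd z))" for d and z :: js
   have isub: "subcomplex (iso_horn p (Suc m)) (isoplex p (Suc m))" by (rule iso_horn_sub)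
   have Ps: "ss ?P" and ihs: "subc ?P (ih p m)"
    using isub unfolding isoplex_ip[symmetric] iso_horn_ih[symmetric] subcomplex_def subc_def by (blast, metis (no_types, lifting) ss_act)
   have ipD: "x \<in> smp J d" "\<beta> \<in> ops d m" "!!j. j \<le> d ==> x j \<noteq> 0 ==> \<beta> j = p" if "(x, \<beta>) \<in> ip p m d" for x \<beta> d
    using that by (auto simp: ip_def)
   have J1: "x j = 1" if "x \<in> smp J d" "j \<le> d" "x j \<noteq> 0" for x d j using J_cases[OF that(1,2)] that(3) by simp
   have \<chi>e: "\<chi> d (x, \<beta>) = ((\<lambda>j\<in>{..d}. if x j = 1 then 1 else y (\<beta> j)), compose {..d} \<gamma> \<beta>)" for d x \<beta>
    unfolding \<chi>_def fst_conv snd_conv ..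
   have \<chi>A: "\<chi> d (x, \<beta>) \<in> Wd n (Suc k) d" if i: "(x, \<beta>) \<in> ip p m d" for d x \<beta>
   proof -
    have "y (\<beta> j) \<in> {0, 1}" if "j \<le> d" for j using J_cases[OF y ops_le[OF ipD(2)[OF i] that]] by auto
    then have a: "(\<lambda>j\<in>{..d}. if x j = 1 then 1 else y (\<beta> j)) \<in> smp J d" unfolding J_simps by (auto simp: PiE_iff)
    have b: "compose {..d} \<gamma> \<beta> \<in> ops d n" by (rule ops_compose[OF ipD(2)[OF i] \<gamma>])
    have "(if x j = 1 then 1 else y (\<beta> j)) = 0 \<or> \<gamma> (\<beta> j) < Suc k" if j: "j \<le> d" for j
     using yk[OF ops_le[OF ipD(2)[OF i] j]] ipD(3)[OF i j] p by (auto simp: less_Suc_eq)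
    note c = this
    show ?thesis unfolding \<chi>e Wd_def
    proof (intro CollectI case_prodI conjI allI impI a b)
     fix j assume "j \<le> d"
     then show "(\<lambda>j\<in>{..d}. if x j = 1 then 1 else y (\<beta> j)) j = 0 \<or> compose {..d} \<gamma> \<beta> j < Suc k" using c[of j] by (simp add: compose_at)
    qed
   qed
   have c\<chi>: "colk k d (\<chi> d (x, \<beta>)) = act ?A d m \<beta> \<sigma>" if i: "(x, \<beta>) \<in> ip p m d" for d x \<beta>
   proof -
    have "(if \<gamma> (\<beta> j) = k then 0 else if x j = 1 then 1 else y (\<beta> j)) = y (\<beta> j)" if j: "j \<le> d" for j
     using yp[OF ops_le[OF ipD(2)[OF i] j]] ipD(3)[OF i j] p by auto
    note c = this
    show ?thesis unfolding \<chi>e cz[OF ipD(2)[OF i]]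
    proof (intro conjI refl allI impI)
     fix j assume "j \<le> d"
     then show "(if compose {..d} \<gamma> \<beta> j = k then 0 else (\<lambda>j\<in>{..d}. if x j = 1 then 1 else y (\<beta> j)) j) = y (\<beta> j)"
      using c[of j] by (auto simp: compose_at split: if_splits)
    qed
   qed
   have \<chi>s: "shom ?P (res ?D (?F ?C)) \<chi>"
   proof (rule shomI)
    fix d z assume z: "z \<in> smp ?P d"
    obtain x \<beta> where zz: "z = (x, \<beta>)" by (cases z)
    have i: "(x, \<beta>) \<in> ip p m d" using z zz by simp
    show "\<chi> d z \<in> smp (res ?D (?F ?C)) d" unfolding zz using \<chi>A[OF i] c\<chi>[OF i] ipD(2)[OF i] by auto
   next
    fix l d \<alpha> z assume a: "\<alpha> \<in> ops l d" and "z \<in> smp ?P d"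
    then show "\<chi> l (act ?P l d \<alpha> z) = act (res ?D (?F ?C)) l d \<alpha> (\<chi> d z)"
     by (cases z) (auto simp: \<chi>_def simplex_simps J_simps compose_def fun_eq_iff ops_le)
   qed
   show ?thesis
   proof (rule lft_attach[OF Ps \<chi>s H[OF p(1)] ihs])
    show "subc (res ?D (?F ?C)) (?F C)"
     by (subst res_simps(3)) (rule subc_res[OF sF[OF sC] sF[OF sC']], blast)
   next
    fix d z assume z: "z \<in> ih p m d"
    obtain x \<beta> where zz: "z = (x, \<beta>)" by (cases z)
    have i: "(x, \<beta>) \<in> ip p m d" and xb: "x = zero d \<or> \<beta> ` {..d} \<noteq> {..m}" using z by (auto simp: zz ih_def)
    show "\<chi> d z \<in> ?F C d"
    proof (cases "x = zero d")
     case True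
     have "\<chi> d (x, \<beta>) = act ?A d m \<beta> \<sigma>" unfolding yg JS_act \<chi>_def True by (auto simp: fun_eq_iff J_simps compose_def)
     then show ?thesis using subc_act[OF sW ipD(2)[OF i] \<sigma>(1)] by (simp add: zz)
    next
     case False
     then have "\<beta> ` {..d} \<noteq> {..m}" using xb by simp
     then obtain \<beta>' \<delta> where b: "m > 0" "\<beta>' \<in> ops d (m - 1)" "\<delta> \<in> ops (m - 1) m" "\<beta> = compose {..d} \<delta> \<beta>'"
      by (rule nonsurj_factor[OF ipD(2)[OF i]])
     have "act ?A (m - 1) m \<delta> \<sigma> \<in> ?fam C (m - 1)" using least[of "m - 1"] subc_act[OF sW b(3) \<sigma>(1)] b(1) by simp
     from subc_act[OF sC b(2) this] have "(d, act ?A d m \<beta> \<sigma>) \<in> C" using ss_comp[OF ss_JS b(2,3) \<sigma>A] b(4) by simp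
     then show ?thesis using \<chi>A[OF i] c\<chi>[OF i] by (simp add: zz)
    qed
   next
    fix d z z' assume z: "z \<in> smp ?P d" "z \<notin> ih p m d" and z': "z' \<in> smp ?P d" "z' \<notin> ih p m d" and e: "\<chi> d z = \<chi> d z'"
    obtain x \<beta> where zz: "z = (x, \<beta>)" by (cases z)
    obtain x' \<beta>' where zz': "z' = (x', \<beta>')" by (cases z')
    have i: "(x, \<beta>) \<in> ip p m d" "(x', \<beta>') \<in> ip p m d" and s: "\<beta> ` {..d} = {..m}" using z z' by (auto simp: zz zz' ih_def)
    have "act ?A d m \<beta> \<sigma> = act ?A d m \<beta>' \<sigma>" using c\<chi>[OF i(1)] c\<chi>[OF i(2)] e by (simp add: zz zz')
    then have bb: "\<beta> = \<beta>'" by (rule nondeg_unique[OF ss_JS nd ipD(2)[OF i(1)] ipD(2)[OF i(2)] s])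
    have "x j = x' j" if j: "j \<le> d" for j
    proof (cases "\<beta> j = p")
     case True
     have "(if x j = 1 then 1 else y (\<beta> j)) = (if x' j = 1 then 1 else y (\<beta> j))"
      using arg_cong[OF e[unfolded zz zz' \<chi>e], of "%z. fst z j"] j bb by (simp only: fst_conv restrict_apply' atMost_iff)
     moreover have "y (\<beta> j) = 0" using True yp[OF p] by simp
     ultimately have "(if x j = 1 then 1 else 0 :: nat) = (if x' j = 1 then 1 else 0)" by (simp only:)
     then show ?thesis using J_cases[OF ipD(1)[OF i(1)] j] J_cases[OF ipD(1)[OF i(2)] j]
      by (elim disjE) simp_all
    next
     case False then show ?thesis using ipD(3)[OF i(1) j] ipD(3)[OF i(2) j] bb by metis
    qed
    then have "x = x'" by (rule J_eqI[OF ipD(1)[OF i(1)] ipD(1)[OF i(2)]])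
    then show "z = z'" using bb by (simp add: zz zz')
   next
    fix d z assume z: "z \<in> smp ?P d" "z \<notin> ih p m d"
    obtain x \<beta> where zz: "z = (x, \<beta>)" by (cases z)
    have i: "(x, \<beta>) \<in> ip p m d" and s: "\<beta> ` {..d} = {..m}" and x0: "x \<noteq> zero d" using z by (auto simp: zz ih_def)
    have "compose {..d} \<gamma> \<beta> ` {..d} = \<gamma> ` (\<beta> ` {..d})" by (auto simp: compose_def)
    then have "\<chi> d z \<notin> Bd n d" using s True by (simp add: zz \<chi>e Bd_def)
    moreover have "\<chi> d z \<notin> Wd n k d"
    proof -
     obtain j where j: "j \<le> d" "x j \<noteq> 0" using x0 J_eqI[OF ipD(1)[OF i] zero_J] by auto
     then have "x j = 1" "\<gamma> (\<beta> j) = k" using J1[OF ipD(1)[OF i] j] ipD(3)[OF i j] p by auto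
     then show ?thesis using j(1) by (auto simp: zz \<chi>e Wd_def compose_at)
    qed
    moreover have "(d, colk k d (\<chi> d z)) \<notin> C"
    proof
     assume "(d, colk k d (\<chi> d z)) \<in> C"
     then have a: "act ?A d m \<beta> \<sigma> \<in> ?fam C d" using c\<chi>[OF i] by (simp add: zz)
     obtain \<tau> where t: "\<tau> \<in> ops m d" "compose {..m} \<beta> \<tau> = (\<lambda>k\<in>{..m}. k)"
      by (rule section_through[OF ipD(2)[OF i] s, of 0]) auto
     have "act ?A m d \<tau> (act ?A d m \<beta> \<sigma>) = \<sigma>" using ss_comp[OF ss_JS t(1) ipD(2)[OF i] \<sigma>A] t(2) ss_id[OF ss_JS \<sigma>A] by simp
     with subc_act[OF sC t(1) a] \<sigma>(2) show False by simp
    qed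
    ultimately show "\<chi> d z \<notin> ?F C d" by blast
   next
    fix d z assume "z \<in> smp (res ?D (?F ?C)) d"
    then consider "z \<in> ?F C d" | "z \<in> Wd n (Suc k) d" "(d, colk k d z) \<in> ?G" by auto
    then show "z \<in> ?F C d \<or> z \<in> \<chi> d ` smp ?P d"
    proof cases
     case 2
     obtain x \<alpha> where zz: "z = (x, \<alpha>)" by (cases z)
     have x: "x \<in> smp J d" "\<alpha> \<in> ops d n" using 2(1) by (auto simp: zz Wd_def)
     obtain \<beta> where b: "\<beta> \<in> ops d m" "colk k d z = act ?A d m \<beta> \<sigma>" using 2(2) by blast
     have a: "\<alpha> = compose {..d} \<gamma> \<beta>" and xy: "!!j. j \<le> d ==> (if \<alpha> j = k then 0 else x j) = y (\<beta> j)"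
      using b(2) cz[OF b(1), of x \<alpha>] by (auto simp: zz)
     let ?x = "\<lambda>j\<in>{..d}. if \<alpha> j = k then x j else 0"
     have xJ: "?x \<in> smp J d" using x(1) unfolding J_simps by (auto simp: PiE_iff)
     have "?x j = 0 \<or> \<beta> j = p" if j: "j \<le> d" for j
      using uniq[OF ops_le[OF b(1) j]] a j by (auto simp: compose_at)
     then have i: "(?x, \<beta>) \<in> ip p m d" using xJ b(1) by (simp add: ip_def)
     have "(if ?x j = 1 then 1 else y (\<beta> j)) = x j" if j: "j \<le> d" for j
      using xy[OF j] J_cases[OF x(1) j] j by (auto split: if_splits)
     then have "fst (\<chi> d (?x, \<beta>)) j = x j" if "j \<le> d" for j using that by (simp only: \<chi>e fst_conv restrict_apply' atMost_iff)
     moreover have "fst (\<chi> d (?x, \<beta>)) \<in> smp J d" using \<chi>A[OF i] unfolding Wd_def by (auto simp: case_prod_unfold)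
     ultimately have "fst (\<chi> d (?x, \<beta>)) = x" by (intro J_eqI[OF _ x(1)])
     then have "z = \<chi> d (?x, \<beta>)" unfolding zz a by (intro prod_eqI) (simp_all add: \<chi>_def)
     then show ?thesis using i by auto
    qed simp
   qed
  qed
  then show "\<exists>C'\<in>?Q. C \<subset> C' \<and> lft X pt (%_ _. ()) (res ?D (?F C')) (?F C)"
   using sC' lt by (intro bexI[of _ ?C] conjI) simp_all
 qed auto
 then show ?thesis by simp
qed

lemma iso_horn_jfib:
 assumes X: "ss X" and H: "\<forall>i\<in>iso_horn_inclusions. rlp (to_point X) i"
 shows "jfib X"
 unfolding jfib_def nfib_def
proof (intro conjI allI X ss_pt shom_pt)
 fix n
 have H': "!!m p. p \<le> m ==> lft X pt (%_ _. ()) (res (JS m) (ip p m)) (ih p m)" using H unfolding iso_horn_rlp[OF X] by blast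
 \<comment> \<open>The vertices 0, ..., n are doubled in this order, which leads from the horn to
   the whole prism.\<close>
 have "k \<le> Suc n ==> lft X pt (%_ _. ()) (res (JS n) (%d. Bd n d \<union> Wd n k d)) (%d. Bd n d \<union> Wd n 0 d)" for k
 proof (induction k)
  case 0
  show ?case using lft_refl[of X pt "%_ _. ()" "res (JS n) (%d. Bd n d \<union> Wd n 0 d)"] by simp
 next
  case (Suc k)
  have s: "Wd n 0 d \<subseteq> Wd n k d" "Wd n k d \<subseteq> Wd n (Suc k) d" for d by (auto simp: Wd_def)
  have "lft X pt (%_ _. ()) (res (JS n) (%d. Bd n d \<union> Wd n (Suc k) d)) (%d. Bd n d \<union> Wd n k d)"
   by (rule prism_step[OF H']) (use Suc.prems in auto)
  then show ?case by (rule lft_trans[rotated]) (use Suc s in auto)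
 qed
 from this[of "Suc n"] have "lft X pt (%_ _. ()) (res (JS n) (%d. Bd n d \<union> Wd n (Suc n) d)) (%d. Bd n d \<union> Wd n 0 d)" by simp
 moreover have "(%d. Bd n d \<union> Wd n 0 d) = HB n"
 proof
  fix d
  have "x = zero d \<longleftrightarrow> (\<forall>j\<le>d. x j = 0)" if "x \<in> smp J d" for x using J_eqI[OF that zero_J] by auto
  then show "Bd n d \<union> Wd n 0 d = HB n d" by (auto simp: Bd_def Wd_def box_def simplex_simps boundary_simps)
 qed
 moreover have "(%d. Bd n d \<union> Wd n (Suc n) d) = smp (JS n)"
  by (auto simp: fun_eq_iff Bd_def Wd_def simplex_simps less_Suc_eq_le ops_le)
 ultimately show "lft X pt (%_ _. ()) (JS n) (HB n)" by simp
qed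

section \<open>Fibrant objects of the minimal model structure\<close>

lemma cisinskiD:
 assumes "cisinski U M"
 shows "weq M \<subseteq> smaps U" "fib M \<subseteq> smaps U" "two_of_three U (weq M)" "retract_closed U (weq M)" "retract_closed U (fib M)"
  "cof M = {f. monic U f}" "!!i p. i \<in> cof M ==> i \<in> weq M ==> p \<in> fib M ==> rlp p i"
  "factors U (cof M \<inter> weq M) (fib M)" "factors U (cof M) (fib M \<inter> weq M)"
 using assms unfolding cisinski_def model_structure_def by auto

lemma monic_smaps: "monic U i ==> i \<in> smaps U"
 by (simp add: monic_def)

context
 fixes U :: "'u set set" and M :: "'u model_str"
 assumes U: "set_universe U" and M: "cisinski U M"
begin

lemma rlp_fib:
 assumes p: "p \<in> smaps U" and r: "!!i. monic U i ==> i \<in> weq M ==> rlp p i"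
 shows "p \<in> fib M"
proof -
 obtain j q where j: "monic U j" "j \<in> weq M" and q: "q \<in> fib M" "tgt j = src q" "q \<circ>\<^sub>s j = p"
  using cisinskiD(8)[OF M] p unfolding factors_def cisinskiD(6)[OF M] by blast
 have "q \<in> smaps U" using q(1) cisinskiD(2)[OF M] by blast
 from retract_fib[OF this monic_smaps[OF j(1)] p q(2,3) r[OF j]] show ?thesis
  using cisinskiD(5)[OF M] q(1) unfolding retract_closed_def by blast
qed

lemma rlp_monic_weq:
 assumes p: "p \<in> smaps U" and r: "!!i. monic U i ==> rlp p i"
 shows "p \<in> weq M"
proof -
 obtain j q where j: "monic U j" and q: "q \<in> fib M" "q \<in> weq M" "tgt j = src q" "q \<circ>\<^sub>s j = p"
  using cisinskiD(9)[OF M] p unfolding factors_def cisinskiD(6)[OF M] by blast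
 have "q \<in> smaps U" using q(1) cisinskiD(2)[OF M] by blast
 from retract_fib[OF this monic_smaps[OF j] p q(3,4) r[OF j]] show ?thesis
  using cisinskiD(4)[OF M] q(2) unfolding retract_closed_def by blast
qed

lemma weq_cancel:
 assumes f: "f \<in> smaps U" and g: "g \<in> smaps U" and fg: "tgt f = src g" and w: "g \<circ>\<^sub>s f \<in> weq M"
 shows "g \<in> weq M ==> f \<in> weq M" "f \<in> weq M ==> g \<in> weq M"
proof -
 note t = cisinskiD(3)[OF M, unfolded two_of_three_def, rule_format, OF f g fg]
 show "g \<in> weq M ==> f \<in> weq M" "f \<in> weq M ==> g \<in> weq M" using t w by simp_all
qed

lemma llp_weq:
 assumes i: "i \<in> smaps U" and r: "!!p. p \<in> fib M ==> rlp p i"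
 shows "i \<in> weq M"
proof -
 obtain j q where j: "monic U j" "j \<in> weq M" and q: "q \<in> fib M" "tgt j = src q" "q \<circ>\<^sub>s j = i"
  using cisinskiD(8)[OF M] i unfolding factors_def cisinskiD(6)[OF M] by blast
 have "q \<in> smaps U" using q(1) cisinskiD(2)[OF M] by blast
 from retract_cof[OF this monic_smaps[OF j(1)] i q(2,3) r[OF q(1)]] show ?thesis
  using cisinskiD(4)[OF M] j(2) unfolding retract_closed_def by blast
qed

lemma to_point_smaps:
 assumes X: "X \<in> ssets U"
 shows "to_point X \<in> smaps U"
proof -
 obtain L where L: "L \<in> U" "infinite L" using U by (auto simp: set_universe_def)
 have "{undefined :: 'u} \<in> U" by (rule set_universe_lepoll[OF U L(1) countable_lepoll_infinite[OF _ L(2)]]) simp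
 moreover have "ss (point :: 'u sset)" by (auto simp: simplicial_set_def point_def)
 ultimately have "(point :: 'u sset) \<in> ssets U" by (simp add: ssets_def point_def)
 then show ?thesis using X to_point_map[of X] by (auto simp: smaps_def ssets_def to_point_def)
qed

lemma jfib_fibrant:
 assumes X: "X \<in> ssets U" "jfib X" and w: "weq M \<subseteq> weq0 U"
 shows "fibrant M X"
 unfolding fibrant_def
proof (rule rlp_fib[OF to_point_smaps[OF X(1)]])
 fix i assume i: "monic U i" "i \<in> weq M"
 have t: "tc (tgt i) (img i)" by (rule weq0_tc[OF U i(1)]) (use i w in blast)
 have s: "src (to_point X) = X" "tgt (to_point X) = point" by (simp_all add: to_point_def)
 have "img i n \<subseteq> smp (tgt i) n" for n using t by (auto simp: tc_def subc_def)
 then show "rlp (to_point X) i"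
  unfolding mono_rlp[OF U to_point_smaps[OF X(1)] i(1)] s using tc_ext(1)[OF t X(2)] by (subst lft_to_point)
qed

section \<open>Pushout-products in an arbitrary Cisinski model structure\<close>

lemma J_ext:
 assumes D: "ss D" and C: "subc D C" and g: "shom (res D C) J g"
 shows "\<exists>h. shom D J h \<and> (\<forall>n. \<forall>x\<in>C n. h n x = g n x)"
proof -
 \<comment> \<open>A map to J amounts to a function on vertices, so it extends from C by any value
   on the remaining vertices; 0 is taken.\<close>
 define v where "v y = (if y \<in> C 0 then g 0 y 0 else 0)" for y
 have v: "v y \<in> {0, 1}" for y
  using shom_in[OF g, of y 0] J_cases[of "g 0 y" 0 0] by (auto simp: v_def)
 have "shom D J (%n x. \<lambda>i\<in>{..n}. v (vertex D n i x))"
 proof (rule shomI)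
  fix n x show "(\<lambda>i\<in>{..n}. v (vertex D n i x)) \<in> smp J n" unfolding J_simps using v by (auto simp: PiE_iff)
 next
  fix m n \<alpha> x assume "\<alpha> \<in> ops m n" "x \<in> smp D n"
  then show "(\<lambda>i\<in>{..m}. v (vertex D m i (act D m n \<alpha> x))) = act J m n \<alpha> (\<lambda>i\<in>{..n}. v (vertex D n i x))"
   by (auto simp: J_simps compose_def fun_eq_iff vertex_act[OF D] ops_le)
 qed
 moreover have "(\<lambda>i\<in>{..n}. v (vertex D n i x)) = g n x" if x: "x \<in> C n" for n x
 proof (rule J_eqI)
  show "(\<lambda>i\<in>{..n}. v (vertex D n i x)) \<in> smp J n" unfolding J_simps using v by (auto simp: PiE_iff)
  show "g n x \<in> smp J n" using shom_in[OF g] x by simp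
  fix i assume i: "i \<le> n"
  have c: "vertex D n i x \<in> C 0" unfolding vertex_def by (rule subc_act[OF C const_ops[OF i] x])
  have "g 0 (vertex D n i x) = act J 0 n (\<lambda>k\<in>{..0}. i) (g n x)"
   unfolding vertex_def using shom_act[OF g const_ops[OF i]] x by simp
  then show "(\<lambda>i\<in>{..n}. v (vertex D n i x)) i = g n x i" using i c by (simp add: v_def J_act_at)
 qed
 ultimately show ?thesis by blast
qed

lemma usmall_J: "usmall U J"
proof -
 obtain L where L: "L \<in> U" "infinite L" using U by (auto simp: set_universe_def)
 have "smp J n \<lesssim> L" for n by (rule countable_lepoll_infinite[OF countable_finite[OF finite_J] L(2)])
 then show ?thesis using L(1) by (auto simp: usmall_def small_def)
qed

text \<open>The projection J \<times> K \<rightarrow> K and its restriction to {0} \<times> K lift against all monomorphisms, hence are weak equivalences.\<close>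

lemma end_inclusion_weq:
 fixes K :: "'k sset"
 assumes K: "usmall U K"
 defines "Y == ucopy U (cyl K)"
 defines "C0 == %n. uto U (cyl K) n ` ({zero n} \<times> smp K n)"
 shows "subc Y C0" "inclusion (res Y C0) Y \<in> weq M"
proof -
 note uJK = small_prod[OF U usmall_J K]
 note c = ucopy[OF U uJK, folded Y_def] and k = ucopy[OF U K]
 let ?e = "uto U (cyl K)" and ?d = "ufr U (cyl K)"
 have z: "act (cyl K) m n \<alpha> x \<in> {zero m} \<times> smp K m" if "\<alpha> \<in> ops m n" "x \<in> {zero n} \<times> smp K n" for m n \<alpha> x
  using that K by (auto simp: usmall_def ss_act)
 have zs: "x \<in> smp (cyl K) n" if "x \<in> {zero n} \<times> smp K n" for n x using that by auto
 show C0: "subc Y C0"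
  unfolding subc_def C0_def
 proof (intro conjI allI ballI subsetI)
  fix n y assume "y \<in> ?e n ` ({zero n} \<times> smp K n)" then show "y \<in> smp Y n" using shom_in[OF c(2)] zs by blast
 next
  fix m n \<alpha> y assume a: "\<alpha> \<in> ops m n" and "y \<in> ?e n ` ({zero n} \<times> smp K n)"
  then obtain x where x: "x \<in> {zero n} \<times> smp K n" "y = ?e n x" by blast
  show "act Y m n \<alpha> y \<in> ?e m ` ({zero m} \<times> smp K m)" unfolding x(2) shom_act[OF c(2) a zs[OF x(1)], symmetric] by (rule imageI[OF z[OF a x(1)]])
 qed
 let ?pr = "mkm Y (ucopy U K) (%n y. uto U K n (snd (?d n y)))" and ?i = "inclusion (res Y C0) Y"
 have prs: "shom Y (ucopy U K) (%n y. uto U K n (snd (?d n y)))" by (rule shom_comp[OF shom_comp[OF c(3) shom_snd] k(2)])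
 have pr: "?pr \<in> smaps U" by (rule mkm_smaps[OF c(1) k(1) prs])
 have im: "monic U ?i" by (rule monic_inclusion[OF U c(1) C0])
 have iU: "?i \<in> smaps U" by (rule monic_smaps[OF im])
 have pi: "?pr \<circ>\<^sub>s ?i \<in> smaps U" by (rule comp_smaps[OF iU pr]) simp
 have "?pr \<in> weq M"
 proof (rule rlp_monic_weq[OF pr])
  fix i assume i: "monic U i"
  have ism: "simplicial_map i" by (rule smapsD(1)[OF monic_smaps[OF i]])
  show "rlp ?pr i"
   unfolding mono_rlp[OF U pr i]
  proof (rule lftI)
   let ?D = "tgt i" and ?C = "img i"
   fix g w assume g: "shom (res ?D ?C) (src ?pr) g" and w: "shom ?D (tgt ?pr) w" and gw: "!!n x. x \<in> ?C n ==> fn ?pr n (g n x) = w n x"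
   have gY: "shom (res ?D ?C) Y g" using g by simp
   have wK: "shom ?D (ucopy U K) w" using w by simp
   have gin: "g n x \<in> smp Y n" if "x \<in> ?C n" for n x using shom_in[OF gY] that by simp
   obtain h where h: "shom ?D J h" "!!n x. x \<in> ?C n ==> h n x = fst (?d n (g n x))"
    using J_ext[OF simplicial_mapD(2)[OF ism] subc_img[OF ism] shom_comp[OF shom_comp[OF gY c(3)] shom_fst]] by blast
   let ?h = "%n x. ?e n (h n x, ufr U K n (w n x))"
   have hs: "shom ?D Y ?h" by (rule shom_comp[OF shom_pair[OF h(1) shom_comp[OF wK k(3)]] c(2)])
   have "fn ?pr n (?h n x) = w n x" if x: "x \<in> smp ?D n" for n x
   proof -
    have p: "(h n x, ufr U K n (w n x)) \<in> smp (cyl K) n" using shom_in[OF h(1) x] shom_in[OF k(3) shom_in[OF wK x]] by simp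
    show ?thesis using shom_in[OF hs x] c(4)[OF p] k(5)[OF shom_in[OF wK x]] by simp
   qed
   moreover have "?h n x = g n x" if x: "x \<in> ?C n" for n x
   proof -
    have s: "snd (?d n (g n x)) \<in> smp K n" using shom_in[OF c(3) gin[OF x]] by auto
    have "ufr U K n (w n x) = snd (?d n (g n x))" using gw[OF x] gin[OF x] k(4)[OF s] by simp
    then show ?thesis using h(2)[OF x] c(5)[OF gin[OF x]] by simp
   qed
   ultimately show "\<exists>h. shom ?D (src ?pr) h \<and> (\<forall>n. \<forall>x\<in>smp ?D n. fn ?pr n (h n x) = w n x) \<and> (\<forall>n. \<forall>x\<in>?C n. h n x = g n x)"
    using hs by (intro exI[of _ ?h]) simp
  qed
 qed
 moreover have "?pr \<circ>\<^sub>s ?i \<in> weq M"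
 proof (rule rlp_monic_weq[OF pi])
  fix i assume i: "monic U i"
  have fp: "fn (?pr \<circ>\<^sub>s ?i) n (?e n (zero n, b)) = uto U K n b" if b: "b \<in> smp K n" for n b
  proof -
   have p: "(zero n, b) \<in> smp (cyl K) n" using b by simp
   have "?e n (zero n, b) \<in> C0 n" using b by (auto simp: C0_def)
   then show ?thesis using c(4)[OF p] shom_in[OF c(2) p] by simp
  qed
  have ks: "shom (ucopy U K) (res Y C0) (%n b. ?e n (zero n, ufr U K n b))"
  proof (rule shom_into_res)
   have "shom K (cyl K) (%n b. (zero n, b))" by (auto simp: shom_def)
   from shom_comp[OF shom_comp[OF k(3) this] c(2)] show "shom (ucopy U K) Y (%n b. ?e n (zero n, ufr U K n b))" .
   show "?e n (zero n, ufr U K n b) \<in> C0 n" if "b \<in> smp (ucopy U K) n" for n b using shom_in[OF k(3) that] by (auto simp: C0_def)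
  qed
  show "rlp (?pr \<circ>\<^sub>s ?i) i"
   unfolding mono_rlp[OF U pi i]
  proof (rule lftI)
   let ?D = "tgt i" and ?C = "img i"
   fix g w assume g: "shom (res ?D ?C) (src (?pr \<circ>\<^sub>s ?i)) g" and w: "shom ?D (tgt (?pr \<circ>\<^sub>s ?i)) w"
    and gw: "!!n x. x \<in> ?C n ==> fn (?pr \<circ>\<^sub>s ?i) n (g n x) = w n x"
   have wK: "shom ?D (ucopy U K) w" using w by simp
   let ?h = "%n x. ?e n (zero n, ufr U K n (w n x))"
   have "?h n x = g n x" if x: "x \<in> ?C n" for n x
   proof -
    have "g n x \<in> C0 n" using shom_in[OF g, of x n] x by simp
    then obtain b where b: "b \<in> smp K n" "g n x = ?e n (zero n, b)" by (auto simp: C0_def)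
    show ?thesis using gw[OF x] fp[OF b(1)] b(2) k(4)[OF b(1)] by simp
   qed
   moreover have "fn (?pr \<circ>\<^sub>s ?i) n (?h n x) = w n x" if "x \<in> smp ?D n" for n x
    unfolding fp[OF shom_in[OF k(3) shom_in[OF wK that]]] by (rule k(5)[OF shom_in[OF wK that]])
   ultimately show "\<exists>h. shom ?D (src (?pr \<circ>\<^sub>s ?i)) h \<and> (\<forall>n. \<forall>x\<in>smp ?D n. fn (?pr \<circ>\<^sub>s ?i) n (h n x) = w n x) \<and> (\<forall>n. \<forall>x\<in>?C n. h n x = g n x)"
    using shom_comp[OF wK ks] by (intro exI[of _ ?h] conjI allI ballI) simp_all
  qed
 qed
 ultimately show "?i \<in> weq M" by (intro weq_cancel(1)[OF iU pr]) simp_all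
qed

lemma end_inclusion_lft:
 assumes K: "usmall U K" and p: "p \<in> fib M"
 shows "lft (src p) (tgt p) (fn p) (cyl K) (%n. {zero n} \<times> smp K n)"
proof -
 note e = end_inclusion_weq[OF K]
 note c = ucopy[OF U small_prod[OF U usmall_J K]]
 have Ks: "ss K" using K by (simp add: usmall_def)
 have C: "subc (cyl K) (%n. {zero n} \<times> smp K n)" by (auto simp: subc_def ss_act[OF Ks])
 have m: "monic U (inclusion (res (ucopy U (cyl K)) (%n. uto U (cyl K) n ` ({zero n} \<times> smp K n))) (ucopy U (cyl K)))"
  by (rule monic_inclusion[OF U c(1) e(1)])
 have pU: "p \<in> smaps U" using p cisinskiD(2)[OF M] by blast
 have "rlp p (inclusion (res (ucopy U (cyl K)) (%n. uto U (cyl K) n ` ({zero n} \<times> smp K n))) (ucopy U (cyl K)))"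
  by (rule cisinskiD(7)[OF M _ e(2) p]) (simp add: cisinskiD(6)[OF M] m)
 then have "lft (src p) (tgt p) (fn p) (ucopy U (cyl K)) (%n. uto U (cyl K) n ` ({zero n} \<times> smp K n))"
  unfolding mono_rlp[OF U pU m] by simp
 then show ?thesis by (rule lft_iso_D[OF _ c(6) e(1) C c(2-5)]) (assumption | rule refl)+
qed

text \<open>The inclusion of {0} x simplex n in the pushout-product is a pushout of {0} x boundary
  in J x boundary, so it lifts against fibrations and is a weak equivalence. By two out of three so
  is the inclusion of the pushout-product in J x simplex n, against which a fibrant X lifts.\<close>

lemma fibrant_jfib:
 assumes X: "X \<in> ssets U" and f: "fibrant M X"
 shows "jfib X"
 unfolding jfib_def nfib_def
proof (intro conjI allI ss_pt shom_pt)
 show Xs: "ss X" using X by (simp add: ssets_def)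
 fix n
 have uD: "usmall U (simplex n)" by (rule usmall_simplex[OF U])
 have Bs: "ss (boundary n)" using subcomplex_boundary by (simp add: subcomplex_def)
 have "small U (smp (boundary n) k)" for k
  using uD small_lepoll[of U "smp (simplex n) k", OF _ subset_imp_lepoll] subc_boundary[of n] by (auto simp: usmall_def subc_def)
 then have uB: "usmall U (boundary n)" using Bs by (simp add: usmall_def)
 let ?Y = "ucopy U (JS n)" and ?e = "uto U (JS n)"
 note c = ucopy[OF U small_prod[OF U usmall_J uD]]
 let ?Z = "%k. {zero k} \<times> smp (simplex n) k" and ?C0 = "%k. ?e k ` ({zero k} \<times> smp (simplex n) k)" and ?C1 = "%k. ?e k ` HB n k"
 note w = end_inclusion_weq[OF uD]
 have img: "subc ?Y (%k. ?e k ` S k)" if S: "subc (JS n) S" for S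
  unfolding subc_def
 proof (intro conjI allI ballI subsetI)
  fix k y assume "y \<in> ?e k ` S k" then show "y \<in> smp ?Y k" using shom_in[OF c(2)] subc_sub[OF S] by blast
 next
  fix m k \<alpha> y assume a: "\<alpha> \<in> ops m k" and "y \<in> ?e k ` S k"
  then obtain x where x: "x \<in> S k" "y = ?e k x" by blast
  show "act ?Y m k \<alpha> y \<in> ?e m ` S m" unfolding x(2) shom_act[OF c(2) a subc_sub[OF S x(1)], symmetric] by (rule imageI[OF subc_act[OF S a x(1)]])
 qed
 have C1: "subc ?Y ?C1" by (rule img[OF subc_HB])
 have ZH: "?Z k \<subseteq> HB n k" for k by (auto simp: box_def)
 have C01: "?C0 k \<subseteq> ?C1 k" for k using ZH by blast
 have C0': "subc (res ?Y ?C1) ?C0" by (rule subc_res[OF w(1) C1 C01])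
 have Y1: "res ?Y ?C1 \<in> ssets U"
  using set_universe_lepoll[OF U _ subset_imp_lepoll, of "smp ?Y k" "?C1 k" for k] c(1) C1 ss_res[OF c(6) C1] by (auto simp: ssets_def subc_def)
 let ?i1 = "inclusion (res ?Y ?C0) (res ?Y ?C1)" and ?i2 = "inclusion (res ?Y ?C1) ?Y"
 have m1: "monic U ?i1" using monic_inclusion[OF U Y1 C0'] by simp
 have m2: "monic U ?i2" by (rule monic_inclusion[OF U c(1) C1])
 have inje: "x = x'" if "?e k x = ?e k x'" "x \<in> smp (JS n) k" "x' \<in> smp (JS n) k" for k x x'
  using arg_cong[OF that(1), of "ufr U (JS n) k"] unfolding c(4)[OF that(2)] c(4)[OF that(3)] .
 have HJ: "x \<in> smp (JS n) k" if "x \<in> HB n k" for k x by (rule subc_sub[OF subc_HB that])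
 have "?i1 \<in> weq M"
 proof (rule llp_weq[OF monic_smaps[OF m1]])
  fix p assume p: "p \<in> fib M"
  then have pU: "p \<in> smaps U" using cisinskiD(2)[OF M] by blast
  let ?P = "cyl (boundary n)" and ?ZB = "%k. {zero k} \<times> smp (boundary n) k"
  have Ps: "ss ?P" using Bs by simp
  have PH: "x \<in> HB n k" if "x \<in> smp ?P k" for x k using that subc_sub[OF subc_boundary, of _ n k] by (auto simp: box_def)
  have actP: "act ?P m k \<alpha> x = act (JS n) m k \<alpha> x" for m k \<alpha> x by (simp add: boundary_simps)
  have "lft (src p) (tgt p) (fn p) (res ?Y ?C1) ?C0"
  proof (rule lft_attach[OF Ps _ end_inclusion_lft[OF uB p] _ C0', where \<chi> = ?e])
   show "shom ?P (res ?Y ?C1) ?e"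
   proof (rule shomI)
    fix k x assume "x \<in> smp ?P k" then show "?e k x \<in> smp (res ?Y ?C1) k" using PH by (simp del: sset_prod_simps)
   next
    fix m k \<alpha> x assume "\<alpha> \<in> ops m k" "x \<in> smp ?P k"
    then show "?e m (act ?P m k \<alpha> x) = act (res ?Y ?C1) m k \<alpha> (?e k x)" using shom_act[OF c(2)] HJ[OF PH] by (simp only: actP res_simps)
   qed
   show "subc ?P ?ZB" by (auto simp: subc_def ss_act[OF Bs])
   show "?e k x \<in> ?C0 k" if "x \<in> ?ZB k" for k x using that subc_sub[OF subc_boundary, of _ n k] by auto
   show "x = x'" if "x \<in> smp ?P k" "x' \<in> smp ?P k" "?e k x = ?e k x'" for k x x' by (rule inje[OF that(3) HJ[OF PH] HJ[OF PH]]) (use that in auto)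
   show "?e k x \<notin> ?C0 k" if x: "x \<in> smp ?P k" "x \<notin> ?ZB k" for k x
   proof
    assume "?e k x \<in> ?C0 k"
    then obtain x' where x': "?e k x = ?e k x'" "x' \<in> ?Z k" by (rule imageE) (rule that)
    have "x = x'" by (rule inje[OF x'(1) HJ[OF PH[OF x(1)]] HJ[OF subsetD[OF ZH x'(2)]]])
    then show False using x x'(2) by auto
   qed
   show "x \<in> ?C0 k \<or> x \<in> ?e k ` smp ?P k" if "x \<in> smp (res ?Y ?C1) k" for k x
   proof -
    from that obtain z where z: "z \<in> HB n k" "x = ?e k z" by auto
    then have "z \<in> ?Z k \<or> z \<in> smp ?P k" by (auto simp: box_def)
    then show ?thesis using z(2) by blast
   qed
  qed
  then show "rlp p ?i1" using mono_rlp[OF U pU m1] img_inclusion[of "res ?Y ?C1" ?C0] by simp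
 qed
 moreover have "?i2 \<circ>\<^sub>s ?i1 = inclusion (res ?Y ?C0) ?Y"
 proof (rule smap_eqI)
  show "simplicial_map (?i2 \<circ>\<^sub>s ?i1)" by (rule comp_map[OF smapsD(1)[OF monic_smaps[OF m1]] smapsD(1)[OF monic_smaps[OF m2]]]) simp
  show "simplicial_map (inclusion (res ?Y ?C0) ?Y)" by (rule inclusion_res[OF c(6) w(1)])
  fix k x assume "x \<in> smp (src (?i2 \<circ>\<^sub>s ?i1)) k"
  then have x: "x \<in> ?C0 k" by simp
  then have "x \<in> ?C1 k" using C01 by blast
  with x show "fn (?i2 \<circ>\<^sub>s ?i1) k x = fn (inclusion (res ?Y ?C0) ?Y) k x" by (simp del: sset_prod_simps)
 qed simp_all
 ultimately have "?i2 \<in> weq M" using w(2) by (intro weq_cancel(2)[OF monic_smaps[OF m1] monic_smaps[OF m2]]) simp_all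
 then have r: "rlp (to_point X) ?i2"
  using cisinskiD(7)[OF M] f m2 unfolding fibrant_def by (simp add: cisinskiD(6)[OF M])
 have sc: "subcomplex (res ?Y ?C1) ?Y" using ss_res[OF c(6) C1] c(6) subc_sub[OF C1] by (auto simp: subcomplex_def)
 have "lft X pt (%_ _. ()) ?Y ?C1" using r unfolding rlp_to_point[OF Xs sc] res_simps(1) .
 then show "lft X pt (%_ _. ()) (JS n) (HB n)" by (rule lft_iso_D[OF _ c(6) C1 subc_HB c(2-5)]) (assumption | rule refl)+
qed

end

theorem theorem5p10:
  fixes U :: "'u set set" and M :: "'u model_str" and X :: "'u sset"
  assumes "set_universe U"
    and "minimal_model_structure U M"
    and "X \<in> ssets U"
  shows "(fibrant M X \<longleftrightarrow> (\<forall>i\<in>widened_inclusions U. rlp (to_point X) i)) \<and>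
         (fibrant M X \<longleftrightarrow> (\<forall>i\<in>iso_horn_inclusions. rlp (to_point X) i))"
proof -
  have M: "cisinski U M" and mn: "\<And>M'. cisinski U M' \<Longrightarrow> weq M \<subseteq> weq M'"
    using assms(2) by (auto simp: minimal_model_structure_def localization_of_def)
  have X: "simplicial_set X" using assms(3) by (simp add: ssets_def)
  have "weq M \<subseteq> weq0 U" using mn[OF cisinski0[OF assms(1)]] by simp
  then have f: "fibrant M X \<longleftrightarrow> jfib X"
    using jfib_fibrant[OF assms(1) M assms(3)] fibrant_jfib[OF assms(1) M assms(3)] by blast
  have "jfib X" if "\<forall>i\<in>widened_inclusions U. rlp (to_point X) i"
    using iso_horn_jfib[OF X] widened_iso_horn[OF assms(1) X that] unfolding iso_horn_rlp[OF X] by blast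
  then show ?thesis unfolding f using jfib_widened[of X _ U] jfib_iso_horn iso_horn_jfib[OF X] by blast
qed

end
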